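(* Let $M=2$, let $\sigma_{\mathrm c}^2,\sigma_{\mathrm r}^2>0$, and let $C(\rho)$ be the capacity, under average power $\rho$, of the electro-optic comb phase-noise channel (with $M=2$ subchannels) described in the context. Then $$C(\rho)=\log\rho+2\log\pi-h(\boldsymbol\Delta^{\mathrm c},\boldsymbol\Delta^{\mathrm r})+o(1),\qquad\rho\to\infty,$$ where $\boldsymbol\Delta^{\mathrm c}\sim\mathcal{WN}(0,\sigma_{\mathrm c}^2)$ and $\boldsymbol\Delta^{\mathrm r}\sim\mathcal{WN}(0,\sigma_{\mathrm r}^2)$ are independent and $o(1)$ vanishes as $\rho\to\infty$.
   Context: Conventions: $\log$ is base 2; $h$ and $I$ denote differential entropy and mutual information (in bits); $j$ is the imaginary unit; $\mathrm{wrap}_\pi(\theta)=((\theta+\pi)\bmod 2\pi)-\pi\in[-\pi,\pi)$ and $\theta\oplus\phi=\mathrm{wrap}_\pi(\theta+\phi)$. $\mathcal{CN}(0,1)$ is the standard circularly symmetric complex Gaussian law; $\mathcal{WN}(0,\sigma^2)$ is the law of $\mathrm{wrap}_\pi(X)$ for $X\sim\mathcal N(0,\sigma^2)$. $\|\cdot\|$ is the Euclidean norm. Channel: for $k=1,2,\dots$ and $m=0,\dots,M-1$, the output is $\mathbf y_{k,m}=e^{j\boldsymbol\theta_{k,m}}\mathbf x_{k,m}+\mathbf w_{k,m}$, where the $\mathbf w_{k,m}$ are i.i.d. $\mathcal{CN}(0,1)$ and $\boldsymbol\theta_{k,m}=\mathrm{wrap}_\pi(\boldsymbol\theta_k^{\mathrm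 c}+m\boldsymbol\theta_k^{\mathrm r})$. The two processes $(\boldsymbol\theta^{\mathrm c}_k)_{k\ge0}$, $(\boldsymbol\theta^{\mathrm r}_k)_{k\ge0}$ are independent of each other; for each of them, $\boldsymbol\theta_0^{\mathrm{c/r}}$ is uniform on $[-\pi,\pi)$ and $\boldsymbol\theta_k^{\mathrm{c/r}}=\boldsymbol\Delta_k^{\mathrm{c/r}}\oplus\boldsymbol\theta_{k-1}^{\mathrm{c/r}}$ for $k\ge1$, where the $\boldsymbol\Delta_k^{\mathrm{c/r}}$ are i.i.d. $\mathcal{WN}(0,\sigma_{\mathrm{c/r}}^2)$, independent of $\boldsymbol\theta_0^{\mathrm{c/r}}$. Inputs, phase noises and additive noise are independent. Capacity: with $\underline{\mathbf x}_k=(\mathbf x_{k,0},\dots,\mathbf x_{k,M-1})\in\mathbb C^M$ and similarly $\underline{\mathbf y}_k$, $C(\rho)=\lim_{n\to\infty}\frac1n\sup I(\underline{\mathbf x}_1,\dots,\underline{\mathbf x}_n;\underline{\mathbf y}_1,\dots,\underline{\mathbf y}_n)$, the supremum being over all laws of $(\underline{\mathbf x}_1,\dots,\underline{\mathbf x}_n)$ with $\sum_{k=1}^n\mathbb E[\|\underline{\mathbf x}_k\|^2]\le n\rho$. *)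

theory Defs
  imports
    "HOL-Probability.Probability"
    "HOL-Library.Landau_Symbols"
    "HOL-Library.Real_Mod"
begin

definition wrap_pi :: "real \<Rightarrow> real" where
  "wrap_pi \<theta> = (\<theta> + pi) rmod (2 * pi) - pi"

definition add_pi :: "real \<Rightarrow> real \<Rightarrow> real"  (infixl \<open>\<oplus>\<^sub>\<pi>\<close> 65) where
  "\<theta> \<oplus>\<^sub>\<pi> \<phi> = wrap_pi (\<theta> + \<phi>)"

(* As for normal_density, the parameter is the standard deviation:
   this is WN(0, \<sigma>^2). *)
definition wrapped_normal :: "real \<Rightarrow> real measure" where
  "wrapped_normal \<sigma> = distr (density lborel (normal_density 0 \<sigma>)) borel wrap_pi"

(* CN(0,1): total variance 1, i.e. variance 1/2 per real dimension. *)
definition std_complex_normal :: "complex measure" where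
  "std_complex_normal = density lborel (\<lambda>z. ennreal (exp (- (cmod z)\<^sup>2) / pi))"

(* A pair (\<theta>0, \<Delta>) carries the initial phase and the increments
   \<Delta> 1, \<Delta> 2, ... of one phase process; all of them are independent. *)
definition phase_space :: "real \<Rightarrow> (real \<times> (nat \<Rightarrow> real)) measure" where
  "phase_space \<sigma> =
     uniform_measure lborel {-pi..<pi} \<Otimes>\<^sub>M (\<Pi>\<^sub>M k\<in>{1..}. wrapped_normal \<sigma>)"

primrec phase :: "real \<times> (nat \<Rightarrow> real) \<Rightarrow> nat \<Rightarrow> real" where
  "phase a 0 = fst a"
| "phase a (Suc k) = snd a (Suc k) \<oplus>\<^sub>\<pi> phase a k"

definition additive_noise_space :: "nat \<Rightarrow> (nat \<Rightarrow> nat \<Rightarrow> complex) measure" where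
  "additive_noise_space M = (\<Pi>\<^sub>M k\<in>{1..}. \<Pi>\<^sub>M m\<in>{..<M}. std_complex_normal)"

type_synonym comb_noise =
  "(real \<times> (nat \<Rightarrow> real)) \<times> (real \<times> (nat \<Rightarrow> real)) \<times> (nat \<Rightarrow> nat \<Rightarrow> complex)"

definition comb_noise_space :: "nat \<Rightarrow> real \<Rightarrow> real \<Rightarrow> comb_noise measure" where
  "comb_noise_space M \<sigma>\<^sub>c \<sigma>\<^sub>r =
     phase_space \<sigma>\<^sub>c \<Otimes>\<^sub>M (phase_space \<sigma>\<^sub>r \<Otimes>\<^sub>M additive_noise_space M)"

(* The measurable space of n blocks, block k \<in> {1..n} being a vector in C^M. *)
definition block_space :: "nat \<Rightarrow> nat \<Rightarrow> (nat \<Rightarrow> nat \<Rightarrow> complex) measure" where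
  "block_space M n = (\<Pi>\<^sub>M k\<in>{1..n}. \<Pi>\<^sub>M m\<in>{..<M}. borel)"

definition comb_output ::
    "nat \<Rightarrow> nat \<Rightarrow> (nat \<Rightarrow> nat \<Rightarrow> complex) \<Rightarrow> comb_noise \<Rightarrow> (nat \<Rightarrow> nat \<Rightarrow> complex)" where
  "comb_output M n x = (\<lambda>(c, r, w).
     \<lambda>k\<in>{1..n}. \<lambda>m\<in>{..<M}.
       cis (wrap_pi (phase c k + real m * phase r k)) * x k m + w k m)"

definition admissible_laws :: "nat \<Rightarrow> nat \<Rightarrow> real \<Rightarrow> (nat \<Rightarrow> nat \<Rightarrow> complex) measure set" where
  "admissible_laws M n \<rho> = {\<mu>. prob_space \<mu> \<and> sets \<mu> = sets (block_space M n) \<and>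
     (\<Sum>k=1..n. \<integral>\<^sup>+x. ennreal ((L2_set (\<lambda>m. cmod (x k m)) {..<M})\<^sup>2) \<partial>\<mu>)
       \<le> ennreal (real n * \<rho>)}"

(* The product with \<mu> makes the input independent of all the noises.  The library's
   mutual information is a Bochner integral, hence 0 if that integral diverges; this does
   not occur for inputs of finite power, because the additive noise is Gaussian. *)
definition comb_information ::
    "nat \<Rightarrow> real \<Rightarrow> real \<Rightarrow> nat \<Rightarrow> (nat \<Rightarrow> nat \<Rightarrow> complex) measure \<Rightarrow> real" where
  "comb_information M \<sigma>\<^sub>c \<sigma>\<^sub>r n \<mu> =
     prob_space.mutual_information (\<mu> \<Otimes>\<^sub>M comb_noise_space M \<sigma>\<^sub>c \<sigma>\<^sub>r) 2
       (block_space M n) (block_space M n) fst (\<lambda>(x, z). comb_output M n x z)"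

definition comb_rate :: "nat \<Rightarrow> real \<Rightarrow> real \<Rightarrow> real \<Rightarrow> nat \<Rightarrow> ereal" where
  "comb_rate M \<sigma>\<^sub>c \<sigma>\<^sub>r \<rho> n =
     (SUP \<mu>\<in>admissible_laws M n \<rho>. ereal (comb_information M \<sigma>\<^sub>c \<sigma>\<^sub>r n \<mu>)) / ereal (real n)"

definition comb_capacity :: "nat \<Rightarrow> real \<Rightarrow> real \<Rightarrow> real \<Rightarrow> ereal" where
  "comb_capacity M \<sigma>\<^sub>c \<sigma>\<^sub>r \<rho> = lim (comb_rate M \<sigma>\<^sub>c \<sigma>\<^sub>r \<rho>)"

end

(* Write p(y|x) for the transition density, i(x,y) = p(y|x) / p(y) and G for a function of the input x
   and the noise, on which the output y depends as well.  Jensen's inequality bounds the information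
   E ln i from both sides:
   - E ln i <= E G if, for each input, E[u(y) exp(-G)] is at most the integral of u q for all u >= 0,
     where q is a reference output density;
   - E ln i >= E G if exp G <= phi(x,y), where phi(.,y) has integral at most 1 under the input law for
     every y (a reverse density).

   Upper bound: exp(-G) contains the reciprocal densities of the phase increments.  Weighted by them,
   the phases become independent and uniform, and the blocks decouple; the expectation of the
   remaining factors is n (ln rho + 2 ln pi + o(1)) if q has a half-normal amplitude.

   Lower bound: take uniform input phases and amplitudes K + |g| with g normal of large variance.  The
   reverse density evaluates the densities of the increments at their estimates from two consecutive
   blocks.  These are off by a few phase errors, whose mean squares are of order 1 / K^2.

   The limit in n exists by Fekete's lemma: as the phase processes are stationary, independent inputs
   for the first m and the last n blocks make the maximal information superadditive. *)
theory Submission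
  imports Defs
begin

subsection \<open>Information densities\<close>

text \<open>The obstacle is memory: the outputs are driven by two hidden Markov phases, and their
  entropy rate has no closed form. The test functions \<open>G\<close> replace it, because their
  means split into single symbols with errors that do not grow with the number of blocks faster than
  a small multiple of it. The constants of the two bounds meet for the following reason. In both, a
  subchannel carries a half-normal amplitude of mean square about \<rho> / 2, worth ln (\<rho> / 4)
  / 2 nats at noise variance 1/2 in the radial direction, and a uniform phase, worth ln (2 pi). Two
  subchannels give ln \<rho> + 2 ln pi, from which the entropies of the increments are taken off.
  The subchannels see one phase and the sum of both, which is a triangular system: the phases can be
  integrated, or estimated, one after the other. The argument of an output is nearly linear in the
  noise only if the input is large. Hence the threshold \<open>K\<close>: against arbitrary inputs,
  \<open>q\<close> gets a Gaussian component of small weight that pays for weak symbols, and the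
  constructed input avoids them.\<close>

lemma (in prob_space) integral_nonpos_if_exp_le_1:
  fixes h :: "'a \<Rightarrow> real"
  assumes h: "integrable M h" and le: "(\<integral>\<^sup>+x. ennreal (exp (h x)) \<partial>M) \<le> 1"
  shows "(\<integral>x. h x \<partial>M) \<le> 0"
proof -
  have [measurable]: "h \<in> borel_measurable M" using h by auto
  have fin: "(\<integral>\<^sup>+x. ennreal (exp (h x)) \<partial>M) < \<infinity>"
    using le by (rule le_less_trans) simp
  have int: "integrable M (\<lambda>x. exp (h x))"
    using fin by (intro integrableI_nonneg) auto
  have "(\<integral>\<^sup>+x. ennreal (exp (h x)) \<partial>M) = ennreal (\<integral>x. exp (h x) \<partial>M)"
    using int by (intro nn_integral_eq_integral) auto
  then have 1: "(\<integral>x. exp (h x) \<partial>M) \<le> 1" using le by (simp add: ennreal_le_1)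
  \<comment> \<open>The inequality \<open>1 + h <= exp h\<close> plays the part of Jensen's
    inequality for the logarithm.\<close>
  have "(\<integral>x. h x + 1 \<partial>M) \<le> (\<integral>x. exp (h x) \<partial>M)"
    using h int by (intro integral_mono) (auto simp: add.commute)
  moreover have "(\<integral>x. h x + 1 \<partial>M) = (\<integral>x. h x \<partial>M) + 1"
    using h by (simp add: prob_space)
  ultimately show ?thesis using 1 by linarith
qed

text \<open>Strict positivity of \<open>p\<close> lets quotients and logarithms be formed at every
  point rather than almost everywhere; the bound \<open>B\<close> makes \<open>p x y\<close>
  integrable in \<open>x\<close> under every input law. The noise \<open>z\<close> may contain more
  than the additive noise, so a test function of \<open>x\<close> and \<open>z\<close> can look at
  the phases.\<close>

locale channel =
  fixes \<mu> :: "'x measure" and N :: "'z measure" and L :: "'y measure"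
    and Y :: "'x \<Rightarrow> 'z \<Rightarrow> 'y" and p :: "'x \<Rightarrow> 'y \<Rightarrow> real" and B :: real
  assumes prob_\<mu>: "prob_space \<mu>" and prob_N: "prob_space N" and sigma_finite_L: "sigma_finite_measure L"
    and Y_measurable[measurable]: "(\<lambda>(x, z). Y x z) \<in> \<mu> \<Otimes>\<^sub>M N \<rightarrow>\<^sub>M L"
    and p_measurable[measurable]: "(\<lambda>(x, y). p x y) \<in> borel_measurable (\<mu> \<Otimes>\<^sub>M L)"
    and p_pos: "\<And>x y. x \<in> space \<mu> \<Longrightarrow> y \<in> space L \<Longrightarrow> 0 < p x y"
    and p_le: "\<And>x y. x \<in> space \<mu> \<Longrightarrow> y \<in> space L \<Longrightarrow> p x y \<le> B"
    and law: "\<And>x. x \<in> space \<mu> \<Longrightarrow> distr N L (Y x) = density L (\<lambda>y. ennreal (p x y))"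
begin

sublocale X: prob_space \<mu> by (rule prob_\<mu>)
sublocale Z: prob_space N by (rule prob_N)
sublocale L: sigma_finite_measure L by (rule sigma_finite_L)
sublocale XZ: pair_prob_space \<mu> N ..
sublocale XL: pair_sigma_finite \<mu> L ..

definition out_density :: "'y \<Rightarrow> real" where
  "out_density y = (\<integral>x. p x y \<partial>\<mu>)"

definition info_density :: "'x \<Rightarrow> 'y \<Rightarrow> real" where
  "info_density x y = p x y / out_density y"

lemma Y_measurable1[measurable]: "x \<in> space \<mu> \<Longrightarrow> Y x \<in> N \<rightarrow>\<^sub>M L"
  using measurable_compose[OF measurable_Pair1' Y_measurable, of x] by simp

lemma integrable_p: "y \<in> space L \<Longrightarrow> integrable \<mu> (\<lambda>x. p x y)"
  using p_le p_pos
  by (intro X.integrable_const_bound[where B=B]) (auto intro!: AE_I2 simp: less_imp_le)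

lemma out_density_measurable[measurable]: "out_density \<in> borel_measurable L"
  unfolding out_density_def by measurable

lemma nn_out_density: "y \<in> space L \<Longrightarrow> (\<integral>\<^sup>+x. ennreal (p x y) \<partial>\<mu>) = ennreal (out_density y)"
  unfolding out_density_def using p_pos
  by (intro nn_integral_eq_integral integrable_p AE_I2) (auto intro: less_imp_le)

lemma out_density_pos: "y \<in> space L \<Longrightarrow> 0 < out_density y"
proof -
  assume y: "y \<in> space L"
  have "(\<integral>\<^sup>+x. ennreal (p x y) \<partial>\<mu>) \<noteq> 0"
  proof
    assume "(\<integral>\<^sup>+x. ennreal (p x y) \<partial>\<mu>) = 0"
    then have "AE x in \<mu>. ennreal (p x y) = 0"
      using y by (subst (asm) nn_integral_0_iff_AE) auto
    then have "AE x in \<mu>. False"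
      using AE_space by eventually_elim (use p_pos[OF _ y] in \<open>force simp: ennreal_eq_0_iff not_le[symmetric]\<close>)
    then show False by simp
  qed
  then show ?thesis using nn_out_density[OF y] by (simp add: ennreal_eq_0_iff not_le)
qed

lemma out_density_nonzero: "y \<in> space L \<Longrightarrow> out_density y \<noteq> 0"
  using out_density_pos by force

lemma info_density_measurable[measurable]:
  "(\<lambda>(x, y). info_density x y) \<in> borel_measurable (\<mu> \<Otimes>\<^sub>M L)"
  unfolding info_density_def by measurable

lemma info_density_pos: "x \<in> space \<mu> \<Longrightarrow> y \<in> space L \<Longrightarrow> 0 < info_density x y"
  unfolding info_density_def using p_pos out_density_pos by auto

text \<open>By Bayes' rule, \<open>info_density x y\<close> is the density of the posterior law of
  the input with respect to the prior. It is thus itself a reverse density.\<close>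

lemma nn_integral_info_density:
  "y \<in> space L \<Longrightarrow> (\<integral>\<^sup>+x. ennreal (info_density x y) \<partial>\<mu>) = 1"
proof -
  assume y: "y \<in> space L"
  have "(\<integral>\<^sup>+x. ennreal (info_density x y) \<partial>\<mu>) = (\<integral>\<^sup>+x. ennreal (p x y) / ennreal (out_density y) \<partial>\<mu>)"
    using p_pos[OF _ y] out_density_pos[OF y]
    by (intro nn_integral_cong) (auto simp: info_density_def divide_ennreal less_imp_le)
  also have "\<dots> = ennreal (out_density y) / ennreal (out_density y)"
    using y by (subst nn_integral_divide) (auto simp: nn_out_density)
  also have "\<dots> = 1" using out_density_pos[OF y] by (simp add: divide_ennreal)
  finally show ?thesis .
qed

lemma nn_integral_Y:
  assumes x: "x \<in> space \<mu>" and [measurable]: "u \<in> borel_measurable L"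
  shows "(\<integral>\<^sup>+z. u (Y x z) \<partial>N) = (\<integral>\<^sup>+y. ennreal (p x y) * u y \<partial>L)"
proof -
  have "(\<integral>\<^sup>+z. u (Y x z) \<partial>N) = (\<integral>\<^sup>+y. u y \<partial>distr N L (Y x))"
    using x by (subst nn_integral_distr) auto
  also have "\<dots> = (\<integral>\<^sup>+y. ennreal (p x y) * u y \<partial>L)"
    using x by (simp add: law nn_integral_density)
  finally show ?thesis .
qed

lemma nn_integral_joint:
  assumes [measurable]: "(\<lambda>(x, y). u x y) \<in> borel_measurable (\<mu> \<Otimes>\<^sub>M L)"
  shows "(\<integral>\<^sup>+(x, z). u x (Y x z) \<partial>(\<mu> \<Otimes>\<^sub>M N)) = (\<integral>\<^sup>+x. \<integral>\<^sup>+y. ennreal (p x y) * u x y \<partial>L \<partial>\<mu>)"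
proof -
  have "(\<integral>\<^sup>+(x, z). u x (Y x z) \<partial>(\<mu> \<Otimes>\<^sub>M N)) = (\<integral>\<^sup>+x. \<integral>\<^sup>+z. u x (Y x z) \<partial>N \<partial>\<mu>)"
    by (subst Z.nn_integral_fst[symmetric]) auto
  also have "\<dots> = (\<integral>\<^sup>+x. \<integral>\<^sup>+y. ennreal (p x y) * u x y \<partial>L \<partial>\<mu>)"
    by (intro nn_integral_cong nn_integral_Y) auto
  finally show ?thesis .
qed

lemma distr_joint:
  "distr (\<mu> \<Otimes>\<^sub>M N) (\<mu> \<Otimes>\<^sub>M L) (\<lambda>(x, z). (x, Y x z)) = density (\<mu> \<Otimes>\<^sub>M L) (\<lambda>(x, y). ennreal (p x y))"
proof (rule measure_eqI)
  fix A assume "A \<in> sets (distr (\<mu> \<Otimes>\<^sub>M N) (\<mu> \<Otimes>\<^sub>M L) (\<lambda>(x, z). (x, Y x z)))"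
  then have [measurable]: "A \<in> sets (\<mu> \<Otimes>\<^sub>M L)" by simp
  have "emeasure (distr (\<mu> \<Otimes>\<^sub>M N) (\<mu> \<Otimes>\<^sub>M L) (\<lambda>(x, z). (x, Y x z))) A
      = (\<integral>\<^sup>+w. indicator A w \<partial>distr (\<mu> \<Otimes>\<^sub>M N) (\<mu> \<Otimes>\<^sub>M L) (\<lambda>(x, z). (x, Y x z)))"
    by simp
  also have "\<dots> = (\<integral>\<^sup>+(x, z). indicator A (x, Y x z) \<partial>(\<mu> \<Otimes>\<^sub>M N))"
    by (subst nn_integral_distr) (auto simp: case_prod_beta')
  also have "\<dots> = (\<integral>\<^sup>+x. \<integral>\<^sup>+y. ennreal (p x y) * indicator A (x, y) \<partial>L \<partial>\<mu>)"
    by (rule nn_integral_joint) auto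
  also have "\<dots> = (\<integral>\<^sup>+(x, y). ennreal (p x y) * indicator A (x, y) \<partial>(\<mu> \<Otimes>\<^sub>M L))"
    by (subst L.nn_integral_fst[symmetric]) (auto simp: case_prod_beta')
  also have "\<dots> = emeasure (density (\<mu> \<Otimes>\<^sub>M L) (\<lambda>(x, y). ennreal (p x y))) A"
    by (subst emeasure_density) (auto simp: case_prod_beta')
  finally show "emeasure (distr (\<mu> \<Otimes>\<^sub>M N) (\<mu> \<Otimes>\<^sub>M L) (\<lambda>(x, z). (x, Y x z))) A = \<dots>" .
qed simp

lemma distr_Y: "distr (\<mu> \<Otimes>\<^sub>M N) L (\<lambda>(x, z). Y x z) = density L (\<lambda>y. ennreal (out_density y))"
proof (rule measure_eqI)
  fix A assume "A \<in> sets (distr (\<mu> \<Otimes>\<^sub>M N) L (\<lambda>(x, z). Y x z))"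
  then have A[measurable]: "A \<in> sets L" by simp
  have "emeasure (distr (\<mu> \<Otimes>\<^sub>M N) L (\<lambda>(x, z). Y x z)) A
      = (\<integral>\<^sup>+w. indicator A w \<partial>distr (\<mu> \<Otimes>\<^sub>M N) L (\<lambda>(x, z). Y x z))"
    by simp
  also have "\<dots> = (\<integral>\<^sup>+(x, z). indicator A (Y x z) \<partial>(\<mu> \<Otimes>\<^sub>M N))"
    by (subst nn_integral_distr) (auto simp: case_prod_beta')
  also have "\<dots> = (\<integral>\<^sup>+x. \<integral>\<^sup>+y. ennreal (p x y) * indicator A y \<partial>L \<partial>\<mu>)"
    by (rule nn_integral_joint) auto
  also have "\<dots> = (\<integral>\<^sup>+y. \<integral>\<^sup>+x. ennreal (p x y) * indicator A y \<partial>\<mu> \<partial>L)"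
    by (subst XL.Fubini') auto
  also have "\<dots> = (\<integral>\<^sup>+y. ennreal (out_density y) * indicator A y \<partial>L)"
    by (intro nn_integral_cong) (auto simp: nn_integral_multc nn_out_density)
  also have "\<dots> = emeasure (density L (\<lambda>y. ennreal (out_density y))) A"
    by (subst emeasure_density) auto
  finally show "emeasure (distr (\<mu> \<Otimes>\<^sub>M N) L (\<lambda>(x, z). Y x z)) A = \<dots>" .
qed simp

lemma nn_integral_out_density: "(\<integral>\<^sup>+y. ennreal (out_density y) \<partial>L) = 1"
proof -
  interpret D: prob_space "density L (\<lambda>y. ennreal (out_density y))"
    by (subst distr_Y[symmetric]) (intro XZ.prob_space_distr, simp)
  have "(\<integral>\<^sup>+y. ennreal (out_density y) \<partial>L) = emeasure (density L (\<lambda>y. ennreal (out_density y))) (space L)"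
    by (subst emeasure_density) (auto intro!: nn_integral_cong)
  then show ?thesis using D.emeasure_space_1 by simp
qed

text \<open>The joint law and the product of the marginals both have densities with respect to
  \<open>\<mu> \<Otimes>\<^sub>M L\<close>, and the divergence is the mean of the logarithm of their
  quotient. \<open>S\<close> and \<open>T\<close> share only the sigma-algebras of
  \<open>\<mu>\<close> and \<open>L\<close>: the information is defined over Borel spaces, whereas
  the densities refer to Lebesgue measure.\<close>

lemma mutual_information_eq:
  assumes S: "sets S = sets \<mu>" and T: "sets T = sets L"
  shows "prob_space.mutual_information (\<mu> \<Otimes>\<^sub>M N) 2 S T fst (\<lambda>(x, z). Y x z)
    = (\<integral>(x, z). ln (info_density x (Y x z)) \<partial>(\<mu> \<Otimes>\<^sub>M N)) / ln 2"
proof -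
  let ?D = "density L (\<lambda>y. ennreal (out_density y))"
  have 1: "distr (\<mu> \<Otimes>\<^sub>M N) S fst = \<mu>"
  proof -
    have "distr (\<mu> \<Otimes>\<^sub>M N) S fst = distr (\<mu> \<Otimes>\<^sub>M N) \<mu> fst" by (rule distr_cong) (auto simp: S)
    then show ?thesis by (simp add: Z.distr_pair_fst)
  qed
  have 2: "distr (\<mu> \<Otimes>\<^sub>M N) T (\<lambda>(x, z). Y x z) = ?D"
  proof -
    have "distr (\<mu> \<Otimes>\<^sub>M N) T (\<lambda>(x, z). Y x z) = distr (\<mu> \<Otimes>\<^sub>M N) L (\<lambda>(x, z). Y x z)"
      by (rule distr_cong) (auto simp: T)
    then show ?thesis by (simp add: distr_Y)
  qed
  interpret D: prob_space ?D
    by (subst distr_Y[symmetric]) (intro XZ.prob_space_distr, simp)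
  interpret XD: pair_prob_space \<mu> ?D ..
  have prod: "\<mu> \<Otimes>\<^sub>M ?D = density (\<mu> \<Otimes>\<^sub>M L) (\<lambda>(x, y). ennreal (out_density y))"
    using pair_measure_density[of "\<lambda>_. 1" \<mu> "\<lambda>y. ennreal (out_density y)" L]
      X.sigma_finite_measure_axioms L.sigma_finite_measure_axioms D.sigma_finite_measure_axioms
    by (simp add: density_1)
  have "distr (\<mu> \<Otimes>\<^sub>M N) (S \<Otimes>\<^sub>M T) (\<lambda>w. (fst w, case w of (x, z) \<Rightarrow> Y x z))
      = distr (\<mu> \<Otimes>\<^sub>M N) (\<mu> \<Otimes>\<^sub>M L) (\<lambda>(x, z). (x, Y x z))"
    by (rule distr_cong) (auto simp: S T case_prod_beta' intro!: sets_pair_measure_cong)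
  also have "\<dots> = density (\<mu> \<Otimes>\<^sub>M L) (\<lambda>(x, y). ennreal (p x y))" by (rule distr_joint)
  also have "\<dots> = density (\<mu> \<Otimes>\<^sub>M ?D) (\<lambda>w. ennreal (info_density (fst w) (snd w)))"
    unfolding prod
  proof (subst density_density_eq)
    show "density (\<mu> \<Otimes>\<^sub>M L) (\<lambda>(x, y). ennreal (p x y)) = density (\<mu> \<Otimes>\<^sub>M L)
     (\<lambda>w. (case w of (x, y) \<Rightarrow> ennreal (out_density y)) * ennreal (info_density (fst w) (snd w)))"
      using out_density_pos p_pos
      by (intro density_cong)
        (auto intro!: AE_I2 simp: space_pair_measure info_density_def ennreal_mult'[symmetric]
          less_imp_le out_density_nonzero)
  qed (auto simp: case_prod_beta')
  finally have J: "distr (\<mu> \<Otimes>\<^sub>M N) (S \<Otimes>\<^sub>M T) (\<lambda>w. (fst w, case w of (x, z) \<Rightarrow> Y x z))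
      = density (\<mu> \<Otimes>\<^sub>M ?D) (\<lambda>w. ennreal (info_density (fst w) (snd w)))" .
  have J': "distr (\<mu> \<Otimes>\<^sub>M N) (\<mu> \<Otimes>\<^sub>M L) (\<lambda>(x, z). (x, Y x z))
      = density (\<mu> \<Otimes>\<^sub>M ?D) (\<lambda>w. ennreal (info_density (fst w) (snd w)))"
    unfolding J[symmetric] by (rule distr_cong) (auto simp: S T case_prod_beta' intro!: sets_pair_measure_cong)
  have nn: "AE w in \<mu> \<Otimes>\<^sub>M ?D. 0 \<le> info_density (fst w) (snd w)"
    by (intro AE_I2) (auto simp: space_pair_measure intro!: less_imp_le info_density_pos)
  have mD[measurable]: "(\<lambda>w. info_density (fst w) (snd w)) \<in> borel_measurable (\<mu> \<Otimes>\<^sub>M ?D)"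
  proof -
    have "borel_measurable (\<mu> \<Otimes>\<^sub>M ?D) = borel_measurable (\<mu> \<Otimes>\<^sub>M L)"
      by (intro measurable_cong_sets sets_pair_measure_cong) auto
    then show ?thesis using info_density_measurable by (simp add: case_prod_beta')
  qed
  have "prob_space.mutual_information (\<mu> \<Otimes>\<^sub>M N) 2 S T fst (\<lambda>(x, z). Y x z)
      = KL_divergence 2 (\<mu> \<Otimes>\<^sub>M ?D) (density (\<mu> \<Otimes>\<^sub>M ?D) (\<lambda>w. ennreal (info_density (fst w) (snd w))))"
    by (subst XZ.mutual_information_def) (simp add: 1 2 J)
  also have "\<dots> = (\<integral>w. info_density (fst w) (snd w) * log 2 (info_density (fst w) (snd w)) \<partial>(\<mu> \<Otimes>\<^sub>M ?D))"
    by (rule XD.KL_density) (use nn in auto)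
  also have "\<dots> = (\<integral>w. log 2 (info_density (fst w) (snd w)) \<partial>distr (\<mu> \<Otimes>\<^sub>M N) (\<mu> \<Otimes>\<^sub>M L) (\<lambda>(x, z). (x, Y x z)))"
    unfolding J' using nn by (subst integral_density) auto
  also have "\<dots> = (\<integral>(x, z). ln (info_density x (Y x z)) / ln 2 \<partial>(\<mu> \<Otimes>\<^sub>M N))"
    by (subst integral_distr) (auto simp: log_def case_prod_beta')
  also have "\<dots> = (\<integral>(x, z). ln (info_density x (Y x z)) \<partial>(\<mu> \<Otimes>\<^sub>M N)) / ln 2"
    by (simp add: case_prod_beta')
  finally show ?thesis .
qed

text \<open>The domination bounds the mean of \<open>exp (ln i - G)\<close> by a double integral of
  \<open>i * q\<close>; after an exchange of the integrals the posterior density integrates to 1 and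
  the integral of \<open>q\<close> is left. Integrability of \<open>ln i\<close> belongs to the
  conclusion because the mutual information is a Bochner integral, which is 0 when it
  diverges.\<close>

lemma info_le:
  fixes G :: "'x \<Rightarrow> 'z \<Rightarrow> real"
  assumes G: "integrable (\<mu> \<Otimes>\<^sub>M N) (\<lambda>(x, z). G x z)"
    and q[measurable]: "q \<in> borel_measurable L" and q1: "(\<integral>\<^sup>+y. q y \<partial>L) \<le> 1"
    and dom: "\<And>x u. x \<in> space \<mu> \<Longrightarrow> u \<in> borel_measurable L \<Longrightarrow>
      (\<integral>\<^sup>+z. u (Y x z) * ennreal (exp (- G x z)) \<partial>N) \<le> (\<integral>\<^sup>+y. u y * q y \<partial>L)"
  shows "integrable (\<mu> \<Otimes>\<^sub>M N) (\<lambda>(x, z). ln (info_density x (Y x z)))"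
    and "(\<integral>(x, z). ln (info_density x (Y x z)) \<partial>(\<mu> \<Otimes>\<^sub>M N)) \<le> (\<integral>(x, z). G x z \<partial>(\<mu> \<Otimes>\<^sub>M N))"
proof -
  let ?d = "\<lambda>w. info_density (fst w) (Y (fst w) (snd w))"
  let ?G = "\<lambda>w. G (fst w) (snd w)"
  have mG[measurable]: "?G \<in> borel_measurable (\<mu> \<Otimes>\<^sub>M N)" and iG: "integrable (\<mu> \<Otimes>\<^sub>M N) ?G"
    using G by (auto simp: case_prod_beta')
  have md[measurable]: "?d \<in> borel_measurable (\<mu> \<Otimes>\<^sub>M N)"
  proof -
    have "(\<lambda>w. (fst w, Y (fst w) (snd w))) \<in> \<mu> \<Otimes>\<^sub>M N \<rightarrow>\<^sub>M \<mu> \<Otimes>\<^sub>M L"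
      using Y_measurable by (auto simp: case_prod_beta')
    from measurable_compose[OF this info_density_measurable] show ?thesis by simp
  qed
  have pos: "w \<in> space (\<mu> \<Otimes>\<^sub>M N) \<Longrightarrow> 0 < ?d w" for w
    by (auto simp: space_pair_measure intro!: info_density_pos measurable_space[OF Y_measurable1])
  \<comment> \<open>The reciprocal of the information density turns the joint law back into the
    product law. Its mean controls the negative part of the logarithm.\<close>
  have inv: "(\<integral>\<^sup>+w. ennreal (1 / ?d w) \<partial>(\<mu> \<Otimes>\<^sub>M N)) \<le> 1"
  proof -
    have "(\<integral>\<^sup>+w. ennreal (1 / ?d w) \<partial>(\<mu> \<Otimes>\<^sub>M N)) = (\<integral>\<^sup>+x. \<integral>\<^sup>+y. ennreal (p x y) * ennreal (1 / info_density x y) \<partial>L \<partial>\<mu>)"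
      by (subst nn_integral_joint[symmetric]) (auto simp: case_prod_beta')
    also have "\<dots> = (\<integral>\<^sup>+x. \<integral>\<^sup>+y. ennreal (out_density y) \<partial>L \<partial>\<mu>)"
      using p_pos out_density_pos
      by (intro nn_integral_cong)
        (auto simp: info_density_def ennreal_mult'[symmetric] less_imp_le dest: less_imp_neq[OF p_pos])
    finally show ?thesis by (simp add: nn_integral_out_density X.emeasure_space_1)
  qed
  have key: "(\<integral>\<^sup>+w. ennreal (exp (ln (?d w) - ?G w)) \<partial>(\<mu> \<Otimes>\<^sub>M N)) \<le> 1"
  proof -
    have "(\<integral>\<^sup>+w. ennreal (exp (ln (?d w) - ?G w)) \<partial>(\<mu> \<Otimes>\<^sub>M N))
        = (\<integral>\<^sup>+w. ennreal (?d w) * ennreal (exp (- ?G w)) \<partial>(\<mu> \<Otimes>\<^sub>M N))"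
      using pos by (intro nn_integral_cong) (auto simp: exp_diff ennreal_mult'[symmetric] exp_minus field_simps)
    also have "\<dots> = (\<integral>\<^sup>+x. \<integral>\<^sup>+z. ennreal (info_density x (Y x z)) * ennreal (exp (- G x z)) \<partial>N \<partial>\<mu>)"
      by (subst Z.nn_integral_fst[symmetric]) auto
    also have "\<dots> \<le> (\<integral>\<^sup>+x. \<integral>\<^sup>+y. ennreal (info_density x y) * q y \<partial>L \<partial>\<mu>)"
      by (intro nn_integral_mono dom) auto
    also have "\<dots> = (\<integral>\<^sup>+y. \<integral>\<^sup>+x. ennreal (info_density x y) * q y \<partial>\<mu> \<partial>L)"
      by (subst XL.Fubini') auto
    also have "\<dots> = (\<integral>\<^sup>+y. q y \<partial>L)"
      by (intro nn_integral_cong) (auto simp: nn_integral_multc nn_integral_info_density)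
    finally show ?thesis using q1 by simp
  qed
  have i1: "integrable (\<mu> \<Otimes>\<^sub>M N) (\<lambda>w. 1 / ?d w)"
    using le_less_trans[OF inv] pos by (intro integrableI_nonneg) (auto intro!: AE_I2 less_imp_le)
  have i2: "integrable (\<mu> \<Otimes>\<^sub>M N) (\<lambda>w. exp (ln (?d w) - ?G w))"
    using le_less_trans[OF key] by (intro integrableI_nonneg) auto
  have "integrable (\<mu> \<Otimes>\<^sub>M N) (\<lambda>w. ln (?d w))"
  proof (rule Bochner_Integration.integrable_bound)
    \<comment> \<open>The majorant combines \<open>- ln i <= 1 / i\<close> with
      \<open>ln i <= exp (ln i - G) + \<bar>G\<bar>\<close>.\<close>
    show "integrable (\<mu> \<Otimes>\<^sub>M N) (\<lambda>w. 1 / ?d w + (exp (ln (?d w) - ?G w) + \<bar>?G w\<bar>))"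
      using i1 i2 iG by (intro Bochner_Integration.integrable_add) auto
    show "AE w in \<mu> \<Otimes>\<^sub>M N. norm (ln (?d w)) \<le> norm (1 / ?d w + (exp (ln (?d w) - ?G w) + \<bar>?G w\<bar>))"
    proof (rule AE_I2)
      fix w assume w: "w \<in> space (\<mu> \<Otimes>\<^sub>M N)"
      have "ln (1 / ?d w) \<le> 1 / ?d w" using pos[OF w] by (intro less_imp_le ln_less_self) auto
      then have a: "- ln (?d w) \<le> 1 / ?d w" using pos[OF w] by (simp add: ln_div)
      have b: "ln (?d w) \<le> exp (ln (?d w) - ?G w) + \<bar>?G w\<bar>"
        using exp_ge_add_one_self[of "ln (?d w) - ?G w"] by linarith
      have "0 < 1 / ?d w" using pos[OF w] by simp
      then show "norm (ln (?d w)) \<le> norm (1 / ?d w + (exp (ln (?d w) - ?G w) + \<bar>?G w\<bar>))"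
        using a b exp_gt_zero[of "ln (?d w) - ?G w"] unfolding real_norm_def by linarith
    qed
  qed simp
  then show I: "integrable (\<mu> \<Otimes>\<^sub>M N) (\<lambda>(x, z). ln (info_density x (Y x z)))"
    by (simp add: case_prod_beta')
  have "(\<integral>w. ln (?d w) - ?G w \<partial>(\<mu> \<Otimes>\<^sub>M N)) \<le> 0"
    using I iG key by (intro XZ.integral_nonpos_if_exp_le_1) (auto simp: case_prod_beta')
  then show "(\<integral>(x, z). ln (info_density x (Y x z)) \<partial>(\<mu> \<Otimes>\<^sub>M N)) \<le> (\<integral>(x, z). G x z \<partial>(\<mu> \<Otimes>\<^sub>M N))"
    using I iG by (simp add: case_prod_beta')
qed

text \<open>The mean of \<open>exp (G - ln i)\<close> is at most the integral of
  \<open>\<phi>\<close> against the output density, and \<open>\<phi>\<close> integrates to at most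
  1 over the input. The domination is asked for almost every input, since the lower bound on the
  amplitudes of the constructed input holds almost surely.\<close>

lemma info_ge:
  fixes G :: "'x \<Rightarrow> 'z \<Rightarrow> real" and \<phi> :: "'x \<Rightarrow> 'y \<Rightarrow> ennreal"
  assumes G: "integrable (\<mu> \<Otimes>\<^sub>M N) (\<lambda>(x, z). G x z)"
    and I: "integrable (\<mu> \<Otimes>\<^sub>M N) (\<lambda>(x, z). ln (info_density x (Y x z)))"
    and \<phi>[measurable]: "(\<lambda>(x, y). \<phi> x y) \<in> borel_measurable (\<mu> \<Otimes>\<^sub>M L)"
    and \<phi>1: "\<And>y. y \<in> space L \<Longrightarrow> (\<integral>\<^sup>+x. \<phi> x y \<partial>\<mu>) \<le> 1"
    and dom: "AE x in \<mu>. \<forall>z\<in>space N. ennreal (exp (G x z)) \<le> \<phi> x (Y x z)"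
  shows "(\<integral>(x, z). G x z \<partial>(\<mu> \<Otimes>\<^sub>M N)) \<le> (\<integral>(x, z). ln (info_density x (Y x z)) \<partial>(\<mu> \<Otimes>\<^sub>M N))"
proof -
  let ?d = "\<lambda>w. info_density (fst w) (Y (fst w) (snd w))"
  let ?G = "\<lambda>w. G (fst w) (snd w)"
  have [measurable]: "(\<lambda>w. \<phi> (fst w) (snd w)) \<in> borel_measurable (\<mu> \<Otimes>\<^sub>M L)"
    using \<phi> by (simp add: case_prod_beta')
  have pos: "w \<in> space (\<mu> \<Otimes>\<^sub>M N) \<Longrightarrow> 0 < ?d w" for w
    by (auto simp: space_pair_measure intro!: info_density_pos measurable_space[OF Y_measurable1])
  have mG[measurable]: "(\<lambda>w. ennreal (exp (?G w - ln (?d w)))) \<in> borel_measurable (\<mu> \<Otimes>\<^sub>M N)"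
  proof -
    have "(\<lambda>t. ennreal (exp t)) \<in> borel_measurable borel" by measurable
    from measurable_compose[OF borel_measurable_diff[OF borel_measurable_integrable[OF G, unfolded case_prod_beta']
      borel_measurable_integrable[OF I, unfolded case_prod_beta']] this]
    show ?thesis .
  qed
  have "(\<integral>\<^sup>+w. ennreal (exp (?G w - ln (?d w))) \<partial>(\<mu> \<Otimes>\<^sub>M N))
      = (\<integral>\<^sup>+x. \<integral>\<^sup>+z. ennreal (exp (G x z - ln (info_density x (Y x z)))) \<partial>N \<partial>\<mu>)"
    by (subst Z.nn_integral_fst[OF mG, symmetric]) simp
  also have "\<dots> \<le> (\<integral>\<^sup>+x. \<integral>\<^sup>+z. \<phi> x (Y x z) * ennreal (1 / info_density x (Y x z)) \<partial>N \<partial>\<mu>)"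
  proof (rule nn_integral_mono_AE)
    show "AE x in \<mu>. (\<integral>\<^sup>+z. ennreal (exp (G x z - ln (info_density x (Y x z)))) \<partial>N)
        \<le> (\<integral>\<^sup>+z. \<phi> x (Y x z) * ennreal (1 / info_density x (Y x z)) \<partial>N)"
      using dom AE_space
    proof eventually_elim
      case (elim x)
      show ?case
      proof (rule nn_integral_mono)
        fix z assume z: "z \<in> space N"
        have p: "0 < info_density x (Y x z)" using pos[of "(x, z)"] elim(2) z by (simp add: space_pair_measure)
        have "ennreal (exp (G x z - ln (info_density x (Y x z)))) = ennreal (exp (G x z)) * ennreal (1 / info_density x (Y x z))"
          using p by (simp add: exp_diff ennreal_mult'[symmetric])
        also have "\<dots> \<le> \<phi> x (Y x z) * ennreal (1 / info_density x (Y x z))"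
          using elim(1) z by (intro mult_right_mono) auto
        finally show "ennreal (exp (G x z - ln (info_density x (Y x z)))) \<le> \<dots>" .
      qed
    qed
  qed
  also have "\<dots> = (\<integral>\<^sup>+w. \<phi> (fst w) (Y (fst w) (snd w)) * ennreal (1 / ?d w) \<partial>(\<mu> \<Otimes>\<^sub>M N))"
    by (subst Z.nn_integral_fst[symmetric]) auto
  also have "\<dots> = (\<integral>\<^sup>+x. \<integral>\<^sup>+y. ennreal (p x y) * (\<phi> x y * ennreal (1 / info_density x y)) \<partial>L \<partial>\<mu>)"
    by (subst nn_integral_joint[symmetric]) (auto simp: case_prod_beta')
  \<comment> \<open>Once \<open>p\<close> has cancelled, the factor besides \<open>\<phi>\<close> is
    the output density, which does not depend on \<open>x\<close>; so the integral over the input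
    falls on \<open>\<phi>\<close> alone.\<close>
  also have "\<dots> = (\<integral>\<^sup>+x. \<integral>\<^sup>+y. \<phi> x y * ennreal (out_density y) \<partial>L \<partial>\<mu>)"
  proof (intro nn_integral_cong)
    fix x y assume x: "x \<in> space \<mu>" "y \<in> space L"
    have "ennreal (p x y) * (\<phi> x y * ennreal (1 / info_density x y)) = \<phi> x y * (ennreal (p x y) * ennreal (1 / info_density x y))"
      by (simp add: ac_simps)
    also have "ennreal (p x y) * ennreal (1 / info_density x y) = ennreal (out_density y)"
      using p_pos[OF x] out_density_pos[OF x(2)]
      by (simp add: info_density_def ennreal_mult'[symmetric] less_imp_le)
    finally show "ennreal (p x y) * (\<phi> x y * ennreal (1 / info_density x y)) = \<phi> x y * ennreal (out_density y)" .
  qed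
  also have "\<dots> = (\<integral>\<^sup>+y. \<integral>\<^sup>+x. \<phi> x y * ennreal (out_density y) \<partial>\<mu> \<partial>L)"
    by (subst XL.Fubini') auto
  also have "\<dots> \<le> (\<integral>\<^sup>+y. ennreal (out_density y) \<partial>L)"
  proof (intro nn_integral_mono)
    fix y assume y: "y \<in> space L"
    have "(\<integral>\<^sup>+x. \<phi> x y * ennreal (out_density y) \<partial>\<mu>) = (\<integral>\<^sup>+x. \<phi> x y \<partial>\<mu>) * ennreal (out_density y)"
      using y by (intro nn_integral_multc) auto
    also have "\<dots> \<le> 1 * ennreal (out_density y)" by (intro mult_right_mono \<phi>1 y) simp
    finally show "(\<integral>\<^sup>+x. \<phi> x y * ennreal (out_density y) \<partial>\<mu>) \<le> ennreal (out_density y)" by simp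
  qed
  also have "\<dots> = 1" by (rule nn_integral_out_density)
  finally have "(\<integral>w. ?G w - ln (?d w) \<partial>(\<mu> \<Otimes>\<^sub>M N)) \<le> 0"
    using I G by (intro XZ.integral_nonpos_if_exp_le_1) (auto simp: case_prod_beta')
  then show ?thesis using I G by (simp add: case_prod_beta')
qed

end

subsection \<open>Fekete's lemma and Gaussian moments\<close>

text \<open>With \<open>n = k * m + r\<close> and \<open>r < m\<close>, superadditivity gives
  \<open>a n >= k * a m\<close>: nonnegativity allows the term \<open>a r\<close> of the remainder
  to be dropped. The linear bound keeps the supremum of the averages finite, and this supremum is
  the limit.\<close>

lemma fekete_superadditive:
  fixes a :: "nat \<Rightarrow> real"
  assumes super: "\<And>m n. m \<ge> 1 \<Longrightarrow> n \<ge> 1 \<Longrightarrow> a m + a n \<le> a (m + n)"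
    and bound: "\<And>n. n \<ge> 1 \<Longrightarrow> a n \<le> real n * B"
    and nonneg: "\<And>n. n \<ge> 1 \<Longrightarrow> 0 \<le> a n"
  obtains l where "(\<lambda>n. a n / real n) \<longlonglongrightarrow> l" "\<And>n. n \<ge> 1 \<Longrightarrow> a n / real n \<le> l"
    "\<And>e. e > 0 \<Longrightarrow> \<exists>n\<ge>1. l - e < a n / real n"
proof -
  let ?S = "(\<lambda>n. a n / real n) ` {1..}"
  let ?l = "Sup ?S"
  have bdd: "bdd_above ?S"
    using bound by (intro bdd_aboveI2[where M=B]) (auto simp: field_simps)
  have le: "a n / real n \<le> ?l" if "n \<ge> 1" for n
    using that bdd by (intro cSup_upper) auto
  have ex: "\<exists>n\<ge>1. ?l - e < a n / real n" if "e > 0" for e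
  proof -
    have "\<exists>x\<in>?S. ?l - e < x" using that bdd by (subst less_cSup_iff[symmetric]) auto
    then show ?thesis by auto
  qed
  have mult: "real k * a m \<le> a (k * m)" if "m \<ge> 1" "k \<ge> 1" for k m
    using that(2)
  proof (induction k rule: dec_induct)
    case (step k)
    have "real (Suc k) * a m = real k * a m + a m" by (simp add: algebra_simps)
    also have "\<dots> \<le> a (k * m) + a m" using step by simp
    also have "\<dots> \<le> a (k * m + m)" using super[of "k * m" m] step that by simp
    finally show ?case by (simp add: algebra_simps)
  qed simp
  have "(\<lambda>n. a n / real n) \<longlonglongrightarrow> ?l"
  proof (rule LIMSEQ_I)
    fix e :: real assume e: "e > 0"
    \<comment> \<open>A block length whose average is within \<open>e / 2\<close> of the supremum.
      The other \<open>e / 2\<close> absorbs the loss from the remainder, which is at most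
      \<open>a m / n\<close>.\<close>
    obtain m where m: "m \<ge> 1" "?l - e / 2 < a m / real m" using ex[of "e / 2"] e by auto
    define K where "K = a m / real m"
    have K0: "0 \<le> K" unfolding K_def using nonneg[OF m(1)] by simp
    obtain n0 :: nat where n0: "real n0 > 2 * a m / e" using reals_Archimedean2 by blast
    show "\<exists>no. \<forall>n\<ge>no. norm (a n / real n - ?l) < e"
    proof (intro exI[of _ "max n0 m + 1"] allI impI)
      fix n assume n: "max n0 m + 1 \<le> n"
      define k r where "k = n div m" and "r = n mod m"
      have nkr: "n = k * m + r" "r < m" unfolding k_def r_def using m by auto
      have k1: "k \<ge> 1" unfolding k_def using n m by (simp add: div_greater_zero_iff Suc_le_eq)
      have "real k * a m \<le> a n"
      proof (cases "r = 0")
        case True then show ?thesis using mult[OF m(1) k1] nkr by simp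
      next
        case False
        then have "a (k * m) + a r \<le> a n" using super[of "k * m" r] nkr m k1 by simp
        then show ?thesis using mult[OF m(1) k1] nonneg[of r] False by simp
      qed
      moreover have "real k * a m = (real n - real r) * K"
        using nkr m by (simp add: K_def field_simps)
      moreover have "real r * K \<le> a m"
        using nkr m nonneg[OF m(1)] by (simp add: K_def field_simps mult_right_mono)
      ultimately have "real n * K - a m \<le> a n" by (simp add: algebra_simps)
      then have "(real n * K - a m) / real n \<le> a n / real n" by (intro divide_right_mono) auto
      then have "K - a m / real n \<le> a n / real n" using n by (simp add: diff_divide_distrib)
      moreover have "a m / real n < e / 2"
      proof -
        have "2 * a m / e < real n" using n0 n by linarith
        then show ?thesis using e n by (simp add: field_simps)
      qed
      moreover have "?l - e / 2 < K" using m by (simp add: K_def)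
      ultimately have "?l - e < a n / real n" by linarith
      moreover have "a n / real n \<le> ?l" using n by (intro le) auto
      ultimately show "norm (a n / real n - ?l) < e" by simp
    qed
  qed
  with le ex show thesis using that by blast
qed

text \<open>Both measures agree on boxes. The identification lets a complex Gaussian be treated as a
  pair of real ones, whose moments are known.\<close>

lemma lborel_eq_distr_Complex: "lborel = distr (lborel \<Otimes>\<^sub>M lborel) borel (\<lambda>(a, b). Complex a b)"
proof (rule lborel_eqI)
  have m: "(\<lambda>(a, b). Complex a b) \<in> borel_measurable (borel :: (real \<times> real) measure)"
    unfolding case_prod_beta' Complex_eq by (intro borel_measurable_continuous_onI continuous_intros)
  fix l u :: complex assume le: "\<And>b. b \<in> Basis \<Longrightarrow> l \<bullet> b \<le> u \<bullet> b"
  have lu: "Re l \<le> Re u" "Im l \<le> Im u"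
    using le[of 1] le[of \<i>] by (simp_all add: Basis_complex_def)
  have "(\<lambda>(a, b). Complex a b) -` box l u = box (Re l, Im l) (Re u, Im u)"
    by (auto simp: in_box_complex_iff mem_box Basis_prod_def)
  then have "emeasure (distr (lborel \<Otimes>\<^sub>M lborel) borel (\<lambda>(a, b). Complex a b)) (box l u)
      = emeasure lborel (box (Re l, Im l) (Re u, Im u))"
    unfolding lborel_prod using m by (subst emeasure_distr) auto
  also have "\<dots> = (\<Prod>b\<in>Basis. (u - l) \<bullet> b)"
    using lu by (subst emeasure_lborel_box) (auto simp: Basis_prod_def Basis_complex_def prod.union_disjoint prod.reindex inj_on_def)
  finally show "emeasure (distr (lborel \<Otimes>\<^sub>M lborel) borel (\<lambda>(a, b). Complex a b)) (box l u) = ennreal (\<Prod>b\<in>Basis. (u - l) \<bullet> b)"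
    by simp
qed simp

section \<open>The standard complex normal law and its moments\<close>

abbreviation normal_half_variance :: "real measure" where
  "normal_half_variance \<equiv> density lborel (\<lambda>x. ennreal (normal_density 0 (1 / sqrt 2) x))"

definition gauss :: "complex \<Rightarrow> real" where
  "gauss z = exp (- (cmod z)\<^sup>2) / pi"

lemma gauss_measurable[measurable]: "gauss \<in> borel_measurable borel"
  unfolding gauss_def by measurable

lemma gauss_pos: "0 < gauss z"
  by (simp add: gauss_def)

lemma gauss_le: "gauss z \<le> 1 / pi"
  by (simp add: gauss_def divide_right_mono)

lemma std_complex_normal_gauss: "std_complex_normal = density lborel (\<lambda>z. ennreal (gauss z))"
  unfolding std_complex_normal_def gauss_def ..

lemma Complex_measurable[measurable]:
  "f \<in> borel_measurable M \<Longrightarrow> g \<in> borel_measurable M \<Longrightarrow> (\<lambda>x. Complex (f x) (g x)) \<in> borel_measurable M"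
proof -
  assume [measurable]: "f \<in> borel_measurable M" "g \<in> borel_measurable M"
  have "(\<lambda>x. Complex (f x) (g x)) = (\<lambda>x. f x *\<^sub>R 1 + g x *\<^sub>R \<i>)"
    by (auto simp: fun_eq_iff complex_eq_iff)
  then show ?thesis by simp
qed

text \<open>The density factors into two normal densities of variance 1/2, so real and imaginary
  part are independent.\<close>

lemma std_complex_normal_eq_distr:
  "std_complex_normal = distr (normal_half_variance \<Otimes>\<^sub>M normal_half_variance) borel (\<lambda>(a, b). Complex a b)"
proof -
  interpret h: prob_space normal_half_variance by (rule prob_space_normal_density) simp
  have "normal_half_variance \<Otimes>\<^sub>M normal_half_variance = density (lborel \<Otimes>\<^sub>M lborel)
     (\<lambda>(a, b). ennreal (normal_density 0 (1 / sqrt 2) a) * ennreal (normal_density 0 (1 / sqrt 2) b))"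
    by (rule pair_measure_density) (auto intro: lborel.sigma_finite_measure_axioms h.sigma_finite_measure_axioms)
  also have "\<dots> = density (lborel \<Otimes>\<^sub>M lborel) (\<lambda>z. ennreal (gauss (case z of (a, b) \<Rightarrow> Complex a b)))"
  proof (intro density_cong AE_I2)
    fix z :: "real \<times> real"
    have "normal_density 0 (1 / sqrt 2) a * normal_density 0 (1 / sqrt 2) b = gauss (Complex a b)" for a b
      by (simp add: normal_density_def gauss_def cmod_power2 power_divide mult_exp_exp)
    then show "(case z of (a, b) \<Rightarrow> ennreal (normal_density 0 (1 / sqrt 2) a) * ennreal (normal_density 0 (1 / sqrt 2) b))
      = ennreal (gauss (case z of (a, b) \<Rightarrow> Complex a b))"
      by (cases z) (simp add: ennreal_mult'[symmetric])
  qed (auto simp: case_prod_beta')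
  finally have *: "normal_half_variance \<Otimes>\<^sub>M normal_half_variance
    = density (lborel \<Otimes>\<^sub>M lborel) (\<lambda>z. ennreal (gauss (case z of (a, b) \<Rightarrow> Complex a b)))" .
  show ?thesis
    unfolding * std_complex_normal_gauss
    by (subst lborel_eq_distr_Complex, subst density_distr) (auto simp: case_prod_beta')
qed

lemma prob_space_std_complex_normal: "prob_space std_complex_normal"
proof -
  interpret h: prob_space normal_half_variance by (rule prob_space_normal_density) simp
  interpret hh: pair_prob_space normal_half_variance normal_half_variance ..
  show ?thesis unfolding std_complex_normal_eq_distr
    by (rule hh.prob_space_distr) (auto simp: case_prod_beta')
qed

lemma sets_std_complex_normal[measurable_cong, simp]: "sets std_complex_normal = sets borel"
  by (simp add: std_complex_normal_def)

lemma space_std_complex_normal[simp]: "space std_complex_normal = UNIV"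
  by (simp add: std_complex_normal_def)

lemma half_normal_moments:
  "has_bochner_integral normal_half_variance (\<lambda>x. x) 0"
  "has_bochner_integral normal_half_variance (\<lambda>x. x\<^sup>2) (1 / 2)"
  "integrable normal_half_variance (\<lambda>x. x ^ k)"
proof -
  let ?d = "normal_density 0 (1 / sqrt 2)"
  have *: "has_bochner_integral normal_half_variance f c \<longleftrightarrow> has_bochner_integral lborel (\<lambda>x. ?d x * f x) c"
    if [measurable]: "f \<in> borel_measurable borel" for f :: "real \<Rightarrow> real" and c
    by (simp add: has_bochner_integral_iff integrable_real_density integral_real_density)
  show "has_bochner_integral normal_half_variance (\<lambda>x. x) 0"
    using normal_moment_odd[of "1 / sqrt 2" 0 0] by (simp add: *)
  show "has_bochner_integral normal_half_variance (\<lambda>x. x\<^sup>2) (1 / 2)"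
    using normal_moment_even[of "1 / sqrt 2" 0 1] by (simp add: * power_divide power2_eq_square fact_numeral)
  show "integrable normal_half_variance (\<lambda>x. x ^ k)"
    using integrable_normal_moment[of "1 / sqrt 2" 0 k]
    by (subst integrable_real_density) auto
qed

lemma has_bochner_integral_product:
  fixes f :: "'a \<Rightarrow> real" and g :: "'b \<Rightarrow> real"
  assumes "pair_prob_space M1 M2" "has_bochner_integral M1 f x" "has_bochner_integral M2 g y"
  shows "has_bochner_integral (M1 \<Otimes>\<^sub>M M2) (\<lambda>(a, b). f a * g b) (x * y)"
proof -
  interpret pair_prob_space M1 M2 by fact
  have f: "integrable M1 f" "integral\<^sup>L M1 f = x" and g: "integrable M2 g" "integral\<^sup>L M2 g = y"
    using assms by (auto simp: has_bochner_integral_iff)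
  have [measurable]: "f \<in> borel_measurable M1" "g \<in> borel_measurable M2" using f g by auto
  have "integrable (M1 \<Otimes>\<^sub>M M2) (\<lambda>(a, b). f a * g b)"
    using f g by (intro Fubini_integrable) (auto simp: abs_mult)
  moreover from this have "integral\<^sup>L (M1 \<Otimes>\<^sub>M M2) (\<lambda>(a, b). f a * g b) = x * y"
    using f g by (subst integral_fst'[symmetric]) auto
  ultimately show ?thesis by (simp add: has_bochner_integral_iff)
qed

lemma std_complex_normal_monomial:
  assumes "has_bochner_integral normal_half_variance (\<lambda>x. x ^ i) c" "has_bochner_integral normal_half_variance (\<lambda>x. x ^ j) d"
  shows "has_bochner_integral std_complex_normal (\<lambda>w. Re w ^ i * Im w ^ j) (c * d)"
proof -
  interpret h: prob_space normal_half_variance by (rule prob_space_normal_density) simp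
  interpret hh: pair_prob_space normal_half_variance normal_half_variance ..
  have "has_bochner_integral (normal_half_variance \<Otimes>\<^sub>M normal_half_variance) (\<lambda>(a, b). a ^ i * b ^ j) (c * d)"
    using assms by (intro has_bochner_integral_product hh.pair_prob_space_axioms)
  then show ?thesis unfolding std_complex_normal_eq_distr
    by (subst has_bochner_integral_distr) (auto simp: case_prod_beta')
qed

text \<open>The noise enters the error terms after a rotation and a division by the input, hence the
  factor \<open>c\<close>; by circular symmetry the second moments see only its modulus. Of the
  fourth moment only finiteness is recorded: it multiplies remainders that vanish for large
  amplitudes.\<close>

lemma std_complex_normal_moments:
  shows has_bochner_integral_Re_std_complex_normal:
    "has_bochner_integral std_complex_normal (\<lambda>w. Re (c * w)) 0"
  and has_bochner_integral_Re2_std_complex_normal: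
    "has_bochner_integral std_complex_normal (\<lambda>w. (Re (c * w))\<^sup>2) ((cmod c)\<^sup>2 / 2)"
  and has_bochner_integral_Im2_std_complex_normal:
    "has_bochner_integral std_complex_normal (\<lambda>w. (Im (c * w))\<^sup>2) ((cmod c)\<^sup>2 / 2)"
  and has_bochner_integral_norm2_std_complex_normal:
    "has_bochner_integral std_complex_normal (\<lambda>w. (cmod w)\<^sup>2) 1"
  and integrable_norm4_std_complex_normal:
    "integrable std_complex_normal (\<lambda>w. cmod w ^ 4)"
proof -
  interpret h: prob_space normal_half_variance by (rule prob_space_normal_density) simp
  have h0: "has_bochner_integral normal_half_variance (\<lambda>x. x ^ 0) 1"
    by (simp add: has_bochner_integral_iff h.prob_space[simplified])
  have h1: "has_bochner_integral normal_half_variance (\<lambda>x. x ^ 1) 0"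
    using half_normal_moments(1) by simp
  note h2 = half_normal_moments(2)
  have h4: "has_bochner_integral normal_half_variance (\<lambda>x. x ^ 4) (integral\<^sup>L normal_half_variance (\<lambda>x. x ^ 4))"
    using half_normal_moments(3)[of 4] by (simp add: has_bochner_integral_iff)
  note m = std_complex_normal_monomial
  have m10: "has_bochner_integral std_complex_normal Re 0" using m[OF h1 h0] by simp
  have m01: "has_bochner_integral std_complex_normal Im 0" using m[OF h0 h1] by simp
  have m20: "has_bochner_integral std_complex_normal (\<lambda>w. (Re w)\<^sup>2) (1/2)" using m[OF h2 h0] by simp
  have m02: "has_bochner_integral std_complex_normal (\<lambda>w. (Im w)\<^sup>2) (1/2)" using m[OF h0 h2] by simp
  have m11: "has_bochner_integral std_complex_normal (\<lambda>w. Re w * Im w) 0" using m[OF h1 h1] by simp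
  have "has_bochner_integral std_complex_normal (\<lambda>w. Re c * Re w - Im c * Im w) (Re c * 0 - Im c * 0)"
    using m10 m01 by (intro has_bochner_integral_diff has_bochner_integral_mult_right)
  then show "has_bochner_integral std_complex_normal (\<lambda>w. Re (c * w)) 0" by simp
  have R: "has_bochner_integral std_complex_normal (\<lambda>w. (Re (c * w))\<^sup>2) ((cmod c)\<^sup>2 / 2)" for c
  proof -
    have "has_bochner_integral std_complex_normal
      (\<lambda>w. (Re c)\<^sup>2 * (Re w)\<^sup>2 + (Im c)\<^sup>2 * (Im w)\<^sup>2 - (2 * Re c * Im c) * (Re w * Im w))
      ((Re c)\<^sup>2 * (1/2) + (Im c)\<^sup>2 * (1/2) - (2 * Re c * Im c) * 0)"
      using m20 m02 m11 by (intro has_bochner_integral_diff has_bochner_integral_add has_bochner_integral_mult_right)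
    also have "(Re c)\<^sup>2 * (1/2) + (Im c)\<^sup>2 * (1/2) - (2 * Re c * Im c) * 0 = (cmod c)\<^sup>2 / 2"
      by (simp add: cmod_power2 field_simps)
    also have "(\<lambda>w. (Re c)\<^sup>2 * (Re w)\<^sup>2 + (Im c)\<^sup>2 * (Im w)\<^sup>2 - (2 * Re c * Im c) * (Re w * Im w)) = (\<lambda>w. (Re (c * w))\<^sup>2)"
      by (auto simp: fun_eq_iff power2_eq_square algebra_simps)
    finally show ?thesis .
  qed
  then show "has_bochner_integral std_complex_normal (\<lambda>w. (Re (c * w))\<^sup>2) ((cmod c)\<^sup>2 / 2)" .
  \<comment> \<open>The imaginary part of \<open>c * w\<close> is the real part of
    \<open>- \<i> * c * w\<close>.\<close>
  show "has_bochner_integral std_complex_normal (\<lambda>w. (Im (c * w))\<^sup>2) ((cmod c)\<^sup>2 / 2)"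
    using R[of "- \<i> * c"] by (simp add: norm_mult)
  have "has_bochner_integral std_complex_normal (\<lambda>w. (Re w)\<^sup>2 + (Im w)\<^sup>2) (1/2 + 1/2)"
    using m20 m02 by (intro has_bochner_integral_add)
  then show "has_bochner_integral std_complex_normal (\<lambda>w. (cmod w)\<^sup>2) 1" by (simp add: cmod_power2)
  have "integrable std_complex_normal (\<lambda>w. (Re w) ^ 4 + 2 * ((Re w)\<^sup>2 * (Im w)\<^sup>2) + (Im w) ^ 4)"
    using m[OF h4 h0] m[OF h2 h2] m[OF h0 h4]
    by (intro Bochner_Integration.integrable_add integrable_mult_right) (auto simp: has_bochner_integral_iff)
  moreover have "cmod w ^ 4 = (Re w) ^ 4 + 2 * ((Re w)\<^sup>2 * (Im w)\<^sup>2) + (Im w) ^ 4" for w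
  proof -
    have "cmod w ^ 4 = ((cmod w)\<^sup>2)\<^sup>2" by simp
    also have "\<dots> = ((Re w)\<^sup>2 + (Im w)\<^sup>2)\<^sup>2" by (simp only: cmod_power2)
    finally show ?thesis by (simp add: power2_eq_square power4_eq_xxxx algebra_simps)
  qed
  ultimately show "integrable std_complex_normal (\<lambda>w. cmod w ^ 4)" by simp
qed

text \<open>To first order the argument of \<open>1 + z\<close> is \<open>Im z\<close>, with a
  remainder of at most \<open>2 * |z|^2\<close> for \<open>|z| <= 1/2\<close>. The factor
  \<open>1 + e\<close> keeps the leading term sharp, and the price \<open>1 + 1 / e\<close> falls on
  a term of fourth order. For larger \<open>z\<close>, where the argument may take any value,
  \<open>16 * pi^2 * |z|^4\<close> exceeds \<open>pi^2\<close>.\<close>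

lemma Arg_one_plus_bounds:
  assumes "0 < e"
  shows "\<bar>Arg (1 + z)\<bar> \<le> 2 * pi * cmod z"
    and "(Arg (1 + z))\<^sup>2 \<le> (1 + e) * (Im z)\<^sup>2 + (4 * (1 + 1 / e) + 16 * pi\<^sup>2) * cmod z ^ 4"
proof -
  have "\<bar>Arg (1 + z)\<bar> \<le> 2 * pi * cmod z \<and>
    (Arg (1 + z))\<^sup>2 \<le> (1 + e) * (Im z)\<^sup>2 + (4 * (1 + 1 / e) + 16 * pi\<^sup>2) * cmod z ^ 4"
  proof (cases "cmod z \<le> 1 / 2")
    case True
    have "1 + z \<noteq> 0"
    proof
      assume "1 + z = 0" then have "z = - 1" by (simp add: eq_neg_iff_add_eq_0 add.commute)
      then show False using True by simp
    qed
    then have A: "Arg (1 + z) = Im (Ln (1 + z))" by (simp add: Arg_eq_Im_Ln)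
    have "cmod (Ln (1 + z) - z) \<le> (cmod z)\<^sup>2 / (1 - cmod z)"
      using True by (intro Ln_approx_linear) auto
    also have "\<dots> \<le> (cmod z)\<^sup>2 / (1 / 2)" using True by (intro divide_left_mono) auto
    finally have "\<bar>Im (Ln (1 + z) - z)\<bar> \<le> 2 * (cmod z)\<^sup>2"
      using abs_Im_le_cmod[of "Ln (1 + z) - z"] by simp
    then have d: "\<bar>Arg (1 + z) - Im z\<bar> \<le> 2 * (cmod z)\<^sup>2" by (simp add: A)
    have "2 * (cmod z)\<^sup>2 \<le> cmod z" using True mult_right_mono[OF True, of "cmod z"] by (simp add: power2_eq_square)
    then have "\<bar>Arg (1 + z)\<bar> \<le> 2 * cmod z" using d abs_Im_le_cmod[of z] by linarith
    moreover have "2 * cmod z \<le> 2 * pi * cmod z" using pi_gt3 by (intro mult_right_mono) auto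
    moreover have "(Arg (1 + z))\<^sup>2 \<le> (1 + e) * (Im z)\<^sup>2 + (4 * (1 + 1 / e) + 16 * pi\<^sup>2) * cmod z ^ 4"
    proof -
      define t where "t = Arg (1 + z) - Im z"
      have "t\<^sup>2 \<le> (2 * (cmod z)\<^sup>2)\<^sup>2" using d unfolding t_def by (rule abs_le_square_iff[THEN iffD1, OF order_trans]) simp
      then have t: "t\<^sup>2 \<le> 4 * cmod z ^ 4" by (simp add: power_mult_distrib)
      \<comment> \<open>Young's inequality for the mixed term, written as the nonnegativity of a
        square.\<close>
      have "0 \<le> (e * Im z - t)\<^sup>2 / e" using assms by simp
      also have "(e * Im z - t)\<^sup>2 / e = e * (Im z)\<^sup>2 - 2 * Im z * t + t\<^sup>2 / e"
        using assms by (simp add: power2_eq_square field_simps)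
      finally have "(Im z + t)\<^sup>2 \<le> (1 + e) * (Im z)\<^sup>2 + (1 + 1 / e) * t\<^sup>2"
        by (simp add: power2_eq_square algebra_simps)
      also have "\<dots> \<le> (1 + e) * (Im z)\<^sup>2 + (1 + 1 / e) * (4 * cmod z ^ 4)"
        using t assms by (intro add_left_mono mult_left_mono) auto
      also have "\<dots> \<le> (1 + e) * (Im z)\<^sup>2 + (4 * (1 + 1 / e) + 16 * pi\<^sup>2) * cmod z ^ 4"
        by (simp add: algebra_simps)
      finally show ?thesis by (simp add: t_def)
    qed
    ultimately show ?thesis by linarith
  next
    case False
    have a: "\<bar>Arg (1 + z)\<bar> \<le> pi" using Arg_bounded[of "1 + z"] by linarith
    have "\<bar>Arg (1 + z)\<bar> \<le> 2 * pi * cmod z"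
    proof -
      have "pi = 2 * pi * (1 / 2)" by simp
      also have "\<dots> \<le> 2 * pi * cmod z" using False by (intro mult_left_mono) auto
      finally show ?thesis using a by linarith
    qed
    moreover have "(Arg (1 + z))\<^sup>2 \<le> pi\<^sup>2" using power_mono[OF a, of 2] by simp
    moreover have "pi\<^sup>2 \<le> 16 * pi\<^sup>2 * cmod z ^ 4"
    proof -
      have "(1/2) ^ 4 \<le> cmod z ^ 4" using False by (intro power_mono) auto
      then have "1 \<le> 16 * cmod z ^ 4" by (simp add: power_divide)
      from mult_left_mono[OF this, of "pi\<^sup>2"] show ?thesis by (simp add: algebra_simps)
    qed
    moreover have "0 \<le> (1 + e) * (Im z)\<^sup>2 + 4 * (1 + 1 / e) * cmod z ^ 4" using assms by simp
    ultimately have "(Arg (1 + z))\<^sup>2 \<le> ((1 + e) * (Im z)\<^sup>2 + 4 * (1 + 1 / e) * cmod z ^ 4) + 16 * pi\<^sup>2 * cmod z ^ 4"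
      and *: "\<bar>Arg (1 + z)\<bar> \<le> 2 * pi * cmod z"
      by linarith+
    then have "(Arg (1 + z))\<^sup>2 \<le> (1 + e) * (Im z)\<^sup>2 + (4 * (1 + 1 / e) + 16 * pi\<^sup>2) * cmod z ^ 4"
      by (simp add: distrib_right)
    with * show ?thesis by simp
  qed
  then show "\<bar>Arg (1 + z)\<bar> \<le> 2 * pi * cmod z"
    and "(Arg (1 + z))\<^sup>2 \<le> (1 + e) * (Im z)\<^sup>2 + (4 * (1 + 1 / e) + 16 * pi\<^sup>2) * cmod z ^ 4"
    by auto
qed

text \<open>Only the component of \<open>z\<close> along 1 changes the modulus to first order. The
  remainder \<open>t\<close> satisfies \<open>t * (|1 + z| + 1 + Re z) = (Im z)^2\<close>, and the
  second factor is at least 1 for \<open>|z| <= 1/2\<close>.\<close>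

lemma cmod_one_plus_bound:
  assumes "0 < e"
  shows "(cmod (1 + z) - 1)\<^sup>2 \<le> (1 + e) * (Re z)\<^sup>2 + 16 * (1 + 1 / e) * cmod z ^ 4"
proof -
  define t where "t = cmod (1 + z) - 1 - Re z"
  have sq: "(cmod (1 + z))\<^sup>2 = (1 + Re z)\<^sup>2 + (Im z)\<^sup>2" by (simp add: cmod_power2)
  have "\<bar>t\<bar> \<le> 4 * (cmod z)\<^sup>2"
  proof (cases "cmod z \<le> 1 / 2")
    case True
    have "\<bar>Re z\<bar> \<le> 1/2" using True abs_Re_le_cmod[of z] by linarith
    then have s: "1 \<le> cmod (1 + z) + 1 + Re z" using complex_Re_le_cmod[of "1 + z"] by simp
    have "t * (cmod (1 + z) + 1 + Re z) = (Im z)\<^sup>2"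
      using sq unfolding t_def by (simp add: power2_eq_square algebra_simps)
    then have "\<bar>t\<bar> * (cmod (1 + z) + 1 + Re z) = (Im z)\<^sup>2"
      using s abs_mult[of t "cmod (1 + z) + 1 + Re z"] by simp
    moreover have "\<bar>t\<bar> * 1 \<le> \<bar>t\<bar> * (cmod (1 + z) + 1 + Re z)" using s by (intro mult_left_mono) auto
    moreover have "(Im z)\<^sup>2 \<le> (cmod z)\<^sup>2" using power_mono[OF abs_Im_le_cmod, of z 2] by simp
    ultimately show ?thesis using zero_le_power2[of "cmod z"] by linarith
  next
    case False
    have "\<bar>cmod (1 + z) - 1\<bar> \<le> cmod z" using norm_triangle_ineq3[of "1 + z" 1] by simp
    then have "\<bar>t\<bar> \<le> 2 * cmod z" unfolding t_def using abs_Re_le_cmod[of z] by linarith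
    also have "\<dots> \<le> 4 * (cmod z)\<^sup>2"
      using False mult_right_mono[of "1/2" "cmod z" "4 * cmod z"] by (simp add: power2_eq_square)
    finally show ?thesis .
  qed
  then have "t\<^sup>2 \<le> (4 * (cmod z)\<^sup>2)\<^sup>2" by (rule abs_le_square_iff[THEN iffD1, OF order_trans]) simp
  then have t: "t\<^sup>2 \<le> 16 * cmod z ^ 4" by (simp add: power_mult_distrib)
  have "0 \<le> (e * Re z - t)\<^sup>2 / e" using assms by simp
  also have "(e * Re z - t)\<^sup>2 / e = e * (Re z)\<^sup>2 - 2 * Re z * t + t\<^sup>2 / e"
    using assms by (simp add: power2_eq_square field_simps)
  finally have "(Re z + t)\<^sup>2 \<le> (1 + e) * (Re z)\<^sup>2 + (1 + 1 / e) * t\<^sup>2"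
    by (simp add: power2_eq_square algebra_simps)
  also have "\<dots> \<le> (1 + e) * (Re z)\<^sup>2 + (1 + 1 / e) * (16 * cmod z ^ 4)"
    using t assms by (intro add_left_mono mult_left_mono) auto
  finally show ?thesis by (simp add: t_def algebra_simps)
qed

subsection \<open>Wrapped normal densities\<close>

abbreviation circle :: "real set" where
  "circle \<equiv> {-pi..<pi}"

lemma wrap_pi_eq_floor: "wrap_pi t = t - 2 * pi * of_int \<lfloor>(t + pi) / (2 * pi)\<rfloor>"
  by (simp add: wrap_pi_def rmod_conv_frac frac_def field_simps)

lemma wrap_pi_in_circle[simp]: "wrap_pi t \<in> circle"
  using rmod_less[of "2 * pi" "t + pi"] rmod_nonneg[of "2 * pi" "t + pi"] by (auto simp: wrap_pi_def)

lemma wrap_pi_ge[simp]: "- pi \<le> wrap_pi t" and wrap_pi_less[simp]: "wrap_pi t < pi"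
  using wrap_pi_in_circle[of t] unfolding atLeastLessThan_iff by blast+

lemma wrap_pi_measurable[measurable]: "wrap_pi \<in> borel_measurable borel"
  unfolding wrap_pi_eq_floor[abs_def] by measurable

lemma wrap_pi_unique: "s \<in> circle \<Longrightarrow> s = t + 2 * pi * of_int k \<Longrightarrow> wrap_pi t = s"
proof -
  assume s: "s \<in> circle" "s = t + 2 * pi * of_int k"
  have "\<lfloor>(t + pi) / (2 * pi)\<rfloor> = - k"
    using s by (intro floor_unique) (auto simp: field_simps)
  then show ?thesis using s by (simp add: wrap_pi_eq_floor)
qed

lemma wrap_pi_id[simp]: "t \<in> circle \<Longrightarrow> wrap_pi t = t"
  by (rule wrap_pi_unique[where k=0]) auto

lemma wrap_pi_shift: "wrap_pi (t + 2 * pi * of_int k) = wrap_pi t"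
  by (rule wrap_pi_unique[OF wrap_pi_in_circle, where k="- k - \<lfloor>(t + pi) / (2 * pi)\<rfloor>"])
    (simp add: wrap_pi_eq_floor algebra_simps)

lemma cis_wrap_pi[simp]: "cis (wrap_pi t) = cis t"
  unfolding wrap_pi_eq_floor cis_eq_iff rcong_altdef
  by (intro exI[of _ "\<lfloor>(t + pi) / (2 * pi)\<rfloor>"]) simp

text \<open>This is periodicity with period \<open>2 * pi\<close>, phrased through the
  representative in [-pi, pi) because wrapped phases are what the channel supplies. Equality of two
  points on the unit circle then suffices for equality of the values.\<close>

definition circle_periodic :: "(real \<Rightarrow> 'a) \<Rightarrow> bool" where
  "circle_periodic f \<longleftrightarrow> (\<forall>t. f (wrap_pi t) = f t)"

lemma circle_periodicD: "circle_periodic f \<Longrightarrow> f (wrap_pi t) = f t"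
  by (simp add: circle_periodic_def)

lemma circle_periodicI:
  assumes "\<And>t (k::int). f (t + 2 * pi * of_int k) = f t"
  shows "circle_periodic f"
  using assms[of _ "- \<lfloor>(_ + pi) / (2 * pi)\<rfloor>"] by (simp add: circle_periodic_def wrap_pi_eq_floor)

lemma wrap_pi_cong: "cis s = cis t \<Longrightarrow> wrap_pi s = wrap_pi t"
proof -
  assume "cis s = cis t"
  then obtain k where "t = s + of_int k * (2 * pi)"
    unfolding cis_eq_iff rcong_altdef by auto
  then show ?thesis using wrap_pi_shift[of s k] by (simp add: ac_simps)
qed

lemma circle_periodic_cong: "circle_periodic f \<Longrightarrow> cis s = cis t \<Longrightarrow> f s = f t"
  by (metis circle_periodic_def wrap_pi_cong)

text \<open>The translates of the circle by multiples of \<open>2 * pi\<close> tile the line. The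
  sign \<open>c\<close> serves substitutions that reflect the variable, as in densities evaluated at
  \<open>b - t\<close>.\<close>

lemma suminf_indicator_circle:
  fixes c :: real
  assumes c: "c = 1 \<or> c = - 1"
  shows "(\<Sum>n. indicator circle (b + c * (2 * pi * of_int (int_decode n))) :: ennreal) = 1"
proof -
  let ?k = "\<lfloor>(b + pi) / (2 * pi)\<rfloor>"
  \<comment> \<open>The code of the one integer that moves \<open>b\<close> into the circle;
    \<open>wrap_pi b\<close> subtracts \<open>?k\<close> periods, and for \<open>c = - 1\<close> the
    sign is turned.\<close>
  define m where "m = int_encode (if c = 1 then - ?k else ?k)"
  have "indicator circle (b + c * (2 * pi * of_int (int_decode n))) = (if n = m then 1 else 0 :: ennreal)" for n
  proof -
    define j where "j = (if c = 1 then int_decode n else - int_decode n)"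
    have e: "b + c * (2 * pi * of_int (int_decode n)) = b + 2 * pi * of_int j"
      using c by (auto simp: j_def)
    have "b + 2 * pi * of_int j \<in> circle \<longleftrightarrow> j = - ?k"
    proof
      assume "b + 2 * pi * of_int j \<in> circle"
      then have "wrap_pi b = b + 2 * pi * of_int j" by (rule wrap_pi_unique) simp
      then have "2 * pi * of_int j = 2 * pi * (of_int (- ?k) :: real)" by (simp add: wrap_pi_eq_floor)
      then have "of_int j = (of_int (- ?k) :: real)" by (simp only: mult_cancel_left) simp
      then show "j = - ?k" by (simp only: of_int_eq_iff)
    next
      assume "j = - ?k"
      then have "b + 2 * pi * of_int j = wrap_pi b" by (simp add: wrap_pi_eq_floor)
      then show "b + 2 * pi * of_int j \<in> circle" by simp
    qed
    also have "j = - ?k \<longleftrightarrow> n = m"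
    proof -
      have *: "int_decode n = i \<longleftrightarrow> n = int_encode i" for i by auto
      show ?thesis using c unfolding m_def j_def by (auto simp: *[symmetric])
    qed
    finally show ?thesis by (simp add: e)
  qed
  then have "(\<Sum>n. indicator circle (b + c * (2 * pi * of_int (int_decode n))) :: ennreal) = (\<Sum>n. if n = m then 1 else 0)"
    by simp
  also have "\<dots> = 1"
    by (subst suminf_finite[of "{m}"]) auto
  finally show ?thesis .
qed

text \<open>Integers are enumerated by \<open>int_decode\<close>, so that sums over all translates are ordinary series.\<close>

lemma nn_integral_unwrap:
  fixes h :: "real \<Rightarrow> ennreal"
  assumes [measurable]: "h \<in> borel_measurable borel"
  shows "(\<integral>\<^sup>+x. h x \<partial>lborel) = (\<integral>\<^sup>+t. (\<Sum>n. h (t + 2 * pi * of_int (int_decode n))) * indicator circle t \<partial>lborel)"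
proof -
  have "(\<integral>\<^sup>+x. h x \<partial>lborel) = (\<integral>\<^sup>+x. (\<Sum>n. h x * indicator circle (x - 2 * pi * of_int (int_decode n))) \<partial>lborel)"
    using suminf_indicator_circle[of "-1"] by simp
  also have "\<dots> = (\<Sum>n. \<integral>\<^sup>+x. h x * indicator circle (x - 2 * pi * of_int (int_decode n)) \<partial>lborel)"
    by (subst nn_integral_suminf) auto
  also have "\<dots> = (\<Sum>n. \<integral>\<^sup>+t. h (t + 2 * pi * of_int (int_decode n)) * indicator circle t \<partial>lborel)"
  proof (intro arg_cong[where f=suminf] ext)
    fix n
    show "(\<integral>\<^sup>+x. h x * indicator circle (x - 2 * pi * of_int (int_decode n)) \<partial>lborel)
      = (\<integral>\<^sup>+t. h (t + 2 * pi * of_int (int_decode n)) * indicator circle t \<partial>lborel)"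
      by (subst nn_integral_real_affine[where c=1 and t="2 * pi * of_int (int_decode n)"]) (auto simp: add.commute)
  qed
  also have "\<dots> = (\<integral>\<^sup>+t. (\<Sum>n. h (t + 2 * pi * of_int (int_decode n)) * indicator circle t) \<partial>lborel)"
    by (subst nn_integral_suminf) auto
  finally show ?thesis by simp
qed

text \<open>Translations and reflections preserve the uniform measure on the circle. The
  substitution is made on the whole line and the line is then cut into periods, which avoids cutting
  the circle at a point that depends on \<open>a\<close>.\<close>

lemma nn_integral_circle_shift:
  fixes g :: "real \<Rightarrow> ennreal" and c :: real
  assumes [measurable]: "g \<in> borel_measurable borel" and c: "c = 1 \<or> c = - 1"
  shows "(\<integral>\<^sup>+t. g (wrap_pi (a + c * t)) * indicator circle t \<partial>lborel) = (\<integral>\<^sup>+t. g t * indicator circle t \<partial>lborel)"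
proof -
  have cc: "c * c = 1" "\<bar>c\<bar> = 1" using c by auto
  have "(\<integral>\<^sup>+t. g (wrap_pi (a + c * t)) * indicator circle t \<partial>lborel)
      = (\<integral>\<^sup>+s. g (wrap_pi s) * indicator circle (- (c * a) + c * s) \<partial>lborel)"
    using c by (subst nn_integral_real_affine[where c=c and t="- (c * a)"])
      (auto simp: cc algebra_simps mult.assoc[symmetric])
  also have "\<dots> = (\<integral>\<^sup>+u. (\<Sum>n. g (wrap_pi (u + 2 * pi * of_int (int_decode n)))
      * indicator circle (- (c * a) + c * (u + 2 * pi * of_int (int_decode n)))) * indicator circle u \<partial>lborel)"
    by (rule nn_integral_unwrap) measurable
  \<comment> \<open>The integrand is periodic apart from the indicator, which selects exactly one
    period.\<close>
  also have "\<dots> = (\<integral>\<^sup>+u. g u * indicator circle u \<partial>lborel)"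
  proof (rule nn_integral_cong)
    fix u
    have "(\<Sum>n. g (wrap_pi (u + 2 * pi * of_int (int_decode n)))
        * indicator circle (- (c * a) + c * (u + 2 * pi * of_int (int_decode n))))
      = (\<Sum>n. g (wrap_pi u) * indicator circle ((- (c * a) + c * u) + c * (2 * pi * of_int (int_decode n))))"
      by (simp only: wrap_pi_shift distrib_left add.assoc)
    also have "\<dots> = g (wrap_pi u)"
      using suminf_indicator_circle[OF c] by simp
    finally show "(\<Sum>n. g (wrap_pi (u + 2 * pi * of_int (int_decode n)))
        * indicator circle (- (c * a) + c * (u + 2 * pi * of_int (int_decode n)))) * indicator circle u = g u * indicator circle u"
      by (auto split: split_indicator)
  qed
  finally show ?thesis .
qed

lemma nn_integral_uniform_circle:
  assumes [measurable]: "g \<in> borel_measurable borel"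
  shows "(\<integral>\<^sup>+t. g t \<partial>uniform_measure lborel circle) = (\<integral>\<^sup>+t. g t * indicator circle t \<partial>lborel) / ennreal (2 * pi)"
  by (subst nn_integral_uniform_measure) auto

lemma prob_space_uniform_circle: "prob_space (uniform_measure lborel circle)"
  by (rule prob_space_uniform_measure) (auto simp: ennreal_eq_0_iff not_le)

section \<open>The wrapped normal density as a periodized series\<close>

definition wrapped_density :: "real \<Rightarrow> real \<Rightarrow> real" where
  "wrapped_density \<sigma> t = (\<Sum>n. normal_density 0 \<sigma> (t + 2 * pi * of_int (int_decode n)))"

text \<open>The enumeration alternates between nonnegative and negative integers, so the integer
  with index \<open>n\<close> has modulus about \<open>n / 2\<close>.\<close>

lemma int_decode_abs_ge: "real n / 2 - 1 \<le> \<bar>of_int (int_decode n)\<bar>"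
proof (cases "even n")
  case True
  then obtain m where "n = 2 * m" by (rule evenE)
  then show ?thesis by (simp add: int_decode_def sum_decode_def)
next
  case False
  then obtain m where "n = 2 * m + 1" by (rule oddE)
  moreover have "\<bar>- (real m) - 1\<bar> = real m + 1" by simp
  ultimately show ?thesis by (simp add: int_decode_def sum_decode_def)
qed

text \<open>From \<open>(2 * pi * k)^2 <= 2 * (t + 2 * pi * k)^2 + 2 * t^2\<close> and
  \<open>|k| <= k^2\<close>, the exponent is at least linear in \<open>|k|\<close>, hence in the
  index \<open>n\<close>. The geometric majorant is uniform on bounded sets of \<open>t\<close>, as
  the Weierstrass test for continuity demands.\<close>

lemma wrapped_density_majorant:
  assumes \<sigma>: "\<sigma> > 0"
  obtains c r where "0 \<le> c" "0 < r" "r < 1"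
    "\<forall>t n. \<bar>t\<bar> \<le> T \<longrightarrow> norm (normal_density 0 \<sigma> (t + 2 * pi * of_int (int_decode n))) \<le> c * r ^ n"
proof
  let ?a = "1 / (2 * \<sigma>\<^sup>2)"
  let ?c = "exp (?a * (T\<^sup>2 + 1)) / sqrt (2 * pi * \<sigma>\<^sup>2)"
  let ?r = "exp (- ?a / 2)"
  show "0 \<le> ?c" "0 < ?r" "?r < 1" using \<sigma> by auto
  show "\<forall>t n. \<bar>t\<bar> \<le> T \<longrightarrow> norm (normal_density 0 \<sigma> (t + 2 * pi * of_int (int_decode n))) \<le> ?c * ?r ^ n"
  proof (intro allI impI)
  fix t n assume t: "\<bar>t\<bar> \<le> T"
  let ?k = "of_int (int_decode n) :: real"
  have k: "\<bar>?k\<bar> \<le> ?k\<^sup>2"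
  proof -
    have "\<bar>int_decode n\<bar> * 1 \<le> \<bar>int_decode n\<bar> * \<bar>int_decode n\<bar>"
      by (cases "int_decode n = 0", simp, rule mult_left_mono) auto
    then have "\<bar>int_decode n\<bar> \<le> (int_decode n)\<^sup>2" by (simp only: power2_eq_square abs_mult[symmetric]) simp
    then have "of_int \<bar>int_decode n\<bar> \<le> (of_int ((int_decode n)\<^sup>2) :: real)" by (simp only: of_int_le_iff)
    then show ?thesis by simp
  qed
  have "t\<^sup>2 \<le> T\<^sup>2" using power_mono[OF t, of 2] by simp
  have "(2 * pi * ?k)\<^sup>2 \<le> 2 * (t + 2 * pi * ?k)\<^sup>2 + 2 * t\<^sup>2"
    using zero_le_power2[of "2 * t + 2 * pi * ?k"] by (simp add: power2_eq_square algebra_simps)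
  moreover have "2 * ?k\<^sup>2 \<le> (2 * pi * ?k)\<^sup>2"
  proof -
    have "1 * 1 \<le> pi * pi" using pi_gt3 by (intro mult_mono) auto
    then have "2 * ?k\<^sup>2 \<le> (4 * (pi * pi)) * ?k\<^sup>2" by (intro mult_right_mono) auto
    then show ?thesis by (simp add: power2_eq_square algebra_simps)
  qed
  ultimately have "real n / 2 - 1 - T\<^sup>2 \<le> (t + 2 * pi * ?k)\<^sup>2"
    using k int_decode_abs_ge[of n] \<open>t\<^sup>2 \<le> T\<^sup>2\<close> by linarith
  then have "?a * (real n / 2 - 1 - T\<^sup>2) \<le> ?a * (t + 2 * pi * ?k)\<^sup>2"
    using \<sigma> by (intro mult_left_mono) auto
  then have "exp (- (?a * (t + 2 * pi * ?k)\<^sup>2)) \<le> exp (?a * (T\<^sup>2 + 1) + real n * (- ?a / 2))"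
    by (simp add: algebra_simps)
  also have "\<dots> = exp (?a * (T\<^sup>2 + 1)) * ?r ^ n" by (simp only: exp_add exp_of_nat_mult)
  finally have "exp (- (?a * (t + 2 * pi * ?k)\<^sup>2)) / sqrt (2 * pi * \<sigma>\<^sup>2) \<le> exp (?a * (T\<^sup>2 + 1)) * ?r ^ n / sqrt (2 * pi * \<sigma>\<^sup>2)"
    by (intro divide_right_mono) auto
  then show "norm (normal_density 0 \<sigma> (t + 2 * pi * of_int (int_decode n))) \<le> ?c * ?r ^ n"
    by (simp add: normal_density_def)
  qed
qed

lemma summable_wrapped_density:
  assumes "\<sigma> > 0"
  shows "summable (\<lambda>n. normal_density 0 \<sigma> (t + 2 * pi * of_int (int_decode n)))"
proof -
  obtain c r where c: "0 \<le> c" "0 < r" "r < 1"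
    "\<forall>t' n. \<bar>t'\<bar> \<le> \<bar>t\<bar> \<longrightarrow> norm (normal_density 0 \<sigma> (t' + 2 * pi * of_int (int_decode n))) \<le> c * r ^ n"
    by (rule wrapped_density_majorant[OF assms])
  have "norm (normal_density 0 \<sigma> (t + 2 * pi * of_int (int_decode n))) \<le> c * r ^ n" for n
    using c(4) by simp
  moreover have "summable (\<lambda>n. c * r ^ n)"
    using c(2,3) by (intro summable_mult summable_geometric) simp
  ultimately show ?thesis by (rule summable_comparison_test'[rotated])
qed

lemma continuous_wrapped_density:
  assumes "\<sigma> > 0" shows "continuous_on UNIV (wrapped_density \<sigma>)"
proof -
  have *: "continuous_on {-T<..<T} (wrapped_density \<sigma>)" for T
  proof -
    obtain c r where c: "0 \<le> c" "0 < r" "r < 1"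
      "\<forall>t n. \<bar>t\<bar> \<le> T \<longrightarrow> norm (normal_density 0 \<sigma> (t + 2 * pi * of_int (int_decode n))) \<le> c * r ^ n"
      by (rule wrapped_density_majorant[OF assms])
    have "uniform_limit {-T<..<T} (\<lambda>n t. \<Sum>i<n. normal_density 0 \<sigma> (t + 2 * pi * of_int (int_decode i)))
       (\<lambda>t. \<Sum>i. normal_density 0 \<sigma> (t + 2 * pi * of_int (int_decode i))) sequentially"
    proof (rule Weierstrass_m_test)
      fix n t assume "t \<in> {-T<..<T}"
      then have "\<bar>t\<bar> \<le> T" by auto
      then show "norm (normal_density 0 \<sigma> (t + 2 * pi * of_int (int_decode n))) \<le> c * r ^ n"
        using c(4) by blast
    qed (use c(2,3) in \<open>simp add: summable_mult summable_geometric\<close>)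
    moreover have "continuous_on {-T<..<T} (\<lambda>t. \<Sum>i<n. normal_density 0 \<sigma> (t + 2 * pi * of_int (int_decode i)))" for n
      unfolding normal_density_def using assms by (intro continuous_intros) auto
    ultimately show ?thesis unfolding wrapped_density_def[abs_def]
      by (intro uniform_limit_theorem[where F=sequentially]) auto
  qed
  show ?thesis
  proof (rule continuous_at_imp_continuous_on, rule ballI)
    fix t :: real
    show "isCont (wrapped_density \<sigma>) t"
      using *[of "\<bar>t\<bar> + 1"] by (rule continuous_on_interior) auto
  qed
qed

lemma wrapped_density_measurable[measurable]: "\<sigma> > 0 \<Longrightarrow> wrapped_density \<sigma> \<in> borel_measurable borel"
  by (intro borel_measurable_continuous_onI continuous_wrapped_density)

lemma wrapped_density_pos: "\<sigma> > 0 \<Longrightarrow> 0 < wrapped_density \<sigma> t"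
  unfolding wrapped_density_def
  by (intro suminf_pos summable_wrapped_density normal_density_pos) auto

lemma ennreal_wrapped_density:
  assumes "\<sigma> > 0"
  shows "(\<Sum>n. ennreal (normal_density 0 \<sigma> (t + 2 * pi * of_int (int_decode n)))) = ennreal (wrapped_density \<sigma> t)"
  unfolding wrapped_density_def using summable_wrapped_density[OF assms]
  by (intro suminf_ennreal2) auto

text \<open>A shift by a period permutes the integers in a way that is awkward along their
  enumeration. The series is therefore rewritten as an integral over the counting measure, which is
  invariant under bijections.\<close>

lemma circle_periodic_wrapped_density:
  assumes "\<sigma> > 0" shows "circle_periodic (wrapped_density \<sigma>)"
proof (rule circle_periodicI)
  fix t :: real and k :: int
  have *: "ennreal (wrapped_density \<sigma> t) = (\<integral>\<^sup>+j. ennreal (normal_density 0 \<sigma> (t + 2 * pi * of_int j)) \<partial>count_space UNIV)" for t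
  proof -
    have "(\<integral>\<^sup>+j. ennreal (normal_density 0 \<sigma> (t + 2 * pi * of_int j)) \<partial>count_space UNIV)
      = (\<integral>\<^sup>+n. ennreal (normal_density 0 \<sigma> (t + 2 * pi * of_int (int_decode n))) \<partial>count_space UNIV)"
      by (rule nn_integral_bij_count_space[symmetric, OF bij_int_decode])
    then show ?thesis by (simp add: nn_integral_count_space_nat ennreal_wrapped_density[OF assms])
  qed
  have "(\<integral>\<^sup>+j. ennreal (normal_density 0 \<sigma> (t + 2 * pi * of_int (j + k))) \<partial>count_space UNIV)
    = (\<integral>\<^sup>+j. ennreal (normal_density 0 \<sigma> (t + 2 * pi * of_int j)) \<partial>count_space UNIV)"
    by (rule nn_integral_bij_count_space) (rule bij_betwI[where g="\<lambda>j. j - k"], auto)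
  then have "ennreal (wrapped_density \<sigma> (t + 2 * pi * of_int k)) = ennreal (wrapped_density \<sigma> t)"
    by (simp add: * algebra_simps)
  then show "wrapped_density \<sigma> (t + 2 * pi * of_int k) = wrapped_density \<sigma> t"
    using wrapped_density_pos[OF assms] by (simp add: less_imp_le)
qed

lemma sets_wrapped_normal[measurable_cong, simp]: "sets (wrapped_normal \<sigma>) = sets borel"
  by (simp add: wrapped_normal_def)

lemma space_wrapped_normal[simp]: "space (wrapped_normal \<sigma>) = UNIV"
  by (simp add: wrapped_normal_def)

lemma prob_space_wrapped_normal: "\<sigma> > 0 \<Longrightarrow> prob_space (wrapped_normal \<sigma>)"
proof -
  assume "\<sigma> > 0"
  then interpret prob_space "density lborel (normal_density 0 \<sigma>)" by (rule prob_space_normal_density)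
  show ?thesis unfolding wrapped_normal_def by (rule prob_space_distr) simp
qed

lemma nn_integral_wrapped_normal:
  assumes \<sigma>: "\<sigma> > 0" and [measurable]: "u \<in> borel_measurable borel"
  shows "(\<integral>\<^sup>+t. u t \<partial>wrapped_normal \<sigma>) = (\<integral>\<^sup>+t. u t * ennreal (wrapped_density \<sigma> t) * indicator circle t \<partial>lborel)"
proof -
  have "(\<integral>\<^sup>+t. u t \<partial>wrapped_normal \<sigma>) = (\<integral>\<^sup>+x. u (wrap_pi x) * ennreal (normal_density 0 \<sigma> x) \<partial>lborel)"
    unfolding wrapped_normal_def
    by (subst nn_integral_distr) (auto simp: nn_integral_density mult.commute)
  also have "\<dots> = (\<integral>\<^sup>+t. (\<Sum>n. u (wrap_pi (t + 2 * pi * of_int (int_decode n)))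
      * ennreal (normal_density 0 \<sigma> (t + 2 * pi * of_int (int_decode n)))) * indicator circle t \<partial>lborel)"
    by (rule nn_integral_unwrap) measurable
  also have "\<dots> = (\<integral>\<^sup>+t. u t * ennreal (wrapped_density \<sigma> t) * indicator circle t \<partial>lborel)"
    by (intro nn_integral_cong) (auto simp: wrap_pi_shift ennreal_wrapped_density[OF \<sigma>] split: split_indicator)
  finally show ?thesis .
qed

lemma wrapped_normal_density:
  assumes \<sigma>: "\<sigma> > 0"
  shows "wrapped_normal \<sigma> = density lborel (\<lambda>t. ennreal (wrapped_density \<sigma> t * indicator circle t))"
proof (rule measure_eqI)
  fix A assume "A \<in> sets (wrapped_normal \<sigma>)"
  then have [measurable]: "A \<in> sets borel" by simp
  have "emeasure (wrapped_normal \<sigma>) A = (\<integral>\<^sup>+t. indicator A t \<partial>wrapped_normal \<sigma>)" by simp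
  also have "\<dots> = (\<integral>\<^sup>+t. ennreal (wrapped_density \<sigma> t * indicator circle t) * indicator A t \<partial>lborel)"
    by (subst nn_integral_wrapped_normal[OF \<sigma>]) (auto intro!: nn_integral_cong split: split_indicator)
  finally show "emeasure (wrapped_normal \<sigma>) A
    = emeasure (density lborel (\<lambda>t. ennreal (wrapped_density \<sigma> t * indicator circle t))) A"
    using \<sigma> by (simp add: emeasure_density)
qed simp

lemma nn_integral_wrapped_density_shift:
  assumes \<sigma>: "\<sigma> > 0" and c: "c = 1 \<or> c = - 1"
  shows "(\<integral>\<^sup>+t. ennreal (wrapped_density \<sigma> (a + c * t)) * indicator circle t \<partial>lborel) = 1"
proof -
  interpret prob_space "wrapped_normal \<sigma>" using \<sigma> by (rule prob_space_wrapped_normal)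
  have "(\<integral>\<^sup>+t. ennreal (wrapped_density \<sigma> (a + c * t)) * indicator circle t \<partial>lborel)
    = (\<integral>\<^sup>+t. ennreal (wrapped_density \<sigma> (wrap_pi (a + c * t))) * indicator circle t \<partial>lborel)"
    by (simp add: circle_periodicD[OF circle_periodic_wrapped_density[OF \<sigma>]])
  also have "\<dots> = (\<integral>\<^sup>+t. ennreal (wrapped_density \<sigma> t) * indicator circle t \<partial>lborel)"
    using \<sigma> by (intro nn_integral_circle_shift c) simp
  also have "\<dots> = (\<integral>\<^sup>+t. 1 \<partial>wrapped_normal \<sigma>)"
    by (subst nn_integral_wrapped_normal[OF \<sigma>]) auto
  also have "\<dots> = 1" by (simp add: emeasure_space_1[simplified])
  finally show ?thesis .
qed

lemma continuous_ln_wrapped_density: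
  assumes "\<sigma> > 0" shows "continuous_on UNIV (\<lambda>t. ln (wrapped_density \<sigma> t))"
proof (rule continuous_on_ln[OF continuous_wrapped_density[OF assms]], rule ballI)
  fix t show "wrapped_density \<sigma> t \<noteq> 0" using wrapped_density_pos[OF assms, of t] by linarith
qed

text \<open>The density is positive and continuous on a compact period, and periodicity carries the
  bound to the line.\<close>

lemma ln_wrapped_density_bounded:
  assumes \<sigma>: "\<sigma> > 0"
  obtains B where "\<forall>t. \<bar>ln (wrapped_density \<sigma> t)\<bar> \<le> B"
proof -
  have "continuous_on {-pi..pi} (\<lambda>t. ln (wrapped_density \<sigma> t))"
    by (rule continuous_on_subset[OF continuous_ln_wrapped_density[OF \<sigma>] subset_UNIV])
  then have "bounded ((\<lambda>t. ln (wrapped_density \<sigma> t)) ` {-pi..pi})"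
    by (intro compact_imp_bounded compact_continuous_image) auto
  then obtain B where "\<forall>x\<in>{-pi..pi}. \<bar>ln (wrapped_density \<sigma> x)\<bar> \<le> B"
    by (auto simp: bounded_iff)
  then have B: "\<And>t. t \<in> {-pi..pi} \<Longrightarrow> \<bar>ln (wrapped_density \<sigma> t)\<bar> \<le> B" by blast
  have "\<bar>ln (wrapped_density \<sigma> t)\<bar> \<le> B" for t
    using B[of "wrap_pi t"] less_imp_le[OF wrap_pi_less[of t]]
      circle_periodicD[OF circle_periodic_wrapped_density[OF \<sigma>], of t] by auto
  then have "\<forall>t. \<bar>ln (wrapped_density \<sigma> t)\<bar> \<le> B" by (rule allI)
  then show thesis by (rule that)
qed

text \<open>Small displacements are covered by uniform continuity, at the cost \<open>e\<close>; for
  large ones the quadratic term outweighs the whole oscillation. The quadratic form is chosen so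
  that the mean squares of the estimation errors are all that has to be computed later.\<close>

lemma ln_wrapped_density_perturb:
  assumes \<sigma>: "\<sigma> > 0" and e: "e > 0"
  obtains C where "0 \<le> C" "\<forall>t d. ln (wrapped_density \<sigma> t) - e - C * d\<^sup>2 \<le> ln (wrapped_density \<sigma> (t + d))"
proof -
  let ?f = "\<lambda>t. ln (wrapped_density \<sigma> t)"
  obtain B where "\<forall>t. \<bar>?f t\<bar> \<le> B" by (rule ln_wrapped_density_bounded[OF \<sigma>])
  then have B: "\<bar>?f t\<bar> \<le> B" for t by (rule spec)
  have B0: "0 \<le> B" using B[of 0] by linarith
  have "continuous_on {-pi - 1..pi + 1} ?f"
    by (rule continuous_on_subset[OF continuous_ln_wrapped_density[OF \<sigma>] subset_UNIV])
  then have "uniformly_continuous_on {-pi - 1..pi + 1} ?f"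
    by (intro compact_uniformly_continuous) auto
  then have "\<exists>\<delta>>0. \<forall>s\<in>{-pi - 1..pi + 1}. \<forall>t\<in>{-pi - 1..pi + 1}. dist t s < \<delta> \<longrightarrow> dist (?f t) (?f s) < e"
    using e unfolding uniformly_continuous_on_def by simp
  then obtain \<delta> where \<delta>0: "\<delta> > 0"
    and \<delta>1: "\<forall>s\<in>{-pi - 1..pi + 1}. \<forall>t\<in>{-pi - 1..pi + 1}. dist t s < \<delta> \<longrightarrow> dist (?f t) (?f s) < e"
    by blast
  have \<delta>: "\<bar>?f t - ?f s\<bar> < e"
    if "s \<in> {-pi - 1..pi + 1}" "t \<in> {-pi - 1..pi + 1}" "\<bar>t - s\<bar> < \<delta>" for s t
    using \<delta>1[rule_format, OF that(1,2)] that(3) by (simp add: dist_real_def)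
  \<comment> \<open>The cap 1 keeps \<open>wrap_pi t + d\<close> inside the enlarged interval on
    which uniform continuity was taken.\<close>
  define d0 where "d0 = min \<delta> 1"
  have d0: "0 < d0" "d0 \<le> \<delta>" "d0 \<le> 1" using \<delta>0 by (auto simp: d0_def)
  have per: "?f (wrap_pi t + d) = ?f (t + d)" for t d
    by (rule arg_cong[where f=ln], rule circle_periodic_cong[OF circle_periodic_wrapped_density[OF \<sigma>]])
      (simp add: cis_mult[symmetric])
  \<comment> \<open>The oscillation is at most \<open>2 * B\<close>, and \<open>C * d^2\<close>
    reaches this value at \<open>|d| = d0\<close>.\<close>
  define C where "C = 2 * B / d0\<^sup>2"
  have C0: "0 \<le> C" using B0 by (simp add: C_def)
  have "?f t - e - C * d\<^sup>2 \<le> ?f (t + d)" for t d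
  proof (cases "\<bar>d\<bar> < d0")
    case True
    have "\<bar>?f (wrap_pi t + d) - ?f (wrap_pi t + 0)\<bar> < e"
    proof (rule \<delta>)
      show "wrap_pi t + 0 \<in> {-pi - 1..pi + 1}" "wrap_pi t + d \<in> {-pi - 1..pi + 1}"
        using True d0 wrap_pi_ge[of t] wrap_pi_less[of t] unfolding atLeastAtMost_iff by linarith+
      show "\<bar>wrap_pi t + d - (wrap_pi t + 0)\<bar> < \<delta>" using True d0 by simp
    qed
    then have "?f t - e \<le> ?f (t + d)" unfolding per by simp
    moreover have "0 \<le> C * d\<^sup>2" using C0 by simp
    ultimately show ?thesis by linarith
  next
    case False
    then have "d0\<^sup>2 \<le> d\<^sup>2" using power_mono[of d0 "\<bar>d\<bar>" 2] d0 by simp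
    then have "C * d0\<^sup>2 \<le> C * d\<^sup>2" using C0 by (rule mult_left_mono)
    moreover have "C * d0\<^sup>2 = 2 * B" using d0 by (simp add: C_def)
    ultimately show ?thesis using B[of t] B[of "t + d"] e by linarith
  qed
  then have "\<forall>t d. ?f t - e - C * d\<^sup>2 \<le> ?f (t + d)" by (intro allI)
  then show thesis by (rule that[OF C0])
qed

declare One_nat_def[simp del]

subsection \<open>Product measures\<close>

text \<open>The index set \<open>I\<close> may be infinite: the noise space carries all blocks at
  once, while an output of \<open>n\<close> blocks reads finitely many of its coordinates.\<close>

lemma distr_PiM_map:
  fixes M :: "'i \<Rightarrow> 'a measure" and N :: "'i \<Rightarrow> 'b measure"
  assumes M: "\<And>i. prob_space (M i)" and F[measurable]: "\<And>i. F i \<in> M i \<rightarrow>\<^sub>M N i"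
    and J: "finite J" "J \<subseteq> I"
  shows "distr (PiM I M) (PiM J N) (\<lambda>w. \<lambda>j\<in>J. F j (w j)) = PiM J (\<lambda>j. distr (M j) (N j) (F j))"
proof -
  interpret M: product_prob_space M by (rule product_prob_spaceI) (rule M)
  interpret D: product_prob_space "\<lambda>j. distr (M j) (N j) (F j)"
    by (rule product_prob_spaceI) (intro prob_space.prob_space_distr M F)
  have comp: "(\<lambda>w. F j (w j)) \<in> PiM I M \<rightarrow>\<^sub>M N j" if "j \<in> J" for j
    using that J by (intro measurable_compose[OF measurable_component_singleton[of j I M] F[of j]]) auto
  have meas[measurable]: "(\<lambda>w. \<lambda>j\<in>J. F j (w j)) \<in> PiM I M \<rightarrow>\<^sub>M PiM J N"
    by (intro measurable_restrict comp)
  show ?thesis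
  proof (rule D.PiM_eqI[OF J(1)])
    show "sets (distr (PiM I M) (PiM J N) (\<lambda>w. \<lambda>j\<in>J. F j (w j))) = sets (PiM J (\<lambda>j. distr (M j) (N j) (F j)))"
      by (auto intro!: sets_PiM_cong)
    fix A assume A: "\<And>j. j \<in> J \<Longrightarrow> A j \<in> sets (distr (M j) (N j) (F j))"
    then have A': "\<And>j. j \<in> J \<Longrightarrow> A j \<in> sets (N j)" by simp
    have "(\<lambda>w. \<lambda>j\<in>J. F j (w j)) -` (Pi\<^sub>E J A) \<inter> space (PiM I M)
        = prod_emb I M J (\<Pi>\<^sub>E j\<in>J. F j -` A j \<inter> space (M j))"
      using J by (auto simp: prod_emb_def space_PiM PiE_iff Pi_iff restrict_def extensional_def subset_iff)
    then have "emeasure (distr (PiM I M) (PiM J N) (\<lambda>w. \<lambda>j\<in>J. F j (w j))) (Pi\<^sub>E J A)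
        = emeasure (PiM I M) (prod_emb I M J (\<Pi>\<^sub>E j\<in>J. F j -` A j \<inter> space (M j)))"
      using A' J by (subst emeasure_distr) (auto intro!: sets_PiM_I_finite)
    also have "\<dots> = (\<Prod>j\<in>J. emeasure (M j) (F j -` A j \<inter> space (M j)))"
      using A' J by (intro M.emeasure_PiM_emb) auto
    also have "\<dots> = (\<Prod>j\<in>J. emeasure (distr (M j) (N j) (F j)) (A j))"
      using A' by (intro prod.cong refl) (simp add: emeasure_distr)
    finally show "emeasure (distr (PiM I M) (PiM J N) (\<lambda>w. \<lambda>j\<in>J. F j (w j))) (Pi\<^sub>E J A)
      = (\<Prod>j\<in>J. emeasure (distr (M j) (N j) (F j)) (A j))" .
  qed
qed

lemma PiM_density:
  fixes M :: "'i \<Rightarrow> 'a measure" and f :: "'i \<Rightarrow> 'a \<Rightarrow> ennreal"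
  assumes M: "\<And>i. sigma_finite_measure (M i)" and D: "\<And>i. sigma_finite_measure (density (M i) (f i))"
    and f[measurable]: "\<And>i. f i \<in> borel_measurable (M i)" and J: "finite J"
  shows "density (PiM J M) (\<lambda>y. \<Prod>j\<in>J. f j (y j)) = PiM J (\<lambda>j. density (M j) (f j))"
proof -
  interpret M: product_sigma_finite M by (rule product_sigma_finite.intro) (rule M)
  interpret D: product_sigma_finite "\<lambda>j. density (M j) (f j)" by (rule product_sigma_finite.intro) (rule D)
  have comp[measurable]: "(\<lambda>y. f j (y j)) \<in> borel_measurable (PiM J M)" if "j \<in> J" for j
    using that by (intro measurable_compose[OF measurable_component_singleton[of j J M] f[of j]])
  have [measurable]: "(\<lambda>y. \<Prod>j\<in>J. f j (y j)) \<in> borel_measurable (PiM J M)"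
    by (intro borel_measurable_prod_ennreal comp)
  show ?thesis
  proof (rule D.PiM_eqI[OF J])
    show "sets (density (PiM J M) (\<lambda>y. \<Prod>j\<in>J. f j (y j))) = sets (PiM J (\<lambda>j. density (M j) (f j)))"
      by (auto intro!: sets_PiM_cong)
    fix A assume "\<And>j. j \<in> J \<Longrightarrow> A j \<in> sets (density (M j) (f j))"
    then have A[measurable]: "\<And>j. j \<in> J \<Longrightarrow> A j \<in> sets (M j)" by simp
    have "emeasure (density (PiM J M) (\<lambda>y. \<Prod>j\<in>J. f j (y j))) (Pi\<^sub>E J A)
        = (\<integral>\<^sup>+y. (\<Prod>j\<in>J. f j (y j)) * indicator (Pi\<^sub>E J A) y \<partial>PiM J M)"
      using J A by (intro emeasure_density) (auto intro!: sets_PiM_I_finite)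
    also have "\<dots> = (\<integral>\<^sup>+y. (\<Prod>j\<in>J. f j (y j) * indicator (A j) (y j)) \<partial>PiM J M)"
    proof (rule nn_integral_cong)
      fix y assume y: "y \<in> space (PiM J M)"
      have "indicator (Pi\<^sub>E J A) y = (\<Prod>j\<in>J. indicator (A j) (y j) :: ennreal)"
      proof (cases "y \<in> Pi\<^sub>E J A")
        case True then show ?thesis by (auto simp: PiE_iff intro!: prod.neutral[symmetric])
      next
        case False
        then obtain j where "j \<in> J" "y j \<notin> A j" using y by (auto simp: PiE_iff space_PiM)
        then have "(\<Prod>j\<in>J. indicator (A j) (y j) :: ennreal) = 0"
          using J by (intro prod_zero) (auto intro!: bexI[of _ j])
        then show ?thesis using False by simp
      qed
      then show "(\<Prod>j\<in>J. f j (y j)) * indicator (Pi\<^sub>E J A) y = (\<Prod>j\<in>J. f j (y j) * indicator (A j) (y j))"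
        by (simp add: prod.distrib)
    qed
    also have "\<dots> = (\<Prod>j\<in>J. \<integral>\<^sup>+y. f j y * indicator (A j) y \<partial>M j)"
      using J A by (intro M.product_nn_integral_prod) auto
    also have "\<dots> = (\<Prod>j\<in>J. emeasure (density (M j) (f j)) (A j))"
      using A by (intro prod.cong refl) (simp add: emeasure_density)
    finally show "emeasure (density (PiM J M) (\<lambda>y. \<Prod>j\<in>J. f j (y j))) (Pi\<^sub>E J A)
      = (\<Prod>j\<in>J. emeasure (density (M j) (f j)) (A j))" .
  qed
qed

lemma distr_pair_snd:
  assumes "prob_space M" "prob_space N"
  shows "distr (M \<Otimes>\<^sub>M N) N snd = N"
proof (rule measure_eqI)
  interpret M: prob_space M by fact
  interpret N: prob_space N by fact
  fix A assume A: "A \<in> sets (distr (M \<Otimes>\<^sub>M N) N snd)"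
  then have "snd -` A \<inter> space (M \<Otimes>\<^sub>M N) = space M \<times> A"
    using sets.sets_into_space[of A N] by (auto simp: space_pair_measure)
  then show "emeasure (distr (M \<Otimes>\<^sub>M N) N snd) A = emeasure N A"
    using A by (simp add: emeasure_distr N.emeasure_pair_measure_Times M.emeasure_space_1)
qed simp

text \<open>Increments are indexed from 1, so the new element takes index 1 and the others move up
  by one. The restriction makes the result an element of the product space over
  \<open>{1..}\<close>.\<close>

definition seq_cons :: "'a \<Rightarrow> (nat \<Rightarrow> 'a) \<Rightarrow> nat \<Rightarrow> 'a" where
  "seq_cons a d = (\<lambda>k\<in>{1..}. if k = 1 then a else d (k - 1))"

lemma seq_cons_1[simp]: "seq_cons a d 1 = a" "seq_cons a d (Suc 0) = a"
  and seq_cons_Suc[simp]: "k \<ge> 1 \<Longrightarrow> seq_cons a d (Suc k) = d k"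
    "k \<ge> 1 \<Longrightarrow> seq_cons a d (1 + k) = d k"
  by (auto simp: seq_cons_def)

lemma seq_cons_measurable[measurable]:
  "(\<lambda>(a, d). seq_cons a d) \<in> M \<Otimes>\<^sub>M (\<Pi>\<^sub>M k\<in>{1..}. M) \<rightarrow>\<^sub>M (\<Pi>\<^sub>M k\<in>{1..}. M)"
  unfolding seq_cons_def case_prod_beta'
proof (intro measurable_restrict)
  fix k :: nat assume k: "k \<in> {1..}"
  show "(\<lambda>x. if k = 1 then fst x else snd x (k - 1)) \<in> M \<Otimes>\<^sub>M (\<Pi>\<^sub>M k\<in>{1..}. M) \<rightarrow>\<^sub>M M"
  proof (cases "k = 1")
    case False
    then have "k - 1 \<in> {1..}" using k by auto
    then have "(\<lambda>x. snd x (k - 1)) \<in> M \<Otimes>\<^sub>M (\<Pi>\<^sub>M k\<in>{1..}. M) \<rightarrow>\<^sub>M M"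
      by (intro measurable_compose[OF measurable_snd measurable_component_singleton])
    then show ?thesis using False by simp
  qed simp
qed

text \<open>An i.i.d. sequence is one coordinate together with an independent copy of the whole
  sequence. Inductions over the number of blocks and the stationarity of the phases both rest on
  this.\<close>

lemma distr_seq_cons:
  assumes M: "prob_space M"
  shows "distr (M \<Otimes>\<^sub>M (\<Pi>\<^sub>M k\<in>{1..}. M)) (\<Pi>\<^sub>M k\<in>{1::nat..}. M) (\<lambda>(a, d). seq_cons a d) = (\<Pi>\<^sub>M k\<in>{1..}. M)"
proof -
  let ?P = "\<Pi>\<^sub>M k\<in>{1::nat..}. M" and ?Q = "\<Pi>\<^sub>M k\<in>{2::nat..}. M"
  let ?s = "\<lambda>d::nat \<Rightarrow> 'a. \<lambda>k\<in>{2..}. d (k - 1)"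
  interpret M: prob_space M by fact
  interpret P: prob_space ?P by (intro prob_space_PiM M)
  interpret Q: prob_space ?Q by (intro prob_space_PiM M)
  have ins: "insert 1 {2..} = {1::nat..}" by auto
  have s[measurable]: "?s \<in> ?P \<rightarrow>\<^sub>M ?Q"
    by (intro measurable_restrict measurable_component_singleton) auto
  \<comment> \<open>Reindexing by \<open>k - 1\<close> identifies sequences that start at index 2
    with sequences that start at index 1.\<close>
  have "?Q = distr ?P ?Q ?s"
    by (rule distr_PiM_reindex[symmetric]) (auto simp: M inj_on_def)
  then have "M \<Otimes>\<^sub>M ?Q = distr M M (\<lambda>x. x) \<Otimes>\<^sub>M distr ?P ?Q ?s" by simp
  also have "\<dots> = distr (M \<Otimes>\<^sub>M ?P) (M \<Otimes>\<^sub>M ?Q) (\<lambda>(a, d). (a, ?s d))"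
    using \<open>?Q = distr ?P ?Q ?s\<close> Q.sigma_finite_measure_axioms
    by (intro pair_measure_distr) auto
  finally have eq: "M \<Otimes>\<^sub>M ?Q = distr (M \<Otimes>\<^sub>M ?P) (M \<Otimes>\<^sub>M ?Q) (\<lambda>(a, d). (a, ?s d))" .
  have upd: "(\<lambda>(x, X). X(1 := x)) \<in> M \<Otimes>\<^sub>M ?Q \<rightarrow>\<^sub>M ?P"
    unfolding case_prod_beta' by (rule measurable_fun_upd[where J="{2..}"]) auto
  have "?P = distr (M \<Otimes>\<^sub>M ?Q) ?P (\<lambda>(x, X). X(1 := x))"
    using distr_pair_PiM_eq_PiM[of "{2::nat..}" "\<lambda>_. M" 1] M unfolding ins by simp
  also have "\<dots> = distr (M \<Otimes>\<^sub>M ?P) ?P ((\<lambda>(x, X). X(1 := x)) \<circ> (\<lambda>(a, d). (a, ?s d)))"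
    by (subst eq, rule distr_distr[OF upd]) measurable
  also have "\<dots> = distr (M \<Otimes>\<^sub>M ?P) ?P (\<lambda>(a, d). seq_cons a d)"
    by (intro distr_cong refl) (auto simp: seq_cons_def fun_eq_iff restrict_def)
  finally show ?thesis by simp
qed

lemma nn_integral_seq_cons:
  assumes M: "prob_space M" and [measurable]: "G \<in> borel_measurable (\<Pi>\<^sub>M k\<in>{1::nat..}. M)"
  shows "(\<integral>\<^sup>+d. G d \<partial>(\<Pi>\<^sub>M k\<in>{1..}. M)) = (\<integral>\<^sup>+a. \<integral>\<^sup>+d. G (seq_cons a d) \<partial>(\<Pi>\<^sub>M k\<in>{1..}. M) \<partial>M)"
proof -
  interpret M: prob_space M by fact
  interpret P: prob_space "\<Pi>\<^sub>M k\<in>{1::nat..}. M" by (intro prob_space_PiM M)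
  have "(\<integral>\<^sup>+d. G d \<partial>(\<Pi>\<^sub>M k\<in>{1..}. M)) = (\<integral>\<^sup>+w. G (case w of (a, d) \<Rightarrow> seq_cons a d) \<partial>(M \<Otimes>\<^sub>M (\<Pi>\<^sub>M k\<in>{1..}. M)))"
    by (subst distr_seq_cons[OF M, symmetric]) (simp add: nn_integral_distr)
  also have "\<dots> = (\<integral>\<^sup>+a. \<integral>\<^sup>+d. G (seq_cons a d) \<partial>(\<Pi>\<^sub>M k\<in>{1..}. M) \<partial>M)"
    using measurable_compose[OF seq_cons_measurable assms(2)]
    by (subst P.nn_integral_fst[symmetric]) (auto simp: case_prod_beta')
  finally show ?thesis .
qed

subsection \<open>Phase processes\<close>

abbreviation "increments \<sigma> \<equiv> \<Pi>\<^sub>M k\<in>{1::nat..}. wrapped_normal \<sigma>"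

lemma prob_space_increments: "\<sigma> > 0 \<Longrightarrow> prob_space (increments \<sigma>)"
  by (intro prob_space_PiM prob_space_wrapped_normal)

lemma prob_space_phase_space: "\<sigma> > 0 \<Longrightarrow> prob_space (phase_space \<sigma>)"
proof -
  assume "\<sigma> > 0"
  then interpret D: prob_space "increments \<sigma>" by (rule prob_space_increments)
  interpret U: prob_space "uniform_measure lborel circle" by (rule prob_space_uniform_circle)
  interpret pair_prob_space "uniform_measure lborel circle" "increments \<sigma>" ..
  show ?thesis unfolding phase_space_def by (rule prob_space_axioms)
qed

lemma snd_phase_space_measurable[measurable]:
  "k \<ge> 1 \<Longrightarrow> (\<lambda>c. snd c k) \<in> borel_measurable (phase_space \<sigma>)"
  unfolding phase_space_def
  using measurable_compose[OF measurable_snd measurable_component_singleton[of k "{1..}" "\<lambda>_. wrapped_normal \<sigma>"]]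
  by simp

lemma fst_phase_space_measurable[measurable]: "fst \<in> borel_measurable (phase_space \<sigma>)"
  unfolding phase_space_def by simp

lemma phase_measurable[measurable]: "(\<lambda>c. phase c k) \<in> borel_measurable (phase_space \<sigma>)"
  by (induction k) (auto simp: add_pi_def)

text \<open>Markov property, path by path: after the first increment the process starts afresh from
  the phase reached.\<close>

lemma phase_seq_cons: "phase (a, seq_cons \<delta> d) (Suc k) = phase (wrap_pi (\<delta> + a), d) k"
  by (induction k) (auto simp: add_pi_def)

lemma nn_integral_phase_space:
  assumes \<sigma>: "\<sigma> > 0" and [measurable]: "G \<in> borel_measurable (phase_space \<sigma>)"
  shows "(\<integral>\<^sup>+c. G c \<partial>phase_space \<sigma>) = (\<integral>\<^sup>+a. \<integral>\<^sup>+d. G (a, d) \<partial>increments \<sigma> \<partial>uniform_measure lborel circle)"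
proof -
  interpret D: prob_space "increments \<sigma>" using \<sigma> by (rule prob_space_increments)
  show ?thesis using assms(2) unfolding phase_space_def
    by (subst D.nn_integral_fst) auto
qed

text \<open>Dividing by the density of the increments makes the phases independent and uniform, whence
  the product can be integrated one block at a time.\<close>

lemma nn_integral_phase_reweighted:
  fixes s :: "nat \<Rightarrow> real \<Rightarrow> ennreal"
  assumes \<sigma>: "\<sigma> > 0" and s[measurable]: "\<And>k. s k \<in> borel_measurable borel"
    and le: "\<And>k t. (\<integral>\<^sup>+\<delta>. s k (wrap_pi (\<delta> + t)) * indicator circle \<delta> \<partial>lborel) \<le> 1"
  shows "(\<integral>\<^sup>+c. (\<Prod>k=1..n. s k (phase c k) * ennreal (1 / wrapped_density \<sigma> (snd c k))) \<partial>phase_space \<sigma>) \<le> 1"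
proof -
  interpret U: prob_space "uniform_measure lborel circle" by (rule prob_space_uniform_circle)
  have meas: "(\<lambda>d. \<Prod>k=1..n. s k (phase (a, d) k) * ennreal (1 / wrapped_density \<sigma> (d k))) \<in> borel_measurable (increments \<sigma>)"
    if s[measurable]: "\<And>k. s k \<in> borel_measurable borel" for n a and s :: "nat \<Rightarrow> real \<Rightarrow> ennreal"
  proof -
    have [measurable]: "(\<lambda>d. d k) \<in> borel_measurable (increments \<sigma>)" if "k \<ge> 1" for k
      using that measurable_component_singleton[of k "{1..}" "\<lambda>_. wrapped_normal \<sigma>"] by simp
    have [measurable]: "(\<lambda>d. d (Suc k)) \<in> borel_measurable (increments \<sigma>)" for k
      using measurable_component_singleton[of "Suc k" "{1..}" "\<lambda>_. wrapped_normal \<sigma>"] by simp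
    have [measurable]: "(\<lambda>d. phase (a, d) k) \<in> borel_measurable (increments \<sigma>)" for k
      by (induction k) (auto simp: add_pi_def)
    show ?thesis using \<sigma> by (intro borel_measurable_prod_ennreal) auto
  qed
  \<comment> \<open>The claim is made for every initial phase \<open>a\<close> and every family
    \<open>s\<close>, because removing the first block changes the initial phase and shifts the
    family.\<close>
  have "(\<integral>\<^sup>+d. (\<Prod>k=1..n. s k (phase (a, d) k) * ennreal (1 / wrapped_density \<sigma> (d k))) \<partial>increments \<sigma>) \<le> 1" for a
    using s le
  proof (induction n arbitrary: a s)
    case 0
    interpret D: prob_space "increments \<sigma>" using \<sigma> by (rule prob_space_increments)
    show ?case by (simp add: D.emeasure_space_1)
  next
    case (Suc n)
    note [measurable] = Suc.prems(1)
    let ?P = "\<lambda>s n b d. \<Prod>k=1..n. s k (phase (b, d) k) * ennreal (1 / wrapped_density \<sigma> (d k))"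
    have "(\<integral>\<^sup>+d. ?P s (Suc n) a d \<partial>increments \<sigma>) = (\<integral>\<^sup>+\<delta>. \<integral>\<^sup>+d. ?P s (Suc n) a (seq_cons \<delta> d) \<partial>increments \<sigma> \<partial>wrapped_normal \<sigma>)"
      by (rule nn_integral_seq_cons[OF prob_space_wrapped_normal[OF \<sigma>] meas[OF Suc.prems(1)]])
    also have "\<dots> = (\<integral>\<^sup>+\<delta>. \<integral>\<^sup>+d. (s 1 (wrap_pi (\<delta> + a)) * ennreal (1 / wrapped_density \<sigma> \<delta>))
        * ?P (\<lambda>k. s (Suc k)) n (wrap_pi (\<delta> + a)) d \<partial>increments \<sigma> \<partial>wrapped_normal \<sigma>)"
    proof (intro nn_integral_cong)
      fix \<delta> d
      have "?P s (Suc n) a (seq_cons \<delta> d) = (s 1 (phase (a, seq_cons \<delta> d) 1) * ennreal (1 / wrapped_density \<sigma> (seq_cons \<delta> d 1)))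
        * (\<Prod>k\<in>Suc ` {1..n}. s k (phase (a, seq_cons \<delta> d) k) * ennreal (1 / wrapped_density \<sigma> (seq_cons \<delta> d k)))"
      proof -
        have "{1..Suc n} = insert 1 (Suc ` {1..n})" by (auto simp: image_Suc_atLeastAtMost)
        then show ?thesis by simp
      qed
      also have "\<dots> = (s 1 (wrap_pi (\<delta> + a)) * ennreal (1 / wrapped_density \<sigma> \<delta>)) * ?P (\<lambda>k. s (Suc k)) n (wrap_pi (\<delta> + a)) d"
        using phase_seq_cons[of a \<delta> d 0]
        by (subst prod.reindex) (auto simp: phase_seq_cons One_nat_def simp del: phase.simps(2))
      finally show "?P s (Suc n) a (seq_cons \<delta> d) = \<dots>" .
    qed
    also have "\<dots> = (\<integral>\<^sup>+\<delta>. (s 1 (wrap_pi (\<delta> + a)) * ennreal (1 / wrapped_density \<sigma> \<delta>))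
        * (\<integral>\<^sup>+d. ?P (\<lambda>k. s (Suc k)) n (wrap_pi (\<delta> + a)) d \<partial>increments \<sigma>) \<partial>wrapped_normal \<sigma>)"
      by (intro nn_integral_cong nn_integral_cmult meas Suc.prems)
    also have "\<dots> \<le> (\<integral>\<^sup>+\<delta>. (s 1 (wrap_pi (\<delta> + a)) * ennreal (1 / wrapped_density \<sigma> \<delta>)) * 1 \<partial>wrapped_normal \<sigma>)"
      using Suc.prems by (intro nn_integral_mono mult_left_mono Suc.IH) auto
    \<comment> \<open>The reciprocal cancels the density of the increment, which leaves Lebesgue
      measure on the circle and brings the hypothesis on \<open>s\<close> to bear.\<close>
    also have "\<dots> = (\<integral>\<^sup>+\<delta>. s 1 (wrap_pi (\<delta> + a)) * indicator circle \<delta> \<partial>lborel)"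
    proof -
      have "ennreal (1 / wrapped_density \<sigma> t) * ennreal (wrapped_density \<sigma> t) = 1" for t
        using wrapped_density_pos[OF \<sigma>, of t] by (simp add: ennreal_mult'[symmetric])
      then show ?thesis using \<sigma>
        by (subst nn_integral_wrapped_normal[OF \<sigma>]) (auto simp: mult.assoc)
    qed
    also have "\<dots> \<le> 1" by (rule Suc.prems(2))
    finally show ?case .
  qed
  then have "(\<integral>\<^sup>+a. \<integral>\<^sup>+d. (\<Prod>k=1..n. s k (phase (a, d) k) * ennreal (1 / wrapped_density \<sigma> (d k))) \<partial>increments \<sigma> \<partial>uniform_measure lborel circle)
      \<le> (\<integral>\<^sup>+a. 1 \<partial>uniform_measure lborel circle)"
    by (intro nn_integral_mono) auto
  also have "\<dots> = 1" using U.emeasure_space_1 by simp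
  finally show ?thesis
    using \<sigma> by (subst nn_integral_phase_space) (auto intro!: borel_measurable_prod_ennreal)
qed

definition shift_phase :: "nat \<Rightarrow> real \<times> (nat \<Rightarrow> real) \<Rightarrow> real \<times> (nat \<Rightarrow> real)" where
  "shift_phase n c = (phase c n, \<lambda>k\<in>{1..}. snd c (n + k))"

lemma phase_shift_phase: "phase (shift_phase n c) k = phase c (n + k)"
  by (induction k) (auto simp: shift_phase_def add_pi_def)

lemma shift_phase_measurable[measurable]: "shift_phase n \<in> phase_space \<sigma> \<rightarrow>\<^sub>M phase_space \<sigma>"
proof -
  have "(\<lambda>c. \<lambda>k\<in>{1..}. snd c (n + k)) \<in> phase_space \<sigma> \<rightarrow>\<^sub>M increments \<sigma>"
    by (intro measurable_restrict) (simp add: measurable_cong_sets[OF refl sets_wrapped_normal])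
  moreover have "(\<lambda>c. phase c n) \<in> phase_space \<sigma> \<rightarrow>\<^sub>M uniform_measure lborel circle" by simp
  ultimately show ?thesis
    unfolding shift_phase_def[abs_def] by (subst (2) phase_space_def) (intro measurable_Pair)
qed

text \<open>The uniform initial law absorbs an independent rotation: for each fixed value of the
  first increment, the new initial phase is again uniform and independent of the remaining
  increments.\<close>

lemma distr_shift_phase_1:
  assumes \<sigma>: "\<sigma> > 0"
  shows "distr (phase_space \<sigma>) (phase_space \<sigma>) (shift_phase 1) = phase_space \<sigma>"
proof (rule measure_eqI)
  let ?U = "uniform_measure lborel circle" and ?W = "wrapped_normal \<sigma>" and ?D = "increments \<sigma>"
  interpret U: prob_space ?U by (rule prob_space_uniform_circle)
  interpret W: prob_space ?W using \<sigma> by (rule prob_space_wrapped_normal)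
  interpret D: prob_space ?D using \<sigma> by (rule prob_space_increments)
  interpret UW: pair_sigma_finite ?U ?W ..
  fix A assume "A \<in> sets (distr (phase_space \<sigma>) (phase_space \<sigma>) (shift_phase 1))"
  then have A[measurable]: "A \<in> sets (phase_space \<sigma>)" by simp
  define g where "g b = (\<integral>\<^sup>+d. indicator A (b, d) \<partial>?D)" for b
  have A': "A \<in> sets (?U \<Otimes>\<^sub>M ?D)" using A unfolding phase_space_def .
  have seq: "sets (?U \<Otimes>\<^sub>M ?D) = sets (borel \<Otimes>\<^sub>M ?D)" by (intro sets_pair_measure_cong) auto
  note A'' = equalityD1[OF seq, THEN subsetD, OF A']
  have g[measurable]: "g \<in> borel_measurable borel"
  proof -
    have "(\<lambda>b. \<integral>\<^sup>+d. indicator A (b, d) \<partial>?D) \<in> borel_measurable borel"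
      using A'' by (intro D.borel_measurable_nn_integral) simp
    then show ?thesis by (simp add: g_def[abs_def])
  qed
  have "emeasure (distr (phase_space \<sigma>) (phase_space \<sigma>) (shift_phase 1)) A
      = (\<integral>\<^sup>+c. indicator A (shift_phase 1 c) \<partial>phase_space \<sigma>)"
    by (subst nn_integral_distr[symmetric, of _ _ "phase_space \<sigma>"]) auto
  also have "\<dots> = (\<integral>\<^sup>+a. \<integral>\<^sup>+d. indicator A (shift_phase 1 (a, d)) \<partial>?D \<partial>?U)"
    using \<sigma> by (intro nn_integral_phase_space) auto
  also have "\<dots> = (\<integral>\<^sup>+a. \<integral>\<^sup>+\<delta>. \<integral>\<^sup>+d. indicator A (shift_phase 1 (a, seq_cons \<delta> d)) \<partial>?D \<partial>?W \<partial>?U)"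
  proof (intro nn_integral_cong nn_integral_seq_cons W.prob_space_axioms)
    fix a
    have "(\<lambda>d. (a, d)) \<in> ?D \<rightarrow>\<^sub>M phase_space \<sigma>" unfolding phase_space_def by simp
    then show "(\<lambda>d. indicator A (shift_phase 1 (a, d)) :: ennreal) \<in> borel_measurable ?D" by measurable
  qed
  also have "\<dots> = (\<integral>\<^sup>+a. \<integral>\<^sup>+\<delta>. g (wrap_pi (\<delta> + a)) \<partial>?W \<partial>?U)"
    unfolding g_def
  proof (intro nn_integral_cong)
    fix a \<delta> d assume "d \<in> space ?D"
    then have "(\<lambda>k\<in>{1..}. seq_cons \<delta> d (1 + k)) = d"
      by (auto simp: space_PiM PiE_iff extensional_def fun_eq_iff)
    moreover have "phase (a, seq_cons \<delta> d) 1 = wrap_pi (\<delta> + a)"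
      using phase_seq_cons[of a \<delta> d 0] by (simp add: One_nat_def)
    ultimately show "indicator A (shift_phase 1 (a, seq_cons \<delta> d)) = (indicator A (wrap_pi (\<delta> + a), d) :: ennreal)"
      by (simp add: shift_phase_def add_pi_def)
  qed
  \<comment> \<open>The initial phase is integrated first, with the increment held fixed, so that
    rotation invariance applies.\<close>
  also have "\<dots> = (\<integral>\<^sup>+\<delta>. \<integral>\<^sup>+a. g (wrap_pi (\<delta> + a)) \<partial>?U \<partial>?W)"
    by (rule UW.Fubini'[symmetric]) measurable
  also have "\<dots> = (\<integral>\<^sup>+\<delta>. \<integral>\<^sup>+a. g a \<partial>?U \<partial>?W)"
  proof (rule nn_integral_cong)
    fix \<delta>
    show "(\<integral>\<^sup>+a. g (wrap_pi (\<delta> + a)) \<partial>?U) = (\<integral>\<^sup>+a. g a \<partial>?U)"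
      using nn_integral_circle_shift[of g 1 \<delta>] by (simp add: nn_integral_uniform_circle)
  qed
  also have "\<dots> = (\<integral>\<^sup>+a. g a \<partial>?U)" by (simp add: W.emeasure_space_1[simplified])
  also have "\<dots> = (\<integral>\<^sup>+c. indicator A c \<partial>phase_space \<sigma>)"
    unfolding g_def using \<sigma> by (intro nn_integral_phase_space[symmetric]) auto
  also have "\<dots> = emeasure (phase_space \<sigma>) A" by simp
  finally show "emeasure (distr (phase_space \<sigma>) (phase_space \<sigma>) (shift_phase 1)) A = emeasure (phase_space \<sigma>) A" .
qed simp

lemma distr_shift_phase:
  assumes \<sigma>: "\<sigma> > 0"
  shows "distr (phase_space \<sigma>) (phase_space \<sigma>) (shift_phase n) = phase_space \<sigma>"
proof (induction n)
  case 0
  have "shift_phase 0 c = c" if "c \<in> space (phase_space \<sigma>)" for c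
    using that by (auto simp: shift_phase_def phase_space_def space_pair_measure space_PiM PiE_iff extensional_def fun_eq_iff)
  then have "distr (phase_space \<sigma>) (phase_space \<sigma>) (shift_phase 0) = distr (phase_space \<sigma>) (phase_space \<sigma>) (\<lambda>c. c)"
    by (intro distr_cong) auto
  then show ?case by simp
next
  case (Suc n)
  have "shift_phase (Suc n) c = shift_phase 1 (shift_phase n c)" for c
    by (auto simp: shift_phase_def fun_eq_iff add_pi_def One_nat_def)
  then have "distr (phase_space \<sigma>) (phase_space \<sigma>) (shift_phase (Suc n))
      = distr (phase_space \<sigma>) (phase_space \<sigma>) (shift_phase 1 \<circ> shift_phase n)"
    by (intro distr_cong) auto
  also have "\<dots> = distr (distr (phase_space \<sigma>) (phase_space \<sigma>) (shift_phase n)) (phase_space \<sigma>) (shift_phase 1)"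
    by (intro distr_distr[symmetric]) auto
  also have "\<dots> = phase_space \<sigma>" by (simp only: Suc distr_shift_phase_1[OF \<sigma>])
  finally show ?case .
qed

lemma distr_increment:
  assumes \<sigma>: "\<sigma> > 0" and k: "k \<ge> 1"
  shows "distr (phase_space \<sigma>) borel (\<lambda>c. snd c k) = wrapped_normal \<sigma>"
proof -
  interpret U: prob_space "uniform_measure lborel circle" by (rule prob_space_uniform_circle)
  interpret D: prob_space "increments \<sigma>" using \<sigma> by (rule prob_space_increments)
  interpret UD: pair_prob_space "uniform_measure lborel circle" "increments \<sigma>" ..
  have 1: "distr (increments \<sigma>) (wrapped_normal \<sigma>) (\<lambda>d. d k) = wrapped_normal \<sigma>"
    using k \<sigma> by (intro distr_PiM_component prob_space_wrapped_normal) auto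
  have 2: "distr (phase_space \<sigma>) (increments \<sigma>) snd = increments \<sigma>"
    unfolding phase_space_def by (rule distr_pair_snd) (rule U.prob_space_axioms, rule D.prob_space_axioms)
  have "distr (phase_space \<sigma>) borel (\<lambda>c. snd c k) = distr (phase_space \<sigma>) (wrapped_normal \<sigma>) ((\<lambda>d. d k) \<circ> snd)"
    by (intro distr_cong) auto
  also have "\<dots> = distr (distr (phase_space \<sigma>) (increments \<sigma>) snd) (wrapped_normal \<sigma>) (\<lambda>d. d k)"
    using k by (intro distr_distr[symmetric]) (auto simp: phase_space_def)
  finally show ?thesis by (simp only: 1 2)
qed

subsection \<open>Additive noise\<close>

lemma prob_space_additive_noise: "prob_space (additive_noise_space M)"
  unfolding additive_noise_space_def by (intro prob_space_PiM prob_space_std_complex_normal)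

lemma additive_noise_measurable:
  assumes "k \<ge> 1" "m < M" shows "(\<lambda>w. w k m) \<in> borel_measurable (additive_noise_space M)"
  using measurable_compose[OF measurable_component_singleton[of k "{1..}" "\<lambda>_. \<Pi>\<^sub>M m\<in>{..<M}. std_complex_normal"]
      measurable_component_singleton[of m "{..<M}" "\<lambda>_. std_complex_normal"]] assms
  by (simp add: additive_noise_space_def measurable_cong_sets[OF refl sets_std_complex_normal])

lemma distr_additive_noise_component:
  assumes "k \<ge> 1" "m < M"
  shows "distr (additive_noise_space M) borel (\<lambda>w. w k m) = std_complex_normal"
proof -
  let ?I = "\<Pi>\<^sub>M m\<in>{..<M}. std_complex_normal"
  have "distr (additive_noise_space M) borel (\<lambda>w. w k m) = distr (additive_noise_space M) std_complex_normal ((\<lambda>v. v m) \<circ> (\<lambda>w. w k))"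
    by (intro distr_cong) auto
  also have "\<dots> = distr (distr (additive_noise_space M) ?I (\<lambda>w. w k)) std_complex_normal (\<lambda>v. v m)"
    using assms by (intro distr_distr[symmetric]) (auto simp: additive_noise_space_def)
  also have "distr (additive_noise_space M) ?I (\<lambda>w. w k) = ?I"
    unfolding additive_noise_space_def using assms
    by (intro distr_PiM_component prob_space_PiM prob_space_std_complex_normal) auto
  also have "distr ?I std_complex_normal (\<lambda>v. v m) = std_complex_normal"
    using assms by (intro distr_PiM_component prob_space_std_complex_normal) auto
  finally show ?thesis .
qed

definition shift_noise :: "nat \<Rightarrow> (nat \<Rightarrow> nat \<Rightarrow> complex) \<Rightarrow> nat \<Rightarrow> nat \<Rightarrow> complex" where
  "shift_noise n w = (\<lambda>k\<in>{1..}. w (n + k))"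

lemma shift_noise_measurable[measurable]: "shift_noise n \<in> additive_noise_space M \<rightarrow>\<^sub>M additive_noise_space M"
  unfolding shift_noise_def[abs_def] additive_noise_space_def
  by (intro measurable_restrict measurable_component_singleton) auto

lemma distr_shift_noise: "distr (additive_noise_space M) (additive_noise_space M) (shift_noise n) = additive_noise_space M"
  unfolding shift_noise_def[abs_def] additive_noise_space_def
  by (rule distr_PiM_reindex) (auto intro!: prob_space_PiM prob_space_std_complex_normal simp: inj_on_def)

abbreviation block_lborel :: "nat \<Rightarrow> nat \<Rightarrow> (nat \<Rightarrow> nat \<Rightarrow> complex) measure" where
  "block_lborel M n \<equiv> \<Pi>\<^sub>M k\<in>{1..n}. \<Pi>\<^sub>M m\<in>{..<M}. lborel"

lemma sets_block_lborel: "sets (block_lborel M n) = sets (block_space M n)"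
  unfolding block_space_def by (intro sets_PiM_cong) auto

lemma sigma_finite_block_lborel_inner: "sigma_finite_measure (\<Pi>\<^sub>M m\<in>{..<M::nat}. (lborel :: complex measure))"
proof -
  interpret product_sigma_finite "\<lambda>_::nat. lborel :: complex measure"
    by (rule product_sigma_finite.intro) (rule lborel.sigma_finite_measure_axioms)
  show ?thesis by (rule sigma_finite) simp
qed

lemma sigma_finite_block_lborel: "sigma_finite_measure (block_lborel M n)"
proof -
  interpret product_sigma_finite "\<lambda>_::nat. \<Pi>\<^sub>M m\<in>{..<M}. (lborel :: complex measure)"
    by (rule product_sigma_finite.intro) (rule sigma_finite_block_lborel_inner)
  show ?thesis by (rule sigma_finite) simp
qed

lemma plus_std_complex_normal_measurable: "(\<lambda>w. c + w) \<in> std_complex_normal \<rightarrow>\<^sub>M borel"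
proof -
  have "(\<lambda>w. c + w) \<in> borel \<rightarrow>\<^sub>M borel" by measurable
  then show ?thesis using measurable_cong_sets[OF sets_std_complex_normal refl] by blast
qed

lemma distr_plus_std_complex_normal:
  "distr std_complex_normal borel (\<lambda>w. c + w) = density lborel (\<lambda>y. ennreal (gauss (y - c)))"
proof -
  have "distr std_complex_normal borel (\<lambda>w. c + w) = distr (density lborel (\<lambda>z. ennreal (gauss ((c + z) - c)))) borel (\<lambda>w. c + w)"
    by (simp add: std_complex_normal_gauss)
  also have "\<dots> = density (distr lborel borel (\<lambda>w. c + w)) (\<lambda>y. ennreal (gauss (y - c)))"
    by (rule density_distr[symmetric]) auto
  finally show ?thesis by (simp add: lborel_distr_plus)
qed

text \<open>With the phases held fixed, \<open>c\<close> is the rotated input, and the output is a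
  translate of i.i.d. Gaussian noise.\<close>

lemma distr_block_noise:
  fixes c :: "nat \<Rightarrow> nat \<Rightarrow> complex"
  shows "distr (additive_noise_space M) (block_lborel M n) (\<lambda>w. \<lambda>k\<in>{1..n}. \<lambda>m\<in>{..<M}. c k m + w k m)
    = density (block_lborel M n) (\<lambda>y. ennreal (\<Prod>k\<in>{1..n}. \<Prod>m\<in>{..<M}. gauss (y k m - c k m)))"
proof -
  let ?S = "\<lambda>_::nat. std_complex_normal" and ?L = "\<lambda>_::nat. lborel :: complex measure"
  let ?g = "\<lambda>k m y. ennreal (gauss (y - c k m))"
  have ps: "prob_space (density lborel (?g k m))" for k m
    unfolding distr_plus_std_complex_normal[symmetric]
    by (intro prob_space.prob_space_distr prob_space_std_complex_normal plus_std_complex_normal_measurable)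
  have plus: "(\<lambda>w. c k m + w) \<in> std_complex_normal \<rightarrow>\<^sub>M lborel" for k m
    by (rule measurable_compose[OF plus_std_complex_normal_measurable]) simp
  have inner: "distr (PiM {..<M} ?S) (PiM {..<M} ?L) (\<lambda>w. \<lambda>m\<in>{..<M}. c k m + w m)
      = density (PiM {..<M} ?L) (\<lambda>y. \<Prod>m\<in>{..<M}. ?g k m (y m))" for k
  proof -
    have "distr (PiM {..<M} ?S) (PiM {..<M} ?L) (\<lambda>w. \<lambda>m\<in>{..<M}. c k m + w m)
      = PiM {..<M} (\<lambda>m. distr std_complex_normal lborel (\<lambda>w. c k m + w))"
      by (rule distr_PiM_map[where F="\<lambda>m w. c k m + w" and M="?S" and N="?L",
        OF prob_space_std_complex_normal plus finite_lessThan subset_refl])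
    also have "\<dots> = PiM {..<M} (\<lambda>m. density lborel (?g k m))"
    proof (intro PiM_cong refl)
      fix m
      have "distr std_complex_normal lborel (\<lambda>w. c k m + w) = distr std_complex_normal borel (\<lambda>w. c k m + w)"
        by (rule distr_cong) auto
      then show "distr std_complex_normal lborel (\<lambda>w. c k m + w) = density lborel (?g k m)"
        by (simp only: distr_plus_std_complex_normal)
    qed
    also have "\<dots> = density (PiM {..<M} ?L) (\<lambda>y. \<Prod>m\<in>{..<M}. ?g k m (y m))"
      by (rule PiM_density[symmetric])
        (auto intro: lborel.sigma_finite_measure_axioms prob_space_imp_sigma_finite[OF ps])
    finally show ?thesis .
  qed
  have psI: "prob_space (PiM {..<M} ?S)" by (intro prob_space_PiM prob_space_std_complex_normal)
  have Fm[measurable]: "(\<lambda>w. \<lambda>m\<in>{..<M}. c k m + w m) \<in> PiM {..<M} ?S \<rightarrow>\<^sub>M PiM {..<M} ?L" for k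
    by (intro measurable_restrict measurable_compose[OF measurable_component_singleton[of _ "{..<M}" ?S] plus])
  have "distr (additive_noise_space M) (block_lborel M n) (\<lambda>w. \<lambda>k\<in>{1..n}. \<lambda>m\<in>{..<M}. c k m + w k m)
      = PiM {1..n} (\<lambda>k. distr (PiM {..<M} ?S) (PiM {..<M} ?L) (\<lambda>w. \<lambda>m\<in>{..<M}. c k m + w m))"
    unfolding additive_noise_space_def
    by (rule distr_PiM_map[where F="\<lambda>k w. \<lambda>m\<in>{..<M}. c k m + w m"]) (auto simp: psI)
  also have "\<dots> = PiM {1..n} (\<lambda>k. density (PiM {..<M} ?L) (\<lambda>y. \<Prod>m\<in>{..<M}. ?g k m (y m)))"
    by (simp only: inner)
  also have "\<dots> = density (PiM {1..n} (\<lambda>k. PiM {..<M} ?L)) (\<lambda>y. \<Prod>k\<in>{1..n}. \<Prod>m\<in>{..<M}. ?g k m (y k m))"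
  proof (rule PiM_density[symmetric])
    show "sigma_finite_measure (density (PiM {..<M} ?L) (\<lambda>y. \<Prod>m\<in>{..<M}. ?g k m (y m)))" for k
      unfolding inner[symmetric]
      by (intro prob_space_imp_sigma_finite prob_space.prob_space_distr psI Fm)
    show "(\<lambda>y. \<Prod>m\<in>{..<M}. ?g k m (y m)) \<in> borel_measurable (PiM {..<M} ?L)" for k
    proof (rule borel_measurable_prod_ennreal)
      fix m assume m: "m \<in> {..<M}"
      have "?g k m \<in> borel_measurable lborel" by simp
      then show "(\<lambda>y. ?g k m (y m)) \<in> borel_measurable (PiM {..<M} ?L)"
        by (rule measurable_compose[OF measurable_component_singleton[OF m, of ?L]])
    qed
  qed (rule sigma_finite_block_lborel_inner, simp)
  finally show ?thesis
    by (simp add: prod_ennreal gauss_pos less_imp_le prod_nonneg)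
qed

subsection \<open>The comb channel\<close>

lemma block_component_measurable:
  assumes "sets \<mu> = sets (block_space M n)" "k \<in> {1..n}" "m < M"
  shows "(\<lambda>x. x k m) \<in> borel_measurable \<mu>"
proof -
  have "(\<lambda>x. x k m) \<in> borel_measurable (block_space M n)"
    unfolding block_space_def
    using measurable_compose[OF measurable_component_singleton[of k "{1..n}" "\<lambda>_. \<Pi>\<^sub>M m\<in>{..<M}. borel"]
        measurable_component_singleton[of m "{..<M}" "\<lambda>_. borel"]] assms by simp
  then show ?thesis using measurable_cong_sets[OF assms(1) refl] by blast
qed

lemma block_measurableI:
  assumes "\<And>k m. k \<in> {1..n} \<Longrightarrow> m < M \<Longrightarrow> (\<lambda>x. f x k m) \<in> borel_measurable A"
  shows "(\<lambda>x. \<lambda>k\<in>{1..n}. \<lambda>m\<in>{..<M}. f x k m) \<in> A \<rightarrow>\<^sub>M block_space M n"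
  unfolding block_space_def by (intro measurable_restrict assms) auto

lemma block_measurable_lborel: "(f \<in> A \<rightarrow>\<^sub>M block_lborel M n) = (f \<in> A \<rightarrow>\<^sub>M block_space M n)"
  using measurable_cong_sets[OF refl sets_block_lborel] by blast

abbreviation "phases \<sigma>\<^sub>c \<sigma>\<^sub>r \<equiv> phase_space \<sigma>\<^sub>c \<Otimes>\<^sub>M phase_space \<sigma>\<^sub>r"

definition rotation :: "(real \<times> (nat \<Rightarrow> real)) \<Rightarrow> (real \<times> (nat \<Rightarrow> real)) \<Rightarrow> nat \<Rightarrow> nat \<Rightarrow> complex" where
  "rotation c r k m = cis (phase c k + real m * phase r k)"

lemma comb_output_eq:
  "comb_output M n x (c, r, w) = (\<lambda>k\<in>{1..n}. \<lambda>m\<in>{..<M}. rotation c r k m * x k m + w k m)"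
  by (simp add: comb_output_def rotation_def)

lemma cis_measurable[measurable]: "cis \<in> borel_measurable borel"
  by (intro borel_measurable_continuous_onI continuous_intros)

lemma rotation_measurable:
  assumes "f \<in> A \<rightarrow>\<^sub>M phase_space \<sigma>\<^sub>c" "g \<in> A \<rightarrow>\<^sub>M phase_space \<sigma>\<^sub>r"
  shows "(\<lambda>p. rotation (f p) (g p) k m) \<in> borel_measurable A"
proof -
  note [measurable] = measurable_compose[OF assms(1) phase_measurable] measurable_compose[OF assms(2) phase_measurable]
  show ?thesis unfolding rotation_def by measurable
qed

lemma gauss_measurable_compose: "f \<in> borel_measurable A \<Longrightarrow> (\<lambda>p. gauss (f p)) \<in> borel_measurable A"
  by (rule measurable_compose[OF _ gauss_measurable])

locale comb =
  fixes \<sigma>\<^sub>c \<sigma>\<^sub>r :: real and M :: nat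
  assumes \<sigma>\<^sub>c_pos: "\<sigma>\<^sub>c > 0" and \<sigma>\<^sub>r_pos: "\<sigma>\<^sub>r > 0"
begin

sublocale C: prob_space "phase_space \<sigma>\<^sub>c" by (rule prob_space_phase_space[OF \<sigma>\<^sub>c_pos])
sublocale R: prob_space "phase_space \<sigma>\<^sub>r" by (rule prob_space_phase_space[OF \<sigma>\<^sub>r_pos])
sublocale W: prob_space "additive_noise_space M" by (rule prob_space_additive_noise)
sublocale CR: pair_prob_space "phase_space \<sigma>\<^sub>c" "phase_space \<sigma>\<^sub>r" ..
sublocale RW: pair_prob_space "phase_space \<sigma>\<^sub>r" "additive_noise_space M" ..
sublocale CRW: pair_prob_space "phase_space \<sigma>\<^sub>c" "phase_space \<sigma>\<^sub>r \<Otimes>\<^sub>M additive_noise_space M" ..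

abbreviation "NN \<equiv> comb_noise_space M \<sigma>\<^sub>c \<sigma>\<^sub>r"

lemma prob_space_NN: "prob_space NN"
  unfolding comb_noise_space_def by (rule CRW.prob_space_axioms)

lemma NN_measurable[measurable]:
  "(\<lambda>z. fst z) \<in> NN \<rightarrow>\<^sub>M phase_space \<sigma>\<^sub>c"
  "(\<lambda>z. fst (snd z)) \<in> NN \<rightarrow>\<^sub>M phase_space \<sigma>\<^sub>r"
  "(\<lambda>z. snd (snd z)) \<in> NN \<rightarrow>\<^sub>M additive_noise_space M"
  unfolding comb_noise_space_def by measurable

lemma nn_integral_NN:
  assumes [measurable]: "G \<in> borel_measurable NN"
  shows "(\<integral>\<^sup>+z. G z \<partial>NN) = (\<integral>\<^sup>+cr. \<integral>\<^sup>+w. G (fst cr, snd cr, w) \<partial>additive_noise_space M \<partial>phases \<sigma>\<^sub>c \<sigma>\<^sub>r)"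
proof -
  have m[measurable]: "G \<in> borel_measurable (phase_space \<sigma>\<^sub>c \<Otimes>\<^sub>M phase_space \<sigma>\<^sub>r \<Otimes>\<^sub>M additive_noise_space M)"
    using assms by (simp add: comb_noise_space_def)
  have "(\<integral>\<^sup>+z. G z \<partial>NN) = (\<integral>\<^sup>+c. \<integral>\<^sup>+rw. G (c, rw) \<partial>(phase_space \<sigma>\<^sub>r \<Otimes>\<^sub>M additive_noise_space M) \<partial>phase_space \<sigma>\<^sub>c)"
    unfolding comb_noise_space_def by (rule RW.nn_integral_fst[symmetric]) measurable
  also have "\<dots> = (\<integral>\<^sup>+c. \<integral>\<^sup>+r. \<integral>\<^sup>+w. G (c, r, w) \<partial>additive_noise_space M \<partial>phase_space \<sigma>\<^sub>r \<partial>phase_space \<sigma>\<^sub>c)"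
    by (intro nn_integral_cong W.nn_integral_fst[symmetric]) measurable
  also have "\<dots> = (\<integral>\<^sup>+cr. \<integral>\<^sup>+w. G (fst cr, snd cr, w) \<partial>additive_noise_space M \<partial>phases \<sigma>\<^sub>c \<sigma>\<^sub>r)"
    by (subst R.nn_integral_fst[symmetric]) (auto intro!: W.borel_measurable_nn_integral)
  finally show ?thesis .
qed

text \<open>Conditional density of the output given the input and both phase processes. Its mean
  over the phases is the transition density of the channel.\<close>

definition kernel :: "nat \<Rightarrow> (nat \<Rightarrow> nat \<Rightarrow> complex) \<Rightarrow> (nat \<Rightarrow> nat \<Rightarrow> complex)
    \<Rightarrow> (real \<times> (nat \<Rightarrow> real)) \<times> (real \<times> (nat \<Rightarrow> real)) \<Rightarrow> real" where
  "kernel n x y cr = (\<Prod>k\<in>{1..n}. \<Prod>m\<in>{..<M}. gauss (y k m - rotation (fst cr) (snd cr) k m * x k m))"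

definition comb_density :: "nat \<Rightarrow> (nat \<Rightarrow> nat \<Rightarrow> complex) \<Rightarrow> (nat \<Rightarrow> nat \<Rightarrow> complex) \<Rightarrow> real" where
  "comb_density n x y = (\<integral>cr. kernel n x y cr \<partial>phases \<sigma>\<^sub>c \<sigma>\<^sub>r)"

lemma kernel_pos: "0 < kernel n x y cr"
  unfolding kernel_def by (intro prod_pos gauss_pos ballI)

lemma kernel_le_1: "kernel n x y cr \<le> 1"
proof -
  have "gauss z \<le> 1" for z
  proof -
    have "1 / pi \<le> 1" using pi_gt3 by simp
    then show ?thesis using gauss_le[of z] by linarith
  qed
  then show ?thesis unfolding kernel_def
    by (intro prod_le_1 conjI prod_nonneg ballI) (auto simp: gauss_pos less_imp_le)
qed

lemma kernel_measurable:
  assumes "sets \<mu> = sets (block_space M n)"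
  shows "(\<lambda>((x, y), cr). kernel n x y cr) \<in> borel_measurable ((\<mu> \<Otimes>\<^sub>M block_lborel M n) \<Otimes>\<^sub>M phases \<sigma>\<^sub>c \<sigma>\<^sub>r)"
  unfolding kernel_def case_prod_beta'
proof (intro borel_measurable_prod)
  fix k m assume k: "k \<in> {1..n}" "m \<in> {..<M}"
  have k': "k \<in> {1..n}" "m < M" using k by auto
  show "(\<lambda>p. gauss (snd (fst p) k m - rotation (fst (snd p)) (snd (snd p)) k m * fst (fst p) k m))
    \<in> borel_measurable ((\<mu> \<Otimes>\<^sub>M block_lborel M n) \<Otimes>\<^sub>M phases \<sigma>\<^sub>c \<sigma>\<^sub>r)"
    by (intro gauss_measurable_compose borel_measurable_diff borel_measurable_times rotation_measurable
        measurable_compose[OF _ block_component_measurable[OF assms k']]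
        measurable_compose[OF _ block_component_measurable[OF sets_block_lborel k']]) measurable
qed

lemma kernel_measurable1:
  "kernel n x y \<in> borel_measurable (phases \<sigma>\<^sub>c \<sigma>\<^sub>r)"
  unfolding kernel_def
  by (intro borel_measurable_prod gauss_measurable_compose borel_measurable_diff borel_measurable_times
      rotation_measurable[of _ _ \<sigma>\<^sub>c _ \<sigma>\<^sub>r] measurable_fst measurable_snd borel_measurable_const)

lemma integrable_kernel: "integrable (phases \<sigma>\<^sub>c \<sigma>\<^sub>r) (kernel n x y)"
  by (rule CR.integrable_const_bound[where B=1])
    (auto intro!: AE_I2 kernel_measurable1 simp: abs_of_pos[OF kernel_pos] kernel_le_1)

lemma nn_integral_kernel:
  "(\<integral>\<^sup>+cr. ennreal (kernel n x y cr) \<partial>phases \<sigma>\<^sub>c \<sigma>\<^sub>r) = ennreal (comb_density n x y)"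
  unfolding comb_density_def
  by (intro nn_integral_eq_integral integrable_kernel) (auto intro!: AE_I2 less_imp_le kernel_pos)

lemma comb_density_pos: "0 < comb_density n x y"
proof -
  have "(\<integral>\<^sup>+cr. ennreal (kernel n x y cr) \<partial>phases \<sigma>\<^sub>c \<sigma>\<^sub>r) \<noteq> 0"
  proof
    assume "(\<integral>\<^sup>+cr. ennreal (kernel n x y cr) \<partial>phases \<sigma>\<^sub>c \<sigma>\<^sub>r) = 0"
    then have "AE cr in phases \<sigma>\<^sub>c \<sigma>\<^sub>r. ennreal (kernel n x y cr) = 0"
      using kernel_measurable1 by (subst (asm) nn_integral_0_iff_AE) auto
    then have "AE cr in phases \<sigma>\<^sub>c \<sigma>\<^sub>r. False"
      by eventually_elim (metis ennreal_eq_0_iff kernel_pos not_le)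
    then show False by simp
  qed
  then show ?thesis by (simp add: nn_integral_kernel ennreal_eq_0_iff not_le)
qed

lemma comb_density_le_1: "comb_density n x y \<le> 1"
  unfolding comb_density_def
  by (rule CR.integral_le_const[OF integrable_kernel]) (intro AE_I2 kernel_le_1)

lemma comb_density_measurable:
  assumes "sets \<mu> = sets (block_space M n)"
  shows "(\<lambda>(x, y). comb_density n x y) \<in> borel_measurable (\<mu> \<Otimes>\<^sub>M block_lborel M n)"
  unfolding comb_density_def case_prod_beta'
  using kernel_measurable[OF assms]
  by (intro CR.borel_measurable_lebesgue_integral) (simp add: case_prod_beta')

lemma comb_output_measurable:
  assumes "sets \<mu> = sets (block_space M n)"
  shows "(\<lambda>(x, z). comb_output M n x z) \<in> \<mu> \<Otimes>\<^sub>M NN \<rightarrow>\<^sub>M block_lborel M n"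
proof -
  have "(\<lambda>p. \<lambda>k\<in>{1..n}. \<lambda>m\<in>{..<M}. rotation (fst (snd p)) (fst (snd (snd p))) k m * fst p k m + snd (snd (snd p)) k m)
      \<in> \<mu> \<Otimes>\<^sub>M NN \<rightarrow>\<^sub>M block_space M n"
  proof (rule block_measurableI)
    fix k m assume k: "k \<in> {1..n}" "m < M"
    have k1: "1 \<le> k" using k by simp
    show "(\<lambda>p. rotation (fst (snd p)) (fst (snd (snd p))) k m * fst p k m + snd (snd (snd p)) k m)
      \<in> borel_measurable (\<mu> \<Otimes>\<^sub>M NN)"
      by (intro borel_measurable_add borel_measurable_times rotation_measurable
        measurable_compose[OF _ block_component_measurable[OF assms k]]
        measurable_compose[OF _ additive_noise_measurable[OF k1 k(2)]]) measurable
  qed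
  then show ?thesis
    by (simp add: block_measurable_lborel case_prod_beta' comb_output_eq[symmetric])
qed

lemma comb_output_measurable1: "comb_output M n x \<in> NN \<rightarrow>\<^sub>M block_lborel M n"
proof -
  have "(\<lambda>p. \<lambda>k\<in>{1..n}. \<lambda>m\<in>{..<M}. rotation (fst p) (fst (snd p)) k m * x k m + snd (snd p) k m)
      \<in> NN \<rightarrow>\<^sub>M block_space M n"
  proof (rule block_measurableI)
    fix k m assume k: "k \<in> {1..n}" "m < M"
    have k1: "1 \<le> k" using k by simp
    show "(\<lambda>p. rotation (fst p) (fst (snd p)) k m * x k m + snd (snd p) k m) \<in> borel_measurable NN"
      by (intro borel_measurable_add borel_measurable_times rotation_measurable borel_measurable_const
        measurable_compose[OF _ additive_noise_measurable[OF k1 k(2)]]) measurable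
  qed
  moreover have "comb_output M n x = (\<lambda>p. \<lambda>k\<in>{1..n}. \<lambda>m\<in>{..<M}. rotation (fst p) (fst (snd p)) k m * x k m + snd (snd p) k m)"
    by (auto simp: comb_output_eq)
  ultimately show ?thesis by (simp add: block_measurable_lborel)
qed

lemma kernel_measurable_y: "(\<lambda>(y, cr). kernel n x y cr) \<in> borel_measurable (block_lborel M n \<Otimes>\<^sub>M phases \<sigma>\<^sub>c \<sigma>\<^sub>r)"
  unfolding kernel_def case_prod_beta'
proof (intro borel_measurable_prod)
  fix k m assume k: "k \<in> {1..n}" "m \<in> {..<M}"
  have k': "k \<in> {1..n}" "m < M" using k by auto
  show "(\<lambda>p. gauss (fst p k m - rotation (fst (snd p)) (snd (snd p)) k m * x k m))
    \<in> borel_measurable (block_lborel M n \<Otimes>\<^sub>M phases \<sigma>\<^sub>c \<sigma>\<^sub>r)"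
    by (intro gauss_measurable_compose borel_measurable_diff borel_measurable_times rotation_measurable
      borel_measurable_const measurable_compose[OF _ block_component_measurable[OF sets_block_lborel k']]) measurable
qed

lemma kernel_measurable_y1: "(\<lambda>y. kernel n x y cr) \<in> borel_measurable (block_lborel M n)"
  unfolding kernel_def
proof (intro borel_measurable_prod)
  fix k m assume k: "k \<in> {1..n}" "m \<in> {..<M}"
  have k': "k \<in> {1..n}" "m < M" using k by auto
  show "(\<lambda>y. gauss (y k m - rotation (fst cr) (snd cr) k m * x k m)) \<in> borel_measurable (block_lborel M n)"
    by (intro gauss_measurable_compose borel_measurable_diff borel_measurable_const
      block_component_measurable[OF sets_block_lborel k'])
qed

lemma nn_integral_noise:
  assumes [measurable]: "v \<in> borel_measurable (block_lborel M n)"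
  shows "(\<integral>\<^sup>+w. v (comb_output M n x (fst cr, snd cr, w)) \<partial>additive_noise_space M)
    = (\<integral>\<^sup>+y. ennreal (kernel n x y cr) * v y \<partial>block_lborel M n)"
proof -
  let ?f = "\<lambda>w. \<lambda>k\<in>{1..n}. \<lambda>m\<in>{..<M}. rotation (fst cr) (snd cr) k m * x k m + w k m"
  have f: "?f \<in> additive_noise_space M \<rightarrow>\<^sub>M block_lborel M n"
    unfolding block_measurable_lborel
  proof (rule block_measurableI)
    fix k m assume k: "k \<in> {1..n}" "m < M"
    have k1: "1 \<le> k" using k by simp
    show "(\<lambda>w. rotation (fst cr) (snd cr) k m * x k m + w k m) \<in> borel_measurable (additive_noise_space M)"
      by (intro borel_measurable_add borel_measurable_const additive_noise_measurable k1 k)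
  qed
  have "(\<integral>\<^sup>+w. v (comb_output M n x (fst cr, snd cr, w)) \<partial>additive_noise_space M)
    = (\<integral>\<^sup>+y. v y \<partial>distr (additive_noise_space M) (block_lborel M n) ?f)"
    by (subst nn_integral_distr[OF f]) (auto simp: comb_output_eq)
  also have "\<dots> = (\<integral>\<^sup>+y. v y \<partial>density (block_lborel M n) (\<lambda>y. ennreal (kernel n x y cr)))"
    unfolding kernel_def
    by (subst distr_block_noise[where c="\<lambda>k m. rotation (fst cr) (snd cr) k m * x k m"]) simp
  also have "\<dots> = (\<integral>\<^sup>+y. ennreal (kernel n x y cr) * v y \<partial>block_lborel M n)"
    by (rule nn_integral_density) (intro measurable_compose[OF _ measurable_ennreal] kernel_measurable_y1, simp)
  finally show ?thesis .
qed

text \<open>The additive noise is integrated with the phases fixed, which yields the kernel;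
  Fubini's theorem then averages the kernel over the phases for each output.\<close>

lemma comb_output_law:
  "distr NN (block_lborel M n) (comb_output M n x) = density (block_lborel M n) (\<lambda>y. ennreal (comb_density n x y))"
proof (rule measure_eqI)
  interpret L: sigma_finite_measure "block_lborel M n" by (rule sigma_finite_block_lborel)
  interpret PL: pair_sigma_finite "phases \<sigma>\<^sub>c \<sigma>\<^sub>r" "block_lborel M n" ..
  note [measurable] = comb_output_measurable1
  fix A assume "A \<in> sets (distr NN (block_lborel M n) (comb_output M n x))"
  then have A[measurable]: "A \<in> sets (block_lborel M n)" by simp
  have km'[measurable]: "(\<lambda>(cr, y). kernel n x y cr) \<in> borel_measurable (phases \<sigma>\<^sub>c \<sigma>\<^sub>r \<Otimes>\<^sub>M block_lborel M n)"
    using measurable_compose[OF measurable_pair_swap' kernel_measurable_y] by (simp add: case_prod_beta')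
  have "emeasure (distr NN (block_lborel M n) (comb_output M n x)) A
      = (\<integral>\<^sup>+z. indicator A (comb_output M n x z) \<partial>NN)"
    by (subst nn_integral_distr[symmetric, of _ _ "block_lborel M n"]) auto
  also have "\<dots> = (\<integral>\<^sup>+cr. \<integral>\<^sup>+w. indicator A (comb_output M n x (fst cr, snd cr, w)) \<partial>additive_noise_space M \<partial>phases \<sigma>\<^sub>c \<sigma>\<^sub>r)"
    by (rule nn_integral_NN) measurable
  also have "\<dots> = (\<integral>\<^sup>+cr. \<integral>\<^sup>+y. ennreal (kernel n x y cr) * indicator A y \<partial>block_lborel M n \<partial>phases \<sigma>\<^sub>c \<sigma>\<^sub>r)"
    by (intro nn_integral_cong nn_integral_noise) measurable
  also have "\<dots> = (\<integral>\<^sup>+y. \<integral>\<^sup>+cr. ennreal (kernel n x y cr) * indicator A y \<partial>phases \<sigma>\<^sub>c \<sigma>\<^sub>r \<partial>block_lborel M n)"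
    by (rule PL.Fubini'[symmetric]) measurable
  also have "\<dots> = (\<integral>\<^sup>+y. ennreal (comb_density n x y) * indicator A y \<partial>block_lborel M n)"
    using kernel_measurable1 by (simp add: nn_integral_multc nn_integral_kernel)
  also have "\<dots> = emeasure (density (block_lborel M n) (\<lambda>y. ennreal (comb_density n x y))) A"
  proof (rule emeasure_density[symmetric])
    show "(\<lambda>y. ennreal (comb_density n x y)) \<in> borel_measurable (block_lborel M n)"
      unfolding comb_density_def using kernel_measurable_y
      by (intro measurable_compose[OF _ measurable_ennreal] CR.borel_measurable_lebesgue_integral)
  qed (rule A)
  finally show "emeasure (distr NN (block_lborel M n) (comb_output M n x)) A = \<dots>" .
qed simp

lemma channel_comb:
  assumes "prob_space \<mu>" "sets \<mu> = sets (block_space M n)"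
  shows "channel \<mu> NN (block_lborel M n) (comb_output M n) (comb_density n) 1"
  using assms
  by (intro channel.intro prob_space_NN sigma_finite_block_lborel comb_output_measurable comb_density_measurable
      comb_density_pos comb_density_le_1 comb_output_law)

lemma comb_information_eq:
  assumes "prob_space \<mu>" "sets \<mu> = sets (block_space M n)"
  shows "comb_information M \<sigma>\<^sub>c \<sigma>\<^sub>r n \<mu>
    = (\<integral>(x, z). ln (channel.info_density \<mu> (comb_density n) x (comb_output M n x z)) \<partial>(\<mu> \<Otimes>\<^sub>M NN)) / ln 2"
proof -
  interpret channel \<mu> NN "block_lborel M n" "comb_output M n" "comb_density n" 1
    by (rule channel_comb[OF assms])
  show ?thesis
    unfolding comb_information_def
    by (rule mutual_information_eq) (simp_all add: assms sets_block_lborel)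
qed

end

subsection \<open>The upper bound\<close>

lemma nn_integral_complex_gaussian:
  assumes a: "a > 0"
  shows "(\<integral>\<^sup>+z. ennreal (exp (- a * (cmod z)\<^sup>2)) \<partial>lborel) = ennreal (pi / a)"
proof -
  interpret prob_space std_complex_normal by (rule prob_space_std_complex_normal)
  have 1: "(\<integral>\<^sup>+z. ennreal (gauss z) \<partial>lborel) = 1"
    using emeasure_space_1 by (simp add: std_complex_normal_gauss emeasure_density)
  have "(\<integral>\<^sup>+z. ennreal (exp (- a * (cmod z)\<^sup>2)) \<partial>lborel)
    = (\<integral>\<^sup>+z. ennreal (exp (- a * (cmod z)\<^sup>2)) \<partial>density (distr lborel borel (\<lambda>x::complex. 0 + (1 / sqrt a) *\<^sub>R x)) (\<lambda>_. ennreal (\<bar>1 / sqrt a\<bar> ^ DIM(complex))))"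
    using a by (subst lborel_affine[of "1 / sqrt a" "0::complex"]) auto
  also have "\<dots> = (\<integral>\<^sup>+z. ennreal (pi / a) * ennreal (gauss z) \<partial>lborel)"
    using a by (subst nn_integral_density, simp, simp, subst nn_integral_distr)
      (auto intro!: nn_integral_cong simp: gauss_def ennreal_mult'[symmetric] power_divide norm_mult power_mult_distrib)
  also have "\<dots> = ennreal (pi / a)" by (simp add: nn_integral_cmult 1)
  finally show ?thesis .
qed

text \<open>Writing \<open>1 / |z|\<close> as a Gaussian integral avoids polar coordinates.\<close>

lemma nn_integral_radial:
  assumes R: "R > 0"
  shows "(\<integral>\<^sup>+z. ennreal (exp (- (cmod z)\<^sup>2 / R)) / ennreal (cmod z) \<partial>lborel) \<le> ennreal (pi * sqrt pi * sqrt R)"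
proof -
  have half: "(\<integral>\<^sup>+t. ennreal (exp (- (t * t) * (b * b))) * indicator {0..} t \<partial>lborel) = ennreal (sqrt pi / 2) / ennreal b"
    if b: "b > 0" for b :: real
  proof -
    have g: "(\<integral>\<^sup>+t. ennreal (exp (- t\<^sup>2)) * indicator {0..} t \<partial>lborel) = ennreal (sqrt pi / 2)"
    proof -
      have "(\<integral>\<^sup>+t. ennreal (exp (- t\<^sup>2)) * indicator {0..} t \<partial>lborel) = (\<integral>\<^sup>+t. ennreal (indicator {0..} t *\<^sub>R exp (- t\<^sup>2)) \<partial>lborel)"
        by (intro nn_integral_cong) (auto split: split_indicator)
      then show ?thesis using gaussian_moment_0
        by (simp add: has_bochner_integral_iff nn_integral_eq_integral)
    qed
    have "ennreal (sqrt pi / 2) = ennreal b * (\<integral>\<^sup>+t. ennreal (exp (- (b * t)\<^sup>2)) * indicator {0..} (b * t) \<partial>lborel)"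
      using b by (subst g[symmetric], subst nn_integral_real_affine[where c=b and t=0]) auto
    also have "\<dots> = ennreal b * (\<integral>\<^sup>+t. ennreal (exp (- (t * t) * (b * b))) * indicator {0..} t \<partial>lborel)"
      using b by (intro arg_cong2[where f="(*)"] refl nn_integral_cong)
        (auto split: split_indicator simp: zero_le_mult_iff power2_eq_square ac_simps)
    finally show ?thesis
      using b by (simp add: ennreal_mult_divide_eq mult.commute[of "ennreal b"])
  qed
  have "(\<integral>\<^sup>+z. ennreal (exp (- (cmod z)\<^sup>2 / R)) / ennreal (cmod z) \<partial>lborel)
      = (\<integral>\<^sup>+z. ennreal (2 / sqrt pi) * (\<integral>\<^sup>+t. ennreal (exp (- (t * t + 1 / R) * (cmod z)\<^sup>2)) * indicator {0..} t \<partial>lborel) \<partial>lborel)"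
  proof (rule nn_integral_cong_AE)
    show "AE z in lborel. ennreal (exp (- (cmod z)\<^sup>2 / R)) / ennreal (cmod z)
      = ennreal (2 / sqrt pi) * (\<integral>\<^sup>+t. ennreal (exp (- (t * t + 1 / R) * (cmod z)\<^sup>2)) * indicator {0..} t \<partial>lborel)"
      using AE_lborel_singleton[of 0]
    proof eventually_elim
      case (elim z)
      then have z: "cmod z > 0" by simp
      have "(\<integral>\<^sup>+t. ennreal (exp (- (t * t + 1 / R) * (cmod z)\<^sup>2)) * indicator {0..} t \<partial>lborel)
        = (\<integral>\<^sup>+t. ennreal (exp (- (cmod z)\<^sup>2 / R)) * (ennreal (exp (- (t * t) * (cmod z * cmod z))) * indicator {0..} t) \<partial>lborel)"
        by (intro nn_integral_cong)
          (auto simp: ennreal_mult'[symmetric] mult_exp_exp power2_eq_square algebra_simps split: split_indicator)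
      also have "\<dots> = ennreal (exp (- (cmod z)\<^sup>2 / R)) * (ennreal (sqrt pi / 2) / ennreal (cmod z))"
        by (subst nn_integral_cmult) (measurable, simp only: half[OF z])
      finally show ?case using z
        by (simp add: divide_ennreal ennreal_mult'[symmetric])
    qed
  qed
  also have "\<dots> = ennreal (2 / sqrt pi) * (\<integral>\<^sup>+z. (\<integral>\<^sup>+t. ennreal (exp (- (t * t + 1 / R) * (cmod z)\<^sup>2)) * indicator {0..} t \<partial>lborel) \<partial>(lborel::complex measure))"
    by (rule nn_integral_cmult) measurable
  \<comment> \<open>After the exchange the integral over \<open>z\<close> is Gaussian with
    coefficient \<open>t^2 + 1 / R\<close>, and what remains is the derivative of an
    arctangent.\<close>
  also have "(\<integral>\<^sup>+z. (\<integral>\<^sup>+t. ennreal (exp (- (t * t + 1 / R) * (cmod z)\<^sup>2)) * indicator {0..} t \<partial>lborel) \<partial>(lborel::complex measure))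
    = (\<integral>\<^sup>+t. (\<integral>\<^sup>+z. ennreal (exp (- (t * t + 1 / R) * (cmod z)\<^sup>2)) * indicator {0..} t \<partial>(lborel::complex measure)) \<partial>lborel)"
    by (rule lborel_pair.Fubini') measurable
  also have "\<dots> = (\<integral>\<^sup>+t. ennreal (pi / (t * t + 1 / R)) * indicator {0..} t \<partial>lborel)"
  proof (rule nn_integral_cong)
    fix t :: real
    have "t * t + 1 / R > 0" using R by (simp add: add_nonneg_pos)
    from nn_integral_complex_gaussian[OF this]
    show "(\<integral>\<^sup>+z. ennreal (exp (- (t * t + 1 / R) * (cmod z)\<^sup>2)) * indicator {0..} t \<partial>(lborel::complex measure)) = ennreal (pi / (t * t + 1 / R)) * indicator {0..} t"
      by (simp add: nn_integral_multc)
  qed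
  also have "\<dots> = ennreal (pi * sqrt R * (pi / 2) - pi * sqrt R * arctan (sqrt R * 0))"
  proof (rule nn_integral_FTC_atLeast)
    fix t :: real assume "0 \<le> t"
    have "((\<lambda>t. pi * sqrt R * arctan (sqrt R * t)) has_real_derivative pi * sqrt R * (inverse (1 + (sqrt R * t)\<^sup>2) * sqrt R)) (at t)"
      by (auto intro!: derivative_eq_intros)
    also have "pi * sqrt R * (inverse (1 + (sqrt R * t)\<^sup>2) * sqrt R) = pi / (t * t + 1 / R)"
    proof -
      have "pi * sqrt R * (inverse (1 + (sqrt R * t)\<^sup>2) * sqrt R) = pi * R / (1 + R * t\<^sup>2)"
        using R by (simp add: divide_inverse power_mult_distrib)
      also have "\<dots> = pi / (t * t + 1 / R)"
        using R by (simp add: field_simps power2_eq_square)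
      finally show ?thesis .
    qed
    finally show "((\<lambda>t. pi * sqrt R * arctan (sqrt R * t)) has_real_derivative pi / (t * t + 1 / R)) (at t)" .
    show "0 \<le> pi / (t * t + 1 / R)" using R by (intro divide_nonneg_pos add_nonneg_pos) auto
  next
    have "filterlim (\<lambda>t. sqrt R * t) at_top at_top"
      using R by (intro filterlim_tendsto_pos_mult_at_top[OF tendsto_const]) (auto simp: filterlim_ident)
    then have "((\<lambda>t. arctan (sqrt R * t)) \<longlongrightarrow> pi / 2) at_top"
      by (rule filterlim_compose[OF tendsto_arctan_at_top])
    then show "((\<lambda>t. pi * sqrt R * arctan (sqrt R * t)) \<longlongrightarrow> pi * sqrt R * (pi / 2)) at_top"
      by (intro tendsto_intros)
  qed measurable
  also have "ennreal (2 / sqrt pi) * ennreal (pi * sqrt R * (pi / 2) - pi * sqrt R * arctan (sqrt R * 0)) = ennreal (pi * sqrt pi * sqrt R)"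
  proof -
    have "2 / sqrt pi * (pi * sqrt R * (pi / 2)) = pi * sqrt pi * sqrt R"
      by (simp add: field_simps real_sqrt_mult_self)
    then show ?thesis by (simp add: ennreal_mult'[symmetric])
  qed
  finally show ?thesis by simp
qed

section \<open>The error of the argument as an estimate of the phase\<close>

definition phase_error :: "complex \<Rightarrow> complex \<Rightarrow> real \<Rightarrow> real" where
  "phase_error x y \<theta> = wrap_pi (Arg (y / x) - \<theta>)"

text \<open>Rotating \<open>y / x\<close> back by \<theta> gives 1 plus the relative noise. Absolute
  values are taken because at the branch cut \<open>Arg\<close> returns pi where
  \<open>wrap_pi\<close> returns -pi.\<close>

lemma phase_error_eq_Arg:
  assumes x: "x \<noteq> 0" and y: "y \<noteq> 0"
  shows "\<bar>phase_error x y \<theta>\<bar> = \<bar>Arg (1 + cis (- \<theta>) * (y - cis \<theta> * x) / x)\<bar>"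
proof -
  let ?z = "1 + cis (- \<theta>) * (y - cis \<theta> * x) / x"
  have z: "?z = cis (- \<theta>) * (y / x)"
    using x by (simp add: field_simps cis_mult)
  have z0: "?z \<noteq> 0" unfolding z using x y by simp
  have "cis (Arg ?z) = cis (Arg (y / x) - \<theta>)"
  proof -
    have "cis (Arg ?z) = ?z / cmod ?z" using z0 by (simp add: cis_Arg sgn_eq)
    also have "\<dots> = cis (- \<theta>) * ((y / x) / cmod (y / x))" unfolding z by (simp add: norm_mult norm_divide)
    also have "(y / x) / cmod (y / x) = cis (Arg (y / x))" using x y by (simp add: cis_Arg sgn_eq)
    finally show ?thesis by (simp add: cis_mult)
  qed
  then have "phase_error x y \<theta> = wrap_pi (Arg ?z)" unfolding phase_error_def by (metis wrap_pi_cong)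
  moreover have "\<bar>wrap_pi t\<bar> = \<bar>t\<bar>" if "- pi < t" "t \<le> pi" for t
  proof (cases "t = pi")
    case True
    have "wrap_pi pi = - pi" by (rule wrap_pi_unique[where k="-1"]) auto
    then show ?thesis using True by simp
  qed (use that in simp)
  ultimately show ?thesis using Arg_bounded[of ?z] by auto
qed

text \<open>The first bound is sharp to leading order, which the converse requires; the third
  suffices for the penalties of the lower bound, which vanish as the amplitudes grow. The output 0
  has no argument to expand; there \<open>z = - 1\<close>, and the trivial bound pi is
  enough.\<close>

lemma phase_error_bounds:
  fixes x y :: complex and \<theta> :: real
  assumes e: "0 < e" and x: "x \<noteq> 0"
  defines "z \<equiv> cis (- \<theta>) * (y - cis \<theta> * x) / x"
  shows "(phase_error x y \<theta>)\<^sup>2 \<le> (1 + e) * (Im z)\<^sup>2 + (4 * (1 + 1 / e) + 16 * pi\<^sup>2) * cmod z ^ 4"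
    and "(phase_error x y \<theta>)\<^sup>2 \<le> pi\<^sup>2"
    and "\<bar>phase_error x y \<theta>\<bar> \<le> 2 * pi * cmod z"
proof -
  have abs_pi: "\<bar>phase_error x y \<theta>\<bar> \<le> pi"
    unfolding phase_error_def using wrap_pi_ge[of "Arg (y / x) - \<theta>"] wrap_pi_less[of "Arg (y / x) - \<theta>"]
    by (simp only: abs_le_iff) linarith
  from power_mono[OF this, of 2] show pi: "(phase_error x y \<theta>)\<^sup>2 \<le> pi\<^sup>2" by simp
  have "(phase_error x y \<theta>)\<^sup>2 \<le> (1 + e) * (Im z)\<^sup>2 + (4 * (1 + 1 / e) + 16 * pi\<^sup>2) * cmod z ^ 4
    \<and> \<bar>phase_error x y \<theta>\<bar> \<le> 2 * pi * cmod z"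
  proof (cases "y = 0")
    case True
    have "z = - 1" using x True by (simp add: z_def cis_mult mult.assoc[symmetric])
    moreover have "0 \<le> 4 * (1 + 1 / e)" using e by simp
    moreover have "(phase_error x y \<theta>)\<^sup>2 \<le> 4 * (1 + 1 / e) + 16 * pi\<^sup>2"
      using pi \<open>0 \<le> 4 * (1 + 1 / e)\<close> zero_le_power2[of pi] by linarith
    moreover have "\<bar>phase_error x y \<theta>\<bar> \<le> 2 * pi"
      using abs_pi pi_gt_zero by linarith
    ultimately show ?thesis by simp
  next
    case False
    have *: "\<bar>phase_error x y \<theta>\<bar> = \<bar>Arg (1 + z)\<bar>"
      unfolding z_def by (rule phase_error_eq_Arg[OF x False])
    then have "(phase_error x y \<theta>)\<^sup>2 = (Arg (1 + z))\<^sup>2" by (metis power2_abs)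
    then show ?thesis using * Arg_one_plus_bounds[OF e, of z] by simp
  qed
  then show "(phase_error x y \<theta>)\<^sup>2 \<le> (1 + e) * (Im z)\<^sup>2 + (4 * (1 + 1 / e) + 16 * pi\<^sup>2) * cmod z ^ 4"
    and "\<bar>phase_error x y \<theta>\<bar> \<le> 2 * pi * cmod z" by auto
qed

text \<open>The argument is continuous off the closed negative half-axis; on the half-axis it takes
  the value pi, and at the origin 0.\<close>

lemma Arg_measurable[measurable]: "Arg \<in> borel_measurable borel"
proof -
  let ?f = "\<lambda>z. indicator (- \<real>\<^sub>\<le>\<^sub>0) z *\<^sub>R Arg z"
  have f[measurable]: "?f \<in> borel_measurable borel"
    by (intro borel_measurable_continuous_on_indicator continuous_on_Arg) auto
  have "(\<lambda>z. if z = 0 then 0 else if z \<in> \<real>\<^sub>\<le>\<^sub>0 then pi else ?f z) \<in> borel_measurable borel"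
    by (intro measurable_If_set measurable_If f) auto
  also have "(\<lambda>z. if z = 0 then 0 else if z \<in> \<real>\<^sub>\<le>\<^sub>0 then pi else ?f z) = Arg"
  proof
    fix z
    show "(if z = 0 then 0 else if z \<in> \<real>\<^sub>\<le>\<^sub>0 then pi else ?f z) = Arg z"
    proof (cases "z \<in> \<real>\<^sub>\<le>\<^sub>0 \<and> z \<noteq> 0")
      case True
      then have "Re z < 0 \<and> Im z = 0" by (auto simp: complex_nonpos_Reals_iff complex_eq_iff)
      then have "Arg z = pi" using Arg_eq_pi by blast
      then show ?thesis using True by simp
    qed (auto simp: Arg_zero)
  qed
  finally show ?thesis .
qed

lemma phase_error_measurable[measurable]:
  assumes [measurable]: "f \<in> borel_measurable A" "g \<in> borel_measurable A" "h \<in> borel_measurable A"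
  shows "(\<lambda>p. phase_error (f p) (g p) (h p)) \<in> borel_measurable A"
  unfolding phase_error_def by measurable

text \<open>The reference output law \<open>ref_density e R\<close> gives weight \<open>e\<close> to a Gaussian and weight \<open>1 - e\<close> to a law
  with half-normal amplitude; inputs of amplitude below \<open>K\<close> are compared with the former, the others
  with the latter.\<close>

definition symbol_cost :: "real \<Rightarrow> real \<Rightarrow> real \<Rightarrow> complex \<Rightarrow> complex \<Rightarrow> real \<Rightarrow> real" where
  "symbol_cost K e R x y \<theta> =
    (if cmod x < K then (cmod y)\<^sup>2 - (cmod (y - cis \<theta> * x))\<^sup>2 - ln e
     else - ln (1 - e) + ln (sqrt R / 2) + (cmod y)\<^sup>2 / R + ((cmod y)\<^sup>2 / (cmod x)\<^sup>2 - 1) / 2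
       + (cmod x)\<^sup>2 * (phase_error x y \<theta>)\<^sup>2 - (cmod (y - cis \<theta> * x))\<^sup>2)"

definition ref_density :: "real \<Rightarrow> real \<Rightarrow> complex \<Rightarrow> ennreal" where
  "ref_density e R y = ennreal ((1 - e) / (pi * sqrt pi * sqrt R)) * (ennreal (exp (- (cmod y)\<^sup>2 / R)) / ennreal (cmod y))
    + ennreal (e * gauss y)"

text \<open>For a strong input this is a normal density of variance \<open>1 / (2 * |x|^2)\<close>
  in the phase error, the law to which the argument of the output tends; a weak input reveals
  nothing about the phase, so the uniform density is used.\<close>

definition angle_density :: "real \<Rightarrow> complex \<Rightarrow> complex \<Rightarrow> real \<Rightarrow> real" where
  "angle_density K x y \<theta> = (if cmod x < K then 1 / (2 * pi)
     else cmod x / sqrt pi * exp (- (cmod x)\<^sup>2 * (phase_error x y \<theta>)\<^sup>2))"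

lemma ref_density_measurable[measurable]: "ref_density e R \<in> borel_measurable borel"
  unfolding ref_density_def by measurable

text \<open>In polar coordinates the first component has amplitude density
  \<open>(1 - e) * 2 / sqrt (pi * R) * exp (- r^2 / R)\<close>, a half-normal law; its constant is
  the value found in \<open>nn_integral_radial\<close>.\<close>

lemma nn_integral_ref_density:
  assumes R: "R > 0" and e: "0 < e" "e < 1"
  shows "(\<integral>\<^sup>+y. ref_density e R y \<partial>lborel) \<le> 1"
proof -
  interpret prob_space std_complex_normal by (rule prob_space_std_complex_normal)
  have 1: "(\<integral>\<^sup>+z. ennreal (gauss z) \<partial>lborel) = 1"
    using emeasure_space_1 by (simp add: std_complex_normal_gauss emeasure_density)
  have "(\<integral>\<^sup>+y. ref_density e R y \<partial>lborel) = ennreal ((1 - e) / (pi * sqrt pi * sqrt R)) *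
      (\<integral>\<^sup>+y. ennreal (exp (- (cmod y)\<^sup>2 / R)) / ennreal (cmod y) \<partial>lborel) + ennreal e * (\<integral>\<^sup>+y. ennreal (gauss y) \<partial>lborel)"
    unfolding ref_density_def using e
    by (subst nn_integral_add) (auto simp: nn_integral_cmult ennreal_mult')
  also have "\<dots> \<le> ennreal ((1 - e) / (pi * sqrt pi * sqrt R)) * ennreal (pi * sqrt pi * sqrt R) + ennreal e * 1"
    by (intro add_mono mult_left_mono nn_integral_radial R) (auto simp: 1)
  also have "\<dots> = ennreal (1 - e) + ennreal e"
    using R e by (simp add: ennreal_mult'[symmetric])
  also have "\<dots> = 1" using e by (simp add: ennreal_plus[symmetric] del: ennreal_plus)
  finally show ?thesis .
qed

text \<open>Every term of the cost yields one factor. The squared noise cancels the exponential of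
  the Gaussian density and leaves \<open>1 / pi\<close>; the squared phase error gives the angle
  density, and \<open>|y|^2 / R\<close> the reference amplitude. The term
  \<open>(|y|^2 / |x|^2 - 1) / 2\<close> majorizes \<open>ln (|y| / |x|)\<close>, which trades the
  factor \<open>|x|\<close> of the angle density for the \<open>1 / |y|\<close> of the reference;
  unlike the logarithm it has an explicit mean.\<close>

lemma symbol_cost_density_large:
  assumes R: "R > 0" and e: "0 < e" "e < 1" and x: "cmod x > 0" "\<not> cmod x < K" and y: "y \<noteq> 0"
  shows "gauss (y - cis \<theta> * x) * exp (- symbol_cost K e R x y \<theta>)
    \<le> ((1 - e) / (pi * sqrt pi * sqrt R) * (exp (- (cmod y)\<^sup>2 / R) / cmod y)) * (2 * pi * angle_density K x y \<theta>)"
proof -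
  define t where "t = cmod y / cmod x"
  define E where "E = exp (- (cmod y)\<^sup>2 / R)"
  define p where "p = exp (- (cmod x)\<^sup>2 * (phase_error x y \<theta>)\<^sup>2)"
  define u where "u = ((cmod y)\<^sup>2 / (cmod x)\<^sup>2 - 1) / 2"
  define w where "w = (cmod (y - cis \<theta> * x))\<^sup>2"
  have t: "t > 0" using x y by (simp add: t_def)
  have u: "u = (t\<^sup>2 - 1) / 2" by (simp add: u_def t_def power_divide)
  \<comment> \<open>Applied to the square of \<open>t\<close>, since the second moment of
    \<open>|y|\<close> is the one known exactly.\<close>
  have "ln (t\<^sup>2) \<le> t\<^sup>2 - 1" using t by (intro ln_le_minus_one) auto
  then have "ln t \<le> u" using t by (simp add: u ln_realpow)
  then have "exp (- u) \<le> exp (- ln t)" by simp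
  also have "\<dots> = cmod x / cmod y" using t by (simp add: exp_minus t_def)
  finally have q: "exp (- u) \<le> cmod x / cmod y" .
  have c: "exp (- symbol_cost K e R x y \<theta>) = (1 - e) * (2 / sqrt R) * E * exp (- u) * p * exp w"
  proof -
    have "- symbol_cost K e R x y \<theta> = ln (1 - e) + (ln (2 / sqrt R)) + (- (cmod y)\<^sup>2 / R) + (- u) + (- (cmod x)\<^sup>2 * (phase_error x y \<theta>)\<^sup>2) + w"
      using x R by (simp add: symbol_cost_def u_def w_def ln_div)
    then have "exp (- symbol_cost K e R x y \<theta>) = exp (ln (1 - e)) * exp (ln (2 / sqrt R)) * E * exp (- u) * p * exp w"
      by (simp only: exp_add E_def p_def)
    moreover have "exp (ln (1 - e)) = 1 - e" "exp (ln (2 / sqrt R)) = 2 / sqrt R"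
      using e R by (intro exp_ln, simp)+
    ultimately show ?thesis by simp
  qed
  have gw: "gauss (y - cis \<theta> * x) * exp w = 1 / pi"
    by (simp add: gauss_def w_def mult_exp_exp)
  have "gauss (y - cis \<theta> * x) * exp (- symbol_cost K e R x y \<theta>)
    = (gauss (y - cis \<theta> * x) * exp w) * ((1 - e) * (2 / sqrt R) * E * p * exp (- u))"
    unfolding c by (simp only: ac_simps)
  then have "gauss (y - cis \<theta> * x) * exp (- symbol_cost K e R x y \<theta>) = (1 / pi * (1 - e) * (2 / sqrt R) * E * p) * exp (- u)"
    unfolding gw by (simp only: mult.assoc)
  also have "\<dots> \<le> (1 / pi * (1 - e) * (2 / sqrt R) * E * p) * (cmod x / cmod y)"
    using e R by (intro mult_left_mono q) (auto simp: E_def p_def)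
  also have "\<dots> = ((1 - e) / (pi * sqrt pi * sqrt R) * (E / cmod y)) * (2 * pi * (cmod x / sqrt pi * p))"
  proof -
    have *: "(1 / (s * s) * a * (2 / r) * E * p) * (cx / cy) = (a / ((s * s) * s * r) * (E / cy)) * (2 * (s * s) * (cx / s * p))"
      if "s \<noteq> 0" "r \<noteq> 0" "cy \<noteq> 0" for s a r cx cy :: real
      using that by (simp add: ac_simps)
    show ?thesis
      using *[of "sqrt pi" "sqrt R" "cmod y" "1 - e" "cmod x"] R y by simp
  qed
  also have "cmod x / sqrt pi * p = angle_density K x y \<theta>"
    using x by (simp add: angle_density_def p_def)
  finally show ?thesis by (simp add: E_def)
qed

lemma symbol_cost_density:
  assumes R: "R > 0" and e: "0 < e" "e < 1" and K: "K > 0"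
  shows "ennreal (gauss (y - cis \<theta> * x) * exp (- symbol_cost K e R x y \<theta>))
    \<le> ref_density e R y * ennreal (2 * pi * angle_density K x y \<theta>)"
proof (cases "cmod x < K")
  case True
  have "gauss (y - cis \<theta> * x) * exp (- symbol_cost K e R x y \<theta>) = e * gauss y"
  proof -
    have "gauss (y - cis \<theta> * x) * exp (- symbol_cost K e R x y \<theta>) = exp (ln e + (- (cmod y)\<^sup>2)) / pi"
      using True by (simp add: gauss_def symbol_cost_def mult_exp_exp)
    then show ?thesis using e by (simp only: exp_add) (simp add: gauss_def)
  qed
  moreover have "2 * pi * angle_density K x y \<theta> = 1" using True by (simp add: angle_density_def)
  ultimately show ?thesis by (simp add: ref_density_def)
next
  case False
  then have x: "cmod x > 0" using K by linarith
  have ang: "2 * pi * angle_density K x y \<theta> > 0" using False x by (simp add: angle_density_def)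
  show ?thesis
  proof (cases "y = 0")
    case True
    \<comment> \<open>At \<open>y = 0\<close> the division by 0 makes the reference density
      infinite, and the bound is trivial.\<close>
    have "ennreal ((1 - e) / (pi * sqrt pi * sqrt R)) \<noteq> 0" using e R by (simp add: ennreal_eq_0_iff not_le)
    then have "ref_density e R y = top"
      using True by (simp add: ref_density_def ennreal_mult_top)
    then show ?thesis using ang by (simp add: ennreal_top_mult ennreal_eq_0_iff not_le)
  next
    case y: False
    let ?a = "(1 - e) / (pi * sqrt pi * sqrt R)" and ?b = "exp (- (cmod y)\<^sup>2 / R)"
    have "ennreal (gauss (y - cis \<theta> * x) * exp (- symbol_cost K e R x y \<theta>))
      \<le> ennreal ((?a * (?b / cmod y)) * (2 * pi * angle_density K x y \<theta>))"
      by (rule ennreal_leI[OF symbol_cost_density_large[OF R e x False y]])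
    also have "\<dots> = ennreal (?a * (?b / cmod y)) * ennreal (2 * pi * angle_density K x y \<theta>)"
      using ang by (intro ennreal_mult'') simp
    also have "ennreal (?a * (?b / cmod y)) = ennreal ?a * (ennreal ?b / ennreal (cmod y))"
      using e R y by (subst divide_ennreal) (auto simp: ennreal_mult[symmetric])
    also have "\<dots> \<le> ref_density e R y" unfolding ref_density_def by simp
    finally show ?thesis by (simp add: mult_right_mono)
  qed
qed

text \<open>As the phase runs over the circle, so does the phase error, and a normal density has
  mass at most 1 over one period. The shift \<open>a\<close> is 0 for the first subchannel and the
  phase already fixed for the second.\<close>

lemma nn_integral_angle_density:
  assumes K: "K > 0"
  shows "(\<integral>\<^sup>+\<delta>. ennreal (angle_density K x y (a + wrap_pi (\<delta> + t))) * indicator circle \<delta> \<partial>lborel) \<le> 1"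
proof (cases "cmod x < K")
  case True
  have "(\<integral>\<^sup>+\<delta>. ennreal (angle_density K x y (a + wrap_pi (\<delta> + t))) * indicator circle \<delta> \<partial>lborel) = ennreal (1 / (2 * pi)) * ennreal (2 * pi)"
    using True by (simp add: angle_density_def nn_integral_cmult)
  also have "\<dots> = 1" by (simp add: ennreal_mult'[symmetric])
  finally show ?thesis by simp
next
  case False
  then have x: "cmod x > 0" using K by linarith
  let ?s = "1 / (sqrt 2 * cmod x)"
  let ?g = "\<lambda>u. ennreal (normal_density 0 ?s u)"
  have e: "angle_density K x y \<theta> = normal_density 0 ?s (phase_error x y \<theta>)" for \<theta>
    using False x
    by (simp add: angle_density_def normal_density_def power_divide power_mult_distrib real_sqrt_divide)
  have "(\<integral>\<^sup>+\<delta>. ennreal (angle_density K x y (a + wrap_pi (\<delta> + t))) * indicator circle \<delta> \<partial>lborel)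
    = (\<integral>\<^sup>+\<delta>. ?g (wrap_pi ((Arg (y / x) - a - t) + (- 1) * \<delta>)) * indicator circle \<delta> \<partial>lborel)"
  proof (intro nn_integral_cong)
    fix \<delta>
    \<comment> \<open>The inner wrapping subtracts a multiple of \<open>2 * pi\<close>, which the
      outer one undoes; the phase enters with sign -1.\<close>
    have "wrap_pi (Arg (y / x) - (a + wrap_pi (\<delta> + t))) = wrap_pi ((Arg (y / x) - a - t) + (- 1) * \<delta>)"
      unfolding wrap_pi_eq_floor[of "\<delta> + t"]
      using wrap_pi_shift[of "(Arg (y / x) - a - t) + (- 1) * \<delta>" "\<lfloor>(\<delta> + t + pi) / (2 * pi)\<rfloor>"]
      by (simp add: algebra_simps)
    then show "ennreal (angle_density K x y (a + wrap_pi (\<delta> + t))) * indicator circle \<delta>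
      = ?g (wrap_pi ((Arg (y / x) - a - t) + (- 1) * \<delta>)) * indicator circle \<delta>"
      unfolding e phase_error_def by simp
  qed
  also have "\<dots> = (\<integral>\<^sup>+\<delta>. ?g \<delta> * indicator circle \<delta> \<partial>lborel)"
    by (rule nn_integral_circle_shift) auto
  also have "\<dots> \<le> (\<integral>\<^sup>+\<delta>. ?g \<delta> \<partial>lborel)"
    by (intro nn_integral_mono) (auto split: split_indicator)
  also have "\<dots> = 1"
  proof -
    interpret prob_space "density lborel (normal_density 0 ?s)" using x by (intro prob_space_normal_density) simp
    show ?thesis using emeasure_space_1 by (simp add: emeasure_density)
  qed
  finally show ?thesis .
qed

text \<open>This serves integrability, so the constants are crude. Second order in the input and
  fourth order in the noise is the growth that the power constraint and the Gaussian moments can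
  carry; \<open>K >= 1\<close> tames the division by \<open>|x|^2\<close>.\<close>

lemma symbol_cost_bound:
  assumes R: "R > 0" and e: "0 < e" "e < 1" and K: "K \<ge> 1"
  obtains B where "\<forall>x w \<theta>. \<bar>symbol_cost K e R x (cis \<theta> * x + w) \<theta>\<bar> \<le> B * (1 + (cmod x)\<^sup>2 + cmod w ^ 4)"
proof
  define C where "C = \<bar>ln e\<bar> + \<bar>ln (1 - e)\<bar> + \<bar>ln (sqrt R / 2)\<bar> + 1"
  define B where "B = 2 * C + 6 + 4 / R + pi\<^sup>2"
  show "\<forall>x w \<theta>. \<bar>symbol_cost K e R x (cis \<theta> * x + w) \<theta>\<bar> \<le> B * (1 + (cmod x)\<^sup>2 + cmod w ^ 4)"
  proof (intro allI)
    fix x w :: complex and \<theta> :: real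
    define y where "y = cis \<theta> * x + w"
    define X where "X = (cmod x)\<^sup>2"
    define W where "W = (cmod w)\<^sup>2"
    define Y where "Y = (cmod y)\<^sup>2"
    define w4 where "w4 = cmod w ^ 4"
    define U where "U = 1 + X + w4"
    have w: "y - cis \<theta> * x = w" by (simp add: y_def)
    have nn: "0 \<le> X" "0 \<le> W" "0 \<le> Y" "0 \<le> w4" by (simp_all add: X_def W_def Y_def w4_def)
    have "0 \<le> (W - 1)\<^sup>2" by simp
    also have "(W - 1)\<^sup>2 = w4 - 2 * W + 1" by (simp add: W_def w4_def power2_diff power_mult[symmetric])
    finally have W4: "2 * W \<le> w4 + 1" by linarith
    have "cmod y \<le> cmod x + cmod w" using norm_triangle_ineq[of "cis \<theta> * x" w] by (simp add: norm_mult y_def)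
    then have "Y \<le> (cmod x + cmod w)\<^sup>2" unfolding Y_def by (intro power_mono) auto
    also have "\<dots> \<le> 2 * X + 2 * W"
      using zero_le_power2[of "cmod x - cmod w"] unfolding X_def W_def power2_sum power2_diff by linarith
    finally have Y: "Y \<le> 2 * X + 2 * W" .
    have Ue: "U = 1 + X + w4" by (simp add: U_def)
    have U: "1 \<le> U" "X \<le> U" using Ue nn by simp_all
    have U: "1 \<le> U" "X \<le> U" "W \<le> 2 * U" "Y \<le> 4 * U"
      subgoal by (rule U) subgoal by (rule U)
      subgoal using Ue W4 nn by linarith
      subgoal using Ue W4 Y nn by linarith
      done
    have C0: "0 \<le> C" by (simp add: C_def)
    have C: "C \<le> C * U" using mult_left_mono[OF U(1) C0] by simp
    have BU: "(2 * C + 6 + 4 / R + pi\<^sup>2) * U = 2 * (C * U) + 6 * U + 4 / R * U + pi\<^sup>2 * U"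
      by (simp only: distrib_right mult.assoc)
    have lns: "\<bar>ln e\<bar> + \<bar>ln (1 - e)\<bar> + \<bar>ln (sqrt R / 2)\<bar> + 1 = C" by (simp add: C_def)
    have "\<bar>symbol_cost K e R x y \<theta>\<bar> \<le> B * U"
    proof (cases "cmod x < K")
      case True
      have "symbol_cost K e R x y \<theta> = Y - W - ln e" using True by (simp add: symbol_cost_def Y_def W_def w)
      then have "\<bar>symbol_cost K e R x y \<theta>\<bar> \<le> C * U + 6 * U"
        using C U nn lns by linarith
      also have "\<dots> \<le> (2 * C + 6 + 4 / R + pi\<^sup>2) * U"
      proof -
        have "0 \<le> C * U" "0 \<le> 4 / R * U" "0 \<le> pi\<^sup>2 * U" using C0 U R by auto
        then show ?thesis unfolding BU by linarith
      qed
      finally show ?thesis by (simp only: B_def)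
    next
      case False
      then have x1: "1 \<le> X" using K power_mono[of 1 "cmod x" 2] by (simp add: X_def)
      then have x0: "x \<noteq> 0" by (auto simp: X_def)
      define P where "P = X * (phase_error x y \<theta>)\<^sup>2"
      have a: "0 \<le> Y / R" using R nn by simp
      have a2: "Y / R \<le> 4 / R * U" using divide_right_mono[OF U(4), of R] R by simp
      have b: "0 \<le> Y / X" using nn by simp
      have b2: "Y / X \<le> 4 * U"
      proof -
        have "Y / X \<le> Y / 1" using x1 nn by (intro divide_left_mono) auto
        then show ?thesis using U by simp
      qed
      have p: "0 \<le> P" by (simp add: P_def X_def)
      have "P \<le> X * pi\<^sup>2"
        unfolding P_def using phase_error_bounds(2)[OF e(1) x0] nn by (intro mult_left_mono) auto
      also have "\<dots> \<le> U * pi\<^sup>2" using U by (intro mult_right_mono) auto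
      finally have p2: "P \<le> pi\<^sup>2 * U" by (simp add: mult.commute)
      have eq: "symbol_cost K e R x y \<theta> = - ln (1 - e) + ln (sqrt R / 2) + Y / R + (Y / X - 1) / 2 + P - W"
        using False by (simp add: symbol_cost_def Y_def X_def W_def P_def w)
      have "\<bar>symbol_cost K e R x y \<theta>\<bar> \<le> C + 4 / R * U + 2 * U + pi\<^sup>2 * U + 2 * U"
      proof -
        define l where "l = - ln (1 - e) + ln (sqrt R / 2)"
        have l: "l \<le> C - 1" "1 - C \<le> l"
          unfolding l_def lns[symmetric]
          using abs_ge_self[of "ln (sqrt R / 2)"] abs_ge_minus_self[of "ln (1 - e)"] abs_ge_zero[of "ln e"]
            abs_ge_minus_self[of "ln (sqrt R / 2)"] abs_ge_self[of "ln (1 - e)"] by simp_all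
        have "\<bar>l + yr + (yx - 1) / 2 + P - W\<bar> \<le> C + ru + 2 * U + pu + 2 * U"
          if "0 \<le> yr" "yr \<le> ru" "0 \<le> yx" "yx \<le> 4 * U" "P \<le> pu" for yr ru yx pu
        proof (rule abs_leI)
          have 1: "(yx - 1) / 2 \<le> 2 * U" using that(4) by (simp add: field_simps)
          have 2: "- (1 / 2) \<le> (yx - 1) / 2" using that(3) by (simp add: field_simps)
          show "l + yr + (yx - 1) / 2 + P - W \<le> C + ru + 2 * U + pu + 2 * U"
            using 1 that l p U nn by linarith
          show "- (l + yr + (yx - 1) / 2 + P - W) \<le> C + ru + 2 * U + pu + 2 * U"
            using 2 that l p U nn by linarith
        qed
        from this[OF a a2 b b2 p2] show ?thesis unfolding eq l_def by simp
      qed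
      also have "\<dots> \<le> (2 * C + 6 + 4 / R + pi\<^sup>2) * U"
      proof -
        have "0 \<le> C * U" using C0 U by auto
        then show ?thesis unfolding BU using C U by linarith
      qed
      finally show ?thesis by (simp only: B_def)
    qed
    then show "\<bar>symbol_cost K e R x (cis \<theta> * x + w) \<theta>\<bar> \<le> B * (1 + (cmod x)\<^sup>2 + cmod w ^ 4)"
      by (simp only: y_def U_def X_def w4_def)
  qed
qed

lemma symbol_cost_measurable[measurable]:
  assumes [measurable]: "f \<in> borel_measurable A" "g \<in> borel_measurable A" "h \<in> borel_measurable A"
  shows "(\<lambda>p. symbol_cost K e R (f p) (g p) (h p)) \<in> borel_measurable A"
  unfolding symbol_cost_def by measurable

text \<open>The means are explicit: \<open>|x|^2 + 1\<close> for the squared output, 1 for the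
  squared noise, and \<open>1 / (2 * |x|^2)\<close> for the squared tangential part of the relative
  noise, whence \<open>(1 + e) / 2\<close>. Together with the final -1 this leaves about -1/2 per
  strong symbol, besides the logarithm and the power term.\<close>

lemma expected_symbol_cost:
  assumes R: "R > 0" and e: "0 < e" "e < 1" and K: "K \<ge> 1"
  defines "C4 \<equiv> (\<integral>w. cmod w ^ 4 \<partial>std_complex_normal)"
  shows "(\<integral>w. symbol_cost K e R x (cis \<theta> * x + w) \<theta> \<partial>std_complex_normal) \<le>
    (if cmod x < K then (cmod x)\<^sup>2 - ln e
     else - ln (1 - e) + ln (sqrt R / 2) + ((cmod x)\<^sup>2 + 1) / R + 1 / (2 * (cmod x)\<^sup>2)
       + (1 + e) / 2 + (4 * (1 + 1 / e) + 16 * pi\<^sup>2) * C4 / (cmod x)\<^sup>2 - 1)"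
proof -
  interpret W: prob_space std_complex_normal by (rule prob_space_std_complex_normal)
  note m = std_complex_normal_moments
  let ?X = "(cmod x)\<^sup>2"
  have one: "has_bochner_integral std_complex_normal (\<lambda>w. c) c" for c :: real
    by (simp add: has_bochner_integral_iff W.prob_space[simplified])
  have y2: "(cmod (cis \<theta> * x + w))\<^sup>2 = ?X + 2 * Re (cnj (cis \<theta> * x) * w) + (cmod w)\<^sup>2" for w
  proof -
    have "(cmod (a + w))\<^sup>2 = (cmod a)\<^sup>2 + 2 * Re (cnj a * w) + (cmod w)\<^sup>2" for a
      unfolding cmod_power2 by (simp add: power2_eq_square algebra_simps)
    from this[of "cis \<theta> * x"] show ?thesis by (simp add: norm_mult)
  qed
  have Y: "has_bochner_integral std_complex_normal (\<lambda>w. (cmod (cis \<theta> * x + w))\<^sup>2) (?X + 2 * 0 + 1)"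
    unfolding y2 by (intro has_bochner_integral_add has_bochner_integral_mult_right one m)
  obtain B where B: "\<forall>x w \<theta>. \<bar>symbol_cost K e R x (cis \<theta> * x + w) \<theta>\<bar> \<le> B * (1 + (cmod x)\<^sup>2 + cmod w ^ 4)"
    by (rule symbol_cost_bound[OF R e K])
  have int: "integrable std_complex_normal (\<lambda>w. symbol_cost K e R x (cis \<theta> * x + w) \<theta>)"
  proof (rule Bochner_Integration.integrable_bound)
    show "integrable std_complex_normal (\<lambda>w. B * (1 + (cmod x)\<^sup>2 + cmod w ^ 4))"
      using integrable_norm4_std_complex_normal by simp
    show "AE w in std_complex_normal. norm (symbol_cost K e R x (cis \<theta> * x + w) \<theta>) \<le> norm (B * (1 + (cmod x)\<^sup>2 + cmod w ^ 4))"
      using B by (intro AE_I2) (metis abs_ge_self order_trans real_norm_def)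
  qed (intro symbol_cost_measurable borel_measurable_const plus_std_complex_normal_measurable)
  show ?thesis
  proof (cases "cmod x < K")
    case True
    have "has_bochner_integral std_complex_normal (\<lambda>w. (cmod (cis \<theta> * x + w))\<^sup>2 - (cmod w)\<^sup>2 - ln e) ((?X + 2 * 0 + 1) - 1 - ln e)"
      by (intro has_bochner_integral_diff Y m one)
    then have "(\<integral>w. symbol_cost K e R x (cis \<theta> * x + w) \<theta> \<partial>std_complex_normal) = (?X + 2 * 0 + 1) - 1 - ln e"
      using True by (simp add: symbol_cost_def has_bochner_integral_iff)
    then show ?thesis using True by simp
  next
    case False
    then have x0: "x \<noteq> 0" and X: "0 < ?X" using K by auto
    \<comment> \<open>The coefficient of the fourth-order term in \<open>phase_error_bounds\<close>;
      \<open>?c * w\<close> below is the relative noise \<open>z\<close> of that lemma.\<close>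
    let ?Ce = "4 * (1 + 1 / e) + 16 * pi\<^sup>2"
    let ?c = "cis (- \<theta>) / x"
    let ?g = "\<lambda>w. - ln (1 - e) + ln (sqrt R / 2) + (cmod (cis \<theta> * x + w))\<^sup>2 * (1 / R) + ((cmod (cis \<theta> * x + w))\<^sup>2 * (1 / ?X) - 1) * (1 / 2)
      + (?X * (1 + e) * (Im (?c * w))\<^sup>2 + (?Ce / ?X) * cmod w ^ 4) - (cmod w)\<^sup>2"
    let ?v = "- ln (1 - e) + ln (sqrt R / 2) + (?X + 2 * 0 + 1) * (1 / R) + ((?X + 2 * 0 + 1) * (1 / ?X) - 1) * (1 / 2)
      + (?X * (1 + e) * ((cmod ?c)\<^sup>2 / 2) + (?Ce / ?X) * C4) - 1"
    have C4: "has_bochner_integral std_complex_normal (\<lambda>w. cmod w ^ 4) C4"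
      using m(5) by (simp add: has_bochner_integral_iff C4_def)
    have g: "has_bochner_integral std_complex_normal ?g ?v"
      by (intro has_bochner_integral_diff has_bochner_integral_add has_bochner_integral_mult_right
        has_bochner_integral_mult_left Y m(3,4) C4 one)
    have c4: "?X * (?Ce * cmod (?c * w) ^ 4) = ?Ce / ?X * cmod w ^ 4" for w
    proof -
      have "cmod (?c * w) ^ 4 = cmod w ^ 4 / cmod x ^ 4" by (simp add: norm_mult norm_divide power_divide)
      also have "cmod x ^ 4 = ?X * ?X" by (simp add: power2_eq_square power4_eq_xxxx)
      finally have q: "cmod (?c * w) ^ 4 = cmod w ^ 4 / (?X * ?X)" .
      have *: "b * (a * (t / (b * b))) = a / b * t" if "b > 0" for a b t :: real
        using that by (simp add: field_simps)
      show ?thesis unfolding q by (rule *[OF X])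
    qed
    have "(\<integral>w. symbol_cost K e R x (cis \<theta> * x + w) \<theta> \<partial>std_complex_normal) \<le> (\<integral>w. ?g w \<partial>std_complex_normal)"
    proof (rule integral_mono[OF int])
      show "integrable std_complex_normal ?g" using g by (simp add: has_bochner_integral_iff)
      fix w
      have "?X * (phase_error x (cis \<theta> * x + w) \<theta>)\<^sup>2 \<le> ?X * ((1 + e) * (Im (?c * w))\<^sup>2 + ?Ce * cmod (?c * w) ^ 4)"
        using phase_error_bounds(1)[OF e(1) x0, of "cis \<theta> * x + w" \<theta>]
        by (intro mult_left_mono) auto
      also have "\<dots> = ?X * (1 + e) * (Im (?c * w))\<^sup>2 + ?Ce / ?X * cmod w ^ 4"
        by (subst distrib_left, subst c4, simp only: mult.assoc)
      finally show "symbol_cost K e R x (cis \<theta> * x + w) \<theta> \<le> ?g w"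
        using False by (simp add: symbol_cost_def)
    qed
    also have "\<dots> = ?v" using g by (simp add: has_bochner_integral_iff)
    also have "\<dots> = - ln (1 - e) + ln (sqrt R / 2) + (?X + 1) / R + 1 / (2 * ?X) + (1 + e) / 2 + ?Ce * C4 / ?X - 1"
    proof -
      have "(cmod ?c)\<^sup>2 = 1 / ?X" by (simp add: norm_divide power_divide)
      then have 1: "?X * (1 + e) * ((cmod ?c)\<^sup>2 / 2) = (1 + e) / 2" using X by simp
      have 2: "((?X + 2 * 0 + 1) * (1 / ?X) - 1) * (1 / 2) = 1 / (2 * ?X)"
      proof -
        have "((v + 2 * 0 + 1) * (1 / v) - 1) * (1 / 2) = 1 / (2 * v)" if "v > 0" for v :: real
          using that by (simp add: field_simps)
        from this[OF X] show ?thesis .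
      qed
      show ?thesis unfolding 1 2 by simp
    qed
    finally show ?thesis using False by simp
  qed
qed

lemma prod_ennreal_mono:
  fixes f g :: "'a \<Rightarrow> ennreal"
  assumes "\<And>i. i \<in> A \<Longrightarrow> f i \<le> g i" shows "prod f A \<le> prod g A"
  using assms
proof (induction A rule: infinite_finite_induct)
  case (insert i A)
  have "f i * prod f A \<le> g i * prod g A" by (rule mult_mono) (use insert in auto)
  then show ?case using insert(1,2) by simp
qed simp_all

lemma prod_ennreal_le_1:
  fixes f :: "'a \<Rightarrow> ennreal"
  assumes "\<And>i. i \<in> A \<Longrightarrow> f i \<le> 1" shows "prod f A \<le> 1"
  using prod_ennreal_mono[of A f "\<lambda>_. 1"] assms by simp

text \<open>Differential entropy of the wrapped normal law in nats. Estimates are carried out in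
  nats throughout, with informations multiplied by \<open>ln 2\<close>.\<close>

definition phase_entropy :: "real \<Rightarrow> real" where
  "phase_entropy \<sigma> = - (\<integral>t. ln (wrapped_density \<sigma> t) \<partial>wrapped_normal \<sigma>)"

lemma integrable_ln_wrapped_density:
  assumes \<sigma>: "\<sigma> > 0" shows "integrable (wrapped_normal \<sigma>) (\<lambda>t. ln (wrapped_density \<sigma> t))"
proof -
  interpret prob_space "wrapped_normal \<sigma>" using \<sigma> by (rule prob_space_wrapped_normal)
  obtain B where "\<forall>t. \<bar>ln (wrapped_density \<sigma> t)\<bar> \<le> B" by (rule ln_wrapped_density_bounded[OF \<sigma>])
  then show ?thesis
    using \<sigma> by (intro integrable_const_bound[where B=B]) (auto intro!: AE_I2)
qed

lemma integrable_ln_2pi_wrapped_density: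
  assumes \<sigma>: "\<sigma> > 0"
  shows "has_bochner_integral (wrapped_normal \<sigma>) (\<lambda>t. ln (2 * pi * wrapped_density \<sigma> t)) (ln (2 * pi) - phase_entropy \<sigma>)"
proof -
  interpret prob_space "wrapped_normal \<sigma>" using \<sigma> by (rule prob_space_wrapped_normal)
  have "ln (2 * pi * wrapped_density \<sigma> t) = ln (2 * pi) + ln (wrapped_density \<sigma> t)" for t
    using wrapped_density_pos[OF \<sigma>, of t] by (simp add: ln_mult)
  then show ?thesis
    using integrable_ln_wrapped_density[OF \<sigma>]
    by (simp add: has_bochner_integral_iff phase_entropy_def prob_space[simplified])
qed

lemma integral_distr_comp:
  fixes f :: "'b \<Rightarrow> real"
  assumes g: "g \<in> M \<rightarrow>\<^sub>M N" and f: "has_bochner_integral (distr M N g) f v"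
  shows "has_bochner_integral M (\<lambda>x. f (g x)) v"
proof -
  have m: "f \<in> borel_measurable N"
    using f by (auto simp: has_bochner_integral_iff dest: borel_measurable_integrable)
  show ?thesis using f integrable_distr_eq[OF g m] integral_distr[OF g m]
    by (simp add: has_bochner_integral_iff)
qed

section \<open>Expectations that involve one increment or one symbol\<close>

context comb
begin

lemma distr_NN_fst: "distr NN (phase_space \<sigma>\<^sub>c) fst = phase_space \<sigma>\<^sub>c"
  unfolding comb_noise_space_def by (rule RW.distr_pair_fst)

lemma distr_NN_fst_snd: "distr NN (phase_space \<sigma>\<^sub>r) (\<lambda>z. fst (snd z)) = phase_space \<sigma>\<^sub>r"
proof -
  have "distr NN (phase_space \<sigma>\<^sub>r) (\<lambda>z. fst (snd z))
    = distr (distr NN (phase_space \<sigma>\<^sub>r \<Otimes>\<^sub>M additive_noise_space M) snd) (phase_space \<sigma>\<^sub>r) fst"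
    unfolding comb_noise_space_def by (subst distr_distr) (auto simp: comp_def)
  also have "distr NN (phase_space \<sigma>\<^sub>r \<Otimes>\<^sub>M additive_noise_space M) snd = phase_space \<sigma>\<^sub>r \<Otimes>\<^sub>M additive_noise_space M"
    unfolding comb_noise_space_def by (rule distr_pair_snd[OF C.prob_space_axioms RW.prob_space_axioms])
  also have "distr (phase_space \<sigma>\<^sub>r \<Otimes>\<^sub>M additive_noise_space M) (phase_space \<sigma>\<^sub>r) fst = phase_space \<sigma>\<^sub>r"
    by (rule W.distr_pair_fst)
  finally show ?thesis .
qed

lemma has_bochner_integral_snd_pair:
  fixes f :: "'b \<Rightarrow> real"
  assumes "prob_space \<mu>" "prob_space N" "has_bochner_integral N f v"
  shows "has_bochner_integral (\<mu> \<Otimes>\<^sub>M N) (\<lambda>p. f (snd p)) v"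
  by (rule integral_distr_comp[OF measurable_snd]) (simp add: distr_pair_snd assms)

lemma has_bochner_integral_fst_pair:
  fixes f :: "'b \<Rightarrow> real"
  assumes "prob_space N" "has_bochner_integral \<mu> f v"
  shows "has_bochner_integral (\<mu> \<Otimes>\<^sub>M N) (\<lambda>p. f (fst p)) v"
  by (rule integral_distr_comp[OF measurable_fst]) (simp add: prob_space.distr_pair_fst assms)

lemma increment_integral_c:
  fixes u :: "real \<Rightarrow> real"
  assumes \<mu>: "prob_space \<mu>" and k: "k \<ge> 1" and u: "has_bochner_integral (wrapped_normal \<sigma>\<^sub>c) u v"
  shows "has_bochner_integral (\<mu> \<Otimes>\<^sub>M NN) (\<lambda>p. u (snd (fst (snd p)) k)) v"
proof -
  have "has_bochner_integral (phase_space \<sigma>\<^sub>c) (\<lambda>c. u (snd c k)) v"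
    by (rule integral_distr_comp[of "\<lambda>c. snd c k" "phase_space \<sigma>\<^sub>c" borel u v])
      (use k u in \<open>simp_all add: distr_increment[OF \<sigma>\<^sub>c_pos k]\<close>)
  then have "has_bochner_integral NN (\<lambda>z. u (snd (fst z) k)) v"
    by (intro integral_distr_comp[of fst NN "phase_space \<sigma>\<^sub>c" "\<lambda>c. u (snd c k)"]) (simp_all add: distr_NN_fst)
  then show ?thesis
    by (rule has_bochner_integral_snd_pair[OF \<mu> prob_space_NN, of "\<lambda>z. u (snd (fst z) k)"])
qed

lemma increment_integral_r:
  fixes u :: "real \<Rightarrow> real"
  assumes \<mu>: "prob_space \<mu>" and k: "k \<ge> 1" and u: "has_bochner_integral (wrapped_normal \<sigma>\<^sub>r) u v"
  shows "has_bochner_integral (\<mu> \<Otimes>\<^sub>M NN) (\<lambda>p. u (snd (fst (snd (snd p))) k)) v"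
proof -
  have "has_bochner_integral (phase_space \<sigma>\<^sub>r) (\<lambda>c. u (snd c k)) v"
    by (rule integral_distr_comp[of "\<lambda>c. snd c k" "phase_space \<sigma>\<^sub>r" borel u v])
      (use k u in \<open>simp_all add: distr_increment[OF \<sigma>\<^sub>r_pos k]\<close>)
  then have "has_bochner_integral NN (\<lambda>z. u (snd (fst (snd z)) k)) v"
    by (intro integral_distr_comp[of "\<lambda>z. fst (snd z)" NN "phase_space \<sigma>\<^sub>r" "\<lambda>c. u (snd c k)"]) (simp_all add: distr_NN_fst_snd)
  then show ?thesis
    by (rule has_bochner_integral_snd_pair[OF \<mu> prob_space_NN, of "\<lambda>z. u (snd (fst (snd z)) k)"])
qed

abbreviation "angle cr k m \<equiv> phase (fst cr) k + real m * phase (snd cr) k"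

text \<open>The input, the angle and the additive noise of one symbol are independent. Expectations
  over the whole process thereby reduce to a product of three laws, of which only that of the noise
  has to be explicit.\<close>

lemma distr_symbol:
  assumes \<mu>: "prob_space \<mu>" "sets \<mu> = sets (block_space M n)" and k: "k \<in> {1..n}" "m < M"
  shows "distr (\<mu> \<Otimes>\<^sub>M NN) ((borel \<Otimes>\<^sub>M borel) \<Otimes>\<^sub>M borel)
      (\<lambda>p. ((fst p k m, angle (fst (snd p), fst (snd (snd p))) k m), snd (snd (snd p)) k m))
    = (distr \<mu> borel (\<lambda>x. x k m) \<Otimes>\<^sub>M distr (phases \<sigma>\<^sub>c \<sigma>\<^sub>r) borel (\<lambda>cr. angle cr k m)) \<Otimes>\<^sub>M std_complex_normal"
    (is "distr _ _ ?f = (?X \<Otimes>\<^sub>M ?T) \<Otimes>\<^sub>M ?S")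
proof (rule measure_eqI)
  have k1: "1 \<le> k" using k by simp
  interpret mu: prob_space \<mu> by fact
  interpret N: prob_space NN by (rule prob_space_NN)
  interpret S: prob_space ?S by (rule prob_space_std_complex_normal)
  note [measurable] = block_component_measurable[OF \<mu>(2) k] additive_noise_measurable[OF k1 k(2)]
  have aw[measurable]: "(\<lambda>p. snd (snd (snd p)) k m) \<in> borel_measurable (\<mu> \<Otimes>\<^sub>M NN)"
    by (rule measurable_compose[OF _ additive_noise_measurable[OF k1 k(2)]]) measurable
  have ang[measurable]: "(\<lambda>cr. angle cr k m) \<in> borel_measurable (phases \<sigma>\<^sub>c \<sigma>\<^sub>r)" by measurable
  have f[measurable]: "?f \<in> \<mu> \<Otimes>\<^sub>M NN \<rightarrow>\<^sub>M (borel \<Otimes>\<^sub>M borel) \<Otimes>\<^sub>M borel" by measurable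
  interpret X: prob_space ?X by (rule mu.prob_space_distr) simp
  interpret T: prob_space ?T by (rule CR.prob_space_distr[OF ang])
  interpret XT: pair_prob_space ?X ?T ..
  have setsQ: "sets ((?X \<Otimes>\<^sub>M ?T) \<Otimes>\<^sub>M ?S) = sets ((borel \<Otimes>\<^sub>M borel) \<Otimes>\<^sub>M borel)"
    by (intro sets_pair_measure_cong) auto
  then show "sets (distr (\<mu> \<Otimes>\<^sub>M NN) ((borel \<Otimes>\<^sub>M borel) \<Otimes>\<^sub>M borel) ?f) = sets ((?X \<Otimes>\<^sub>M ?T) \<Otimes>\<^sub>M ?S)" by simp
  fix A assume "A \<in> sets (distr (\<mu> \<Otimes>\<^sub>M NN) ((borel \<Otimes>\<^sub>M borel) \<Otimes>\<^sub>M borel) ?f)"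
  then have A[measurable]: "A \<in> sets ((borel \<Otimes>\<^sub>M borel) \<Otimes>\<^sub>M (borel :: complex measure))" by simp
  have A': "A \<in> sets ((?X \<Otimes>\<^sub>M ?T) \<Otimes>\<^sub>M ?S)" using A setsQ by blast
  have A'': "A \<in> sets ((borel \<Otimes>\<^sub>M borel) \<Otimes>\<^sub>M ?S)"
  proof -
    have "sets ((borel \<Otimes>\<^sub>M borel) \<Otimes>\<^sub>M ?S) = sets ((borel \<Otimes>\<^sub>M borel) \<Otimes>\<^sub>M (borel :: complex measure))"
      by (intro sets_pair_measure_cong) auto
    then show ?thesis using A by blast
  qed
  define g where "g q = (\<integral>\<^sup>+s. indicator A (q, s) \<partial>?S)" for q
  have g[measurable]: "g \<in> borel_measurable (borel \<Otimes>\<^sub>M borel)"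
    unfolding g_def[abs_def] using A'' by (intro S.borel_measurable_nn_integral) simp
  have noise: "(\<integral>\<^sup>+w. indicator A (q, w k m) \<partial>additive_noise_space M) = g q" for q
  proof -
    have [measurable]: "(\<lambda>s. (q, s)) \<in> borel \<rightarrow>\<^sub>M (borel \<Otimes>\<^sub>M borel) \<Otimes>\<^sub>M (borel :: complex measure)"
      by (rule measurable_Pair1') (simp add: space_pair_measure)
    have mA: "(\<lambda>s. indicator A (q, s) :: ennreal) \<in> borel_measurable borel" by measurable
    have "g q = (\<integral>\<^sup>+s. indicator A (q, s) \<partial>distr (additive_noise_space M) borel (\<lambda>w. w k m))"
      by (simp add: g_def distr_additive_noise_component[OF k1 k(2)])
    also have "\<dots> = (\<integral>\<^sup>+w. indicator A (q, w k m) \<partial>additive_noise_space M)"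
      using mA by (intro nn_integral_distr) auto
    finally show ?thesis by simp
  qed
  have "emeasure (distr (\<mu> \<Otimes>\<^sub>M NN) ((borel \<Otimes>\<^sub>M borel) \<Otimes>\<^sub>M borel) ?f) A
    = (\<integral>\<^sup>+p. indicator A (?f p) \<partial>(\<mu> \<Otimes>\<^sub>M NN))"
    by (subst nn_integral_distr[symmetric, OF f]) auto
  also have "\<dots> = (\<integral>\<^sup>+x. \<integral>\<^sup>+z. indicator A (?f (x, z)) \<partial>NN \<partial>\<mu>)"
    by (rule N.nn_integral_fst[symmetric]) measurable
  also have "\<dots> = (\<integral>\<^sup>+x. \<integral>\<^sup>+cr. \<integral>\<^sup>+w. indicator A ((x k m, angle cr k m), w k m) \<partial>additive_noise_space M \<partial>phases \<sigma>\<^sub>c \<sigma>\<^sub>r \<partial>\<mu>)"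
  proof (rule nn_integral_cong)
    fix x assume "x \<in> space \<mu>"
    then have m: "(\<lambda>z. indicator A (?f (x, z)) :: ennreal) \<in> borel_measurable NN"
      by (intro measurable_compose[OF measurable_Pair1'[of x \<mu> NN]]) measurable
    show "(\<integral>\<^sup>+z. indicator A (?f (x, z)) \<partial>NN) = (\<integral>\<^sup>+cr. \<integral>\<^sup>+w. indicator A ((x k m, angle cr k m), w k m) \<partial>additive_noise_space M \<partial>phases \<sigma>\<^sub>c \<sigma>\<^sub>r)"
      using nn_integral_NN[OF m] by simp
  qed
  also have "\<dots> = (\<integral>\<^sup>+x. \<integral>\<^sup>+cr. g (x k m, angle cr k m) \<partial>phases \<sigma>\<^sub>c \<sigma>\<^sub>r \<partial>\<mu>)"
    by (simp only: noise)
  also have "\<dots> = (\<integral>\<^sup>+x. \<integral>\<^sup>+t. g (x k m, t) \<partial>?T \<partial>\<mu>)"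
    by (intro nn_integral_cong nn_integral_distr[symmetric] ang) measurable
  also have "\<dots> = (\<integral>\<^sup>+x. \<integral>\<^sup>+t. g (x, t) \<partial>?T \<partial>?X)"
  proof (rule nn_integral_distr[symmetric])
    show "(\<lambda>x. \<integral>\<^sup>+t. g (x, t) \<partial>?T) \<in> borel_measurable (distr \<mu> borel (\<lambda>x. x k m))"
      by (rule T.borel_measurable_nn_integral) measurable
  qed measurable
  also have "\<dots> = (\<integral>\<^sup>+q. g q \<partial>(?X \<Otimes>\<^sub>M ?T))"
    by (rule T.nn_integral_fst) measurable
  also have "\<dots> = (\<integral>\<^sup>+q. indicator A q \<partial>((?X \<Otimes>\<^sub>M ?T) \<Otimes>\<^sub>M ?S))"
    unfolding g_def using A' by (intro S.nn_integral_fst) simp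
  also have "\<dots> = emeasure ((?X \<Otimes>\<^sub>M ?T) \<Otimes>\<^sub>M ?S) A" using A' by simp
  finally show "emeasure (distr (\<mu> \<Otimes>\<^sub>M NN) ((borel \<Otimes>\<^sub>M borel) \<Otimes>\<^sub>M borel) ?f) A = \<dots>" .
qed

text \<open>The bound \<open>a x\<close> on the mean over the noise holds for every angle
  \<open>t\<close>, so the law of the angle does not have to be computed. The growth condition
  matches a finite second moment of the input and a finite fourth moment of the noise.\<close>

lemma symbol_integral:
  fixes H :: "complex \<Rightarrow> real \<Rightarrow> complex \<Rightarrow> real"
  assumes \<mu>: "prob_space \<mu>" "sets \<mu> = sets (block_space M n)" and k: "k \<in> {1..n}" "m < M"
    and H[measurable]: "(\<lambda>((x, t), w). H x t w) \<in> borel_measurable ((borel \<Otimes>\<^sub>M borel) \<Otimes>\<^sub>M borel)"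
    and bound: "\<And>x t w. \<bar>H x t w\<bar> \<le> B * (1 + (cmod x)\<^sup>2 + cmod w ^ 4)"
    and sq: "integrable \<mu> (\<lambda>x. (cmod (x k m))\<^sup>2)"
  shows "integrable (\<mu> \<Otimes>\<^sub>M NN) (\<lambda>p. H (fst p k m) (angle (fst (snd p), fst (snd (snd p))) k m) (snd (snd (snd p)) k m))"
    and "\<lbrakk>\<And>x t. (\<integral>w. H x t w \<partial>std_complex_normal) \<le> a x; integrable \<mu> (\<lambda>x. a (x k m)); a \<in> borel_measurable borel\<rbrakk> \<Longrightarrow>
      (\<integral>p. H (fst p k m) (angle (fst (snd p), fst (snd (snd p))) k m) (snd (snd (snd p)) k m) \<partial>(\<mu> \<Otimes>\<^sub>M NN)) \<le> (\<integral>x. a (x k m) \<partial>\<mu>)"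
proof -
  let ?X = "distr \<mu> borel (\<lambda>x. x k m)" and ?T = "distr (phases \<sigma>\<^sub>c \<sigma>\<^sub>r) borel (\<lambda>cr. angle cr k m)" and ?S = std_complex_normal
  let ?f = "\<lambda>p. ((fst p k m, angle (fst (snd p), fst (snd (snd p))) k m), snd (snd (snd p)) k m)"
  let ?h = "\<lambda>q. H (fst (fst q)) (snd (fst q)) (snd q)"
  let ?Q = "(?X \<Otimes>\<^sub>M ?T) \<Otimes>\<^sub>M ?S"
  have k1: "1 \<le> k" using k by simp
  interpret mu: prob_space \<mu> by fact
  interpret S: prob_space ?S by (rule prob_space_std_complex_normal)
  note [measurable] = block_component_measurable[OF \<mu>(2) k]
  have aw[measurable]: "(\<lambda>p. snd (snd (snd p)) k m) \<in> borel_measurable (\<mu> \<Otimes>\<^sub>M NN)"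
    by (rule measurable_compose[OF _ additive_noise_measurable[OF k1 k(2)]]) measurable
  have ang[measurable]: "(\<lambda>cr. angle cr k m) \<in> borel_measurable (phases \<sigma>\<^sub>c \<sigma>\<^sub>r)" by measurable
  have f[measurable]: "?f \<in> \<mu> \<Otimes>\<^sub>M NN \<rightarrow>\<^sub>M (borel \<Otimes>\<^sub>M borel) \<Otimes>\<^sub>M borel" by measurable
  interpret X: prob_space ?X by (rule mu.prob_space_distr) simp
  interpret T: prob_space ?T by (rule CR.prob_space_distr[OF ang])
  interpret XT: pair_prob_space ?X ?T ..
  interpret XTS: pair_prob_space "?X \<Otimes>\<^sub>M ?T" ?S ..
  note Q = distr_symbol[OF \<mu> k]
  have hm[measurable]: "?h \<in> borel_measurable ((borel \<Otimes>\<^sub>M borel) \<Otimes>\<^sub>M borel)"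
    using H by (simp add: case_prod_beta')
  have sX: "has_bochner_integral ?X (\<lambda>x. (cmod x)\<^sup>2) (\<integral>x. (cmod (x k m))\<^sup>2 \<partial>\<mu>)"
    using sq by (subst has_bochner_integral_distr) (auto simp: has_bochner_integral_iff)
  have iX: "integrable ?Q (\<lambda>q. (cmod (fst (fst q)))\<^sup>2)"
    using has_bochner_integral_fst_pair[OF S.prob_space_axioms has_bochner_integral_fst_pair[OF T.prob_space_axioms sX]]
    by (simp add: has_bochner_integral_iff)
  have iS: "integrable ?Q (\<lambda>q. cmod (snd q) ^ 4)"
    using has_bochner_integral_snd_pair[OF XT.prob_space_axioms S.prob_space_axioms, of "\<lambda>w. cmod w ^ 4" "\<integral>w. cmod w ^ 4 \<partial>?S"]
      integrable_norm4_std_complex_normal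
    by (simp add: has_bochner_integral_iff)
  have hQ: "?h \<in> borel_measurable ?Q"
  proof -
    have "sets ?Q = sets ((borel \<Otimes>\<^sub>M borel) \<Otimes>\<^sub>M borel)"
      by (intro sets_pair_measure_cong) auto
    from measurable_cong_sets[OF this refl] hm show ?thesis by blast
  qed
  have int: "integrable ?Q ?h"
  proof (rule Bochner_Integration.integrable_bound)
    show "integrable ?Q (\<lambda>q. B * (1 + (cmod (fst (fst q)))\<^sup>2 + cmod (snd q) ^ 4))"
      using iX iS by (intro integrable_mult_right Bochner_Integration.integrable_add) (auto intro!: XTS.P.integrable_const)
    show "AE q in ?Q. norm (?h q) \<le> norm (B * (1 + (cmod (fst (fst q)))\<^sup>2 + cmod (snd q) ^ 4))"
      using bound by (intro AE_I2) (auto intro: order_trans[OF _ abs_ge_self])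
  qed (rule hQ)
  have "integrable (distr (\<mu> \<Otimes>\<^sub>M NN) ((borel \<Otimes>\<^sub>M borel) \<Otimes>\<^sub>M borel) ?f) ?h" unfolding Q by (rule int)
  from integrable_distr[OF f this]
  show "integrable (\<mu> \<Otimes>\<^sub>M NN) (\<lambda>p. H (fst p k m) (angle (fst (snd p), fst (snd (snd p))) k m) (snd (snd (snd p)) k m))"
    by simp
  assume a: "\<And>x t. (\<integral>w. H x t w \<partial>std_complex_normal) \<le> a x" "integrable \<mu> (\<lambda>x. a (x k m))"
    and am[measurable]: "a \<in> borel_measurable borel"
  have aX: "has_bochner_integral ?X a (\<integral>x. a (x k m) \<partial>\<mu>)"
    using a(2) by (subst has_bochner_integral_distr) (auto simp: has_bochner_integral_iff)
  have aXT: "has_bochner_integral (?X \<Otimes>\<^sub>M ?T) (\<lambda>q. a (fst q)) (\<integral>x. a (x k m) \<partial>\<mu>)"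
    by (rule has_bochner_integral_fst_pair[OF T.prob_space_axioms aX])
  have "(\<integral>p. H (fst p k m) (angle (fst (snd p), fst (snd (snd p))) k m) (snd (snd (snd p)) k m) \<partial>(\<mu> \<Otimes>\<^sub>M NN))
    = (\<integral>q. ?h q \<partial>?Q)"
    unfolding Q[symmetric] by (subst integral_distr[OF f hm]) simp
  also have "\<dots> = (\<integral>q. (\<integral>w. ?h (q, w) \<partial>?S) \<partial>(?X \<Otimes>\<^sub>M ?T))"
    by (rule XTS.integral_fst'[symmetric]) (rule int)
  also have "\<dots> \<le> (\<integral>q. a (fst q) \<partial>(?X \<Otimes>\<^sub>M ?T))"
  proof (rule integral_mono)
    show "integrable (?X \<Otimes>\<^sub>M ?T) (\<lambda>q. \<integral>w. ?h (q, w) \<partial>?S)"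
      by (rule XTS.integrable_fst') (rule int)
    show "integrable (?X \<Otimes>\<^sub>M ?T) (\<lambda>q. a (fst q))" using aXT by (simp add: has_bochner_integral_iff)
  qed (use a(1) in simp)
  also have "\<dots> = (\<integral>x. a (x k m) \<partial>\<mu>)" using aXT by (simp add: has_bochner_integral_iff)
  finally show "(\<integral>p. H (fst p k m) (angle (fst (snd p), fst (snd (snd p))) k m) (snd (snd (snd p)) k m) \<partial>(\<mu> \<Otimes>\<^sub>M NN)) \<le> (\<integral>x. a (x k m) \<partial>\<mu>)" .
qed

lemma admissible_power:
  assumes adm: "\<mu> \<in> admissible_laws M n \<rho>" and \<rho>: "\<rho> \<ge> 0"
  shows "\<And>k m. k \<in> {1..n} \<Longrightarrow> m < M \<Longrightarrow> integrable \<mu> (\<lambda>x. (cmod (x k m))\<^sup>2)"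
    and "(\<Sum>k=1..n. \<Sum>m<M. \<integral>x. (cmod (x k m))\<^sup>2 \<partial>\<mu>) \<le> real n * \<rho>"
proof -
  have s: "sets \<mu> = sets (block_space M n)" using adm by (simp add: admissible_laws_def)
  have L2: "ennreal ((L2_set (\<lambda>m. cmod (x k m)) {..<M})\<^sup>2) = (\<Sum>m<M. ennreal ((cmod (x k m))\<^sup>2))" for x :: "nat \<Rightarrow> nat \<Rightarrow> complex" and k
    by (simp add: L2_set_def sum_nonneg sum_ennreal)
  have m: "k \<in> {1..n} \<Longrightarrow> m < M \<Longrightarrow> (\<lambda>x. (cmod (x k m))\<^sup>2) \<in> borel_measurable \<mu>" for k m
    using block_component_measurable[OF s, of k m] by simp
  have "(\<Sum>k=1..n. \<Sum>m<M. \<integral>\<^sup>+x. ennreal ((cmod (x k m))\<^sup>2) \<partial>\<mu>)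
    = (\<Sum>k=1..n. \<integral>\<^sup>+x. ennreal ((L2_set (\<lambda>m. cmod (x k m)) {..<M})\<^sup>2) \<partial>\<mu>)"
    unfolding L2 by (intro sum.cong refl nn_integral_sum[symmetric] measurable_compose[OF m measurable_ennreal])
      (auto simp del: atLeastAtMost_iff)
  also have "\<dots> \<le> ennreal (real n * \<rho>)" using adm by (simp add: admissible_laws_def)
  finally have le: "(\<Sum>k=1..n. \<Sum>m<M. \<integral>\<^sup>+x. ennreal ((cmod (x k m))\<^sup>2) \<partial>\<mu>) \<le> ennreal (real n * \<rho>)" .
  show I: "integrable \<mu> (\<lambda>x. (cmod (x k m))\<^sup>2)" if k: "k \<in> {1..n}" "m < M" for k m
  proof (rule integrableI_nonneg[OF m[OF k]])
    have "(\<integral>\<^sup>+x. ennreal ((cmod (x k m))\<^sup>2) \<partial>\<mu>) \<le> (\<Sum>m<M. \<integral>\<^sup>+x. ennreal ((cmod (x k m))\<^sup>2) \<partial>\<mu>)"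
      using k by (intro member_le_sum[of m "{..<M}"]) auto
    also have "\<dots> \<le> (\<Sum>k=1..n. \<Sum>m<M. \<integral>\<^sup>+x. ennreal ((cmod (x k m))\<^sup>2) \<partial>\<mu>)"
      using k by (intro member_le_sum[of k "{1..n}" "\<lambda>k. \<Sum>m<M. \<integral>\<^sup>+x. ennreal ((cmod (x k m))\<^sup>2) \<partial>\<mu>"]) auto
    also have "\<dots> < \<infinity>" by (rule le_less_trans[OF le]) simp
    finally show "(\<integral>\<^sup>+x. ennreal ((cmod (x k m))\<^sup>2) \<partial>\<mu>) < \<infinity>" .
  qed simp
  have "(\<Sum>k=1..n. \<Sum>m<M. \<integral>\<^sup>+x. ennreal ((cmod (x k m))\<^sup>2) \<partial>\<mu>)
    = (\<Sum>k=1..n. \<Sum>m<M. ennreal (\<integral>x. (cmod (x k m))\<^sup>2 \<partial>\<mu>))"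
    using I by (intro sum.cong refl nn_integral_eq_integral) auto
  also have "\<dots> = ennreal (\<Sum>k=1..n. \<Sum>m<M. \<integral>x. (cmod (x k m))\<^sup>2 \<partial>\<mu>)"
    by (simp add: sum_ennreal sum_nonneg)
  finally have "ennreal (\<Sum>k=1..n. \<Sum>m<M. \<integral>x. (cmod (x k m))\<^sup>2 \<partial>\<mu>) \<le> ennreal (real n * \<rho>)" using le by simp
  then show "(\<Sum>k=1..n. \<Sum>m<M. \<integral>x. (cmod (x k m))\<^sup>2 \<partial>\<mu>) \<le> real n * \<rho>"
    using \<rho> by (subst (asm) ennreal_le_iff) auto
qed

end

lemma prod_lessThan_2: "prod f {..<2::nat} = f 0 * f (1::nat)"
  and sum_lessThan_2: "sum g {..<2::nat} = g 0 + g (1::nat)"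
  by (simp_all add: numeral_2_eq_2 One_nat_def)

text \<open>The bound on the expected cost with \<open>K\<close> in place of \<open>|x|\<close> in
  the decreasing remainders. On either side of the threshold it is affine in \<open>|x|^2\<close>,
  so the power constraint can be inserted.\<close>

definition symbol_bound :: "real \<Rightarrow> real \<Rightarrow> real \<Rightarrow> complex \<Rightarrow> real" where
  "symbol_bound K e R x = (if cmod x < K then (cmod x)\<^sup>2 - ln e
     else - ln (1 - e) + ln (sqrt R / 2) + ((cmod x)\<^sup>2 + 1) / R + 1 / (2 * K\<^sup>2) + (1 + e) / 2
       + (4 * (1 + 1 / e) + 16 * pi\<^sup>2) * (\<integral>w. cmod w ^ 4 \<partial>std_complex_normal) / K\<^sup>2 - 1)"

lemma symbol_bound_measurable[measurable]: "symbol_bound K e R \<in> borel_measurable borel"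
  unfolding symbol_bound_def by measurable

lemma expected_symbol_cost_le:
  assumes R: "R > 0" and e: "0 < e" "e < 1" and K: "K \<ge> 1"
  shows "(\<integral>w. symbol_cost K e R x (cis \<theta> * x + w) \<theta> \<partial>std_complex_normal) \<le> symbol_bound K e R x"
proof -
  let ?C4 = "\<integral>w. cmod w ^ 4 \<partial>std_complex_normal"
  let ?C = "(4 * (1 + 1 / e) + 16 * pi\<^sup>2) * ?C4"
  have C: "0 \<le> ?C" using e by (intro mult_nonneg_nonneg integral_nonneg add_nonneg_nonneg) auto
  show ?thesis
  proof (cases "cmod x < K")
    case True
    then show ?thesis using expected_symbol_cost[OF R e K, of x \<theta>] by (simp add: symbol_bound_def)
  next
    case False
    then have "K\<^sup>2 \<le> (cmod x)\<^sup>2" using K by (intro power_mono) auto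
    moreover have "0 < K\<^sup>2" using K by simp
    ultimately have "1 / (2 * (cmod x)\<^sup>2) \<le> 1 / (2 * K\<^sup>2)" "?C / (cmod x)\<^sup>2 \<le> ?C / K\<^sup>2"
      using C by (auto intro!: divide_left_mono mult_pos_pos intro: less_le_trans)
    then show ?thesis using expected_symbol_cost[OF R e K, of x \<theta>] False
      by (simp add: symbol_bound_def)
  qed
qed

lemma integrable_symbol_bound:
  assumes R: "R > 0" and mu: "prob_space \<mu>" and f[measurable]: "f \<in> borel_measurable \<mu>"
    and sq: "integrable \<mu> (\<lambda>x. (cmod (f x))\<^sup>2)"
  shows "integrable \<mu> (\<lambda>x. symbol_bound K e R (f x))"
proof -
  interpret prob_space \<mu> by fact
  \<comment> \<open>The constant part of the branch for strong inputs, read off at the modulus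
    \<open>max K 0\<close>.\<close>
  let ?c = "symbol_bound K e R (of_real (max K 0)) - (max K 0)\<^sup>2 / R"
  let ?d = "\<bar>ln e\<bar> + \<bar>?c\<bar>"
  have "\<bar>symbol_bound K e R z\<bar> \<le> ?d + (1 + 1 / R) * (cmod z)\<^sup>2" for z
  proof (cases "cmod z < K")
    case True
    have "0 \<le> 1 / R * (cmod z)\<^sup>2" "0 \<le> (cmod z)\<^sup>2" using R by auto
    moreover have "symbol_bound K e R z = (cmod z)\<^sup>2 - ln e" using True by (simp add: symbol_bound_def)
    moreover have "\<bar>(cmod z)\<^sup>2 - ln e\<bar> \<le> (cmod z)\<^sup>2 + \<bar>ln e\<bar>"
      using abs_triangle_ineq4[of "(cmod z)\<^sup>2" "ln e"] by simp
    ultimately show ?thesis unfolding distrib_right by simp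
  next
    case False
    have "symbol_bound K e R z = ?c + (cmod z)\<^sup>2 / R"
      using False by (simp add: symbol_bound_def add_divide_distrib)
    moreover have "\<bar>?c + (cmod z)\<^sup>2 / R\<bar> \<le> \<bar>?c\<bar> + (cmod z)\<^sup>2 / R"
      using abs_triangle_ineq[of ?c "(cmod z)\<^sup>2 / R"] R by simp
    moreover have "0 \<le> (cmod z)\<^sup>2" by simp
    moreover have "(1 + 1 / R) * (cmod z)\<^sup>2 = (cmod z)\<^sup>2 + (cmod z)\<^sup>2 / R" by (simp add: distrib_right)
    ultimately show ?thesis using abs_ge_zero[of "ln e"] by linarith
  qed
  then show ?thesis
    using sq by (intro Bochner_Integration.integrable_bound[where f="\<lambda>x. ?d + (1 + 1 / R) * (cmod (f x))\<^sup>2" and g="\<lambda>x. symbol_bound K e R (f x)"])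
      (auto intro!: AE_I2 order_trans[OF _ abs_ge_self])
qed

section \<open>Two subchannels: the cost of a whole input\<close>

locale comb2 = comb \<sigma>\<^sub>c \<sigma>\<^sub>r 2 for \<sigma>\<^sub>c \<sigma>\<^sub>r
begin

definition cost_y where
  "cost_y n K e R x cr y = (\<Sum>k\<in>{1..n}. ln (2 * pi * wrapped_density \<sigma>\<^sub>c (snd (fst cr) k))
     + ln (2 * pi * wrapped_density \<sigma>\<^sub>r (snd (snd cr) k))
     + (\<Sum>m<2. symbol_cost K e R (x k m) (y k m) (angle cr k m)))"

text \<open>The same quantity as \<open>cost_y\<close> with the output written out through the
  noise. In this form its mean splits over increments and symbols, whereas \<open>cost_y\<close>, as
  a function of the output, is the form that multiplies the kernel.\<close>

definition cost where
  "cost n K e R x z = (\<Sum>k\<in>{1..n}. ln (2 * pi * wrapped_density \<sigma>\<^sub>c (snd (fst z) k))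
     + ln (2 * pi * wrapped_density \<sigma>\<^sub>r (snd (fst (snd z)) k))
     + (\<Sum>m<2. symbol_cost K e R (x k m)
         (cis (angle (fst z, fst (snd z)) k m) * x k m + snd (snd z) k m) (angle (fst z, fst (snd z)) k m)))"

lemma cost_eq_cost_y: "cost n K e R x (c, r, w) = cost_y n K e R x (c, r) (comb_output 2 n x (c, r, w))"
  unfolding cost_def cost_y_def by (intro sum.cong refl) (auto simp: comb_output_eq rotation_def)

lemma integral_cost:
  assumes \<mu>: "prob_space \<mu>" "sets \<mu> = sets (block_space 2 n)"
    and sq: "\<And>k m. k \<in> {1..n} \<Longrightarrow> m < 2 \<Longrightarrow> integrable \<mu> (\<lambda>x. (cmod (x k m))\<^sup>2)"
    and R: "R > 0" and e: "0 < e" "e < 1" and K: "K \<ge> 1"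
  shows "integrable (\<mu> \<Otimes>\<^sub>M NN) (\<lambda>(x, z). cost n K e R x z)"
    and "(\<integral>(x, z). cost n K e R x z \<partial>(\<mu> \<Otimes>\<^sub>M NN)) \<le>
      real n * (2 * ln (2 * pi) - phase_entropy \<sigma>\<^sub>c - phase_entropy \<sigma>\<^sub>r) + (\<Sum>k=1..n. \<Sum>m<2. \<integral>x. symbol_bound K e R (x k m) \<partial>\<mu>)"
proof -
  obtain B where B: "\<forall>x w \<theta>. \<bar>symbol_cost K e R x (cis \<theta> * x + w) \<theta>\<bar> \<le> B * (1 + (cmod x)\<^sup>2 + cmod w ^ 4)"
    by (rule symbol_cost_bound[OF R e K])
  let ?u = "\<lambda>k p. ln (2 * pi * wrapped_density \<sigma>\<^sub>c (snd (fst (snd p)) k))"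
  let ?v = "\<lambda>k p. ln (2 * pi * wrapped_density \<sigma>\<^sub>r (snd (fst (snd (snd p))) k))"
  let ?H = "\<lambda>x t w. symbol_cost K e R x (cis t * x + w) t"
  let ?s = "\<lambda>k m p. ?H (fst p k m) (angle (fst (snd p), fst (snd (snd p))) k m) (snd (snd (snd p)) k m)"
  have u: "has_bochner_integral (\<mu> \<Otimes>\<^sub>M NN) (?u k) (ln (2 * pi) - phase_entropy \<sigma>\<^sub>c)" if "k \<in> {1..n}" for k
    using that by (intro increment_integral_c[OF \<mu>(1)] integrable_ln_2pi_wrapped_density[OF \<sigma>\<^sub>c_pos]) simp
  have v: "has_bochner_integral (\<mu> \<Otimes>\<^sub>M NN) (?v k) (ln (2 * pi) - phase_entropy \<sigma>\<^sub>r)" if "k \<in> {1..n}" for k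
    using that by (intro increment_integral_r[OF \<mu>(1)] integrable_ln_2pi_wrapped_density[OF \<sigma>\<^sub>r_pos]) simp
  have H: "(\<lambda>((x, t), w). ?H x t w) \<in> borel_measurable ((borel \<Otimes>\<^sub>M borel) \<Otimes>\<^sub>M borel)"
    unfolding case_prod_beta' by measurable
  have si: "integrable (\<mu> \<Otimes>\<^sub>M NN) (?s k m)" if "k \<in> {1..n}" "m < 2" for k m
    using B by (intro symbol_integral(1)[OF \<mu> that H, of B] sq that) blast
  have sb: "integral\<^sup>L (\<mu> \<Otimes>\<^sub>M NN) (?s k m) \<le> (\<integral>x. symbol_bound K e R (x k m) \<partial>\<mu>)" if "k \<in> {1..n}" "m < 2" for k m
  proof (rule symbol_integral(2)[OF \<mu> that H, of B])
    show "integrable \<mu> (\<lambda>x. symbol_bound K e R (x k m))"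
      by (rule integrable_symbol_bound[OF R \<mu>(1) block_component_measurable[OF \<mu>(2) that] sq[OF that]])
  qed (use B sq that expected_symbol_cost_le[OF R e K] in \<open>auto simp del: atLeastAtMost_iff\<close>)
  have eq: "(\<lambda>(x, z). cost n K e R x z) = (\<lambda>p. \<Sum>k\<in>{1..n}. ?u k p + ?v k p + (\<Sum>m<2. ?s k m p))"
    by (simp add: fun_eq_iff cost_def)
  have iuv: "integrable (\<mu> \<Otimes>\<^sub>M NN) (?u k)" "integrable (\<mu> \<Otimes>\<^sub>M NN) (?v k)" if "k \<in> {1..n}" for k
    using u[OF that] v[OF that] by (simp_all add: has_bochner_integral_iff)
  have is2: "integrable (\<mu> \<Otimes>\<^sub>M NN) (\<lambda>p. \<Sum>m<2. ?s k m p)" if "k \<in> {1..n}" for k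
    using that by (intro Bochner_Integration.integrable_sum si) auto
  show "integrable (\<mu> \<Otimes>\<^sub>M NN) (\<lambda>(x, z). cost n K e R x z)"
    unfolding eq by (intro Bochner_Integration.integrable_sum Bochner_Integration.integrable_add iuv is2)
  have "(\<integral>(x, z). cost n K e R x z \<partial>(\<mu> \<Otimes>\<^sub>M NN)) = (\<Sum>k\<in>{1..n}. \<integral>p. ?u k p + ?v k p + (\<Sum>m<2. ?s k m p) \<partial>(\<mu> \<Otimes>\<^sub>M NN))"
    unfolding eq by (intro Bochner_Integration.integral_sum Bochner_Integration.integrable_add iuv is2)
  also have "\<dots> = (\<Sum>k\<in>{1..n}. (ln (2 * pi) - phase_entropy \<sigma>\<^sub>c) + (ln (2 * pi) - phase_entropy \<sigma>\<^sub>r) + (\<Sum>m<2. integral\<^sup>L (\<mu> \<Otimes>\<^sub>M NN) (?s k m)))"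
  proof (rule sum.cong[OF refl])
    fix k assume k: "k \<in> {1..n}"
    have "(\<integral>p. ?u k p + ?v k p + (\<Sum>m<2. ?s k m p) \<partial>(\<mu> \<Otimes>\<^sub>M NN)) = integral\<^sup>L (\<mu> \<Otimes>\<^sub>M NN) (?u k) + integral\<^sup>L (\<mu> \<Otimes>\<^sub>M NN) (?v k) + (\<integral>p. (\<Sum>m<2. ?s k m p) \<partial>(\<mu> \<Otimes>\<^sub>M NN))"
      by (subst Bochner_Integration.integral_add, intro Bochner_Integration.integrable_add iuv k, rule is2[OF k],
        subst Bochner_Integration.integral_add, rule iuv(1)[OF k], rule iuv(2)[OF k], rule refl)
    also have "(\<integral>p. (\<Sum>m<2. ?s k m p) \<partial>(\<mu> \<Otimes>\<^sub>M NN)) = (\<Sum>m<2. integral\<^sup>L (\<mu> \<Otimes>\<^sub>M NN) (?s k m))"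
      by (rule Bochner_Integration.integral_sum) (use si[OF k] in simp)
    finally show "(\<integral>p. ?u k p + ?v k p + (\<Sum>m<2. ?s k m p) \<partial>(\<mu> \<Otimes>\<^sub>M NN))
      = (ln (2 * pi) - phase_entropy \<sigma>\<^sub>c) + (ln (2 * pi) - phase_entropy \<sigma>\<^sub>r) + (\<Sum>m<2. integral\<^sup>L (\<mu> \<Otimes>\<^sub>M NN) (?s k m))"
      using u[OF k] v[OF k] by (simp add: has_bochner_integral_iff)
  qed
  also have "\<dots> \<le> (\<Sum>k\<in>{1..n}. (2 * ln (2 * pi) - phase_entropy \<sigma>\<^sub>c - phase_entropy \<sigma>\<^sub>r) + (\<Sum>m<2. \<integral>x. symbol_bound K e R (x k m) \<partial>\<mu>))"
  proof (rule sum_mono)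
    fix k assume k: "k \<in> {1..n}"
    have "(\<Sum>m<2. integral\<^sup>L (\<mu> \<Otimes>\<^sub>M NN) (?s k m)) \<le> (\<Sum>m<2. \<integral>x. symbol_bound K e R (x k m) \<partial>\<mu>)"
      by (rule sum_mono) (use sb[OF k] in simp)
    then show "(ln (2 * pi) - phase_entropy \<sigma>\<^sub>c) + (ln (2 * pi) - phase_entropy \<sigma>\<^sub>r) + (\<Sum>m<2. integral\<^sup>L (\<mu> \<Otimes>\<^sub>M NN) (?s k m))
      \<le> (2 * ln (2 * pi) - phase_entropy \<sigma>\<^sub>c - phase_entropy \<sigma>\<^sub>r) + (\<Sum>m<2. \<integral>x. symbol_bound K e R (x k m) \<partial>\<mu>)"
      by linarith
  qed
  also have "\<dots> = real n * (2 * ln (2 * pi) - phase_entropy \<sigma>\<^sub>c - phase_entropy \<sigma>\<^sub>r) + (\<Sum>k=1..n. \<Sum>m<2. \<integral>x. symbol_bound K e R (x k m) \<partial>\<mu>)"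
    by (simp add: sum.distrib)
  finally show "(\<integral>(x, z). cost n K e R x z \<partial>(\<mu> \<Otimes>\<^sub>M NN)) \<le>
      real n * (2 * ln (2 * pi) - phase_entropy \<sigma>\<^sub>c - phase_entropy \<sigma>\<^sub>r) + (\<Sum>k=1..n. \<Sum>m<2. \<integral>x. symbol_bound K e R (x k m) \<partial>\<mu>)" .
qed

text \<open>What block \<open>k\<close> leaves for the first phase once the reference density has
  been split off. The summand 0 is the shift \<open>a\<close> of
  \<open>nn_integral_angle_density\<close>.\<close>

definition weight_c :: "real \<Rightarrow> (nat \<Rightarrow> nat \<Rightarrow> complex) \<Rightarrow> (nat \<Rightarrow> nat \<Rightarrow> complex) \<Rightarrow> nat \<Rightarrow> real \<times> (nat \<Rightarrow> real) \<Rightarrow> ennreal" where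
  "weight_c K x y k c = ennreal (angle_density K (x k 0) (y k 0) (0 + phase c k)) * ennreal (1 / wrapped_density \<sigma>\<^sub>c (snd c k))"

definition weight_r :: "real \<Rightarrow> (nat \<Rightarrow> nat \<Rightarrow> complex) \<Rightarrow> (nat \<Rightarrow> nat \<Rightarrow> complex) \<Rightarrow> nat
    \<Rightarrow> real \<times> (nat \<Rightarrow> real) \<Rightarrow> real \<times> (nat \<Rightarrow> real) \<Rightarrow> ennreal" where
  "weight_r K x y k c r = ennreal (angle_density K (x k 1) (y k 1) (phase c k + phase r k)) * ennreal (1 / wrapped_density \<sigma>\<^sub>r (snd r k))"

lemma angle_density_measurable[measurable]:
  assumes [measurable]: "f \<in> borel_measurable A" "g \<in> borel_measurable A"
  shows "(\<lambda>p. angle_density K x (f p) (g p)) \<in> borel_measurable A"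
  unfolding angle_density_def by measurable

lemma weight_measurable:
  assumes "\<sigma> > 0" and [measurable]: "f \<in> borel_measurable A" "g \<in> borel_measurable A" "h \<in> borel_measurable A"
  shows "(\<lambda>p. ennreal (angle_density K x (f p) (g p)) * ennreal (1 / wrapped_density \<sigma> (h p))) \<in> borel_measurable A"
proof -
  have "(\<lambda>p. wrapped_density \<sigma> (h p)) \<in> borel_measurable A"
    by (rule measurable_compose[OF assms(4) wrapped_density_measurable[OF assms(1)]])
  then show ?thesis by measurable
qed

text \<open>With the first phases fixed, the second product is integrated over the second phases:
  its angle densities depend on the sum of both, and the fixed phase acts as a mere shift. The first
  phases are then left with their own product.\<close>

lemma nn_integral_weights:
  assumes K: "K > 0"
  shows "(\<integral>\<^sup>+cr. (\<Prod>k=1..n. weight_c K x y k (fst cr)) * (\<Prod>k=1..n. weight_r K x y k (fst cr) (snd cr)) \<partial>phases \<sigma>\<^sub>c \<sigma>\<^sub>r) \<le> 1"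
proof -
  have mc: "weight_c K x y k \<in> borel_measurable (phase_space \<sigma>\<^sub>c)" if "k \<in> {1..n}" for k
    unfolding weight_c_def[abs_def] using that
    by (intro weight_measurable[OF \<sigma>\<^sub>c_pos] borel_measurable_add borel_measurable_const phase_measurable snd_phase_space_measurable) simp
  have mr: "(\<lambda>cr. weight_r K x y k (fst cr) (snd cr)) \<in> borel_measurable (phases \<sigma>\<^sub>c \<sigma>\<^sub>r)" if k: "k \<in> {1..n}" for k
    unfolding weight_r_def using k
    by (intro weight_measurable[OF \<sigma>\<^sub>r_pos] borel_measurable_add borel_measurable_const
      measurable_compose[OF measurable_fst phase_measurable] measurable_compose[OF measurable_snd phase_measurable]
      measurable_compose[OF measurable_snd snd_phase_space_measurable]) simp
  have mr1: "weight_r K x y k c \<in> borel_measurable (phase_space \<sigma>\<^sub>r)" if "k \<in> {1..n}" for k c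
    unfolding weight_r_def[abs_def] using that
    by (intro weight_measurable[OF \<sigma>\<^sub>r_pos] borel_measurable_add borel_measurable_const phase_measurable snd_phase_space_measurable) simp
  have mcr: "(\<lambda>cr. (\<Prod>k=1..n. weight_c K x y k (fst cr)) * (\<Prod>k=1..n. weight_r K x y k (fst cr) (snd cr))) \<in> borel_measurable (phases \<sigma>\<^sub>c \<sigma>\<^sub>r)"
    by (intro borel_measurable_times_ennreal borel_measurable_prod_ennreal mr measurable_compose[OF measurable_fst mc])
  have "(\<integral>\<^sup>+cr. (\<Prod>k=1..n. weight_c K x y k (fst cr)) * (\<Prod>k=1..n. weight_r K x y k (fst cr) (snd cr)) \<partial>phases \<sigma>\<^sub>c \<sigma>\<^sub>r)
    = (\<integral>\<^sup>+c. \<integral>\<^sup>+r. (\<Prod>k=1..n. weight_c K x y k c) * (\<Prod>k=1..n. weight_r K x y k c r) \<partial>phase_space \<sigma>\<^sub>r \<partial>phase_space \<sigma>\<^sub>c)"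
    using mcr by (subst R.nn_integral_fst[symmetric]) auto
  also have "\<dots> = (\<integral>\<^sup>+c. (\<Prod>k=1..n. weight_c K x y k c) * (\<integral>\<^sup>+r. (\<Prod>k=1..n. weight_r K x y k c r) \<partial>phase_space \<sigma>\<^sub>r) \<partial>phase_space \<sigma>\<^sub>c)"
    by (intro nn_integral_cong nn_integral_cmult borel_measurable_prod_ennreal mr1)
  also have "\<dots> \<le> (\<integral>\<^sup>+c. (\<Prod>k=1..n. weight_c K x y k c) * 1 \<partial>phase_space \<sigma>\<^sub>c)"
  proof (intro nn_integral_mono mult_left_mono)
    fix c
    show "(\<integral>\<^sup>+r. (\<Prod>k=1..n. weight_r K x y k c r) \<partial>phase_space \<sigma>\<^sub>r) \<le> 1"
      unfolding weight_r_def
      by (rule nn_integral_phase_reweighted[OF \<sigma>\<^sub>r_pos, of "\<lambda>k \<theta>. ennreal (angle_density K (x k 1) (y k 1) (phase c k + \<theta>))"])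
        (measurable, rule nn_integral_angle_density[OF K])
  qed simp
  also have "\<dots> = (\<integral>\<^sup>+c. (\<Prod>k=1..n. weight_c K x y k c) \<partial>phase_space \<sigma>\<^sub>c)" by simp
  also have "\<dots> \<le> 1"
    unfolding weight_c_def
    by (rule nn_integral_phase_reweighted[OF \<sigma>\<^sub>c_pos, of "\<lambda>k \<theta>. ennreal (angle_density K (x k 0) (y k 0) (0 + \<theta>))"])
      (measurable, rule nn_integral_angle_density[OF K])
  finally show ?thesis .
qed

lemma exp_minus_ln_ln:
  fixes a b c d :: real
  assumes "0 < a" "0 < b"
  shows "exp (- (ln a + ln b + (c + d))) = 1 / a * (1 / b) * (exp (- c) * exp (- d))"
proof -
  have "- (ln a + ln b + (c + d)) = - ln a + - ln b + (- c + - d)" by simp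
  then have "exp (- (ln a + ln b + (c + d))) = exp (- ln a) * exp (- ln b) * (exp (- c) * exp (- d))"
    by (simp only: exp_add)
  moreover have "exp (- ln t) = 1 / t" if "0 < t" for t :: real
    using that by (simp add: exp_minus inverse_eq_divide)
  ultimately show ?thesis using assms by simp
qed

lemma ennreal_mult4:
  fixes a b c d :: real
  assumes "0 \<le> a" "0 \<le> b" "0 \<le> c" "0 \<le> d"
  shows "ennreal (a * b * (c * d)) = ennreal a * ennreal b * (ennreal c * ennreal d)"
  using assms by (simp add: ennreal_mult)

lemma ennreal_cancel_2pi:
  fixes a f :: real
  assumes "0 < f" "0 \<le> a"
  shows "ennreal (1 / (2 * pi * f)) * ennreal (2 * pi * a) = ennreal a * ennreal (1 / f)"
  using assms by (simp add: ennreal_mult[symmetric])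

text \<open>The factors \<open>2 * pi\<close> inside the logarithms of the cost cancel those with
  which \<open>symbol_cost_density\<close> measures the angle densities against the uniform law.
  What remains of each increment is the reciprocal of its density.\<close>

lemma kernel_cost_le:
  assumes R: "R > 0" and e: "0 < e" "e < 1" and K: "K \<ge> 1"
  shows "ennreal (kernel n x y cr) * ennreal (exp (- cost_y n K e R x cr y))
    \<le> (\<Prod>k=1..n. \<Prod>m<2. ref_density e R (y k m))
      * ((\<Prod>k=1..n. weight_c K x y k (fst cr)) * (\<Prod>k=1..n. weight_r K x y k (fst cr) (snd cr)))"
proof -
  let ?fc = "\<lambda>k. wrapped_density \<sigma>\<^sub>c (snd (fst cr) k)" and ?fr = "\<lambda>k. wrapped_density \<sigma>\<^sub>r (snd (snd cr) k)"
  let ?g = "\<lambda>k m. gauss (y k m - cis (angle cr k m) * x k m) * exp (- symbol_cost K e R (x k m) (y k m) (angle cr k m))"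
  let ?a = "\<lambda>k m. angle_density K (x k m) (y k m) (angle cr k m)"
  have fpos: "0 < ?fc k" "0 < ?fr k" for k
    using wrapped_density_pos[OF \<sigma>\<^sub>c_pos] wrapped_density_pos[OF \<sigma>\<^sub>r_pos] by auto
  have apos: "0 \<le> ?a k m" for k m by (simp add: angle_density_def)
  have gpos: "0 \<le> ?g k m" for k m using gauss_pos by (simp add: less_imp_le)
  have "kernel n x y cr * exp (- cost_y n K e R x cr y)
    = (\<Prod>k=1..n. 1 / (2 * pi * ?fc k) * (1 / (2 * pi * ?fr k)) * (?g k 0 * ?g k 1))"
  proof -
    have "exp (- cost_y n K e R x cr y) = (\<Prod>k=1..n. exp (- (ln (2 * pi * ?fc k) + ln (2 * pi * ?fr k)
        + (\<Sum>m<2. symbol_cost K e R (x k m) (y k m) (angle cr k m)))))"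
      unfolding cost_y_def by (subst sum_negf[symmetric], rule exp_sum) simp
    also have "\<dots> = (\<Prod>k=1..n. 1 / (2 * pi * ?fc k) * (1 / (2 * pi * ?fr k)) *
        (exp (- symbol_cost K e R (x k 0) (y k 0) (angle cr k 0)) * exp (- symbol_cost K e R (x k 1) (y k 1) (angle cr k 1))))"
    proof (rule prod.cong[OF refl])
      fix k
      have "0 < 2 * pi * ?fc k" "0 < 2 * pi * ?fr k" using fpos[of k] by simp_all
      then show "exp (- (ln (2 * pi * ?fc k) + ln (2 * pi * ?fr k) + (\<Sum>m<2. symbol_cost K e R (x k m) (y k m) (angle cr k m))))
        = 1 / (2 * pi * ?fc k) * (1 / (2 * pi * ?fr k)) *
        (exp (- symbol_cost K e R (x k 0) (y k 0) (angle cr k 0)) * exp (- symbol_cost K e R (x k 1) (y k 1) (angle cr k 1)))"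
        unfolding sum_lessThan_2 by (rule exp_minus_ln_ln)
    qed
    finally have *: "exp (- cost_y n K e R x cr y) = \<dots>" .
    have "kernel n x y cr = (\<Prod>k=1..n. gauss (y k 0 - cis (angle cr k 0) * x k 0) * gauss (y k 1 - cis (angle cr k 1) * x k 1))"
      unfolding kernel_def rotation_def by (simp only: prod_lessThan_2)
    then show ?thesis unfolding * by (simp only: prod.distrib[symmetric]) (simp only: ac_simps)
  qed
  then have "ennreal (kernel n x y cr) * ennreal (exp (- cost_y n K e R x cr y))
    = ennreal (\<Prod>k=1..n. 1 / (2 * pi * ?fc k) * (1 / (2 * pi * ?fr k)) * (?g k 0 * ?g k 1))"
    by (simp add: ennreal_mult''[symmetric])
  also have "\<dots> = (\<Prod>k=1..n. ennreal (1 / (2 * pi * ?fc k) * (1 / (2 * pi * ?fr k)) * (?g k 0 * ?g k 1)))"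
    using fpos by (intro prod_ennreal[symmetric] mult_nonneg_nonneg) (auto simp: less_imp_le gauss_pos)
  also have "\<dots> \<le> (\<Prod>k=1..n. (\<Prod>m<2. ref_density e R (y k m)) * (weight_c K x y k (fst cr) * weight_r K x y k (fst cr) (snd cr)))"
  proof (rule prod_ennreal_mono)
    fix k
    have "ennreal (1 / (2 * pi * ?fc k) * (1 / (2 * pi * ?fr k)) * (?g k 0 * ?g k 1))
      = ennreal (1 / (2 * pi * ?fc k)) * ennreal (1 / (2 * pi * ?fr k)) * (ennreal (?g k 0) * ennreal (?g k 1))"
      using fpos[of k] by (intro ennreal_mult4 gpos) (simp_all add: less_imp_le)
    also have "\<dots> \<le> ennreal (1 / (2 * pi * ?fc k)) * ennreal (1 / (2 * pi * ?fr k)) *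
      ((ref_density e R (y k 0) * ennreal (2 * pi * ?a k 0)) * (ref_density e R (y k 1) * ennreal (2 * pi * ?a k 1)))"
      using K by (intro mult_left_mono mult_mono symbol_cost_density R e) auto
    \<comment> \<open>The reciprocal density of the first phase is paired with subchannel 0, that of
      the second with subchannel 1.\<close>
    also have "\<dots> = (ref_density e R (y k 0) * ref_density e R (y k 1)) *
       ((ennreal (1 / (2 * pi * ?fc k)) * ennreal (2 * pi * ?a k 0)) * (ennreal (1 / (2 * pi * ?fr k)) * ennreal (2 * pi * ?a k 1)))"
      by (simp only: ac_simps)
    also have "ennreal (1 / (2 * pi * ?fc k)) * ennreal (2 * pi * ?a k 0) = weight_c K x y k (fst cr)"
      unfolding weight_c_def using ennreal_cancel_2pi[OF fpos(1)[of k] apos[of k 0]] by simp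
    also have "ennreal (1 / (2 * pi * ?fr k)) * ennreal (2 * pi * ?a k 1) = weight_r K x y k (fst cr) (snd cr)"
      unfolding weight_r_def using ennreal_cancel_2pi[OF fpos(2)[of k] apos[of k 1]] by simp
    finally show "ennreal (1 / (2 * pi * ?fc k) * (1 / (2 * pi * ?fr k)) * (?g k 0 * ?g k 1))
      \<le> (\<Prod>m<2. ref_density e R (y k m)) * (weight_c K x y k (fst cr) * weight_r K x y k (fst cr) (snd cr))"
      by (simp only: prod_lessThan_2)
  qed
  finally show ?thesis by (simp only: prod.distrib)
qed

text \<open>The domination hypothesis of \<open>info_le\<close>, with the product of the reference
  densities as \<open>q\<close>.\<close>

lemma nn_integral_cost:
  assumes u[measurable]: "u \<in> borel_measurable (block_lborel 2 n)"
    and R: "R > 0" and e: "0 < e" "e < 1" and K: "K \<ge> 1"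
    and cost: "(\<lambda>z. cost n K e R x z) \<in> borel_measurable NN"
  shows "(\<integral>\<^sup>+z. u (comb_output 2 n x z) * ennreal (exp (- cost n K e R x z)) \<partial>NN)
    \<le> (\<integral>\<^sup>+y. u y * (\<Prod>k=1..n. \<Prod>m<2. ref_density e R (y k m)) \<partial>block_lborel 2 n)"
proof -
  interpret L: sigma_finite_measure "block_lborel 2 n" by (rule sigma_finite_block_lborel)
  interpret PL: pair_sigma_finite "phases \<sigma>\<^sub>c \<sigma>\<^sub>r" "block_lborel 2 n" ..
  note [measurable] = comb_output_measurable1 cost
  let ?q = "\<lambda>y. \<Prod>k=1..n. \<Prod>m<2. ref_density e R (y k m)"
  let ?w = "\<lambda>cr y. (\<Prod>k=1..n. weight_c K x y k (fst cr)) * (\<Prod>k=1..n. weight_r K x y k (fst cr) (snd cr))"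
  have comp: "(\<lambda>p. snd p k m) \<in> borel_measurable (phases \<sigma>\<^sub>c \<sigma>\<^sub>r \<Otimes>\<^sub>M block_lborel 2 n)" if "k \<in> {1..n}" "m < 2" for k m
    by (rule measurable_compose[OF measurable_snd block_component_measurable[OF sets_block_lborel that]])
  have mq[measurable]: "?q \<in> borel_measurable (block_lborel 2 n)"
    by (intro borel_measurable_prod_ennreal measurable_compose[OF block_component_measurable[OF sets_block_lborel] ref_density_measurable]) auto
  have mw[measurable]: "(\<lambda>p. ?w (fst p) (snd p)) \<in> borel_measurable (phases \<sigma>\<^sub>c \<sigma>\<^sub>r \<Otimes>\<^sub>M block_lborel 2 n)"
  proof (intro borel_measurable_times_ennreal borel_measurable_prod_ennreal)
    fix k assume k: "k \<in> {1..n}"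
    have k1: "1 \<le> k" using k by simp
    note fs = measurable_compose[OF measurable_fst measurable_fst] measurable_compose[OF measurable_fst measurable_snd]
    show "(\<lambda>p. weight_c K x (snd p) k (fst (fst p))) \<in> borel_measurable (phases \<sigma>\<^sub>c \<sigma>\<^sub>r \<Otimes>\<^sub>M block_lborel 2 n)"
      unfolding weight_c_def using k
      by (intro weight_measurable[OF \<sigma>\<^sub>c_pos] borel_measurable_add borel_measurable_const comp
        measurable_compose[OF fs(1) phase_measurable] measurable_compose[OF fs(1) snd_phase_space_measurable[OF k1]]) simp_all
    show "(\<lambda>p. weight_r K x (snd p) k (fst (fst p)) (snd (fst p))) \<in> borel_measurable (phases \<sigma>\<^sub>c \<sigma>\<^sub>r \<Otimes>\<^sub>M block_lborel 2 n)"
      unfolding weight_r_def using k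
      by (intro weight_measurable[OF \<sigma>\<^sub>r_pos] borel_measurable_add borel_measurable_const comp
        measurable_compose[OF fs(1) phase_measurable] measurable_compose[OF fs(2) phase_measurable]
        measurable_compose[OF fs(2) snd_phase_space_measurable[OF k1]]) simp_all
  qed
  have my: "(\<lambda>y. cost_y n K e R x cr y) \<in> borel_measurable (block_lborel 2 n)" for cr
    unfolding cost_y_def
    by (intro borel_measurable_sum borel_measurable_add borel_measurable_const symbol_cost_measurable
      block_component_measurable[OF sets_block_lborel]) auto
  have "(\<integral>\<^sup>+z. u (comb_output 2 n x z) * ennreal (exp (- cost n K e R x z)) \<partial>NN)
    = (\<integral>\<^sup>+cr. \<integral>\<^sup>+w. u (comb_output 2 n x (fst cr, snd cr, w)) * ennreal (exp (- cost n K e R x (fst cr, snd cr, w))) \<partial>additive_noise_space 2 \<partial>phases \<sigma>\<^sub>c \<sigma>\<^sub>r)"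
    by (rule nn_integral_NN) measurable
  also have "\<dots> = (\<integral>\<^sup>+cr. \<integral>\<^sup>+y. ennreal (kernel n x y cr) * (u y * ennreal (exp (- cost_y n K e R x cr y))) \<partial>block_lborel 2 n \<partial>phases \<sigma>\<^sub>c \<sigma>\<^sub>r)"
  proof (rule nn_integral_cong)
    fix cr
    have v: "(\<lambda>y. u y * ennreal (exp (- cost_y n K e R x cr y))) \<in> borel_measurable (block_lborel 2 n)"
      using my by measurable
    show "(\<integral>\<^sup>+w. u (comb_output 2 n x (fst cr, snd cr, w)) * ennreal (exp (- cost n K e R x (fst cr, snd cr, w))) \<partial>additive_noise_space 2)
      = (\<integral>\<^sup>+y. ennreal (kernel n x y cr) * (u y * ennreal (exp (- cost_y n K e R x cr y))) \<partial>block_lborel 2 n)"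
      unfolding cost_eq_cost_y using nn_integral_noise[OF v] by simp
  qed
  also have "\<dots> \<le> (\<integral>\<^sup>+cr. \<integral>\<^sup>+y. u y * ?q y * ?w cr y \<partial>block_lborel 2 n \<partial>phases \<sigma>\<^sub>c \<sigma>\<^sub>r)"
  proof (intro nn_integral_mono)
    fix cr y
    have "ennreal (kernel n x y cr) * (u y * ennreal (exp (- cost_y n K e R x cr y)))
      = u y * (ennreal (kernel n x y cr) * ennreal (exp (- cost_y n K e R x cr y)))" by (simp only: ac_simps)
    also have "\<dots> \<le> u y * (?q y * ?w cr y)" by (intro mult_left_mono kernel_cost_le R e K) simp
    finally show "ennreal (kernel n x y cr) * (u y * ennreal (exp (- cost_y n K e R x cr y))) \<le> u y * ?q y * ?w cr y"
      by (simp only: mult.assoc)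
  qed
  \<comment> \<open>For a given output, the phases now meet only the weights, whose integral is at
    most 1.\<close>
  also have "\<dots> = (\<integral>\<^sup>+y. \<integral>\<^sup>+cr. u y * ?q y * ?w cr y \<partial>phases \<sigma>\<^sub>c \<sigma>\<^sub>r \<partial>block_lborel 2 n)"
  proof (rule PL.Fubini'[symmetric])
    have "(\<lambda>p. u (snd p) * ?q (snd p) * ?w (fst p) (snd p)) \<in> borel_measurable (phases \<sigma>\<^sub>c \<sigma>\<^sub>r \<Otimes>\<^sub>M block_lborel 2 n)"
      by (intro borel_measurable_times_ennreal mw measurable_compose[OF measurable_snd u] measurable_compose[OF measurable_snd mq])
    then show "(\<lambda>(cr, y). u y * ?q y * ?w cr y) \<in> borel_measurable (phases \<sigma>\<^sub>c \<sigma>\<^sub>r \<Otimes>\<^sub>M block_lborel 2 n)"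
      by (simp only: case_prod_beta')
  qed
  also have "\<dots> = (\<integral>\<^sup>+y. u y * ?q y * (\<integral>\<^sup>+cr. ?w cr y \<partial>phases \<sigma>\<^sub>c \<sigma>\<^sub>r) \<partial>block_lborel 2 n)"
  proof (intro nn_integral_cong nn_integral_cmult)
    fix y assume "y \<in> space (block_lborel 2 n)"
    then show "(\<lambda>cr. ?w cr y) \<in> borel_measurable (phases \<sigma>\<^sub>c \<sigma>\<^sub>r)"
      using measurable_compose[OF measurable_Pair2'[of y "block_lborel 2 n"] mw] by simp
  qed
  also have "\<dots> \<le> (\<integral>\<^sup>+y. u y * ?q y * 1 \<partial>block_lborel 2 n)"
    using K by (intro nn_integral_mono mult_left_mono nn_integral_weights) auto
  finally show ?thesis by simp
qed

lemma nn_integral_ref_product: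
  assumes R: "R > 0" and e: "0 < e" "e < 1"
  shows "(\<integral>\<^sup>+y. (\<Prod>k=1..n. \<Prod>m<2. ref_density e R (y k m)) \<partial>block_lborel 2 n) \<le> 1"
proof -
  let ?I = "\<Pi>\<^sub>M m\<in>{..<2::nat}. (lborel :: complex measure)"
  interpret I: product_sigma_finite "\<lambda>_::nat. lborel :: complex measure"
    by (rule product_sigma_finite.intro) (rule lborel.sigma_finite_measure_axioms)
  interpret O: product_sigma_finite "\<lambda>_::nat. ?I"
    by (rule product_sigma_finite.intro) (rule sigma_finite_block_lborel_inner)
  have "(\<integral>\<^sup>+y. (\<Prod>k=1..n. \<Prod>m<2. ref_density e R (y k m)) \<partial>block_lborel 2 n)
    = (\<Prod>k=1..n. \<integral>\<^sup>+y. (\<Prod>m<2. ref_density e R (y m)) \<partial>?I)"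
  proof (rule O.product_nn_integral_prod)
    fix k assume "k \<in> {1..n}"
    have "(\<lambda>y. ref_density e R (y m)) \<in> borel_measurable ?I" if m: "m \<in> {..<2}" for m
    proof -
      have "ref_density e R \<in> borel_measurable lborel" by simp
      then show ?thesis by (rule measurable_compose[OF measurable_component_singleton[OF m]])
    qed
    then show "(\<lambda>y. \<Prod>m<2. ref_density e R (y m)) \<in> borel_measurable ?I"
      by (rule borel_measurable_prod_ennreal)
  qed simp
  also have "(\<integral>\<^sup>+y. (\<Prod>m<2. ref_density e R (y m)) \<partial>?I) = (\<Prod>m<2::nat. \<integral>\<^sup>+y. ref_density e R y \<partial>lborel)"
    by (rule I.product_nn_integral_prod) auto
  also have "(\<Prod>k=1..n. \<Prod>m<2::nat. \<integral>\<^sup>+y. ref_density e R y \<partial>lborel) \<le> 1"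
    by (intro prod_ennreal_le_1 nn_integral_ref_density R e)
  finally show ?thesis .
qed

text \<open>\<open>R\<close>, \<open>e\<close> and \<open>K\<close> are still free. Any choice gives
  integrability of the information density, which the lower bound and superadditivity also draw on;
  the sharp constant comes from a choice adapted to the power.\<close>

lemma information_le:
  assumes adm: "\<mu> \<in> admissible_laws 2 n \<rho>" and \<rho>: "\<rho> \<ge> 0" and R: "R > 0" and e: "0 < e" "e < 1" and K: "K \<ge> 1"
  shows "integrable (\<mu> \<Otimes>\<^sub>M NN) (\<lambda>(x, z). ln (channel.info_density \<mu> (comb_density n) x (comb_output 2 n x z)))"
    and "comb_information 2 \<sigma>\<^sub>c \<sigma>\<^sub>r n \<mu> * ln 2 \<le>
      real n * (2 * ln (2 * pi) - phase_entropy \<sigma>\<^sub>c - phase_entropy \<sigma>\<^sub>r) + (\<Sum>k=1..n. \<Sum>m<2. \<integral>x. symbol_bound K e R (x k m) \<partial>\<mu>)"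
proof -
  have \<mu>: "prob_space \<mu>" "sets \<mu> = sets (block_space 2 n)" using adm by (auto simp: admissible_laws_def)
  interpret channel \<mu> NN "block_lborel 2 n" "comb_output 2 n" "comb_density n" 1
    by (rule channel_comb[OF \<mu>])
  note cost = integral_cost[OF \<mu> admissible_power(1)[OF adm \<rho>] R e K]
  have mq: "(\<lambda>y. \<Prod>k=1..n. \<Prod>m<2. ref_density e R (y k m)) \<in> borel_measurable (block_lborel 2 n)"
    by (intro borel_measurable_prod_ennreal measurable_compose[OF block_component_measurable[OF sets_block_lborel] ref_density_measurable]) auto
  have mc: "(\<lambda>z. cost n K e R x z) \<in> borel_measurable NN" if "x \<in> space \<mu>" for x
    using measurable_compose[OF measurable_Pair1'[OF that] borel_measurable_integrable[OF cost(1)]] by simp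
  have dom: "(\<integral>\<^sup>+z. u (comb_output 2 n x z) * ennreal (exp (- cost n K e R x z)) \<partial>NN)
      \<le> (\<integral>\<^sup>+y. u y * (\<Prod>k=1..n. \<Prod>m<2. ref_density e R (y k m)) \<partial>block_lborel 2 n)"
    if "x \<in> space \<mu>" "u \<in> borel_measurable (block_lborel 2 n)" for x u
    by (rule nn_integral_cost[OF that(2) R e K mc[OF that(1)]])
  note I = info_le[OF cost(1) mq nn_integral_ref_product[OF R e] dom]
  show "integrable (\<mu> \<Otimes>\<^sub>M NN) (\<lambda>(x, z). ln (info_density x (comb_output 2 n x z)))" by (rule I(1))
  show "comb_information 2 \<sigma>\<^sub>c \<sigma>\<^sub>r n \<mu> * ln 2 \<le>
      real n * (2 * ln (2 * pi) - phase_entropy \<sigma>\<^sub>c - phase_entropy \<sigma>\<^sub>r) + (\<Sum>k=1..n. \<Sum>m<2. \<integral>x. symbol_bound K e R (x k m) \<partial>\<mu>)"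
  proof -
    have "comb_information 2 \<sigma>\<^sub>c \<sigma>\<^sub>r n \<mu> * ln 2
        = (\<integral>(x, z). ln (info_density x (comb_output 2 n x z)) \<partial>(\<mu> \<Otimes>\<^sub>M NN))"
      unfolding comb_information_eq[OF \<mu>] by simp
    also note I(2)
    also note cost(2)
    finally show ?thesis .
  qed
qed

end

text \<open>A crude majorant for arbitrary parameters; it makes the information per block bounded at
  every positive power, so that a finite capacity exists.\<close>

lemma symbol_bound_growth:
  assumes R: "R > 0"
  obtains A where "\<forall>z. symbol_bound K e R z \<le> A + (1 + 1 / R) * (cmod z)\<^sup>2"
proof
  let ?c = "symbol_bound K e R (of_real (max K 0)) - (max K 0)\<^sup>2 / R"
  show "\<forall>z. symbol_bound K e R z \<le> (\<bar>ln e\<bar> + \<bar>?c\<bar>) + (1 + 1 / R) * (cmod z)\<^sup>2"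
  proof
    fix z :: complex
    have d: "(1 + 1 / R) * (cmod z)\<^sup>2 = (cmod z)\<^sup>2 + (cmod z)\<^sup>2 / R" by (simp add: distrib_right)
    have nn: "0 \<le> (cmod z)\<^sup>2" "0 \<le> (cmod z)\<^sup>2 / R" using R by auto
    show "symbol_bound K e R z \<le> (\<bar>ln e\<bar> + \<bar>?c\<bar>) + (1 + 1 / R) * (cmod z)\<^sup>2"
    proof (cases "cmod z < K")
      case True
      then have "symbol_bound K e R z = (cmod z)\<^sup>2 - ln e" by (simp add: symbol_bound_def)
      then show ?thesis unfolding d using nn abs_ge_minus_self[of "ln e"] abs_ge_zero[of ?c] by linarith
    next
      case False
      have "symbol_bound K e R z = ?c + (cmod z)\<^sup>2 / R"
        using False by (simp add: symbol_bound_def add_divide_distrib)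
      then show ?thesis unfolding d using nn abs_ge_self[of ?c] abs_ge_zero[of "ln e"] by linarith
    qed
  qed
qed

text \<open>With \<open>R\<close> equal to the power, the half-normal reference has the mean square
  \<rho> / 2 that is available per subchannel. The branch of weak inputs is bounded while the other
  grows like \<open>ln \<rho> / 2\<close>, so one affine majorant serves both for large
  powers.\<close>

lemma symbol_bound_asymptotic:
  assumes \<eta>: "\<eta> > 0"
  obtains e K \<rho>\<^sub>0 where "0 < e" "e < 1" "K \<ge> 1" "\<rho>\<^sub>0 > 0"
    "\<forall>\<rho>\<ge>\<rho>\<^sub>0. \<forall>z. symbol_bound K e \<rho> z \<le> (ln (\<rho> / 4) / 2 - 1 / 2 + \<eta>) + 1 / \<rho> * (cmod z)\<^sup>2"
proof -
  \<comment> \<open>The weight \<open>e\<close> costs \<open>2 * e\<close> through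
    \<open>- ln (1 - e)\<close> and \<open>e / 2\<close> through Young's inequality, together at
    most \<open>\<eta> / 3\<close>.\<close>
  define e where "e = min (1 / 4) (\<eta> / 12)"
  have e: "0 < e" "e \<le> 1 / 4" "e \<le> \<eta> / 12" using \<eta> by (auto simp: e_def)
  \<comment> \<open>All remainders of order \<open>1 / K^2\<close> in the strong branch;
    \<open>K\<close> is chosen to bring them below \<open>\<eta> / 3\<close>.\<close>
  define C where "C = 1 / 2 + (4 * (1 + 1 / e) + 16 * pi\<^sup>2) * (\<integral>w. cmod w ^ 4 \<partial>std_complex_normal)"
  have C: "0 \<le> C" unfolding C_def using e by (intro add_nonneg_nonneg mult_nonneg_nonneg integral_nonneg) auto
  define K where "K = max 1 (sqrt (3 * C / \<eta>))"
  have K: "K \<ge> 1" by (simp add: K_def)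
  have "3 * C / \<eta> \<le> K\<^sup>2"
  proof -
    have "sqrt (3 * C / \<eta>) \<le> K" by (simp add: K_def)
    then have "(sqrt (3 * C / \<eta>))\<^sup>2 \<le> K\<^sup>2" using C \<eta> by (intro power_mono) auto
    then show ?thesis using C \<eta> by simp
  qed
  then have CK: "C / K\<^sup>2 \<le> \<eta> / 3" using K \<eta> by (simp add: field_simps)
  have ln1: "- ln (1 - e) \<le> 2 * e"
  proof -
    have "- ln (1 - e) = ln (1 / (1 - e))" using e by (simp add: ln_div)
    also have "\<dots> \<le> 1 / (1 - e) - 1" using e by (intro ln_le_minus_one) auto
    also have "\<dots> \<le> 2 * e"
    proof -
      have "1 / (1 - e) - 1 = e / (1 - e)" using e by (simp add: field_simps)
      also have "\<dots> \<le> e / (1 / 2)" using e by (intro divide_left_mono) auto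
      finally show ?thesis by simp
    qed
    finally show ?thesis .
  qed
  \<comment> \<open>The first entry bounds \<open>1 / \<rho>\<close> by \<open>\<eta> / 3\<close>;
    the second lifts the majorant above \<open>K^2 - ln e\<close>, the largest value in the weak
    branch.\<close>
  define \<rho>\<^sub>0 where "\<rho>\<^sub>0 = max (3 / \<eta>) (4 * exp (2 * (K\<^sup>2 - ln e + 1 / 2)))"
  have \<rho>\<^sub>0: "\<rho>\<^sub>0 > 0" using \<eta> by (simp add: \<rho>\<^sub>0_def less_max_iff_disj)
  have "symbol_bound K e \<rho> z \<le> (ln (\<rho> / 4) / 2 - 1 / 2 + \<eta>) + 1 / \<rho> * (cmod z)\<^sup>2" if \<rho>: "\<rho> \<ge> \<rho>\<^sub>0" for \<rho> z
  proof -
    have r0: "\<rho> > 0" using \<rho> \<rho>\<^sub>0 by linarith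
    have r1: "1 / \<rho> \<le> \<eta> / 3"
    proof -
      have "3 / \<eta> \<le> \<rho>" using \<rho> by (simp add: \<rho>\<^sub>0_def)
      then show ?thesis using r0 \<eta> by (simp add: field_simps)
    qed
    have sq: "ln (sqrt \<rho> / 2) = ln (\<rho> / 4) / 2"
    proof -
      have "ln (\<rho> / 4) = ln ((sqrt \<rho> / 2)\<^sup>2)" using r0 by (simp add: power_divide)
      also have "\<dots> = 2 * ln (sqrt \<rho> / 2)" using r0 by (simp add: ln_realpow)
      finally show ?thesis by simp
    qed
    show ?thesis
    proof (cases "cmod z < K")
      case True
      have "exp (2 * (K\<^sup>2 - ln e + 1 / 2)) \<le> \<rho> / 4" using \<rho> by (simp add: \<rho>\<^sub>0_def)
      then have "2 * (K\<^sup>2 - ln e + 1 / 2) \<le> ln (\<rho> / 4)" using r0 by (subst ln_ge_iff) auto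
      then have "K\<^sup>2 - ln e \<le> ln (\<rho> / 4) / 2 - 1 / 2" by (simp add: field_simps)
      moreover have "(cmod z)\<^sup>2 \<le> K\<^sup>2" using True by (intro power_mono) auto
      moreover have "symbol_bound K e \<rho> z = (cmod z)\<^sup>2 - ln e" using True by (simp add: symbol_bound_def)
      moreover have "0 \<le> 1 / \<rho> * (cmod z)\<^sup>2" using r0 by simp
      ultimately show ?thesis using \<eta> by linarith
    next
      case False
      have "symbol_bound K e \<rho> z = - ln (1 - e) + ln (\<rho> / 4) / 2 + 1 / \<rho> * (cmod z)\<^sup>2 + 1 / \<rho> + C / K\<^sup>2 + (e / 2 - 1 / 2)"
        using False unfolding symbol_bound_def sq C_def
        by (simp add: add_divide_distrib)
      also have "\<dots> \<le> 2 * e + ln (\<rho> / 4) / 2 + 1 / \<rho> * (cmod z)\<^sup>2 + \<eta> / 3 + \<eta> / 3 + (e / 2 - 1 / 2)"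
        using ln1 r1 CK by linarith
      also have "\<dots> \<le> (ln (\<rho> / 4) / 2 - 1 / 2 + \<eta>) + 1 / \<rho> * (cmod z)\<^sup>2"
        using e by linarith
      finally show ?thesis .
    qed
  qed
  then have "\<forall>\<rho>\<ge>\<rho>\<^sub>0. \<forall>z. symbol_bound K e \<rho> z \<le> (ln (\<rho> / 4) / 2 - 1 / 2 + \<eta>) + 1 / \<rho> * (cmod z)\<^sup>2" by blast
  then show thesis using that[of e K \<rho>\<^sub>0] e K \<rho>\<^sub>0 by simp
qed

section \<open>Upper bounds on the information under the power constraint\<close>

context comb2
begin

text \<open>An affine majorant in \<open>|x|^2\<close> sees the input law only through its total
  power. The intercept occurs twice per block, once for each subchannel.\<close>

lemma information_le_linear:
  assumes adm: "\<mu> \<in> admissible_laws 2 n \<rho>" and \<rho>: "\<rho> \<ge> 0" and R: "R > 0" and e: "0 < e" "e < 1" and K: "K \<ge> 1"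
    and growth: "\<forall>z. symbol_bound K e R z \<le> A + b * (cmod z)\<^sup>2" and b: "b \<ge> 0"
  shows "comb_information 2 \<sigma>\<^sub>c \<sigma>\<^sub>r n \<mu> * ln 2 \<le>
      real n * (2 * ln (2 * pi) - phase_entropy \<sigma>\<^sub>c - phase_entropy \<sigma>\<^sub>r + 2 * A + b * \<rho>)"
proof -
  have \<mu>: "prob_space \<mu>" "sets \<mu> = sets (block_space 2 n)" using adm by (auto simp: admissible_laws_def)
  interpret prob_space \<mu> by fact
  note pow = admissible_power[OF adm \<rho>]
  have "(\<integral>x. symbol_bound K e R (x k m) \<partial>\<mu>) \<le> A + b * (\<integral>x. (cmod (x k m))\<^sup>2 \<partial>\<mu>)" if km: "k \<in> {1..n}" "m < 2" for k m
  proof -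
    have "(\<integral>x. symbol_bound K e R (x k m) \<partial>\<mu>) \<le> (\<integral>x. A + b * (cmod (x k m))\<^sup>2 \<partial>\<mu>)"
      using growth pow(1)[OF km]
      by (intro integral_mono integrable_symbol_bound[OF R \<mu>(1) block_component_measurable[OF \<mu>(2) km]]) auto
    also have "\<dots> = A + b * (\<integral>x. (cmod (x k m))\<^sup>2 \<partial>\<mu>)"
      using pow(1)[OF km] by (simp add: prob_space)
    finally show ?thesis .
  qed
  then have "(\<Sum>k=1..n. \<Sum>m<2. \<integral>x. symbol_bound K e R (x k m) \<partial>\<mu>)
    \<le> (\<Sum>k=1..n. \<Sum>m<(2::nat). A + b * (\<integral>x. (cmod (x k m))\<^sup>2 \<partial>\<mu>))"
    by (intro sum_mono) auto
  also have "\<dots> = real n * (2 * A) + b * (\<Sum>k=1..n. \<Sum>m<2. \<integral>x. (cmod (x k m))\<^sup>2 \<partial>\<mu>)"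
    by (simp add: sum.distrib sum_distrib_left)
  also have "\<dots> \<le> real n * (2 * A) + b * (real n * \<rho>)"
    using pow(2) b by (intro add_left_mono mult_left_mono) auto
  finally have "(\<Sum>k=1..n. \<Sum>m<2. \<integral>x. symbol_bound K e R (x k m) \<partial>\<mu>) \<le> real n * (2 * A + b * \<rho>)"
    by (simp add: algebra_simps)
  moreover have "real n * (2 * ln (2 * pi) - phase_entropy \<sigma>\<^sub>c - phase_entropy \<sigma>\<^sub>r + 2 * A + b * \<rho>)
    = real n * (2 * ln (2 * pi) - phase_entropy \<sigma>\<^sub>c - phase_entropy \<sigma>\<^sub>r) + real n * (2 * A + b * \<rho>)"
    by (simp add: algebra_simps)
  ultimately show ?thesis using information_le(2)[OF adm \<rho> R e K] by linarith
qed

lemma information_bounded: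
  assumes \<rho>: "\<rho> > 0"
  obtains B where "\<forall>n. \<forall>\<mu>\<in>admissible_laws 2 n \<rho>. comb_information 2 \<sigma>\<^sub>c \<sigma>\<^sub>r n \<mu> \<le> real n * B"
proof -
  obtain A where A: "\<forall>z. symbol_bound 1 (1/2) 1 z \<le> A + (1 + 1 / 1) * (cmod z)\<^sup>2"
    by (rule symbol_bound_growth[of 1 1 "1/2"]) simp
  let ?B = "2 * ln (2 * pi) - phase_entropy \<sigma>\<^sub>c - phase_entropy \<sigma>\<^sub>r + 2 * A + (1 + 1 / 1) * \<rho>"
  have "comb_information 2 \<sigma>\<^sub>c \<sigma>\<^sub>r n \<mu> \<le> real n * (?B / ln 2)" if "\<mu> \<in> admissible_laws 2 n \<rho>" for n \<mu>
  proof -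
    have "comb_information 2 \<sigma>\<^sub>c \<sigma>\<^sub>r n \<mu> * ln 2 \<le> real n * ?B"
      by (rule information_le_linear[OF that _ _ _ _ _ A]) (use \<rho> in auto)
    then show ?thesis by (simp add: pos_le_divide_eq)
  qed
  then have "\<forall>n. \<forall>\<mu>\<in>admissible_laws 2 n \<rho>. comb_information 2 \<sigma>\<^sub>c \<sigma>\<^sub>r n \<mu> \<le> real n * (?B / ln 2)" by blast
  then show thesis by (rule that)
qed

lemma information_upper:
  assumes \<eta>: "\<eta> > 0"
  obtains \<rho>\<^sub>0 where "\<rho>\<^sub>0 > 0" "\<forall>\<rho>\<ge>\<rho>\<^sub>0. \<forall>n. \<forall>\<mu>\<in>admissible_laws 2 n \<rho>. comb_information 2 \<sigma>\<^sub>c \<sigma>\<^sub>r n \<mu> * ln 2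
    \<le> real n * (ln \<rho> + 2 * ln pi - phase_entropy \<sigma>\<^sub>c - phase_entropy \<sigma>\<^sub>r + \<eta>)"
proof -
  have "\<eta> / 2 > 0" using \<eta> by simp
  then obtain e K \<rho>\<^sub>0 where e: "0 < e" "e < 1" and K: "K \<ge> 1" and \<rho>\<^sub>0: "\<rho>\<^sub>0 > 0"
    and b: "\<forall>\<rho>\<ge>\<rho>\<^sub>0. \<forall>z. symbol_bound K e \<rho> z \<le> (ln (\<rho> / 4) / 2 - 1 / 2 + \<eta> / 2) + 1 / \<rho> * (cmod z)\<^sup>2"
    by (rule symbol_bound_asymptotic)
  have "comb_information 2 \<sigma>\<^sub>c \<sigma>\<^sub>r n \<mu> * ln 2 \<le> real n * (ln \<rho> + 2 * ln pi - phase_entropy \<sigma>\<^sub>c - phase_entropy \<sigma>\<^sub>r + \<eta>)"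
    if \<rho>: "\<rho> \<ge> \<rho>\<^sub>0" and adm: "\<mu> \<in> admissible_laws 2 n \<rho>" for \<rho> n \<mu>
  proof -
    have r: "\<rho> > 0" using \<rho> \<rho>\<^sub>0 by linarith
    have "comb_information 2 \<sigma>\<^sub>c \<sigma>\<^sub>r n \<mu> * ln 2 \<le> real n * (2 * ln (2 * pi) - phase_entropy \<sigma>\<^sub>c - phase_entropy \<sigma>\<^sub>r
        + 2 * (ln (\<rho> / 4) / 2 - 1 / 2 + \<eta> / 2) + 1 / \<rho> * \<rho>)"
      by (rule information_le_linear[OF adm _ r e K spec[OF b, THEN mp, OF \<rho>]]) (use r in auto)
    \<comment> \<open>The two summands -1/2 cancel the power term
      \<open>1 / \<rho> * \<rho>\<close>, and \<open>2 * ln (2 * pi)\<close> with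
      \<open>ln (\<rho> / 4)\<close> makes \<open>ln \<rho> + 2 * ln pi\<close>.\<close>
    also have "2 * ln (2 * pi) - phase_entropy \<sigma>\<^sub>c - phase_entropy \<sigma>\<^sub>r
        + 2 * (ln (\<rho> / 4) / 2 - 1 / 2 + \<eta> / 2) + 1 / \<rho> * \<rho> = ln \<rho> + 2 * ln pi - phase_entropy \<sigma>\<^sub>c - phase_entropy \<sigma>\<^sub>r + \<eta>"
    proof -
      have "ln (2 * pi) = ln 2 + ln pi" by (simp add: ln_mult)
      moreover have "ln (\<rho> / 4) = ln \<rho> - 2 * ln 2"
        using r ln_realpow[of 2 2] by (simp add: ln_div)
      moreover have "1 / \<rho> * \<rho> = 1" using r by simp
      ultimately show ?thesis by (simp add: field_simps)
    qed
    finally show ?thesis .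
  qed
  then show thesis using that[OF \<rho>\<^sub>0] by blast
qed

end

subsection \<open>The input law of the lower bound\<close>

abbreviation normal_law :: "real \<Rightarrow> real measure" where
  "normal_law \<tau> \<equiv> density lborel (\<lambda>x. ennreal (normal_density 0 \<tau> x))"

definition symbol_law :: "real \<Rightarrow> real \<Rightarrow> complex measure" where
  "symbol_law K \<tau> = distr (normal_law \<tau> \<Otimes>\<^sub>M uniform_measure lborel circle) borel (\<lambda>(g, a). of_real (K + \<bar>g\<bar>) * cis a)"

lemma sets_symbol_law[simp, measurable_cong]: "sets (symbol_law K \<tau>) = sets borel"
  by (simp add: symbol_law_def)

lemma symbol_map_measurable[measurable]:
  "(\<lambda>(g, a). of_real (K + \<bar>g\<bar>) * cis a) \<in> normal_law \<tau> \<Otimes>\<^sub>M uniform_measure lborel circle \<rightarrow>\<^sub>M (borel :: complex measure)"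
proof -
  have "(\<lambda>(g, a). of_real (K + \<bar>g\<bar>) * cis a) \<in> borel \<Otimes>\<^sub>M borel \<rightarrow>\<^sub>M (borel :: complex measure)"
    unfolding case_prod_beta' by measurable
  moreover have "sets (normal_law \<tau> \<Otimes>\<^sub>M uniform_measure lborel circle) = sets (borel \<Otimes>\<^sub>M borel)"
    by (intro sets_pair_measure_cong) auto
  ultimately show ?thesis using measurable_cong_sets by blast
qed

text \<open>A quotient of two amplitude densities at \<open>r = |x|\<close>: the normal density with
  mean \<open>|y|\<close> and variance 1/2, over the input density \<open>2 / (\<tau> * sqrt (2 *
  pi)) * exp (- (r - K)^2 / (2 * \<tau>^2))\<close> on \<open>r >= K\<close>.\<close>

definition amp :: "real \<Rightarrow> real \<Rightarrow> complex \<Rightarrow> complex \<Rightarrow> real" where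
  "amp K \<tau> x y = \<tau> * sqrt (2 * pi) / 2 * exp ((cmod x - K)\<^sup>2 / (2 * \<tau>\<^sup>2)) * (exp (- (cmod x - cmod y)\<^sup>2) / sqrt pi)"

lemma amp_measurable[measurable]: "(\<lambda>(x, y). amp K \<tau> x y) \<in> borel_measurable (borel \<Otimes>\<^sub>M borel)"
  unfolding amp_def by measurable

text \<open>Averaging over the uniform input phase integrates the density of the increment over a full period.\<close>

context
  fixes K \<tau> :: real
  assumes K: "K > 0" and \<tau>: "\<tau> > 0"
begin

lemma prob_space_symbol_law: "prob_space (symbol_law K \<tau>)"
proof -
  interpret G: prob_space "normal_law \<tau>" using \<tau> by (rule prob_space_normal_density)
  interpret U: prob_space "uniform_measure lborel circle" by (rule prob_space_uniform_circle)
  interpret GU: pair_prob_space "normal_law \<tau>" "uniform_measure lborel circle" ..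
  show ?thesis unfolding symbol_law_def by (rule GU.prob_space_distr[OF symbol_map_measurable])
qed

lemma nn_integral_symbol_law:
  assumes u[measurable]: "u \<in> borel_measurable borel"
  shows "(\<integral>\<^sup>+x. u x \<partial>symbol_law K \<tau>) =
    (\<integral>\<^sup>+g. \<integral>\<^sup>+a. u (of_real (K + \<bar>g\<bar>) * cis a) \<partial>uniform_measure lborel circle \<partial>normal_law \<tau>)"
proof -
  interpret U: prob_space "uniform_measure lborel circle" by (rule prob_space_uniform_circle)
  have m: "(\<lambda>w. u (case w of (g, a) \<Rightarrow> of_real (K + \<bar>g\<bar>) * cis a)) \<in> borel_measurable (normal_law \<tau> \<Otimes>\<^sub>M uniform_measure lborel circle)"
    by (rule measurable_compose[OF symbol_map_measurable u])
  have "(\<integral>\<^sup>+x. u x \<partial>symbol_law K \<tau>) = (\<integral>\<^sup>+w. u (case w of (g, a) \<Rightarrow> of_real (K + \<bar>g\<bar>) * cis a) \<partial>(normal_law \<tau> \<Otimes>\<^sub>M uniform_measure lborel circle))"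
    unfolding symbol_law_def by (rule nn_integral_distr[OF symbol_map_measurable]) simp
  also have "\<dots> = (\<integral>\<^sup>+g. \<integral>\<^sup>+a. u (of_real (K + \<bar>g\<bar>) * cis a) \<partial>uniform_measure lborel circle \<partial>normal_law \<tau>)"
    using U.nn_integral_fst[OF m] by simp
  finally show ?thesis .
qed

lemma norm_symbol: "cmod (of_real (K + \<bar>g\<bar>) * cis a) = K + \<bar>g\<bar>"
proof -
  have "cmod (of_real (K + \<bar>g\<bar>)) = K + \<bar>g\<bar>" using K by (subst norm_of_real) simp
  then show ?thesis by (simp add: norm_mult del: of_real_add)
qed

lemma AE_symbol_law: "AE x in symbol_law K \<tau>. K \<le> cmod x"
  unfolding symbol_law_def
  by (subst AE_distr_iff[OF symbol_map_measurable]) (auto intro!: AE_I2 simp: norm_symbol[simplified])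

lemma normal_law_sq: "has_bochner_integral (normal_law \<tau>) (\<lambda>g. g\<^sup>2) (\<tau>\<^sup>2)"
  using normal_moment_even[OF \<tau>, of 0 1]
  by (simp add: has_bochner_integral_iff integrable_real_density integral_real_density fact_numeral)

text \<open>The first bound replaces the mean of \<open>|g|\<close> by \<open>\<tau>\<close>; the
  resulting perfect square lets the power constraint be met by solving for
  \<open>\<tau>\<close>.\<close>

lemma symbol_law_moments:
  shows "(\<integral>\<^sup>+x. ennreal ((cmod x)\<^sup>2) \<partial>symbol_law K \<tau>) \<le> ennreal ((K + \<tau>)\<^sup>2)"
    and "has_bochner_integral (symbol_law K \<tau>) (\<lambda>x. (cmod x - K)\<^sup>2) (\<tau>\<^sup>2)"
proof -
  interpret G: prob_space "normal_law \<tau>" using \<tau> by (rule prob_space_normal_density)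
  interpret U: prob_space "uniform_measure lborel circle" by (rule prob_space_uniform_circle)
  interpret GU: pair_prob_space "normal_law \<tau>" "uniform_measure lborel circle" ..
  have sq: "integrable (normal_law \<tau>) (\<lambda>g. g\<^sup>2)" "(\<integral>g. g\<^sup>2 \<partial>normal_law \<tau>) = \<tau>\<^sup>2"
    using normal_law_sq by (auto simp: has_bochner_integral_iff)
  have "(\<integral>\<^sup>+x. ennreal ((cmod x)\<^sup>2) \<partial>symbol_law K \<tau>) = (\<integral>\<^sup>+g. ennreal ((K + \<bar>g\<bar>)\<^sup>2) \<partial>normal_law \<tau>)"
    by (subst nn_integral_symbol_law) (simp_all add: norm_symbol U.emeasure_space_1[simplified] del: of_real_add)
  also have "\<dots> \<le> (\<integral>\<^sup>+g. ennreal ((K\<^sup>2 + K * \<tau>) + (1 + K / \<tau>) * g\<^sup>2) \<partial>normal_law \<tau>)"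
  proof (intro nn_integral_mono ennreal_leI)
    fix g
    \<comment> \<open>The mixed term \<open>2 * K * |g|\<close> is bounded by a multiple of
      \<open>g^2\<close> plus a constant whose mean is \<open>2 * K * \<tau>\<close>, which
      completes the square.\<close>
    have "0 \<le> (\<bar>g\<bar> - \<tau>)\<^sup>2" by simp
    then have "2 * \<tau> * \<bar>g\<bar> \<le> g\<^sup>2 + \<tau>\<^sup>2" by (simp add: power2_diff ac_simps)
    then have "K / \<tau> * (2 * \<tau> * \<bar>g\<bar>) \<le> K / \<tau> * (g\<^sup>2 + \<tau>\<^sup>2)" using K \<tau> by (intro mult_left_mono) auto
    then have "2 * K * \<bar>g\<bar> \<le> K / \<tau> * g\<^sup>2 + K * \<tau>" using \<tau> by (simp add: distrib_left power2_eq_square)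
    then show "(K + \<bar>g\<bar>)\<^sup>2 \<le> (K\<^sup>2 + K * \<tau>) + (1 + K / \<tau>) * g\<^sup>2"
      by (simp add: power2_sum distrib_right)
  qed
  also have "\<dots> = ennreal (\<integral>g. (K\<^sup>2 + K * \<tau>) + (1 + K / \<tau>) * g\<^sup>2 \<partial>normal_law \<tau>)"
    using sq K \<tau> by (intro nn_integral_eq_integral) auto
  also have "(\<integral>g. (K\<^sup>2 + K * \<tau>) + (1 + K / \<tau>) * g\<^sup>2 \<partial>normal_law \<tau>) = (K\<^sup>2 + K * \<tau>) + (1 + K / \<tau>) * \<tau>\<^sup>2"
    using sq G.prob_space by simp
  also have "\<dots> = (K + \<tau>)\<^sup>2" using \<tau> by (simp add: field_simps power2_eq_square)
  finally show "(\<integral>\<^sup>+x. ennreal ((cmod x)\<^sup>2) \<partial>symbol_law K \<tau>) \<le> ennreal ((K + \<tau>)\<^sup>2)" .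
  have nn: "(\<integral>\<^sup>+x. ennreal ((cmod x - K)\<^sup>2) \<partial>symbol_law K \<tau>) = ennreal (\<tau>\<^sup>2)"
  proof -
    have "(\<integral>\<^sup>+x. ennreal ((cmod x - K)\<^sup>2) \<partial>symbol_law K \<tau>) = (\<integral>\<^sup>+g. ennreal (g\<^sup>2) \<partial>normal_law \<tau>)"
      by (subst nn_integral_symbol_law) (simp_all add: norm_symbol U.emeasure_space_1[simplified] del: of_real_add)
    also have "\<dots> = ennreal (\<tau>\<^sup>2)" using sq by (subst nn_integral_eq_integral) auto
    finally show ?thesis .
  qed
  show "has_bochner_integral (symbol_law K \<tau>) (\<lambda>x. (cmod x - K)\<^sup>2) (\<tau>\<^sup>2)"
    by (rule has_bochner_integral_nn_integral[OF _ _ _ nn]) auto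
qed

lemma amp_pos: "0 < amp K \<tau> x y"
  using \<tau> by (simp add: amp_def)

lemma nn_integral_amp_wrapped_density:
  assumes \<sigma>: "\<sigma> > 0"
  shows "(\<integral>\<^sup>+x. ennreal (amp K \<tau> x y * (2 * pi * wrapped_density \<sigma> (b - Arg x))) \<partial>symbol_law K \<tau>) \<le> 1"
proof -
  let ?U = "uniform_measure lborel circle"
  have wd[measurable]: "wrapped_density \<sigma> \<in> borel_measurable borel" using \<sigma> by simp
  have am[measurable]: "(\<lambda>x. amp K \<tau> x y) \<in> borel_measurable borel" unfolding amp_def by measurable
  let ?A = "\<lambda>g. amp K \<tau> (of_real (K + \<bar>g\<bar>)) y"
  have arg: "wrapped_density \<sigma> (b - Arg (of_real (K + \<bar>g\<bar>) * cis a)) = wrapped_density \<sigma> (b + (- 1) * a)" for g a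
  proof (rule circle_periodic_cong[OF circle_periodic_wrapped_density[OF \<sigma>]])
    let ?z = "of_real (K + \<bar>g\<bar>) * cis a"
    have "?z \<noteq> 0" using norm_symbol[of g a] K by (metis abs_ge_zero add_pos_nonneg less_irrefl norm_zero)
    then have "cis (Arg ?z) = ?z / cmod ?z" by (simp add: cis_Arg sgn_eq del: of_real_add)
    also have "\<dots> = of_real (K + \<bar>g\<bar>) * cis a / of_real (K + \<bar>g\<bar>)" by (simp only: norm_symbol)
    also have "\<dots> = cis a"
    proof -
      have "K + \<bar>g\<bar> \<noteq> 0" using K by simp
      then have "(of_real (K + \<bar>g\<bar>) :: complex) \<noteq> 0" by (simp only: of_real_eq_0_iff not_False_eq_True)
      then show ?thesis by (simp del: of_real_add)
    qed
    finally have "cis (Arg ?z) = cis a" .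
    then show "cis (b - Arg ?z) = cis (b + (- 1) * a)"
      by (simp add: cis_divide[symmetric] del: of_real_add)
  qed
  have amp_eq: "amp K \<tau> (of_real (K + \<bar>g\<bar>) * cis a) y = ?A g" for g a
    using norm_symbol[of g a] norm_symbol[of g 0] by (simp add: amp_def del: of_real_add)
  have "(\<integral>\<^sup>+x. ennreal (amp K \<tau> x y * (2 * pi * wrapped_density \<sigma> (b - Arg x))) \<partial>symbol_law K \<tau>)
    = (\<integral>\<^sup>+g. \<integral>\<^sup>+a. ennreal (?A g * (2 * pi)) * ennreal (wrapped_density \<sigma> (b + (- 1) * a)) \<partial>?U \<partial>normal_law \<tau>)"
    using amp_pos by (subst nn_integral_symbol_law)
      (simp_all only: arg amp_eq, measurable, simp add: ennreal_mult'[symmetric] less_imp_le mult.assoc)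
  also have "\<dots> = (\<integral>\<^sup>+g. ennreal (?A g) \<partial>normal_law \<tau>)"
  proof (rule nn_integral_cong)
    fix g
    have "(\<integral>\<^sup>+a. ennreal (?A g * (2 * pi)) * ennreal (wrapped_density \<sigma> (b + (- 1) * a)) \<partial>?U)
      = ennreal (?A g * (2 * pi)) * ((\<integral>\<^sup>+a. ennreal (wrapped_density \<sigma> (b + (- 1) * a)) * indicator circle a \<partial>lborel) / ennreal (2 * pi))"
      by (subst nn_integral_cmult) (simp_all add: nn_integral_uniform_circle)
    also have "\<dots> = ennreal (?A g * (2 * pi)) * (1 / ennreal (2 * pi))"
      by (subst nn_integral_wrapped_density_shift[OF \<sigma>]) auto
    also have "\<dots> = ennreal (?A g)"
    proof -
      have "1 / ennreal (2 * pi) = ennreal (1 / (2 * pi))" using divide_ennreal[of 1 "2 * pi"] by simp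
      then show ?thesis
        using amp_pos[of "of_real (K + \<bar>g\<bar>)" y] by (simp add: ennreal_mult[symmetric] del: of_real_add)
    qed
    finally show "(\<integral>\<^sup>+a. ennreal (?A g * (2 * pi)) * ennreal (wrapped_density \<sigma> (b + (- 1) * a)) \<partial>?U) = ennreal (?A g)" .
  qed
  also have "\<dots> = (\<integral>\<^sup>+g. ennreal (normal_density 0 \<tau> g * ?A g) \<partial>lborel)"
    by (subst nn_integral_density) (auto simp: ennreal_mult')
  \<comment> \<open>The normal density of \<open>g\<close> cancels the exponential with
    \<open>\<tau>\<close> and leaves half a normal density of variance 1/2 at \<open>|g|\<close>. It
    is bounded by its two branches, centred at \<open>|y| - K\<close> for \<open>g >= 0\<close> and
    at \<open>K - |y|\<close> for \<open>g < 0\<close>, each extended to the whole line with weight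
    1/2.\<close>
  also have "\<dots> \<le> (\<integral>\<^sup>+g. ennreal (1 / 2) * ennreal (normal_density (cmod y - K) (1 / sqrt 2) g)
      + ennreal (1 / 2) * ennreal (normal_density (K - cmod y) (1 / sqrt 2) g) \<partial>lborel)"
  proof (rule nn_integral_mono)
    fix g
    let ?r = "cmod y"
    have n: "cmod (of_real (K + \<bar>g\<bar>)) = K + \<bar>g\<bar>" using norm_symbol[of g 0] by simp
    have "normal_density 0 \<tau> g * ?A g = 1 / 2 * (exp (- (K + \<bar>g\<bar> - ?r)\<^sup>2) / sqrt pi)"
    proof -
      have "exp (- (g\<^sup>2 / (2 * \<tau>\<^sup>2))) * exp (g\<^sup>2 / (2 * \<tau>\<^sup>2)) = 1" by (simp add: mult_exp_exp)
      moreover have "normal_density 0 \<tau> g * ?A g = (exp (- (g\<^sup>2 / (2 * \<tau>\<^sup>2))) * exp (g\<^sup>2 / (2 * \<tau>\<^sup>2))) * (1 / 2 * (exp (- (K + \<bar>g\<bar> - ?r)\<^sup>2) / sqrt pi))"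
        using \<tau> K by (simp add: normal_density_def amp_def n[simplified] real_sqrt_mult abs_of_pos add_pos_nonneg)
      ultimately show ?thesis by simp
    qed
    also have "\<dots> \<le> 1 / 2 * (exp (- (g - (?r - K))\<^sup>2) / sqrt pi + exp (- (g - (K - ?r))\<^sup>2) / sqrt pi)"
    proof (intro mult_left_mono)
      have "exp (- (K + \<bar>g\<bar> - ?r)\<^sup>2) \<le> exp (- (g - (?r - K))\<^sup>2) + exp (- (g - (K - ?r))\<^sup>2)"
      proof (cases "g \<ge> 0")
        case True
        then have "K + \<bar>g\<bar> - ?r = g - (?r - K)" by simp
        then have "(K + \<bar>g\<bar> - ?r)\<^sup>2 = (g - (?r - K))\<^sup>2" by (simp only:)
        then show ?thesis by simp
      next
        case False
        then have "K + \<bar>g\<bar> - ?r = - (g - (K - ?r))" by simp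
        then have "(K + \<bar>g\<bar> - ?r)\<^sup>2 = (g - (K - ?r))\<^sup>2" by (simp only: power2_minus)
        then show ?thesis by simp
      qed
      then show "exp (- (K + \<bar>g\<bar> - ?r)\<^sup>2) / sqrt pi \<le> exp (- (g - (?r - K))\<^sup>2) / sqrt pi + exp (- (g - (K - ?r))\<^sup>2) / sqrt pi"
        unfolding add_divide_distrib[symmetric] by (intro divide_right_mono) auto
    qed simp
    also have "\<dots> = 1 / 2 * normal_density (?r - K) (1 / sqrt 2) g + 1 / 2 * normal_density (K - ?r) (1 / sqrt 2) g"
      by (simp add: normal_density_def power_divide)
    finally show "ennreal (normal_density 0 \<tau> g * ?A g) \<le> ennreal (1 / 2) * ennreal (normal_density (?r - K) (1 / sqrt 2) g)
      + ennreal (1 / 2) * ennreal (normal_density (K - ?r) (1 / sqrt 2) g)"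
      by (simp only: ennreal_mult''[symmetric] normal_density_nonneg ennreal_plus[symmetric] mult_nonneg_nonneg zero_le_divide_1_iff zero_le_numeral ennreal_leI)
  qed
  also have "\<dots> = 1"
  proof -
    have one: "(\<integral>\<^sup>+g. ennreal (normal_density v (1 / sqrt 2) g) \<partial>lborel) = 1" for v
    proof -
      interpret prob_space "density lborel (normal_density v (1 / sqrt 2))" by (rule prob_space_normal_density) simp
      show ?thesis using emeasure_space_1 by (simp add: emeasure_density)
    qed
    have "ennreal (1 / 2) + ennreal (1 / 2) = ennreal (1 / 2 + 1 / 2)" by (rule ennreal_plus[symmetric]) simp_all
    also have "\<dots> = 1" by simp
    finally have "ennreal (1 / 2) + ennreal (1 / 2) = 1" .
    then show ?thesis by (subst nn_integral_add) (auto simp: nn_integral_cmult one)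
  qed
  finally show ?thesis .
qed

end

subsection \<open>The lower bound\<close>

text \<open>The difference of the arguments of output and input is an unwrapped estimate of the
  angle, hence the equality on the unit circle. A crude constant is sufficient, as the error only
  has to vanish in mean square when \<open>K\<close> grows.\<close>

lemma estimation_error:
  assumes K: "0 < K" "K \<le> cmod x"
  defines "\<psi> \<equiv> \<lambda>y \<theta>. wrap_pi (Arg y - Arg x - \<theta>)"
  shows "cis (Arg y - Arg x) = cis (\<theta> + \<psi> y \<theta>)"
    and "(\<psi> y \<theta>)\<^sup>2 \<le> 4 * pi\<^sup>2 / K\<^sup>2 * (cmod (y - cis \<theta> * x))\<^sup>2"
proof -
  have x: "x \<noteq> 0" using K by auto
  have "cis (\<theta> + \<psi> y \<theta>) = cis \<theta> * cis (Arg y - Arg x - \<theta>)" by (simp add: cis_mult[symmetric] \<psi>_def)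
  also have "\<dots> = cis (Arg y - Arg x)" by (simp add: cis_mult)
  finally show "cis (Arg y - Arg x) = cis (\<theta> + \<psi> y \<theta>)" by simp
  have le: "\<bar>\<psi> y \<theta>\<bar> \<le> 2 * pi * (cmod (y - cis \<theta> * x) / cmod x)"
  proof (cases "y = 0")
    case True
    have "\<bar>\<psi> y \<theta>\<bar> \<le> pi"
      using wrap_pi_ge[of "Arg y - Arg x - \<theta>"] wrap_pi_less[of "Arg y - Arg x - \<theta>"]
      unfolding \<psi>_def by (simp only: abs_le_iff) linarith
    moreover have "cmod (y - cis \<theta> * x) / cmod x = 1" using True x by (simp add: norm_mult)
    ultimately show ?thesis using pi_gt_zero by (simp only: mult_1_right)
  next
    case False
    have "cis (Arg y - Arg x - \<theta>) = cis (Arg (y / x) - \<theta>)"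
      using x False by (simp add: cis_divide[symmetric] cis_Arg sgn_eq norm_divide)
    then have "\<psi> y \<theta> = phase_error x y \<theta>"
      unfolding \<psi>_def phase_error_def by (rule wrap_pi_cong)
    then show ?thesis using phase_error_bounds(3)[OF zero_less_one x, of y \<theta>] by (simp add: norm_mult norm_divide)
  qed
  also have "\<dots> \<le> 2 * pi * (cmod (y - cis \<theta> * x) / K)"
    using K by (intro mult_left_mono divide_left_mono mult_pos_pos less_le_trans[OF K]) auto
  finally have "\<bar>\<psi> y \<theta>\<bar>\<^sup>2 \<le> (2 * pi * (cmod (y - cis \<theta> * x) / K))\<^sup>2" by (intro power_mono) auto
  then show "(\<psi> y \<theta>)\<^sup>2 \<le> 4 * pi\<^sup>2 / K\<^sup>2 * (cmod (y - cis \<theta> * x))\<^sup>2"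
    by (simp add: power_mult_distrib power_divide)
qed

text \<open>Close to 1/2, the variance of the noise component along the rotated input, when
  \<open>e\<close> is small and \<open>K\<close> is large compared with the resulting fourth-order
  constant.\<close>

definition amplitude_bound :: "real \<Rightarrow> real \<Rightarrow> real" where
  "amplitude_bound K e = (1 + e) / 2 + 16 * (1 + 1 / e) * (\<integral>w. cmod w ^ 4 \<partial>std_complex_normal) / K\<^sup>2"

lemma amplitude_error_le: "(cmod x - cmod (cis \<theta> * x + w))\<^sup>2 \<le> (cmod w)\<^sup>2"
proof -
  have "\<bar>cmod (cis \<theta> * x + w) - cmod (cis \<theta> * x)\<bar> \<le> cmod w"
    using norm_triangle_ineq3[of "cis \<theta> * x + w" "cis \<theta> * x"] by simp
  then have "\<bar>cmod x - cmod (cis \<theta> * x + w)\<bar> \<le> cmod w" by (simp add: norm_mult abs_minus_commute)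
  from power_mono[OF this, of 2] show ?thesis by simp
qed

lemma norm_sq_le_norm4: "(cmod w)\<^sup>2 \<le> 1 + cmod w ^ 4"
proof -
  have "0 \<le> ((cmod w)\<^sup>2 - 1)\<^sup>2" by simp
  also have "((cmod w)\<^sup>2 - 1)\<^sup>2 = cmod w ^ 4 - 2 * (cmod w)\<^sup>2 + 1" by (simp add: power2_diff power_mult[symmetric])
  finally have "2 * (cmod w)\<^sup>2 \<le> cmod w ^ 4 + 1" by linarith
  moreover have "0 \<le> (cmod w)\<^sup>2" by simp
  ultimately show ?thesis by linarith
qed

text \<open>To first order only the radial component of the noise changes the modulus. The value 1
  for weak symbols completes the bound to all \<open>x\<close>, as \<open>symbol_integral\<close>
  expects; the constructed input almost surely stays in the other branch.\<close>

lemma expected_amplitude_error: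
  assumes e: "0 < e" and K: "K > 0"
  shows "(\<integral>w. (cmod x - cmod (cis \<theta> * x + w))\<^sup>2 \<partial>std_complex_normal) \<le> (if cmod x < K then 1 else amplitude_bound K e)"
proof -
  note m = std_complex_normal_moments
  let ?C4 = "\<integral>w. cmod w ^ 4 \<partial>std_complex_normal"
  have meas: "(\<lambda>w. (cmod x - cmod (cis \<theta> * x + w))\<^sup>2) \<in> borel_measurable std_complex_normal"
    by (rule measurable_compose[OF plus_std_complex_normal_measurable]) simp
  have m2: "integrable std_complex_normal (\<lambda>w. (cmod w)\<^sup>2)" "(\<integral>w. (cmod w)\<^sup>2 \<partial>std_complex_normal) = 1"
    using m(4) by (auto simp: has_bochner_integral_iff)
  have int: "integrable std_complex_normal (\<lambda>w. (cmod x - cmod (cis \<theta> * x + w))\<^sup>2)"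
    by (rule Bochner_Integration.integrable_bound[OF m2(1) meas])
      (auto intro!: AE_I2 simp: amplitude_error_le)
  show ?thesis
  proof (cases "cmod x < K")
    case True
    have "(\<integral>w. (cmod x - cmod (cis \<theta> * x + w))\<^sup>2 \<partial>std_complex_normal) \<le> (\<integral>w. (cmod w)\<^sup>2 \<partial>std_complex_normal)"
      by (rule integral_mono[OF int m2(1) amplitude_error_le])
    then show ?thesis using True m2 by simp
  next
    case False
    then have x: "x \<noteq> 0" and xK: "K \<le> cmod x" using K by auto
    let ?X = "(cmod x)\<^sup>2"
    \<comment> \<open>A number of modulus 1 that turns the direction of the rotated input into the
      real axis, so \<open>Re (?c * w)\<close> has second moment 1/2.\<close>
    let ?c = "of_real (cmod x) * cis (- \<theta>) / x"
    have c1: "cmod ?c = 1" using x by (simp add: norm_mult norm_divide)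
    let ?g = "\<lambda>w. (1 + e) * (Re (?c * w))\<^sup>2 + 16 * (1 + 1 / e) / ?X * cmod w ^ 4"
    have g: "has_bochner_integral std_complex_normal ?g ((1 + e) * ((cmod ?c)\<^sup>2 / 2) + 16 * (1 + 1 / e) / ?X * ?C4)"
      by (intro has_bochner_integral_add has_bochner_integral_mult_right m(2))
        (simp add: has_bochner_integral_iff m(5))
    have "(\<integral>w. (cmod x - cmod (cis \<theta> * x + w))\<^sup>2 \<partial>std_complex_normal) \<le> integral\<^sup>L std_complex_normal ?g"
    proof (rule integral_mono[OF int])
      show "integrable std_complex_normal ?g" using g by (simp add: has_bochner_integral_iff)
      fix w
      let ?z = "cis (- \<theta>) * w / x"
      have "cis \<theta> * x + w = cis \<theta> * x * (1 + ?z)" using x by (simp add: field_simps cis_mult)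
      then have "cmod (cis \<theta> * x + w) = cmod x * cmod (1 + ?z)" by (simp add: norm_mult)
      then have "(cmod x - cmod (cis \<theta> * x + w))\<^sup>2 = ?X * (cmod (1 + ?z) - 1)\<^sup>2"
        by (simp add: power2_eq_square algebra_simps)
      also have "\<dots> \<le> ?X * ((1 + e) * (Re ?z)\<^sup>2 + 16 * (1 + 1 / e) * cmod ?z ^ 4)"
        using cmod_one_plus_bound[OF e, of ?z] by (intro mult_left_mono) auto
      also have "\<dots> = (1 + e) * (cmod x * Re ?z)\<^sup>2 + 16 * (1 + 1 / e) * (?X * cmod ?z ^ 4)"
        by (simp add: power_mult_distrib algebra_simps)
      also have "cmod x * Re ?z = Re (?c * w)"
      proof -
        have "?c * w = of_real (cmod x) * ?z" by simp
        then have "Re (?c * w) = Re (of_real (cmod x) * ?z)" by (rule arg_cong)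
        then show ?thesis by (simp del: times_divide_eq_right times_divide_eq_left)
      qed
      also have "?X * cmod ?z ^ 4 = cmod w ^ 4 / ?X"
      proof -
        have q: "cmod ?z ^ 4 = cmod w ^ 4 / (?X * ?X)"
          by (simp add: norm_mult norm_divide power_divide power2_eq_square power4_eq_xxxx)
        have "?X \<noteq> 0" using x by simp
        then show ?thesis unfolding q by (simp only: times_divide_eq_right mult_divide_mult_cancel_left simp_thms)
      qed
      finally show "(cmod x - cmod (cis \<theta> * x + w))\<^sup>2 \<le> ?g w" by simp
    qed
    also have "\<dots> = (1 + e) / 2 + 16 * (1 + 1 / e) * ?C4 / ?X"
      using g unfolding c1 by (simp add: has_bochner_integral_iff)
    also have "\<dots> \<le> amplitude_bound K e"
    proof -
      have "0 \<le> 16 * (1 + 1 / e) * ?C4" using e by (intro mult_nonneg_nonneg integral_nonneg) auto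
      moreover have "K\<^sup>2 \<le> ?X" using xK K by (intro power_mono) auto
      moreover have "0 < K\<^sup>2" using K by simp
      ultimately show ?thesis unfolding amplitude_bound_def
        by (intro add_left_mono divide_left_mono) (auto intro!: mult_pos_pos intro: less_le_trans)
    qed
    finally show ?thesis using False by simp
  qed
qed

text \<open>Estimate of the angle of subchannel \<open>m\<close> in block \<open>k\<close>, up to
  multiples of \<open>2 * pi\<close>. The default 0 at \<open>k = 0\<close> stands in for the
  missing block before the first; it costs a constant that does not depend on the number of
  blocks.\<close>

definition estimate :: "(nat \<Rightarrow> nat \<Rightarrow> complex) \<Rightarrow> (nat \<Rightarrow> nat \<Rightarrow> complex) \<Rightarrow> nat \<Rightarrow> nat \<Rightarrow> real" where
  "estimate x y k m = (if k = 0 then 0 else Arg (y k m) - Arg (x k m))"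

definition input_law :: "real \<Rightarrow> real \<Rightarrow> nat \<Rightarrow> (nat \<Rightarrow> nat \<Rightarrow> complex) measure" where
  "input_law K \<tau> n = (\<Pi>\<^sub>M k\<in>{1..n}. \<Pi>\<^sub>M m\<in>{..<2}. symbol_law K \<tau>)"

lemma sets_input_law: "sets (input_law K \<tau> n) = sets (block_space 2 n)"
  unfolding input_law_def block_space_def by (intro sets_PiM_cong) auto

context
  fixes K \<tau> :: real
  assumes K: "K > 0" and \<tau>: "\<tau> > 0"
begin

lemma prob_space_input_law: "prob_space (input_law K \<tau> n)"
  unfolding input_law_def by (intro prob_space_PiM prob_space_symbol_law K \<tau>)

lemma distr_input_component:
  assumes "k \<in> {1..n}" "m < 2"
  shows "distr (input_law K \<tau> n) borel (\<lambda>x. x k m) = symbol_law K \<tau>"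
proof -
  let ?I = "\<Pi>\<^sub>M m\<in>{..<2::nat}. symbol_law K \<tau>"
  have "distr (input_law K \<tau> n) borel (\<lambda>x. x k m) = distr (input_law K \<tau> n) (symbol_law K \<tau>) ((\<lambda>v. v m) \<circ> (\<lambda>x. x k))"
    by (intro distr_cong) auto
  also have "\<dots> = distr (distr (input_law K \<tau> n) ?I (\<lambda>x. x k)) (symbol_law K \<tau>) (\<lambda>v. v m)"
    using assms by (intro distr_distr[symmetric]) (auto simp: input_law_def)
  also have "distr (input_law K \<tau> n) ?I (\<lambda>x. x k) = ?I"
    unfolding input_law_def using assms
    by (intro distr_PiM_component prob_space_PiM prob_space_symbol_law K \<tau>) auto
  also have "distr ?I (symbol_law K \<tau>) (\<lambda>v. v m) = symbol_law K \<tau>"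
    using assms by (intro distr_PiM_component prob_space_symbol_law K \<tau>) auto
  finally show ?thesis .
qed

lemma input_admissible: "input_law K \<tau> n \<in> admissible_laws 2 n (2 * (K + \<tau>)\<^sup>2)"
proof -
  have L2: "ennreal ((L2_set (\<lambda>m. cmod (x k m)) {..<2::nat})\<^sup>2) = (\<Sum>m<2. ennreal ((cmod (x k m))\<^sup>2))" for x :: "nat \<Rightarrow> nat \<Rightarrow> complex" and k
    by (simp add: L2_set_def sum_nonneg sum_ennreal)
  have m: "(\<lambda>x. x k m) \<in> borel_measurable (input_law K \<tau> n)" if "k \<in> {1..n}" "m < 2" for k m
    by (rule block_component_measurable[OF sets_input_law that])
  have one: "(\<integral>\<^sup>+x. ennreal ((cmod (x k m))\<^sup>2) \<partial>input_law K \<tau> n) \<le> ennreal ((K + \<tau>)\<^sup>2)" if km: "k \<in> {1..n}" "m < 2" for k m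
  proof -
    have "(\<integral>\<^sup>+x. ennreal ((cmod (x k m))\<^sup>2) \<partial>input_law K \<tau> n) = (\<integral>\<^sup>+v. ennreal ((cmod v)\<^sup>2) \<partial>distr (input_law K \<tau> n) borel (\<lambda>x. x k m))"
      by (subst nn_integral_distr[OF m[OF km]]) auto
    then show ?thesis using symbol_law_moments(1)[OF K \<tau>] by (simp add: distr_input_component[OF km])
  qed
  have "(\<Sum>k=1..n. \<integral>\<^sup>+x. ennreal ((L2_set (\<lambda>m. cmod (x k m)) {..<2})\<^sup>2) \<partial>input_law K \<tau> n)
    = (\<Sum>k=1..n. \<Sum>m<2. \<integral>\<^sup>+x. ennreal ((cmod (x k m))\<^sup>2) \<partial>input_law K \<tau> n)"
  proof (intro sum.cong refl)
    fix k assume k: "k \<in> {1..n}"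
    have "(\<lambda>x. ennreal ((cmod (x k m))\<^sup>2)) \<in> borel_measurable (input_law K \<tau> n)" if "m \<in> {..<2}" for m
    proof -
      have "(\<lambda>v. ennreal ((cmod v)\<^sup>2)) \<in> borel_measurable borel" by measurable
      from measurable_compose[OF m[OF k, of m] this] show ?thesis using that by (simp only: lessThan_iff)
    qed
    then show "(\<integral>\<^sup>+x. ennreal ((L2_set (\<lambda>m. cmod (x k m)) {..<2})\<^sup>2) \<partial>input_law K \<tau> n)
      = (\<Sum>m<2. \<integral>\<^sup>+x. ennreal ((cmod (x k m))\<^sup>2) \<partial>input_law K \<tau> n)"
      unfolding L2 by (rule nn_integral_sum)
  qed
  also have "\<dots> \<le> (\<Sum>k=1..n. \<Sum>m<(2::nat). ennreal ((K + \<tau>)\<^sup>2))"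
    by (intro sum_mono one) auto
  also have "\<dots> = ennreal (real n * (2 * (K + \<tau>)\<^sup>2))"
    by (simp add: ennreal_of_nat_eq_real_of_nat ennreal_mult'[symmetric] ennreal_numeral[symmetric] del: ennreal_numeral)
  finally show ?thesis
    using prob_space_input_law sets_input_law by (simp add: admissible_laws_def)
qed

lemma AE_input: "AE x in input_law K \<tau> n. \<forall>k\<in>{1..n}. \<forall>m\<in>{..<2}. K \<le> cmod (x k m)"
proof (intro AE_ball_countable[THEN iffD2] ballI)
  fix k m assume km: "k \<in> {1..n}" "m \<in> {..<2::nat}"
  then have km': "k \<in> {1..n}" "m < 2" by auto
  have "AE v in distr (input_law K \<tau> n) borel (\<lambda>x. x k m). K \<le> cmod v"
    unfolding distr_input_component[OF km'] by (rule AE_symbol_law[OF K \<tau>])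
  then show "AE x in input_law K \<tau> n. K \<le> cmod (x k m)"
    by (rule AE_distrD[OF block_component_measurable[OF sets_input_law km']])
qed auto

lemma input_sq_integral:
  assumes km: "k \<in> {1..n}" "m < 2"
  shows "has_bochner_integral (input_law K \<tau> n) (\<lambda>x. (cmod (x k m) - K)\<^sup>2) (\<tau>\<^sup>2)"
  by (rule integral_distr_comp[OF block_component_measurable[OF sets_input_law km]])
    (simp add: distr_input_component[OF km] symbol_law_moments(2)[OF K \<tau>])

end

lemma amp_measurable_compose:
  assumes [measurable]: "f \<in> borel_measurable A" "g \<in> borel_measurable A"
  shows "(\<lambda>p. amp K \<tau> (f p) (g p)) \<in> borel_measurable A"
  unfolding amp_def by measurable

section \<open>The reverse density\<close>

context comb2
begin

text \<open>\<open>p\<^sub>0\<close> and \<open>p\<^sub>1\<close> are the estimated angles of the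
  preceding block. Subchannel 0 yields the increment of the first phase; the increment of the second
  is the difference between the changes in the two subchannels. The summand with
  \<open>Arg (v m)\<close> stands last in each argument, which is the shape that
  \<open>nn_integral_amp_wrapped_density\<close> integrates.\<close>

definition block_factor ::
    "real \<Rightarrow> real \<Rightarrow> (nat \<Rightarrow> nat \<Rightarrow> complex) \<Rightarrow> nat \<Rightarrow> (nat \<Rightarrow> complex) \<Rightarrow> real \<Rightarrow> real \<Rightarrow> ennreal" where
  "block_factor K \<tau> y k v p\<^sub>0 p\<^sub>1 =
     ennreal (amp K \<tau> (v 0) (y k 0) * (2 * pi * wrapped_density \<sigma>\<^sub>c ((Arg (y k 0) - p\<^sub>0) - Arg (v (0::nat)))))
   * ennreal (amp K \<tau> (v 1) (y k 1) * (2 * pi * wrapped_density \<sigma>\<^sub>r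
       ((Arg (y k 1) - p\<^sub>1 - (Arg (y k 0) - Arg (v 0) - p\<^sub>0)) - Arg (v (1::nat)))))"

definition reverse_density ::
    "real \<Rightarrow> real \<Rightarrow> nat \<Rightarrow> (nat \<Rightarrow> nat \<Rightarrow> complex) \<Rightarrow> (nat \<Rightarrow> nat \<Rightarrow> complex) \<Rightarrow> ennreal" where
  "reverse_density K \<tau> n x y = (\<Prod>k=1..n. block_factor K \<tau> y k (x k) (estimate x y (k - 1) 0) (estimate x y (k - 1) 1))"

lemma block_factor_measurable:
  assumes v: "\<And>m. m < 2 \<Longrightarrow> (\<lambda>p. v p m) \<in> borel_measurable A"
    and y: "\<And>m. m < 2 \<Longrightarrow> (\<lambda>p. y p k m) \<in> borel_measurable A"
    and [measurable]: "f \<in> borel_measurable A" "g \<in> borel_measurable A"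
  shows "(\<lambda>p. block_factor K \<tau> (y p) k (v p) (f p) (g p)) \<in> borel_measurable A"
proof -
  note [measurable] = v[of 0, simplified] v[of 1, simplified] y[of 0, simplified] y[of 1, simplified]
  note wd = measurable_compose[OF _ wrapped_density_measurable[OF \<sigma>\<^sub>c_pos]] measurable_compose[OF _ wrapped_density_measurable[OF \<sigma>\<^sub>r_pos]]
  show ?thesis unfolding block_factor_def
    by (intro borel_measurable_times_ennreal measurable_compose[OF _ measurable_ennreal] borel_measurable_times
      borel_measurable_const amp_measurable_compose wd borel_measurable_diff measurable_compose[OF _ Arg_measurable] v y assms) simp_all
qed

lemma reverse_density_measurable:
  assumes x: "\<And>k m. k \<in> {1..n} \<Longrightarrow> m < 2 \<Longrightarrow> (\<lambda>p. x p k m) \<in> borel_measurable A"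
    and y: "\<And>k m. k \<in> {1..n} \<Longrightarrow> m < 2 \<Longrightarrow> (\<lambda>p. y p k m) \<in> borel_measurable A"
  shows "(\<lambda>p. reverse_density K \<tau> n (x p) (y p)) \<in> borel_measurable A"
proof -
  have est: "(\<lambda>p. estimate (x p) (y p) (k - 1) m) \<in> borel_measurable A" if "k \<in> {1..n}" "m < 2" for k m
  proof (cases "k = 1")
    case False
    then have k: "k - 1 \<in> {1..n}" using that by auto
    show ?thesis using x[OF k that(2)] y[OF k that(2)] unfolding estimate_def by measurable
  qed (simp add: estimate_def)
  show ?thesis unfolding reverse_density_def
    by (intro borel_measurable_prod_ennreal block_factor_measurable x y est) auto
qed

text \<open>The second factor depends on \<open>v 0\<close> only through a shift of its argument, so
  the second symbol is integrated before the first and gives at most 1 whatever that shift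
  is.\<close>

lemma nn_integral_block_factor:
  assumes K: "K > 0" and \<tau>: "\<tau> > 0"
  shows "(\<integral>\<^sup>+v. block_factor K \<tau> y k v p\<^sub>0 p\<^sub>1 \<partial>(\<Pi>\<^sub>M m\<in>{..<2}. symbol_law K \<tau>)) \<le> 1"
proof -
  interpret P: product_sigma_finite "\<lambda>_::nat. symbol_law K \<tau>"
    by (rule product_sigma_finite.intro) (rule prob_space_imp_sigma_finite[OF prob_space_symbol_law[OF K \<tau>]])
  let ?A = "\<lambda>u. amp K \<tau> u (y k 0) * (2 * pi * wrapped_density \<sigma>\<^sub>c ((Arg (y k 0) - p\<^sub>0) - Arg u))"
  let ?b = "\<lambda>u. Arg (y k 1) - p\<^sub>1 - (Arg (y k 0) - Arg u - p\<^sub>0)"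
  let ?B = "\<lambda>b u. amp K \<tau> u (y k 1) * (2 * pi * wrapped_density \<sigma>\<^sub>r (b - Arg u))"
  have i: "{..<2} = insert 1 {0::nat}" by auto
  have m: "(\<lambda>v. block_factor K \<tau> y k v p\<^sub>0 p\<^sub>1) \<in> borel_measurable (\<Pi>\<^sub>M m\<in>insert 1 {0::nat}. symbol_law K \<tau>)"
  proof (rule block_factor_measurable[where v = "\<lambda>v. v" and y = "\<lambda>_. y"])
    fix m :: nat assume "m < 2"
    then have "m \<in> insert 1 {0}" by auto
    then have "(\<lambda>v. v m) \<in> (\<Pi>\<^sub>M m\<in>insert 1 {0::nat}. symbol_law K \<tau>) \<rightarrow>\<^sub>M symbol_law K \<tau>"
      by (rule measurable_component_singleton)
    then show "(\<lambda>v. v m) \<in> borel_measurable (\<Pi>\<^sub>M m\<in>insert 1 {0::nat}. symbol_law K \<tau>)"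
      using measurable_cong_sets[OF refl sets_symbol_law] by blast
  qed simp_all
  have wd: "wrapped_density \<sigma>\<^sub>c \<in> borel_measurable borel" "wrapped_density \<sigma>\<^sub>r \<in> borel_measurable borel"
    using \<sigma>\<^sub>c_pos \<sigma>\<^sub>r_pos by auto
  have mA: "(\<lambda>u. ennreal (?A u)) \<in> borel_measurable (symbol_law K \<tau>)"
  proof -
    have "(\<lambda>u. ennreal (?A u)) \<in> borel_measurable borel"
      by (intro measurable_compose[OF _ measurable_ennreal] borel_measurable_times borel_measurable_const amp_measurable_compose
        measurable_compose[OF _ wd(1)]) measurable
    then show ?thesis using measurable_cong_sets[OF sets_symbol_law refl] by blast
  qed
  have mB: "(\<lambda>u. ennreal (?B b u)) \<in> borel_measurable (symbol_law K \<tau>)" for b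
  proof -
    have "(\<lambda>u. ennreal (?B b u)) \<in> borel_measurable borel"
      by (intro measurable_compose[OF _ measurable_ennreal] borel_measurable_times borel_measurable_const amp_measurable_compose
        measurable_compose[OF _ wd(2)]) measurable
    then show ?thesis using measurable_cong_sets[OF sets_symbol_law refl] by blast
  qed
  have "(\<integral>\<^sup>+v. block_factor K \<tau> y k v p\<^sub>0 p\<^sub>1 \<partial>(\<Pi>\<^sub>M m\<in>{..<2}. symbol_law K \<tau>))
    = (\<integral>\<^sup>+v. \<integral>\<^sup>+u. block_factor K \<tau> y k (v(1 := u)) p\<^sub>0 p\<^sub>1 \<partial>symbol_law K \<tau> \<partial>(\<Pi>\<^sub>M m\<in>{0::nat}. symbol_law K \<tau>))"
    unfolding i by (rule P.product_nn_integral_insert[OF _ _ m]) auto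
  also have "\<dots> = (\<integral>\<^sup>+v. ennreal (?A (v 0)) * (\<integral>\<^sup>+u. ennreal (?B (?b (v 0)) u) \<partial>symbol_law K \<tau>) \<partial>(\<Pi>\<^sub>M m\<in>{0::nat}. symbol_law K \<tau>))"
  proof (rule nn_integral_cong)
    fix v
    have "block_factor K \<tau> y k (v(1 := u)) p\<^sub>0 p\<^sub>1 = ennreal (?A (v 0)) * ennreal (?B (?b (v 0)) u)" for u
      unfolding block_factor_def by simp
    then show "(\<integral>\<^sup>+u. block_factor K \<tau> y k (v(1 := u)) p\<^sub>0 p\<^sub>1 \<partial>symbol_law K \<tau>)
      = ennreal (?A (v 0)) * (\<integral>\<^sup>+u. ennreal (?B (?b (v 0)) u) \<partial>symbol_law K \<tau>)"
      by (simp only: nn_integral_cmult[OF mB])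
  qed
  also have "\<dots> \<le> (\<integral>\<^sup>+v. ennreal (?A (v 0)) * 1 \<partial>(\<Pi>\<^sub>M m\<in>{0::nat}. symbol_law K \<tau>))"
    by (intro nn_integral_mono mult_left_mono nn_integral_amp_wrapped_density K \<tau> \<sigma>\<^sub>r_pos) simp
  also have "\<dots> = (\<integral>\<^sup>+u. ennreal (?A u) \<partial>symbol_law K \<tau>)"
    using P.product_nn_integral_singleton[OF mA, of 0] by simp
  also have "\<dots> \<le> 1"
    by (rule nn_integral_amp_wrapped_density[OF K \<tau> \<sigma>\<^sub>c_pos])
  finally show ?thesis .
qed

text \<open>The factor of a block depends on the inputs of that block and, through the estimates, of
  the preceding one. The last block thus occurs in a single factor, and integrating it leaves the
  product of the earlier ones.\<close>

lemma nn_integral_reverse_density: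
  assumes K: "K > 0" and \<tau>: "\<tau> > 0"
  shows "(\<integral>\<^sup>+x. reverse_density K \<tau> n x y \<partial>input_law K \<tau> n) \<le> 1"
proof (induction n)
  case 0
  interpret prob_space "input_law K \<tau> 0" by (rule prob_space_input_law[OF K \<tau>])
  show ?case by (simp add: reverse_density_def emeasure_space_1)
next
  case (Suc n)
  let ?I = "\<Pi>\<^sub>M m\<in>{..<2::nat}. symbol_law K \<tau>"
  interpret P: product_sigma_finite "\<lambda>_::nat. ?I"
    by (rule product_sigma_finite.intro)
      (intro prob_space_imp_sigma_finite prob_space_PiM prob_space_symbol_law K \<tau>)
  have i: "{1..Suc n} = insert (Suc n) {1..n}" by auto
  have m: "(\<lambda>x. reverse_density K \<tau> (Suc n) x y) \<in> borel_measurable (input_law K \<tau> (Suc n))"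
    by (rule reverse_density_measurable) (auto intro!: block_component_measurable[OF sets_input_law])
  have m': "(\<lambda>x. reverse_density K \<tau> (Suc n) x y) \<in> borel_measurable (\<Pi>\<^sub>M k\<in>insert (Suc n) {1..n}. ?I)"
    using m unfolding input_law_def i .
  have mb: "(\<lambda>v. block_factor K \<tau> y k v p q) \<in> borel_measurable ?I" for k p q
  proof (rule block_factor_measurable[where v = "\<lambda>v. v" and y = "\<lambda>_. y"])
    fix m :: nat assume "m < 2"
    then have "(\<lambda>v. v m) \<in> ?I \<rightarrow>\<^sub>M symbol_law K \<tau>"
      by (intro measurable_component_singleton) simp
    then show "(\<lambda>v. v m) \<in> borel_measurable ?I"
      using measurable_cong_sets[OF refl sets_symbol_law] by blast
  qed simp_all
  have "(\<integral>\<^sup>+x. reverse_density K \<tau> (Suc n) x y \<partial>input_law K \<tau> (Suc n))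
    = (\<integral>\<^sup>+x. \<integral>\<^sup>+v. reverse_density K \<tau> (Suc n) (x(Suc n := v)) y \<partial>?I \<partial>(\<Pi>\<^sub>M k\<in>{1..n}. ?I))"
    unfolding input_law_def i by (rule P.product_nn_integral_insert[OF _ _ m']) auto
  also have "\<dots> = (\<integral>\<^sup>+x. reverse_density K \<tau> n x y * (\<integral>\<^sup>+v. block_factor K \<tau> y (Suc n) v (estimate x y n 0) (estimate x y n 1) \<partial>?I) \<partial>(\<Pi>\<^sub>M k\<in>{1..n}. ?I))"
  proof (rule nn_integral_cong)
    fix x
    have "reverse_density K \<tau> (Suc n) (x(Suc n := v)) y
      = reverse_density K \<tau> n x y * block_factor K \<tau> y (Suc n) v (estimate x y n 0) (estimate x y n 1)" for v
    proof -
      have "(\<Prod>k=1..n. block_factor K \<tau> y k ((x(Suc n := v)) k) (estimate (x(Suc n := v)) y (k - 1) 0) (estimate (x(Suc n := v)) y (k - 1) 1))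
        = reverse_density K \<tau> n x y"
        unfolding reverse_density_def by (intro prod.cong refl) (auto simp: estimate_def)
      then show ?thesis by (simp add: reverse_density_def estimate_def mult.commute)
    qed
    then show "(\<integral>\<^sup>+v. reverse_density K \<tau> (Suc n) (x(Suc n := v)) y \<partial>?I)
      = reverse_density K \<tau> n x y * (\<integral>\<^sup>+v. block_factor K \<tau> y (Suc n) v (estimate x y n 0) (estimate x y n 1) \<partial>?I)"
      by (simp only: nn_integral_cmult[OF mb])
  qed
  also have "\<dots> \<le> (\<integral>\<^sup>+x. reverse_density K \<tau> n x y * 1 \<partial>(\<Pi>\<^sub>M k\<in>{1..n}. ?I))"
    by (intro nn_integral_mono mult_left_mono nn_integral_block_factor K \<tau>) simp
  also have "\<dots> \<le> 1" using Suc by (simp add: input_law_def)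
  finally show ?case .
qed

end

lemma amp_eq_exp:
  assumes "\<tau> > 0"
  shows "amp K \<tau> x y = exp (ln (\<tau> * sqrt (2 * pi) / 2 / sqrt pi) + (cmod x - K)\<^sup>2 / (2 * \<tau>\<^sup>2) - (cmod x - cmod y)\<^sup>2)"
proof -
  have "exp (ln (\<tau> * sqrt (2 * pi) / 2 / sqrt pi)) = \<tau> * sqrt (2 * pi) / 2 / sqrt pi"
    using assms by (intro exp_ln) simp
  then show ?thesis by (simp add: amp_def exp_add exp_diff exp_minus field_simps)
qed

section \<open>The mean of the logarithm of the reverse density\<close>

context comb2
begin

text \<open>Lower bound for the logarithm of one factor of the reverse density, expressed through
  the true increments and the noise so that its mean can be computed. \<open>D\<close> is paid in
  the first block; \<open>E\<close> weighs the squared noises of blocks \<open>k\<close> and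
  \<open>k - 1\<close>, which enter the estimated increments.\<close>

definition reward :: "real \<Rightarrow> real \<Rightarrow> real \<Rightarrow> real \<Rightarrow> real \<Rightarrow> (nat \<Rightarrow> nat \<Rightarrow> complex) \<Rightarrow> comb_noise \<Rightarrow> nat \<Rightarrow> real" where
  "reward K \<tau> e D E x z k =
     ln (2 * pi * wrapped_density \<sigma>\<^sub>c (snd (fst z) k)) + ln (2 * pi * wrapped_density \<sigma>\<^sub>r (snd (fst (snd z)) k))
     - 2 * e - (if k = 1 then D else 0)
     - E * (\<Sum>m<2. (cmod (snd (snd z) k m))\<^sup>2) - (if k = 1 then 0 else E * (\<Sum>m<2. (cmod (snd (snd z) (k - 1) m))\<^sup>2))
     + (\<Sum>m<2. ln (\<tau> * sqrt (2 * pi) / 2 / sqrt pi) + (cmod (x k m) - K)\<^sup>2 / (2 * \<tau>\<^sup>2)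
         - (cmod (x k m) - cmod (cis (angle (fst z, fst (snd z)) k m) * x k m + snd (snd z) k m))\<^sup>2)"

lemma block_factor_eq_exp:
  assumes \<tau>: "\<tau> > 0"
  shows "block_factor K \<tau> y k v p\<^sub>0 p\<^sub>1 = ennreal (exp (
     ln (2 * pi * wrapped_density \<sigma>\<^sub>c ((Arg (y k 0) - p\<^sub>0) - Arg (v 0)))
     + ln (2 * pi * wrapped_density \<sigma>\<^sub>r ((Arg (y k 1) - p\<^sub>1 - (Arg (y k 0) - Arg (v 0) - p\<^sub>0)) - Arg (v 1)))
     + (\<Sum>m<2. ln (\<tau> * sqrt (2 * pi) / 2 / sqrt pi) + (cmod (v m) - K)\<^sup>2 / (2 * \<tau>\<^sup>2) - (cmod (v m) - cmod (y k m))\<^sup>2)))"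
proof -
  have l: "exp (ln (2 * pi * wrapped_density \<sigma>\<^sub>c t)) = 2 * pi * wrapped_density \<sigma>\<^sub>c t"
    "exp (ln (2 * pi * wrapped_density \<sigma>\<^sub>r t)) = 2 * pi * wrapped_density \<sigma>\<^sub>r t" for t
    using wrapped_density_pos[OF \<sigma>\<^sub>c_pos, of t] wrapped_density_pos[OF \<sigma>\<^sub>r_pos, of t] by (auto intro!: exp_ln)
  have p: "0 \<le> 2 * pi * wrapped_density \<sigma>\<^sub>c t" "0 \<le> 2 * pi * wrapped_density \<sigma>\<^sub>r t" for t
    using wrapped_density_pos[OF \<sigma>\<^sub>c_pos, of t] wrapped_density_pos[OF \<sigma>\<^sub>r_pos, of t] by auto
  have a: "0 \<le> amp K \<tau> u u'" for u u' using \<tau> by (simp add: amp_def)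
  show ?thesis
    unfolding block_factor_def sum_lessThan_2 exp_add l amp_eq_exp[OF \<tau>, symmetric]
      ennreal_mult[OF mult_nonneg_nonneg[OF a p(1)] mult_nonneg_nonneg[OF a p(2)], symmetric]
    by (intro arg_cong[where f = ennreal]) algebra
qed

context
  fixes K \<tau> e C\<^sub>c C\<^sub>r B :: real
  assumes K: "K > 0" and \<tau>: "\<tau> > 0" and e: "e \<ge> 0" and C: "C\<^sub>c \<ge> 0" "C\<^sub>r \<ge> 0"
    and perturb\<^sub>c: "\<forall>t d. ln (wrapped_density \<sigma>\<^sub>c t) - e - C\<^sub>c * d\<^sup>2 \<le> ln (wrapped_density \<sigma>\<^sub>c (t + d))"
    and perturb\<^sub>r: "\<forall>t d. ln (wrapped_density \<sigma>\<^sub>r t) - e - C\<^sub>r * d\<^sup>2 \<le> ln (wrapped_density \<sigma>\<^sub>r (t + d))"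
    and bound: "\<forall>t. \<bar>ln (wrapped_density \<sigma>\<^sub>c t)\<bar> \<le> B" "\<forall>t. \<bar>ln (wrapped_density \<sigma>\<^sub>r t)\<bar> \<le> B"
begin

text \<open>The numbers 2 and 4 come from squaring a sum of two and of four phase errors, and
  \<open>4 * pi\<^sup>2 / K\<^sup>2\<close> is the constant of
  \<open>estimation_error\<close>.\<close>

abbreviation "penalty \<equiv> (2 * C\<^sub>c + 4 * C\<^sub>r) * (4 * pi\<^sup>2 / K\<^sup>2)"

lemma ln_2pi_wrapped:
  "ln (2 * pi * wrapped_density \<sigma>\<^sub>c t) = ln (2 * pi) + ln (wrapped_density \<sigma>\<^sub>c t)"
  "ln (2 * pi * wrapped_density \<sigma>\<^sub>r t) = ln (2 * pi) + ln (wrapped_density \<sigma>\<^sub>r t)"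
  using wrapped_density_pos[OF \<sigma>\<^sub>c_pos, of t] wrapped_density_pos[OF \<sigma>\<^sub>r_pos, of t] by (simp_all add: ln_mult)

text \<open>The increments are estimated from two consecutive blocks; each estimate is off by at most four
  phase errors, which are small because the amplitudes are at least \<open>K\<close>.\<close>

lemma increments_perturbed:
  assumes \<alpha>: "cis \<alpha> = cis (\<delta>\<^sub>c + \<alpha>')" and \<beta>: "cis \<beta> = cis (\<delta>\<^sub>r + \<beta>')"
    and q: "cis q\<^sub>0 = cis (\<alpha> + \<psi>\<^sub>0)" "cis q\<^sub>1 = cis (\<alpha> + \<beta> + \<psi>\<^sub>1)"
    and p: "cis p\<^sub>0 = cis (\<alpha>' + \<psi>\<^sub>0')" "cis p\<^sub>1 = cis (\<alpha>' + \<beta>' + \<psi>\<^sub>1')"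
  shows "ln (2 * pi * wrapped_density \<sigma>\<^sub>c \<delta>\<^sub>c) + ln (2 * pi * wrapped_density \<sigma>\<^sub>r \<delta>\<^sub>r) - 2 * e
      - (2 * C\<^sub>c + 4 * C\<^sub>r) * (\<psi>\<^sub>0\<^sup>2 + \<psi>\<^sub>1\<^sup>2 + \<psi>\<^sub>0'\<^sup>2 + \<psi>\<^sub>1'\<^sup>2)
    \<le> ln (2 * pi * wrapped_density \<sigma>\<^sub>c (q\<^sub>0 - p\<^sub>0)) + ln (2 * pi * wrapped_density \<sigma>\<^sub>r (q\<^sub>1 - p\<^sub>1 - (q\<^sub>0 - p\<^sub>0)))"
proof -
  let ?d = "\<psi>\<^sub>0 - \<psi>\<^sub>0'" and ?d' = "\<psi>\<^sub>1 - \<psi>\<^sub>1' - \<psi>\<^sub>0 + \<psi>\<^sub>0'"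
  have 1: "cis (q\<^sub>0 - p\<^sub>0) = cis (\<delta>\<^sub>c + ?d)"
    by (simp add: cis_divide[symmetric] cis_mult[symmetric] p q \<alpha> del: cis_mult)
  have 2: "cis (q\<^sub>1 - p\<^sub>1 - (q\<^sub>0 - p\<^sub>0)) = cis (\<delta>\<^sub>r + ?d')"
    by (simp add: cis_divide[symmetric] cis_mult[symmetric] p q \<alpha> \<beta> field_simps del: cis_mult)
  have f: "wrapped_density \<sigma>\<^sub>c (q\<^sub>0 - p\<^sub>0) = wrapped_density \<sigma>\<^sub>c (\<delta>\<^sub>c + ?d)"
    "wrapped_density \<sigma>\<^sub>r (q\<^sub>1 - p\<^sub>1 - (q\<^sub>0 - p\<^sub>0)) = wrapped_density \<sigma>\<^sub>r (\<delta>\<^sub>r + ?d')"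
    by (rule circle_periodic_cong[OF circle_periodic_wrapped_density[OF \<sigma>\<^sub>c_pos] 1],
        rule circle_periodic_cong[OF circle_periodic_wrapped_density[OF \<sigma>\<^sub>r_pos] 2])
  have c: "ln (wrapped_density \<sigma>\<^sub>c \<delta>\<^sub>c) - e - C\<^sub>c * ?d\<^sup>2 \<le> ln (wrapped_density \<sigma>\<^sub>c (\<delta>\<^sub>c + ?d))" using perturb\<^sub>c by blast
  have r: "ln (wrapped_density \<sigma>\<^sub>r \<delta>\<^sub>r) - e - C\<^sub>r * ?d'\<^sup>2 \<le> ln (wrapped_density \<sigma>\<^sub>r (\<delta>\<^sub>r + ?d'))" using perturb\<^sub>r by blast
  let ?S = "\<psi>\<^sub>0\<^sup>2 + \<psi>\<^sub>1\<^sup>2 + \<psi>\<^sub>0'\<^sup>2 + \<psi>\<^sub>1'\<^sup>2"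
  \<comment> \<open>The square of a sum of two or four errors is at most 2 or 4 times the sum of the
    squares; the gaps are exhibited as sums of squares.\<close>
  have "2 * ?S - ?d\<^sup>2 = (\<psi>\<^sub>0 + \<psi>\<^sub>0')\<^sup>2 + 2 * \<psi>\<^sub>1\<^sup>2 + 2 * \<psi>\<^sub>1'\<^sup>2" by (simp add: power2_eq_square algebra_simps)
  then have dc: "?d\<^sup>2 \<le> 2 * ?S" by (smt (verit) zero_le_power2)
  have "4 * ?S - ?d'\<^sup>2 = (\<psi>\<^sub>1 + \<psi>\<^sub>1')\<^sup>2 + (\<psi>\<^sub>1 + \<psi>\<^sub>0)\<^sup>2 + (\<psi>\<^sub>1 - \<psi>\<^sub>0')\<^sup>2 + (\<psi>\<^sub>1' - \<psi>\<^sub>0)\<^sup>2 + (\<psi>\<^sub>1' + \<psi>\<^sub>0')\<^sup>2 + (\<psi>\<^sub>0 + \<psi>\<^sub>0')\<^sup>2"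
    by (simp add: power2_eq_square algebra_simps)
  then have dr: "?d'\<^sup>2 \<le> 4 * ?S" by (smt (verit) zero_le_power2)
  have "C\<^sub>c * ?d\<^sup>2 + C\<^sub>r * ?d'\<^sup>2 \<le> C\<^sub>c * (2 * ?S) + C\<^sub>r * (4 * ?S)"
    using C dc dr by (intro add_mono mult_left_mono) auto
  then have "C\<^sub>c * ?d\<^sup>2 + C\<^sub>r * ?d'\<^sup>2 \<le> (2 * C\<^sub>c + 4 * C\<^sub>r) * ?S" by (simp add: algebra_simps)
  with c r show ?thesis unfolding f ln_2pi_wrapped by linarith
qed

text \<open>Block by block: later blocks compare true and estimated increments through
  \<open>increments_perturbed\<close>, with the squared errors replaced by the squared noises; the
  first block falls back on the boundedness of the logarithms.\<close>

lemma reverse_density_ge: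
  assumes x: "\<forall>k\<in>{1..n}. \<forall>m\<in>{..<2}. K \<le> cmod (x k m)"
  shows "ennreal (exp (\<Sum>k=1..n. reward K \<tau> e (4 * B) penalty x z k)) \<le> reverse_density K \<tau> n x (comb_output 2 n x z)"
proof -
  obtain c r w where z: "z = (c, r, w)" by (cases z)
  let ?y = "comb_output 2 n x z"
  have y: "?y k m = cis (angle (c, r) k m) * x k m + w k m" if "k \<in> {1..n}" "m < 2" for k m
    using that by (simp add: z comb_output_eq rotation_def)
  have less_2: "(0::nat) < 2" "(1::nat) < 2" by simp_all
  have pen: "0 \<le> penalty" using C by simp
  have B0: "0 \<le> B" using bound(1) abs_ge_zero order_trans by blast
  have est: "\<exists>\<psi>. cis (Arg (?y k m) - Arg (x k m)) = cis (angle (c, r) k m + \<psi>) \<and> \<psi>\<^sup>2 \<le> 4 * pi\<^sup>2 / K\<^sup>2 * (cmod (w k m))\<^sup>2"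
    if km: "k \<in> {1..n}" "m < 2" for k m
  proof -
    have xK: "K \<le> cmod (x k m)" using x km by auto
    show ?thesis
      using estimation_error(1)[OF K xK, of "?y k m" "angle (c, r) k m"] estimation_error(2)[OF K xK, of "?y k m" "angle (c, r) k m"]
      by (intro exI conjI) (assumption, simp add: y[OF km])
  qed
  have main: "ennreal (exp (reward K \<tau> e (4 * B) penalty x z k))
      \<le> block_factor K \<tau> ?y k (x k) (estimate x ?y (k - 1) 0) (estimate x ?y (k - 1) 1)" if k: "k \<in> {1..n}" for k
  proof -
    let ?p0 = "estimate x ?y (k - 1) 0" and ?p1 = "estimate x ?y (k - 1) 1"
    let ?fc = "ln (2 * pi * wrapped_density \<sigma>\<^sub>c ((Arg (?y k 0) - ?p0) - Arg (x k 0)))"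
    let ?fr = "ln (2 * pi * wrapped_density \<sigma>\<^sub>r ((Arg (?y k 1) - ?p1 - (Arg (?y k 0) - Arg (x k 0) - ?p0)) - Arg (x k 1)))"
    let ?g = "ln (2 * pi * wrapped_density \<sigma>\<^sub>c (snd c k)) + ln (2 * pi * wrapped_density \<sigma>\<^sub>r (snd r k))
       - 2 * e - (if k = 1 then 4 * B else 0)
       - penalty * (\<Sum>m<2. (cmod (w k m))\<^sup>2) - (if k = 1 then 0 else penalty * (\<Sum>m<2. (cmod (w (k - 1) m))\<^sup>2))"
    have le: "?g \<le> ?fc + ?fr"
    proof (cases "k = 1")
      \<comment> \<open>Without a preceding block the densities are evaluated at an arbitrary point.
        Each of the two logarithms then loses at most \<open>2 * B\<close>.\<close>
      case True
      have "0 \<le> penalty * (\<Sum>m<2. (cmod (w k m))\<^sup>2)" by (intro mult_nonneg_nonneg[OF pen] sum_nonneg) auto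
      moreover have "ln (wrapped_density \<sigma>\<^sub>c s) - ln (wrapped_density \<sigma>\<^sub>c t) \<le> 2 * B" "ln (wrapped_density \<sigma>\<^sub>r s) - ln (wrapped_density \<sigma>\<^sub>r t) \<le> 2 * B" for s t
        using bound(1)[rule_format, of s] bound(1)[rule_format, of t] bound(2)[rule_format, of s] bound(2)[rule_format, of t] by linarith+
      note this(1)[of "snd c k" "(Arg (?y k 0) - ?p0) - Arg (x k 0)"]
        this(2)[of "snd r k" "(Arg (?y k 1) - ?p1 - (Arg (?y k 0) - Arg (x k 0) - ?p0)) - Arg (x k 1)"]
      ultimately show ?thesis unfolding ln_2pi_wrapped using True e by simp
    next
      case False
      then have k': "k - 1 \<in> {1..n}" "k \<noteq> 0" "k - 1 \<noteq> 0" and kS: "k = Suc (k - 1)" using k by auto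
      obtain \<psi>\<^sub>0 where \<psi>\<^sub>0: "cis (Arg (?y k 0) - Arg (x k 0)) = cis (angle (c, r) k 0 + \<psi>\<^sub>0)" "\<psi>\<^sub>0\<^sup>2 \<le> 4 * pi\<^sup>2 / K\<^sup>2 * (cmod (w k 0))\<^sup>2"
        using est[OF k, of 0] by auto
      obtain \<psi>\<^sub>1 where \<psi>\<^sub>1: "cis (Arg (?y k 1) - Arg (x k 1)) = cis (angle (c, r) k 1 + \<psi>\<^sub>1)" "\<psi>\<^sub>1\<^sup>2 \<le> 4 * pi\<^sup>2 / K\<^sup>2 * (cmod (w k 1))\<^sup>2"
        using est[OF k, of 1] by auto
      obtain \<psi>\<^sub>0' where \<psi>\<^sub>0': "cis ?p0 = cis (angle (c, r) (k - 1) 0 + \<psi>\<^sub>0')" "\<psi>\<^sub>0'\<^sup>2 \<le> 4 * pi\<^sup>2 / K\<^sup>2 * (cmod (w (k - 1) 0))\<^sup>2"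
        using est[OF k'(1), of 0] k'(3) by (auto simp: estimate_def)
      obtain \<psi>\<^sub>1' where \<psi>\<^sub>1': "cis ?p1 = cis (angle (c, r) (k - 1) 1 + \<psi>\<^sub>1')" "\<psi>\<^sub>1'\<^sup>2 \<le> 4 * pi\<^sup>2 / K\<^sup>2 * (cmod (w (k - 1) 1))\<^sup>2"
        using est[OF k'(1), of 1] k'(3) by (auto simp: estimate_def)
      have step: "cis (phase c k) = cis (snd c k + phase c (k - 1))" for c
      proof -
        have "phase c k = wrap_pi (snd c k + phase c (k - 1))"
          by (subst (1 2) kS) (simp add: add_pi_def)
        then show ?thesis by simp
      qed
      have "ln (2 * pi * wrapped_density \<sigma>\<^sub>c (snd c k)) + ln (2 * pi * wrapped_density \<sigma>\<^sub>r (snd r k)) - 2 * e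
          - (2 * C\<^sub>c + 4 * C\<^sub>r) * (\<psi>\<^sub>0\<^sup>2 + \<psi>\<^sub>1\<^sup>2 + \<psi>\<^sub>0'\<^sup>2 + \<psi>\<^sub>1'\<^sup>2)
        \<le> ln (2 * pi * wrapped_density \<sigma>\<^sub>c (Arg (?y k 0) - Arg (x k 0) - ?p0))
          + ln (2 * pi * wrapped_density \<sigma>\<^sub>r (Arg (?y k 1) - Arg (x k 1) - ?p1 - (Arg (?y k 0) - Arg (x k 0) - ?p0)))"
        by (rule increments_perturbed[OF step step]) (use \<psi>\<^sub>0(1) \<psi>\<^sub>1(1) \<psi>\<^sub>0'(1) \<psi>\<^sub>1'(1) in simp_all)
      also have "\<dots> = ?fc + ?fr" by (simp add: algebra_simps)
      finally have a: "ln (2 * pi * wrapped_density \<sigma>\<^sub>c (snd c k)) + ln (2 * pi * wrapped_density \<sigma>\<^sub>r (snd r k)) - 2 * e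
          - (2 * C\<^sub>c + 4 * C\<^sub>r) * (\<psi>\<^sub>0\<^sup>2 + \<psi>\<^sub>1\<^sup>2 + \<psi>\<^sub>0'\<^sup>2 + \<psi>\<^sub>1'\<^sup>2) \<le> ?fc + ?fr" .
      have "(2 * C\<^sub>c + 4 * C\<^sub>r) * (\<psi>\<^sub>0\<^sup>2 + \<psi>\<^sub>1\<^sup>2 + \<psi>\<^sub>0'\<^sup>2 + \<psi>\<^sub>1'\<^sup>2)
        \<le> (2 * C\<^sub>c + 4 * C\<^sub>r) * (4 * pi\<^sup>2 / K\<^sup>2 * (cmod (w k 0))\<^sup>2 + 4 * pi\<^sup>2 / K\<^sup>2 * (cmod (w k 1))\<^sup>2
          + 4 * pi\<^sup>2 / K\<^sup>2 * (cmod (w (k - 1) 0))\<^sup>2 + 4 * pi\<^sup>2 / K\<^sup>2 * (cmod (w (k - 1) 1))\<^sup>2)"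
        using C by (intro mult_left_mono add_mono \<psi>\<^sub>0(2) \<psi>\<^sub>1(2) \<psi>\<^sub>0'(2) \<psi>\<^sub>1'(2)) auto
      also have "\<dots> = penalty * (\<Sum>m<2. (cmod (w k m))\<^sup>2) + penalty * (\<Sum>m<2. (cmod (w (k - 1) m))\<^sup>2)"
        unfolding sum_lessThan_2 by algebra
      finally show ?thesis using a False by simp
    qed
    have "reward K \<tau> e (4 * B) penalty x z k = ?g + (\<Sum>m<2. ln (\<tau> * sqrt (2 * pi) / 2 / sqrt pi) + (cmod (x k m) - K)\<^sup>2 / (2 * \<tau>\<^sup>2) - (cmod (x k m) - cmod (?y k m))\<^sup>2)"
      unfolding reward_def sum_lessThan_2 y[OF k less_2(1)] y[OF k less_2(2)] by (simp add: z)
    with le show ?thesis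
      unfolding block_factor_eq_exp[OF \<tau>] by (intro ennreal_leI) simp
  qed
  have "ennreal (exp (\<Sum>k=1..n. reward K \<tau> e (4 * B) penalty x z k)) = (\<Prod>k=1..n. ennreal (exp (reward K \<tau> e (4 * B) penalty x z k)))"
    by (simp add: exp_sum prod_ennreal)
  also have "\<dots> \<le> reverse_density K \<tau> n x ?y"
    unfolding reverse_density_def by (rule prod_ennreal_mono) (rule main)
  finally show ?thesis .
qed

lemma noise_integral:
  assumes \<mu>: "prob_space \<mu>" and k: "k \<ge> 1" "m < 2"
  shows "has_bochner_integral (\<mu> \<Otimes>\<^sub>M NN) (\<lambda>p. (cmod (snd (snd (snd p)) k m))\<^sup>2) 1"
proof -
  have W: "has_bochner_integral (additive_noise_space 2) (\<lambda>w. (cmod (w k m))\<^sup>2) 1"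
    by (rule integral_distr_comp[OF additive_noise_measurable[OF k]])
      (simp add: distr_additive_noise_component[OF k] std_complex_normal_moments(4))
  have "has_bochner_integral NN (\<lambda>z. (cmod (snd (snd z) k m))\<^sup>2) 1"
    unfolding comb_noise_space_def
    by (rule has_bochner_integral_snd_pair[OF C.prob_space_axioms RW.prob_space_axioms
      has_bochner_integral_snd_pair[OF R.prob_space_axioms W.prob_space_axioms W]])
  then show ?thesis by (rule has_bochner_integral_snd_pair[OF \<mu> prob_space_NN])
qed

text \<open>All means are exact except that of the amplitude error. Each symbol contributes 1/2 from
  \<open>(|x| - K)^2 / (2 * \<tau>^2)\<close>, and \<open>4 * \<bar>E\<bar>\<close> covers four
  squared noises of mean 1, two in each of the two blocks involved.\<close>

lemma reward_integral:
  assumes k: "k \<in> {1..n}" and e': "e' > 0"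
  shows "integrable (input_law K \<tau> n \<Otimes>\<^sub>M NN) (\<lambda>p. reward K \<tau> e D E (fst p) (snd p) k)"
    and "2 * ln (2 * pi) - phase_entropy \<sigma>\<^sub>c - phase_entropy \<sigma>\<^sub>r - 2 * e - (if k = 1 then D else 0) - 4 * \<bar>E\<bar>
        + 2 * (ln (\<tau> * sqrt (2 * pi) / 2 / sqrt pi) + 1 / 2 - amplitude_bound K e')
      \<le> (\<integral>p. reward K \<tau> e D E (fst p) (snd p) k \<partial>(input_law K \<tau> n \<Otimes>\<^sub>M NN))"
proof -
  let ?\<mu> = "input_law K \<tau> n"
  let ?P = "?\<mu> \<Otimes>\<^sub>M NN"
  let ?A = "ln (\<tau> * sqrt (2 * pi) / 2 / sqrt pi)"
  let ?L = "\<lambda>p. ln (2 * pi * wrapped_density \<sigma>\<^sub>c (snd (fst (snd p)) k)) + ln (2 * pi * wrapped_density \<sigma>\<^sub>r (snd (fst (snd (snd p))) k))"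
  let ?W = "\<lambda>k p. \<Sum>m<2. (cmod (snd (snd (snd p)) k m))\<^sup>2"
  let ?X = "\<lambda>m p. (cmod (fst p k m) - K)\<^sup>2 / (2 * \<tau>\<^sup>2)"
  let ?H = "\<lambda>x t w. (cmod x - cmod (cis t * x + w))\<^sup>2"
  let ?Y = "\<lambda>m p. ?H (fst p k m) (angle (fst (snd p), fst (snd (snd p))) k m) (snd (snd (snd p)) k m)"
  have k1: "1 \<le> k" using k by simp
  have \<mu>: "prob_space ?\<mu>" "sets ?\<mu> = sets (block_space 2 n)"
    by (rule prob_space_input_law[OF K \<tau>], rule sets_input_law)
  interpret mu: prob_space ?\<mu> by (rule \<mu>)
  interpret N: prob_space NN by (rule prob_space_NN)
  interpret P: pair_prob_space ?\<mu> NN ..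
  have L: "has_bochner_integral ?P ?L ((ln (2 * pi) - phase_entropy \<sigma>\<^sub>c) + (ln (2 * pi) - phase_entropy \<sigma>\<^sub>r))"
    by (intro has_bochner_integral_add increment_integral_c increment_integral_r integrable_ln_2pi_wrapped_density \<mu>(1) k1 \<sigma>\<^sub>c_pos \<sigma>\<^sub>r_pos)
  have W: "has_bochner_integral ?P (?W j) 2" if "j \<ge> 1" for j
    unfolding sum_lessThan_2
    using has_bochner_integral_add[OF noise_integral[OF \<mu>(1) that, of 0] noise_integral[OF \<mu>(1) that, of 1]] by simp
  \<comment> \<open>The noise space has no block 0, so the term of the preceding block occurs for
    \<open>k > 1\<close> only.\<close>
  define W' where "W' p = (if k = 1 then 0 else E * ?W (k - 1) p)" for p :: "(nat \<Rightarrow> nat \<Rightarrow> complex) \<times> comb_noise"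
  have W': "has_bochner_integral ?P W' (if k = 1 then 0 else E * 2)"
    unfolding W'_def using W[of "k - 1"] k1 by (auto intro!: has_bochner_integral_mult_right)
  have X: "has_bochner_integral ?P (?X m) (1 / 2)" if m: "m < 2" for m
  proof -
    have "has_bochner_integral ?\<mu> (\<lambda>x. (cmod (x k m) - K)\<^sup>2 / (2 * \<tau>\<^sup>2)) (\<tau>\<^sup>2 / (2 * \<tau>\<^sup>2))"
      by (rule has_bochner_integral_divide_zero[OF input_sq_integral[OF K \<tau> k m]])
    moreover have "\<tau>\<^sup>2 / (2 * \<tau>\<^sup>2) = 1 / 2" using \<tau> by simp
    ultimately have "has_bochner_integral ?\<mu> (\<lambda>x. (cmod (x k m) - K)\<^sup>2 / (2 * \<tau>\<^sup>2)) (1 / 2)" by (simp only:)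
    then show ?thesis by (rule has_bochner_integral_fst_pair[OF prob_space_NN])
  qed
  have Hm: "(\<lambda>((x, t), w). ?H x t w) \<in> borel_measurable ((borel \<Otimes>\<^sub>M borel) \<Otimes>\<^sub>M borel)"
    unfolding case_prod_beta' by measurable
  have Hb: "\<bar>?H x t w\<bar> \<le> 1 * (1 + (cmod x)\<^sup>2 + cmod w ^ 4)" for x w :: complex and t
  proof -
    have "?H x t w \<le> (cmod w)\<^sup>2" by (rule amplitude_error_le)
    also have "\<dots> \<le> 1 + cmod w ^ 4" by (rule norm_sq_le_norm4)
    also have "\<dots> \<le> 1 + (cmod x)\<^sup>2 + cmod w ^ 4" by simp
    finally show ?thesis by simp
  qed
  have sq: "integrable ?\<mu> (\<lambda>x. (cmod (x k m))\<^sup>2)" if "m < 2" for m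
    by (rule admissible_power(1)[OF input_admissible[OF K \<tau>] _ k that]) simp
  have Yi: "integrable ?P (?Y m)" if "m < 2" for m
    by (rule symbol_integral(1)[OF \<mu> k that Hm Hb sq[OF that]])
  have Yb: "(\<integral>p. ?Y m p \<partial>?P) \<le> amplitude_bound K e'" if m: "m < 2" for m
  proof -
    let ?a = "\<lambda>v. if cmod v < K then 1 else amplitude_bound K e'"
    have am: "?a \<in> borel_measurable borel" by measurable
    have ax: "(\<lambda>x. ?a (x k m)) \<in> borel_measurable ?\<mu>"
      by (rule measurable_compose[OF block_component_measurable[OF \<mu>(2) k m] am])
    have ae: "AE x in ?\<mu>. ?a (x k m) = amplitude_bound K e'"
      using AE_input[OF K \<tau>, of n] by eventually_elim (use k m in \<open>auto simp: not_less[symmetric]\<close>)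
    have "integrable ?\<mu> (\<lambda>x. ?a (x k m))"
      using integrable_cong_AE[THEN iffD2, OF ax _ ae] by simp
    then have "(\<integral>p. ?Y m p \<partial>?P) \<le> (\<integral>x. ?a (x k m) \<partial>?\<mu>)"
      by (intro symbol_integral(2)[OF \<mu> k m Hm Hb sq[OF m]] expected_amplitude_error e' K am)
    also have "\<dots> = (\<integral>x. amplitude_bound K e' \<partial>?\<mu>)" by (rule integral_cong_AE[OF ax _ ae]) simp
    also have "\<dots> = amplitude_bound K e'" by (simp add: mu.prob_space)
    finally show ?thesis .
  qed
  define V where "V = ?A + 1 / 2 - (\<integral>p. ?Y 0 p \<partial>?P) + (?A + 1 / 2 - (\<integral>p. ?Y 1 p \<partial>?P))"
  have const: "has_bochner_integral ?P (\<lambda>_. c) c" for c :: real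
    by (simp add: has_bochner_integral_iff P.P.prob_space)
  have Y: "has_bochner_integral ?P (?Y m) (\<integral>p. ?Y m p \<partial>?P)" if "m < 2" for m
    using Yi[OF that] by (simp only: has_bochner_integral_iff simp_thms)
  have Z: "has_bochner_integral ?P (\<lambda>p. \<Sum>m<2. ?A + ?X m p - ?Y m p) V"
    unfolding sum_lessThan_2 V_def
    by (intro has_bochner_integral_add has_bochner_integral_diff const X Y) simp_all
  have EW: "has_bochner_integral ?P (\<lambda>p. E * ?W k p) (E * 2)"
    by (rule has_bochner_integral_mult_right) (rule W[OF k1])
  have R: "has_bochner_integral ?P (\<lambda>p. reward K \<tau> e D E (fst p) (snd p) k)
    ((ln (2 * pi) - phase_entropy \<sigma>\<^sub>c) + (ln (2 * pi) - phase_entropy \<sigma>\<^sub>r) - 2 * e - (if k = 1 then D else 0)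
      - E * 2 - (if k = 1 then 0 else E * 2) + V)"
    unfolding reward_def
    by (rule has_bochner_integral_add[OF has_bochner_integral_diff[OF has_bochner_integral_diff[OF
      has_bochner_integral_diff[OF has_bochner_integral_diff[OF L const] const] EW] W'[unfolded W'_def]] Z])
  show "integrable ?P (\<lambda>p. reward K \<tau> e D E (fst p) (snd p) k)" using R by (simp add: has_bochner_integral_iff)
  have "2 * (?A + 1 / 2 - amplitude_bound K e') \<le> V" unfolding V_def using Yb[of 0] Yb[of 1] by simp
  moreover have "E * 2 + (if k = 1 then 0 else E * 2) \<le> 4 * \<bar>E\<bar>" by auto
  ultimately show "2 * ln (2 * pi) - phase_entropy \<sigma>\<^sub>c - phase_entropy \<sigma>\<^sub>r - 2 * e - (if k = 1 then D else 0) - 4 * \<bar>E\<bar>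
        + 2 * (?A + 1 / 2 - amplitude_bound K e')
      \<le> (\<integral>p. reward K \<tau> e D E (fst p) (snd p) k \<partial>?P)"
    using R by (simp add: has_bochner_integral_iff)
qed

text \<open>The sum of the rewards is the test function for \<open>info_ge\<close>. The loss
  \<open>4 * B\<close> of the first block is taken off once, so it does not affect the rate.\<close>

lemma input_information_ge:
  assumes e': "e' > 0"
  shows "real n * (2 * ln (2 * pi) - phase_entropy \<sigma>\<^sub>c - phase_entropy \<sigma>\<^sub>r - 2 * e - 4 * penalty
        + 2 * (ln (\<tau> * sqrt (2 * pi) / 2 / sqrt pi) + 1 / 2 - amplitude_bound K e')) - 4 * B
    \<le> comb_information 2 \<sigma>\<^sub>c \<sigma>\<^sub>r n (input_law K \<tau> n) * ln 2"
proof -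
  let ?\<mu> = "input_law K \<tau> n"
  let ?P = "?\<mu> \<Otimes>\<^sub>M NN"
  let ?c = "2 * ln (2 * pi) - phase_entropy \<sigma>\<^sub>c - phase_entropy \<sigma>\<^sub>r - 2 * e - 4 * penalty
        + 2 * (ln (\<tau> * sqrt (2 * pi) / 2 / sqrt pi) + 1 / 2 - amplitude_bound K e')"
  let ?R = "\<lambda>k p. reward K \<tau> e (4 * B) penalty (fst p) (snd p) k"
  have \<mu>: "prob_space ?\<mu>" "sets ?\<mu> = sets (block_space 2 n)"
    by (rule prob_space_input_law[OF K \<tau>], rule sets_input_law)
  interpret channel ?\<mu> NN "block_lborel 2 n" "comb_output 2 n" "comb_density n" 1
    by (rule channel_comb[OF \<mu>])
  have pen: "0 \<le> penalty" using C by (intro mult_nonneg_nonneg) auto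
  have B: "0 \<le> B" using bound(1) abs_ge_zero order_trans by blast
  have "real n * ?c - 4 * B \<le> (\<Sum>k=1..n. ?c - (if k = 1 then 4 * B else 0))"
    using B by (simp add: sum_subtractf)
  also have "\<dots> \<le> (\<Sum>k=1..n. \<integral>p. ?R k p \<partial>?P)"
  proof (rule sum_mono)
    fix k assume "k \<in> {1..n}"
    from reward_integral(2)[OF this e', of "4 * B" penalty] pen
    show "?c - (if k = 1 then 4 * B else 0) \<le> (\<integral>p. ?R k p \<partial>?P)" by (simp only: abs_of_nonneg)
  qed
  also have "\<dots> = (\<integral>p. (\<Sum>k=1..n. ?R k p) \<partial>?P)"
    using reward_integral(1)[OF _ e'] by (intro Bochner_Integration.integral_sum[symmetric]) auto
  also have "\<dots> = (\<integral>(x, z). (\<Sum>k=1..n. reward K \<tau> e (4 * B) penalty x z k) \<partial>?P)"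
    by (simp add: case_prod_beta')
  also have "\<dots> \<le> (\<integral>(x, z). ln (info_density x (comb_output 2 n x z)) \<partial>?P)"
  proof (rule info_ge)
    show "integrable ?P (\<lambda>(x, z). \<Sum>k=1..n. reward K \<tau> e (4 * B) penalty x z k)"
      unfolding case_prod_beta' using reward_integral(1)[OF _ e'] by (intro Bochner_Integration.integrable_sum) auto
    \<comment> \<open>The upper bound supplies integrability; \<open>R = 1\<close>,
      \<open>e = 1 / 2\<close> and \<open>K = 1\<close> are one permitted choice of its
      parameters.\<close>
    show "integrable ?P (\<lambda>(x, z). ln (info_density x (comb_output 2 n x z)))"
      by (rule information_le(1)[OF input_admissible[OF K \<tau>], of 1 "1 / 2" 1]) auto
    show "(\<lambda>(x, y). reverse_density K \<tau> n x y) \<in> borel_measurable (?\<mu> \<Otimes>\<^sub>M block_lborel 2 n)"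
      unfolding case_prod_beta'
      by (intro reverse_density_measurable measurable_compose[OF measurable_fst block_component_measurable[OF \<mu>(2)]]
        measurable_compose[OF measurable_snd block_component_measurable[OF sets_block_lborel]])
    show "(\<integral>\<^sup>+x. reverse_density K \<tau> n x y \<partial>?\<mu>) \<le> 1" for y
      by (rule nn_integral_reverse_density[OF K \<tau>])
    show "AE x in ?\<mu>. \<forall>z\<in>space NN. ennreal (exp (\<Sum>k=1..n. reward K \<tau> e (4 * B) penalty x z k))
        \<le> reverse_density K \<tau> n x (comb_output 2 n x z)"
      using AE_input[OF K \<tau>, of n] by eventually_elim (intro ballI reverse_density_ge, blast)
  qed
  also have "\<dots> = comb_information 2 \<sigma>\<^sub>c \<sigma>\<^sub>r n ?\<mu> * ln 2"
    unfolding comb_information_eq[OF \<mu>] by simp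
  finally show ?thesis .
qed

end

text \<open>\<open>D\<close> is quantified before \<open>n\<close>, so it disappears in the rate.
  The losses are \<open>2 * e\<close>, \<open>e\<close>, \<open>Q / K^2\<close> and
  \<open>4 * t\<close>, together at most \<open>7 / 8 * \<eta>\<close>.\<close>

lemma information_lower:
  assumes \<eta>: "\<eta> > 0"
  obtains \<rho>\<^sub>1 where "\<rho>\<^sub>1 > 0" "\<forall>\<rho>\<ge>\<rho>\<^sub>1. \<exists>D. \<forall>n. \<exists>\<mu>\<in>admissible_laws 2 n \<rho>.
    real n * (ln \<rho> + 2 * ln pi - phase_entropy \<sigma>\<^sub>c - phase_entropy \<sigma>\<^sub>r - \<eta>) - D \<le> comb_information 2 \<sigma>\<^sub>c \<sigma>\<^sub>r n \<mu> * ln 2"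
proof -
  define e where "e = \<eta> / 8"
  have e: "e > 0" using \<eta> by (simp add: e_def)
  obtain C\<^sub>c where C\<^sub>c: "C\<^sub>c \<ge> 0" "\<forall>t d. ln (wrapped_density \<sigma>\<^sub>c t) - e - C\<^sub>c * d\<^sup>2 \<le> ln (wrapped_density \<sigma>\<^sub>c (t + d))"
    by (rule ln_wrapped_density_perturb[OF \<sigma>\<^sub>c_pos e])
  obtain C\<^sub>r where C\<^sub>r: "C\<^sub>r \<ge> 0" "\<forall>t d. ln (wrapped_density \<sigma>\<^sub>r t) - e - C\<^sub>r * d\<^sup>2 \<le> ln (wrapped_density \<sigma>\<^sub>r (t + d))"
    by (rule ln_wrapped_density_perturb[OF \<sigma>\<^sub>r_pos e])
  obtain B\<^sub>c where B\<^sub>c: "\<forall>t. \<bar>ln (wrapped_density \<sigma>\<^sub>c t)\<bar> \<le> B\<^sub>c" by (rule ln_wrapped_density_bounded[OF \<sigma>\<^sub>c_pos])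
  obtain B\<^sub>r where B\<^sub>r: "\<forall>t. \<bar>ln (wrapped_density \<sigma>\<^sub>r t)\<bar> \<le> B\<^sub>r" by (rule ln_wrapped_density_bounded[OF \<sigma>\<^sub>r_pos])
  define B where "B = max B\<^sub>c B\<^sub>r"
  have B: "\<forall>t. \<bar>ln (wrapped_density \<sigma>\<^sub>c t)\<bar> \<le> B" "\<forall>t. \<bar>ln (wrapped_density \<sigma>\<^sub>r t)\<bar> \<le> B"
    using B\<^sub>c B\<^sub>r by (auto simp: B_def le_max_iff_disj)
  let ?C4 = "\<integral>w. cmod w ^ 4 \<partial>std_complex_normal"
  \<comment> \<open>The numerator of all terms of order \<open>1 / K^2\<close>: four times the
    penalty and twice the fourth-order part of \<open>amplitude_bound\<close>.\<close>
  define Q where "Q = 4 * (2 * C\<^sub>c + 4 * C\<^sub>r) * (4 * pi\<^sup>2) + 32 * (1 + 1 / e) * ?C4"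
  have "0 \<le> ?C4" by (intro Bochner_Integration.integral_nonneg) auto
  then have Q: "0 \<le> Q" unfolding Q_def using C\<^sub>c(1) C\<^sub>r(1) e by (intro add_nonneg_nonneg mult_nonneg_nonneg) auto
  define K where "K = max 1 (sqrt (4 * Q / \<eta>))"
  have K: "K > 0" by (simp add: K_def)
  have QK: "Q / K\<^sup>2 \<le> \<eta> / 4"
  proof -
    have "4 * Q / \<eta> = (sqrt (4 * Q / \<eta>))\<^sup>2" using Q \<eta> by simp
    also have "\<dots> \<le> K\<^sup>2" unfolding K_def using Q \<eta> by (intro power_mono) auto
    finally show ?thesis using K \<eta> by (simp add: field_simps)
  qed
  \<comment> \<open>Lower bound for the ratio of the total amplitude to the floor \<open>K\<close>.
    The value 2 permits the expansion of \<open>ln (1 - t)\<close>, and \<open>16 / \<eta>\<close>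
    makes \<open>4 * t\<close> at most \<open>\<eta> / 4\<close>.\<close>
  define T where "T = max 2 (16 / \<eta>)"
  have T: "T \<ge> 2" "1 / T \<le> \<eta> / 16"
  proof -
    show "T \<ge> 2" by (simp add: T_def)
    have "16 / \<eta> \<le> T" by (simp add: T_def)
    then show "1 / T \<le> \<eta> / 16" using \<eta> \<open>T \<ge> 2\<close> by (simp add: field_simps)
  qed
  define \<rho>\<^sub>1 where "\<rho>\<^sub>1 = 2 * (K * T)\<^sup>2"
  have \<rho>\<^sub>1: "\<rho>\<^sub>1 > 0" using K T by (simp add: \<rho>\<^sub>1_def)
  have main: "real n * (ln \<rho> + 2 * ln pi - phase_entropy \<sigma>\<^sub>c - phase_entropy \<sigma>\<^sub>r - \<eta>) - 4 * B
      \<le> comb_information 2 \<sigma>\<^sub>c \<sigma>\<^sub>r n (input_law K (sqrt (\<rho> / 2) - K) n) * ln 2"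
    "input_law K (sqrt (\<rho> / 2) - K) n \<in> admissible_laws 2 n \<rho>" if \<rho>: "\<rho> \<ge> \<rho>\<^sub>1" for \<rho> n
  proof -
    define s where "s = sqrt (\<rho> / 2)"
    have \<rho>0: "\<rho> > 0" using \<rho> \<rho>\<^sub>1 by simp
    then have s2: "s\<^sup>2 = \<rho> / 2" and s0: "s > 0" by (simp_all add: s_def)
    have KT: "K * T \<le> s"
      using \<rho> K T unfolding s_def \<rho>\<^sub>1_def by (intro real_le_rsqrt) simp
    \<comment> \<open>The share of the amplitude \<open>sqrt (\<rho> / 2)\<close> that goes into the
      floor \<open>K\<close>; what is left for \<open>\<tau>\<close> is the factor
      \<open>1 - t\<close>.\<close>
    define t where "t = K / s"
    have t: "0 < t" "t \<le> 1 / T"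
      using KT K T s0 by (simp_all add: t_def field_simps)
    have t2: "t \<le> 1 / 2"
    proof -
      have "1 / T \<le> 1 / 2" using T(1) by (intro divide_left_mono) auto
      then show ?thesis using t(2) by linarith
    qed
    have t\<eta>: "t \<le> \<eta> / 16" using t(2) T(2) by linarith
    let ?\<tau> = "s - K"
    have \<tau>eq: "?\<tau> = s * (1 - t)" using s0 by (simp add: t_def field_simps)
    have \<tau>: "?\<tau> > 0" unfolding \<tau>eq using s0 t2 by simp
    have "input_law K ?\<tau> n \<in> admissible_laws 2 n (2 * (K + ?\<tau>)\<^sup>2)" by (rule input_admissible[OF K \<tau>])
    then show "input_law K (sqrt (\<rho> / 2) - K) n \<in> admissible_laws 2 n \<rho>"
      using s2 by (simp add: s_def[symmetric])
    have lt: "- 2 * t \<le> ln (1 - t)"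
    proof -
      have "- t - 2 * t\<^sup>2 \<le> ln (1 - t)" using ln_one_minus_pos_lower_bound[of t] t t2 by simp
      moreover have "2 * t\<^sup>2 \<le> t" using t t2 by (simp add: power2_eq_square)
      ultimately show ?thesis by linarith
    qed
    let ?A = "ln (?\<tau> * sqrt (2 * pi) / 2 / sqrt pi)"
    have "?\<tau> * sqrt (2 * pi) / 2 / sqrt pi = s * (1 - t) * (sqrt 2 / 2)"
      unfolding \<tau>eq by (simp add: real_sqrt_mult)
    then have "2 * ?A = 2 * ln (s * (1 - t) * (sqrt 2 / 2))" by (simp only:)
    also have "\<dots> = ln ((s * (1 - t) * (sqrt 2 / 2))\<^sup>2)"
      using s0 t2 by (subst ln_realpow) simp_all
    also have "(s * (1 - t) * (sqrt 2 / 2))\<^sup>2 = \<rho> / 4 * (1 - t)\<^sup>2"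
      by (simp add: power_mult_distrib power_divide s2)
    also have "ln (\<rho> / 4 * (1 - t)\<^sup>2) = ln \<rho> - ln 4 + 2 * ln (1 - t)"
      using \<rho>0 t2 by (simp add: ln_mult ln_div ln_realpow)
    also have "ln (4::real) = 2 * ln 2" using ln_realpow[of 2 2] by simp
    finally have A: "2 * ?A + 2 * ln (2 * pi) = ln \<rho> + 2 * ln pi + 2 * ln (1 - t)"
      by (simp add: ln_mult)
    have b: "4 * ((2 * C\<^sub>c + 4 * C\<^sub>r) * (4 * pi\<^sup>2 / K\<^sup>2)) + 2 * amplitude_bound K e = 1 + e + Q / K\<^sup>2"
      using K e by (simp add: amplitude_bound_def Q_def field_simps)
    have arith: "h\<^sub>1 - h\<^sub>c - h\<^sub>r - \<eta> \<le> h\<^sub>2 - h\<^sub>c - h\<^sub>r - 2 * e - 4 * P + 2 * (A + 1 / 2 - a)"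
      if "2 * A + h\<^sub>2 = h\<^sub>1 + 2 * ln (1 - t)" "4 * P + 2 * a = 1 + e + Q / K\<^sup>2" for h\<^sub>1 h\<^sub>2 h\<^sub>c h\<^sub>r A P a
    proof -
      define q where "q = Q / K\<^sup>2"
      have "q \<le> \<eta> / 4" unfolding q_def by (rule QK)
      then have "4 * q \<le> \<eta>" by (simp add: field_simps)
      moreover have "16 * t \<le> \<eta>" using t\<eta> by (simp add: field_simps)
      moreover have "8 * e = \<eta>" by (simp add: e_def)
      moreover have "4 * P + 2 * a = 1 + e + q" using that(2) by (simp add: q_def)
      moreover have "2 * (A + 1 / 2 - a) = 2 * A + 1 - 2 * a" by (simp add: field_simps)
      ultimately show ?thesis using that(1) lt \<eta> by linarith
    qed
    have "ln \<rho> + 2 * ln pi - phase_entropy \<sigma>\<^sub>c - phase_entropy \<sigma>\<^sub>r - \<eta>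
      \<le> 2 * ln (2 * pi) - phase_entropy \<sigma>\<^sub>c - phase_entropy \<sigma>\<^sub>r - 2 * e - 4 * ((2 * C\<^sub>c + 4 * C\<^sub>r) * (4 * pi\<^sup>2 / K\<^sup>2))
        + 2 * (?A + 1 / 2 - amplitude_bound K e)"
      by (rule arith[OF A b])
    then have "real n * (ln \<rho> + 2 * ln pi - phase_entropy \<sigma>\<^sub>c - phase_entropy \<sigma>\<^sub>r - \<eta>) - 4 * B
      \<le> real n * (2 * ln (2 * pi) - phase_entropy \<sigma>\<^sub>c - phase_entropy \<sigma>\<^sub>r - 2 * e - 4 * ((2 * C\<^sub>c + 4 * C\<^sub>r) * (4 * pi\<^sup>2 / K\<^sup>2))
        + 2 * (?A + 1 / 2 - amplitude_bound K e)) - 4 * B"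
      by (intro diff_right_mono mult_left_mono) auto
    also have "\<dots> \<le> comb_information 2 \<sigma>\<^sub>c \<sigma>\<^sub>r n (input_law K ?\<tau> n) * ln 2"
      by (rule input_information_ge[OF K \<tau> less_imp_le[OF e] C\<^sub>c(1) C\<^sub>r(1) C\<^sub>c(2) C\<^sub>r(2) B e])
    finally show "real n * (ln \<rho> + 2 * ln pi - phase_entropy \<sigma>\<^sub>c - phase_entropy \<sigma>\<^sub>r - \<eta>) - 4 * B
      \<le> comb_information 2 \<sigma>\<^sub>c \<sigma>\<^sub>r n (input_law K (sqrt (\<rho> / 2) - K) n) * ln 2"
      unfolding s_def .
  qed
  show thesis
  proof (rule that[OF \<rho>\<^sub>1], intro allI impI exI[of _ "4 * B"])
    fix \<rho> n assume \<rho>: "\<rho>\<^sub>1 \<le> \<rho>"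
    show "\<exists>\<mu>\<in>admissible_laws 2 n \<rho>. real n * (ln \<rho> + 2 * ln pi - phase_entropy \<sigma>\<^sub>c - phase_entropy \<sigma>\<^sub>r - \<eta>) - 4 * B
      \<le> comb_information 2 \<sigma>\<^sub>c \<sigma>\<^sub>r n \<mu> * ln 2"
      by (rule bexI[where x = "input_law K (sqrt (\<rho> / 2) - K) n"]) (rule main[OF \<rho>])+
  qed
qed

end

subsection \<open>Superadditivity\<close>

definition block_append :: "nat \<Rightarrow> nat \<Rightarrow> (nat \<Rightarrow> nat \<Rightarrow> complex) \<Rightarrow> (nat \<Rightarrow> nat \<Rightarrow> complex) \<Rightarrow> nat \<Rightarrow> nat \<Rightarrow> complex" where
  "block_append m n x x' = (\<lambda>k\<in>{1..m + n}. if k \<le> m then x k else x' (k - m))"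

definition block_take :: "nat \<Rightarrow> (nat \<Rightarrow> nat \<Rightarrow> complex) \<Rightarrow> nat \<Rightarrow> nat \<Rightarrow> complex" where
  "block_take m x = (\<lambda>k\<in>{1..m}. x k)"

definition block_drop :: "nat \<Rightarrow> nat \<Rightarrow> (nat \<Rightarrow> nat \<Rightarrow> complex) \<Rightarrow> nat \<Rightarrow> nat \<Rightarrow> complex" where
  "block_drop m n x = (\<lambda>k\<in>{1..n}. x (m + k))"

definition shift_comb_noise :: "nat \<Rightarrow> comb_noise \<Rightarrow> comb_noise" where
  "shift_comb_noise m = (\<lambda>(c, r, w). (shift_phase m c, shift_phase m r, shift_noise m w))"

lemma block_append_measurable:
  "(\<lambda>(x, x'). block_append m n x x') \<in> block_space M m \<Otimes>\<^sub>M block_space M n \<rightarrow>\<^sub>M block_space M (m + n)"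
proof -
  have "(\<lambda>p. if k \<le> m then fst p k else snd p (k - m)) \<in> block_space M m \<Otimes>\<^sub>M block_space M n \<rightarrow>\<^sub>M (\<Pi>\<^sub>M m\<in>{..<M}. borel)"
    if k: "k \<in> {1..m + n}" for k
  proof (cases "k \<le> m")
    case True
    have "(\<lambda>x. x k) \<in> block_space M m \<rightarrow>\<^sub>M (\<Pi>\<^sub>M m\<in>{..<M}. borel)"
      unfolding block_space_def using True k by (intro measurable_component_singleton) auto
    from measurable_compose[OF measurable_fst this] True show ?thesis by simp
  next
    case False
    have "(\<lambda>x. x (k - m)) \<in> block_space M n \<rightarrow>\<^sub>M (\<Pi>\<^sub>M m\<in>{..<M}. borel)"
      unfolding block_space_def using False k by (intro measurable_component_singleton) auto
    from measurable_compose[OF measurable_snd this] False show ?thesis by simp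
  qed
  then show ?thesis unfolding block_append_def case_prod_beta'
    by (subst (3) block_space_def) (intro measurable_restrict)
qed

lemma block_take_measurable: "block_take m \<in> block_space M (m + n) \<rightarrow>\<^sub>M block_space M m"
  unfolding block_take_def[abs_def] block_space_def
  by (intro measurable_restrict measurable_component_singleton) auto

lemma block_drop_measurable: "block_drop m n \<in> block_space M (m + n) \<rightarrow>\<^sub>M block_space M n"
  unfolding block_drop_def[abs_def] block_space_def
  by (intro measurable_restrict measurable_component_singleton) auto

lemma block_take_append: "x \<in> space (block_space M m) \<Longrightarrow> block_take m (block_append m n x x') = x"
  by (auto simp: block_take_def block_append_def block_space_def space_PiM PiE_iff extensional_def fun_eq_iff)

lemma block_drop_append: "x' \<in> space (block_space M n) \<Longrightarrow> block_drop m n (block_append m n x x') = x'"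
  by (auto simp: block_drop_def block_append_def block_space_def space_PiM PiE_iff extensional_def fun_eq_iff)

lemma block_take_comb_output: "block_take m (comb_output M (m + n) x z) = comb_output M m (block_take m x) z"
  by (cases z) (auto simp: comb_output_eq block_take_def fun_eq_iff)

text \<open>The last blocks are an output of the same channel whose phases start at time
  \<open>m\<close>, because the phase recursion depends on the past only through the current
  phase.\<close>

lemma block_drop_comb_output:
  "block_drop m n (comb_output M (m + n) x z) = comb_output M n (block_drop m n x) (shift_comb_noise m z)"
  by (cases z) (auto simp: comb_output_eq block_drop_def fun_eq_iff shift_comb_noise_def rotation_def phase_shift_phase shift_noise_def)

context comb
begin

lemma shift_comb_noise_measurable: "shift_comb_noise m \<in> NN \<rightarrow>\<^sub>M NN"
  unfolding shift_comb_noise_def case_prod_beta' comb_noise_space_def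
  by (intro measurable_Pair measurable_compose[OF _ shift_phase_measurable] measurable_compose[OF _ shift_noise_measurable]) simp_all

text \<open>Each phase process is stationary and the additive noise is i.i.d., so the shift
  preserves the three independent factors separately.\<close>

lemma distr_shift_comb_noise: "distr NN NN (shift_comb_noise m) = NN"
proof -
  have W: "sigma_finite_measure (distr (additive_noise_space M) (additive_noise_space M) (shift_noise m))"
    unfolding distr_shift_noise by (rule W.sigma_finite_measure_axioms)
  have rw: "distr (phase_space \<sigma>\<^sub>r \<Otimes>\<^sub>M additive_noise_space M) (phase_space \<sigma>\<^sub>r \<Otimes>\<^sub>M additive_noise_space M)
      (\<lambda>(r, w). (shift_phase m r, shift_noise m w)) = phase_space \<sigma>\<^sub>r \<Otimes>\<^sub>M additive_noise_space M"
    using pair_measure_distr[OF shift_phase_measurable[of m \<sigma>\<^sub>r] shift_noise_measurable W]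
    by (simp add: distr_shift_noise distr_shift_phase \<sigma>\<^sub>r_pos)
  have m: "(\<lambda>(r, w). (shift_phase m r, shift_noise m w)) \<in> phase_space \<sigma>\<^sub>r \<Otimes>\<^sub>M additive_noise_space M
      \<rightarrow>\<^sub>M phase_space \<sigma>\<^sub>r \<Otimes>\<^sub>M additive_noise_space M"
    by measurable
  have "sigma_finite_measure (distr (phase_space \<sigma>\<^sub>r \<Otimes>\<^sub>M additive_noise_space M) (phase_space \<sigma>\<^sub>r \<Otimes>\<^sub>M additive_noise_space M)
      (\<lambda>(r, w). (shift_phase m r, shift_noise m w)))"
    unfolding rw by (rule RW.sigma_finite_measure_axioms)
  from pair_measure_distr[OF shift_phase_measurable[of m \<sigma>\<^sub>c] m this]
  have "NN = distr NN NN (\<lambda>(c, rw). (shift_phase m c, case rw of (r, w) \<Rightarrow> (shift_phase m r, shift_noise m w)))"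
    by (simp add: rw distr_shift_phase \<sigma>\<^sub>c_pos comb_noise_space_def)
  then show ?thesis by (simp add: shift_comb_noise_def case_prod_beta')
qed

text \<open>Independent inputs for the first \<open>m\<close> and the last \<open>n\<close> blocks; the noise of the last \<open>n\<close> blocks
  is again a comb noise because the phase processes are stationary.\<close>

lemma append_law:
  assumes \<mu>: "prob_space \<mu>" "sets \<mu> = sets (block_space M m)"
    and \<mu>': "prob_space \<mu>'" "sets \<mu>' = sets (block_space M n)"
  defines "\<nu> \<equiv> distr (\<mu> \<Otimes>\<^sub>M \<mu>') (block_space M (m + n)) (\<lambda>(x, x'). block_append m n x x')"
  shows "prob_space \<nu>" "distr \<nu> \<mu> (block_take m) = \<mu>" "distr \<nu> \<mu>' (block_drop m n) = \<mu>'"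
    and "block_take m \<in> \<nu> \<rightarrow>\<^sub>M \<mu>" "block_drop m n \<in> \<nu> \<rightarrow>\<^sub>M \<mu>'"
    and "\<And>f f'. f \<in> borel_measurable \<mu> \<Longrightarrow> f' \<in> borel_measurable \<mu>' \<Longrightarrow>
      (\<integral>\<^sup>+x. f (block_take m x) * f' (block_drop m n x) \<partial>\<nu>) = (\<integral>\<^sup>+x. f x \<partial>\<mu>) * (\<integral>\<^sup>+x. f' x \<partial>\<mu>')"
proof -
  interpret mu: prob_space \<mu> by fact
  interpret mu': prob_space \<mu>' by fact
  interpret pair_prob_space \<mu> \<mu>' ..
  let ?a = "\<lambda>(x, x'). block_append m n x x'"
  have "sets (\<mu> \<Otimes>\<^sub>M \<mu>') = sets (block_space M m \<Otimes>\<^sub>M block_space M n)" by (intro sets_pair_measure_cong \<mu> \<mu>')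
  then have a: "?a \<in> \<mu> \<Otimes>\<^sub>M \<mu>' \<rightarrow>\<^sub>M block_space M (m + n)"
    using measurable_cong_sets[OF _ refl] block_append_measurable by blast
  have sp: "space \<mu> = space (block_space M m)" "space \<mu>' = space (block_space M n)"
    using \<mu>(2) \<mu>'(2) by (auto dest: sets_eq_imp_space_eq)
  have t: "block_take m \<in> block_space M (m + n) \<rightarrow>\<^sub>M \<mu>" and d: "block_drop m n \<in> block_space M (m + n) \<rightarrow>\<^sub>M \<mu>'"
    using block_take_measurable[of m M n] block_drop_measurable[of m n M]
      measurable_cong_sets[OF refl \<mu>(2)] measurable_cong_sets[OF refl \<mu>'(2)] by blast+
  show "prob_space \<nu>" unfolding \<nu>_def by (rule P.prob_space_distr[OF a])
  show t': "block_take m \<in> \<nu> \<rightarrow>\<^sub>M \<mu>" and d': "block_drop m n \<in> \<nu> \<rightarrow>\<^sub>M \<mu>'"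
    using t d by (simp_all add: \<nu>_def)
  have "distr \<nu> \<mu> (block_take m) = distr (\<mu> \<Otimes>\<^sub>M \<mu>') \<mu> fst"
    unfolding \<nu>_def distr_distr[OF t a] by (intro distr_cong) (auto simp: space_pair_measure sp block_take_append)
  then show "distr \<nu> \<mu> (block_take m) = \<mu>" by (simp add: mu'.distr_pair_fst)
  have "distr \<nu> \<mu>' (block_drop m n) = distr (\<mu> \<Otimes>\<^sub>M \<mu>') \<mu>' snd"
    unfolding \<nu>_def distr_distr[OF d a] by (intro distr_cong) (auto simp: space_pair_measure sp block_drop_append)
  then show "distr \<nu> \<mu>' (block_drop m n) = \<mu>'" by (simp add: distr_pair_snd[OF \<mu>(1) \<mu>'(1)])
  fix f f' :: "(nat \<Rightarrow> nat \<Rightarrow> complex) \<Rightarrow> ennreal"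
  assume f[measurable]: "f \<in> borel_measurable \<mu>" "f' \<in> borel_measurable \<mu>'"
  have "(\<lambda>x. f (block_take m x) * f' (block_drop m n x)) \<in> borel_measurable (block_space M (m + n))"
    by (intro borel_measurable_times_ennreal measurable_compose[OF t] measurable_compose[OF d] f)
  then have "(\<integral>\<^sup>+x. f (block_take m x) * f' (block_drop m n x) \<partial>\<nu>)
    = (\<integral>\<^sup>+p. f (block_take m (?a p)) * f' (block_drop m n (?a p)) \<partial>(\<mu> \<Otimes>\<^sub>M \<mu>'))"
    unfolding \<nu>_def by (intro nn_integral_distr a) simp
  also have "\<dots> = (\<integral>\<^sup>+p. f (fst p) * f' (snd p) \<partial>(\<mu> \<Otimes>\<^sub>M \<mu>'))"
    by (intro nn_integral_cong) (auto simp: space_pair_measure sp block_take_append block_drop_append)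
  also have "\<dots> = (\<integral>\<^sup>+x. \<integral>\<^sup>+x'. f x * f' x' \<partial>\<mu>' \<partial>\<mu>)"
    by (subst mu'.nn_integral_fst[symmetric]) auto
  also have "\<dots> = (\<integral>\<^sup>+x. f x \<partial>\<mu>) * (\<integral>\<^sup>+x. f' x \<partial>\<mu>')"
    by (simp add: nn_integral_cmult nn_integral_multc)
  finally show "(\<integral>\<^sup>+x. f (block_take m x) * f' (block_drop m n x) \<partial>\<nu>) = (\<integral>\<^sup>+x. f x \<partial>\<mu>) * (\<integral>\<^sup>+x. f' x \<partial>\<mu>')" .
qed

text \<open>The power is a sum over blocks, and each block of the joined input has the law of the
  corresponding block in its half.\<close>

lemma append_admissible:
  assumes \<mu>: "\<mu> \<in> admissible_laws M m \<rho>" and \<mu>': "\<mu>' \<in> admissible_laws M n \<rho>" and \<rho>: "\<rho> \<ge> 0"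
  shows "distr (\<mu> \<Otimes>\<^sub>M \<mu>') (block_space M (m + n)) (\<lambda>(x, x'). block_append m n x x') \<in> admissible_laws M (m + n) \<rho>"
    (is "?\<nu> \<in> _")
proof -
  note p = \<mu>[unfolded admissible_laws_def, simplified] and p' = \<mu>'[unfolded admissible_laws_def, simplified]
  have 1: "prob_space \<mu>" "sets \<mu> = sets (block_space M m)" "prob_space \<mu>'" "sets \<mu>' = sets (block_space M n)"
    using p p' by auto
  note a = append_law[OF 1]
  let ?q = "\<lambda>x k. ennreal ((L2_set (\<lambda>m. cmod (x k m)) {..<M})\<^sup>2) :: ennreal"
  have q: "(\<lambda>x. ?q x k) \<in> borel_measurable \<kappa>" if "sets \<kappa> = sets (block_space M j)" "k \<in> {1..j}" for \<kappa> :: "(nat \<Rightarrow> nat \<Rightarrow> complex) measure" and j k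
  proof -
    have cm: "cmod \<in> borel_measurable borel" by (intro borel_measurable_continuous_onI continuous_intros)
    have "(\<lambda>x. cmod (x k m)) \<in> borel_measurable \<kappa>" if "m \<in> {..<M}" for m
      using measurable_compose[OF block_component_measurable[OF \<open>sets \<kappa> = _\<close> \<open>k \<in> _\<close>, of m] cm] that by simp
    then show ?thesis unfolding L2_set_def
      by (intro measurable_compose[OF _ measurable_ennreal] borel_measurable_power borel_measurable_sum
        measurable_compose[where f = "\<lambda>x. \<Sum>m\<in>{..<M}. (cmod (x k m))\<^sup>2" and g = sqrt and N = borel]) simp_all
  qed
  have I: "(\<integral>\<^sup>+x. ?q x k \<partial>?\<nu>) = (\<integral>\<^sup>+x. ?q x k \<partial>\<mu>)" if k: "k \<in> {1..m}" for k
  proof -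
    have "(\<integral>\<^sup>+x. ?q x k \<partial>\<mu>) = (\<integral>\<^sup>+x. ?q x k \<partial>distr ?\<nu> \<mu> (block_take m))" by (simp only: a(2))
    also have "\<dots> = (\<integral>\<^sup>+x. ?q (block_take m x) k \<partial>?\<nu>)" by (rule nn_integral_distr[OF a(4)]) (simp add: q[OF 1(2) k])
    finally show ?thesis using k by (simp add: block_take_def)
  qed
  have I': "(\<integral>\<^sup>+x. ?q x (k + m) \<partial>?\<nu>) = (\<integral>\<^sup>+x. ?q x k \<partial>\<mu>')" if k: "k \<in> {1..n}" for k
  proof -
    have "(\<integral>\<^sup>+x. ?q x k \<partial>\<mu>') = (\<integral>\<^sup>+x. ?q x k \<partial>distr ?\<nu> \<mu>' (block_drop m n))" by (simp only: a(3))
    also have "\<dots> = (\<integral>\<^sup>+x. ?q (block_drop m n x) k \<partial>?\<nu>)" by (rule nn_integral_distr[OF a(5)]) (simp add: q[OF 1(4) k])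
    finally show ?thesis using k by (simp add: block_drop_def add.commute)
  qed
  have "(\<Sum>k=1..m + n. \<integral>\<^sup>+x. ?q x k \<partial>?\<nu>) = (\<Sum>k=1..m. \<integral>\<^sup>+x. ?q x k \<partial>?\<nu>) + (\<Sum>k=m+1..m + n. \<integral>\<^sup>+x. ?q x k \<partial>?\<nu>)"
    by (rule sum.ub_add_nat) simp
  also have "(\<Sum>k=m+1..m + n. \<integral>\<^sup>+x. ?q x k \<partial>?\<nu>) = (\<Sum>k=1..n. \<integral>\<^sup>+x. ?q x (k + m) \<partial>?\<nu>)"
    using sum.shift_bounds_cl_nat_ivl[of "\<lambda>k. \<integral>\<^sup>+x. ?q x k \<partial>?\<nu>" 1 m n] by (simp add: add.commute)
  also have "(\<Sum>k=1..m. \<integral>\<^sup>+x. ?q x k \<partial>?\<nu>) + \<dots> = (\<Sum>k=1..m. \<integral>\<^sup>+x. ?q x k \<partial>\<mu>) + (\<Sum>k=1..n. \<integral>\<^sup>+x. ?q x k \<partial>\<mu>')"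
    by (intro arg_cong2[where f = "(+)"] sum.cong refl I I')
  also have "\<dots> \<le> ennreal (real m * \<rho>) + ennreal (real n * \<rho>)"
    using \<mu> \<mu>' unfolding admissible_laws_def by (intro add_mono) auto
  also have "\<dots> = ennreal (real (m + n) * \<rho>)"
    using \<rho> by (simp add: ennreal_plus[symmetric] algebra_simps del: ennreal_plus)
  finally show ?thesis using a(1) by (simp add: admissible_laws_def)
qed

end

section \<open>Superadditivity of the information and existence of the capacity\<close>

context comb2
begin

lemma integrable_information:
  assumes "\<mu> \<in> admissible_laws 2 n \<rho>" "\<rho> \<ge> 0"
  shows "integrable (\<mu> \<Otimes>\<^sub>M NN) (\<lambda>(x, z). ln (channel.info_density \<mu> (comb_density n) x (comb_output 2 n x z)))"
  by (rule information_le(1)[OF assms, of 1 "1 / 2" 1]) auto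

text \<open>The constant 1 is a reverse density, with test function 0.\<close>

lemma information_nonneg:
  assumes adm: "\<mu> \<in> admissible_laws 2 n \<rho>" and \<rho>: "\<rho> \<ge> 0"
  shows "0 \<le> comb_information 2 \<sigma>\<^sub>c \<sigma>\<^sub>r n \<mu>"
proof -
  have \<mu>: "prob_space \<mu>" "sets \<mu> = sets (block_space 2 n)" using adm by (auto simp: admissible_laws_def)
  interpret channel \<mu> NN "block_lborel 2 n" "comb_output 2 n" "comb_density n" 1
    by (rule channel_comb[OF \<mu>])
  have "(\<integral>(x, z). 0 \<partial>(\<mu> \<Otimes>\<^sub>M NN)) \<le> (\<integral>(x, z). ln (info_density x (comb_output 2 n x z)) \<partial>(\<mu> \<Otimes>\<^sub>M NN))"
    by (rule info_ge[where \<phi> = "\<lambda>_ _. 1", OF _ integrable_information[OF adm \<rho>]]) (simp_all add: case_prod_beta' X.emeasure_space_1)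
  then show ?thesis unfolding comb_information_eq[OF \<mu>] by (simp add: case_prod_beta')
qed

text \<open>The product of the information densities of the two halves is a reverse density for the
  joined channel: for a given output, independence of the input halves splits its integral into two
  posterior masses. The outputs of the halves remain dependent through the phases, which
  \<open>info_ge\<close> tolerates.\<close>

lemma information_superadditive:
  assumes adm: "\<mu> \<in> admissible_laws 2 m \<rho>" and adm': "\<mu>' \<in> admissible_laws 2 n \<rho>" and \<rho>: "\<rho> \<ge> 0"
  shows "\<exists>\<nu>\<in>admissible_laws 2 (m + n) \<rho>.
    comb_information 2 \<sigma>\<^sub>c \<sigma>\<^sub>r m \<mu> + comb_information 2 \<sigma>\<^sub>c \<sigma>\<^sub>r n \<mu>' \<le> comb_information 2 \<sigma>\<^sub>c \<sigma>\<^sub>r (m + n) \<nu>"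
proof -
  define \<nu> where "\<nu> = distr (\<mu> \<Otimes>\<^sub>M \<mu>') (block_space 2 (m + n)) (\<lambda>(x, x'). block_append m n x x')"
  have adm\<nu>: "\<nu> \<in> admissible_laws 2 (m + n) \<rho>" unfolding \<nu>_def by (rule append_admissible[OF adm adm' \<rho>])
  have \<mu>: "prob_space \<mu>" "sets \<mu> = sets (block_space 2 m)" using adm by (auto simp: admissible_laws_def)
  have \<mu>': "prob_space \<mu>'" "sets \<mu>' = sets (block_space 2 n)" using adm' by (auto simp: admissible_laws_def)
  have \<nu>: "prob_space \<nu>" "sets \<nu> = sets (block_space 2 (m + n))" using adm\<nu> by (auto simp: admissible_laws_def)
  interpret A: channel \<mu> NN "block_lborel 2 m" "comb_output 2 m" "comb_density m" 1
    by (rule channel_comb[OF \<mu>])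
  interpret B: channel \<mu>' NN "block_lborel 2 n" "comb_output 2 n" "comb_density n" 1
    by (rule channel_comb[OF \<mu>'])
  interpret channel \<nu> NN "block_lborel 2 (m + n)" "comb_output 2 (m + n)" "comb_density (m + n)" 1
    by (rule channel_comb[OF \<nu>])
  note law = append_law[OF \<mu> \<mu>', folded \<nu>_def]
  let ?t = "block_take m" and ?d = "block_drop m n"
  let ?f = "\<lambda>x z. ln (A.info_density x (comb_output 2 m x z))" and ?g = "\<lambda>x z. ln (B.info_density x (comb_output 2 n x z))"
  have yt: "?t \<in> block_lborel 2 (m + n) \<rightarrow>\<^sub>M block_lborel 2 m" and yd: "?d \<in> block_lborel 2 (m + n) \<rightarrow>\<^sub>M block_lborel 2 n"
    using block_take_measurable[of m 2 n] block_drop_measurable[of m n 2]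
    unfolding block_measurable_lborel measurable_cong_sets[OF sets_block_lborel refl] by blast+
  have shm: "shift_comb_noise m \<in> NN \<rightarrow>\<^sub>M NN" by (rule shift_comb_noise_measurable)
  have mt: "(\<lambda>(x, z). (?t x, z)) \<in> \<nu> \<Otimes>\<^sub>M NN \<rightarrow>\<^sub>M \<mu> \<Otimes>\<^sub>M NN"
    unfolding case_prod_beta' by (intro measurable_Pair measurable_compose[OF measurable_fst law(4)] measurable_snd)
  have md: "(\<lambda>(x, z). (?d x, shift_comb_noise m z)) \<in> \<nu> \<Otimes>\<^sub>M NN \<rightarrow>\<^sub>M \<mu>' \<Otimes>\<^sub>M NN"
    unfolding case_prod_beta' by (intro measurable_Pair measurable_compose[OF measurable_fst law(5)] measurable_compose[OF measurable_snd shm])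
  have dt: "distr (\<nu> \<Otimes>\<^sub>M NN) (\<mu> \<Otimes>\<^sub>M NN) (\<lambda>(x, z). (?t x, z)) = \<mu> \<Otimes>\<^sub>M NN"
    using pair_measure_distr[OF law(4), of "\<lambda>z. z" NN NN] prob_space_imp_sigma_finite[OF prob_space_NN]
    by (simp add: law(2) distr_id measurable_ident_sets)
  \<comment> \<open>Stationarity: the shifted noise has the law of the noise, so the second half
    contributes its own information without loss.\<close>
  have dd: "distr (\<nu> \<Otimes>\<^sub>M NN) (\<mu>' \<Otimes>\<^sub>M NN) (\<lambda>(x, z). (?d x, shift_comb_noise m z)) = \<mu>' \<Otimes>\<^sub>M NN"
    using pair_measure_distr[OF law(5) shm] prob_space_imp_sigma_finite[OF prob_space_NN]
    by (simp add: law(3) distr_shift_comb_noise)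
  have F: "has_bochner_integral (\<mu> \<Otimes>\<^sub>M NN) (\<lambda>(x, z). ?f x z) (comb_information 2 \<sigma>\<^sub>c \<sigma>\<^sub>r m \<mu> * ln 2)"
    using integrable_information[OF adm \<rho>] by (simp add: has_bochner_integral_iff comb_information_eq[OF \<mu>])
  have G: "has_bochner_integral (\<mu>' \<Otimes>\<^sub>M NN) (\<lambda>(x, z). ?g x z) (comb_information 2 \<sigma>\<^sub>c \<sigma>\<^sub>r n \<mu>' * ln 2)"
    using integrable_information[OF adm' \<rho>] by (simp add: has_bochner_integral_iff comb_information_eq[OF \<mu>'])
  have F': "has_bochner_integral (\<nu> \<Otimes>\<^sub>M NN) (\<lambda>p. case (case p of (x, z) \<Rightarrow> (?t x, z)) of (x, z) \<Rightarrow> ?f x z) (comb_information 2 \<sigma>\<^sub>c \<sigma>\<^sub>r m \<mu> * ln 2)"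
    by (rule integral_distr_comp[OF mt]) (simp only: dt F)
  have G': "has_bochner_integral (\<nu> \<Otimes>\<^sub>M NN) (\<lambda>p. case (case p of (x, z) \<Rightarrow> (?d x, shift_comb_noise m z)) of (x, z) \<Rightarrow> ?g x z) (comb_information 2 \<sigma>\<^sub>c \<sigma>\<^sub>r n \<mu>' * ln 2)"
    by (rule integral_distr_comp[OF md]) (simp only: dd G)
  let ?G = "\<lambda>x z. ?f (?t x) z + ?g (?d x) (shift_comb_noise m z)"
  have FG: "has_bochner_integral (\<nu> \<Otimes>\<^sub>M NN) (\<lambda>(x, z). ?G x z) (comb_information 2 \<sigma>\<^sub>c \<sigma>\<^sub>r m \<mu> * ln 2 + comb_information 2 \<sigma>\<^sub>c \<sigma>\<^sub>r n \<mu>' * ln 2)"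
    using has_bochner_integral_add[OF F' G'] by (simp add: case_prod_beta')
  let ?\<phi> = "\<lambda>x y. ennreal (A.info_density (?t x) (?t y)) * ennreal (B.info_density (?d x) (?d y))"
  have "(\<integral>(x, z). ?G x z \<partial>(\<nu> \<Otimes>\<^sub>M NN)) \<le> (\<integral>(x, z). ln (info_density x (comb_output 2 (m + n) x z)) \<partial>(\<nu> \<Otimes>\<^sub>M NN))"
  proof (rule info_ge)
    show "integrable (\<nu> \<Otimes>\<^sub>M NN) (\<lambda>(x, z). ?G x z)" using FG by (simp add: has_bochner_integral_iff)
    show "integrable (\<nu> \<Otimes>\<^sub>M NN) (\<lambda>(x, z). ln (info_density x (comb_output 2 (m + n) x z)))"
      by (rule integrable_information[OF adm\<nu> \<rho>])
    have tt: "(\<lambda>p. (?t (fst p), ?t (snd p))) \<in> \<nu> \<Otimes>\<^sub>M block_lborel 2 (m + n) \<rightarrow>\<^sub>M \<mu> \<Otimes>\<^sub>M block_lborel 2 m"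
      by (intro measurable_Pair measurable_compose[OF measurable_fst law(4)] measurable_compose[OF measurable_snd yt])
    have ddm: "(\<lambda>p. (?d (fst p), ?d (snd p))) \<in> \<nu> \<Otimes>\<^sub>M block_lborel 2 (m + n) \<rightarrow>\<^sub>M \<mu>' \<Otimes>\<^sub>M block_lborel 2 n"
      by (intro measurable_Pair measurable_compose[OF measurable_fst law(5)] measurable_compose[OF measurable_snd yd])
    show "(\<lambda>(x, y). ?\<phi> x y) \<in> borel_measurable (\<nu> \<Otimes>\<^sub>M block_lborel 2 (m + n))"
      using measurable_compose[OF tt A.info_density_measurable] measurable_compose[OF ddm B.info_density_measurable]
      unfolding case_prod_beta' by (intro borel_measurable_times_ennreal measurable_compose[OF _ measurable_ennreal]) auto
    fix y assume y: "y \<in> space (block_lborel 2 (m + n))"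
    have yt': "?t y \<in> space (block_lborel 2 m)" and yd': "?d y \<in> space (block_lborel 2 n)"
      using measurable_space[OF yt y] measurable_space[OF yd y] by auto
    have "(\<lambda>x. ennreal (A.info_density x (?t y))) \<in> borel_measurable \<mu>" "(\<lambda>x. ennreal (B.info_density x (?d y))) \<in> borel_measurable \<mu>'"
      using measurable_compose[OF measurable_Pair2'[OF yt'] A.info_density_measurable]
        measurable_compose[OF measurable_Pair2'[OF yd'] B.info_density_measurable] by simp_all
    from law(6)[OF this] show "(\<integral>\<^sup>+x. ?\<phi> x y \<partial>\<nu>) \<le> 1"
      by (simp add: A.nn_integral_info_density[OF yt'] B.nn_integral_info_density[OF yd'])
  next
    show "AE x in \<nu>. \<forall>z\<in>space NN. ennreal (exp (?G x z)) \<le> ?\<phi> x (comb_output 2 (m + n) x z)"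
    proof (intro AE_I2 ballI)
      fix x z assume x: "x \<in> space \<nu>" and z: "z \<in> space NN"
      have p: "0 < A.info_density (?t x) (comb_output 2 m (?t x) z)"
        using measurable_space[OF law(4) x] measurable_space[OF comb_output_measurable1 z] by (intro A.info_density_pos) auto
      have q: "0 < B.info_density (?d x) (comb_output 2 n (?d x) (shift_comb_noise m z))"
        using measurable_space[OF law(5) x] measurable_space[OF comb_output_measurable1 measurable_space[OF shm z]] by (intro B.info_density_pos) auto
      have "exp (?G x z) = A.info_density (?t x) (comb_output 2 m (?t x) z) * B.info_density (?d x) (comb_output 2 n (?d x) (shift_comb_noise m z))"
        using p q by (simp add: exp_add)
      then show "ennreal (exp (?G x z)) \<le> ?\<phi> x (comb_output 2 (m + n) x z)"
        using p q by (simp add: block_take_comb_output block_drop_comb_output ennreal_mult less_imp_le)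
    qed
  qed
  also have "\<dots> = comb_information 2 \<sigma>\<^sub>c \<sigma>\<^sub>r (m + n) \<nu> * ln 2" unfolding comb_information_eq[OF \<nu>] by simp
  finally have "(comb_information 2 \<sigma>\<^sub>c \<sigma>\<^sub>r m \<mu> + comb_information 2 \<sigma>\<^sub>c \<sigma>\<^sub>r n \<mu>') * ln 2 \<le> comb_information 2 \<sigma>\<^sub>c \<sigma>\<^sub>r (m + n) \<nu> * ln 2"
    using FG by (simp add: has_bochner_integral_iff algebra_simps)
  then have "comb_information 2 \<sigma>\<^sub>c \<sigma>\<^sub>r m \<mu> + comb_information 2 \<sigma>\<^sub>c \<sigma>\<^sub>r n \<mu>' \<le> comb_information 2 \<sigma>\<^sub>c \<sigma>\<^sub>r (m + n) \<nu>" by simp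
  with adm\<nu> show ?thesis by (rule bexI[rotated])
qed

lemma admissible_nonempty:
  assumes "\<rho> > 0" shows "admissible_laws 2 n \<rho> \<noteq> {}"
proof -
  \<comment> \<open>Used both as \<open>K\<close> and as \<open>\<tau>\<close>; the power
    \<open>2 * (K + \<tau>)^2\<close> is then exactly \<rho>.\<close>
  let ?K = "sqrt (\<rho> / 2) / 2"
  have K: "?K > 0" using assms by simp
  have "2 * (?K + ?K)\<^sup>2 = \<rho>" using assms by simp
  with input_admissible[OF K K, of n] show ?thesis by auto
qed

text \<open>By Fekete's lemma the limit is also the supremum over \<open>n\<close> of the averages.
  The last two conclusions say this in the form in which the upper and lower bounds are compared
  with it.\<close>

lemma capacity:
  assumes \<rho>: "\<rho> > 0"
  obtains l where "comb_rate 2 \<sigma>\<^sub>c \<sigma>\<^sub>r \<rho> \<longlonglongrightarrow> ereal l" "comb_capacity 2 \<sigma>\<^sub>c \<sigma>\<^sub>r \<rho> = ereal l"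
    "\<forall>n\<ge>1. \<forall>\<mu>\<in>admissible_laws 2 n \<rho>. comb_information 2 \<sigma>\<^sub>c \<sigma>\<^sub>r n \<mu> \<le> real n * l"
    "\<forall>u. (\<forall>n. \<forall>\<mu>\<in>admissible_laws 2 n \<rho>. comb_information 2 \<sigma>\<^sub>c \<sigma>\<^sub>r n \<mu> \<le> real n * u) \<longrightarrow> l \<le> u"
proof -
  let ?A = "\<lambda>n. admissible_laws 2 n \<rho>" and ?I = "comb_information 2 \<sigma>\<^sub>c \<sigma>\<^sub>r"
  define a where "a n = (SUP \<mu>\<in>?A n. ?I n \<mu>)" for n
  obtain B where B: "\<forall>n. \<forall>\<mu>\<in>?A n. ?I n \<mu> \<le> real n * B" by (rule information_bounded[OF \<rho>])
  have bdd: "bdd_above (?I n ` ?A n)" for n using B by (intro bdd_aboveI2[where M = "real n * B"]) auto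
  note ne = admissible_nonempty[OF \<rho>]
  have upper: "?I n \<mu> \<le> a n" if "\<mu> \<in> ?A n" for n \<mu>
    unfolding a_def by (rule cSUP_upper[OF that bdd])
  have least: "a n \<le> u" if "\<forall>\<mu>\<in>?A n. ?I n \<mu> \<le> u" for n u
    unfolding a_def using that by (intro cSUP_least ne) auto
  have nonneg: "0 \<le> a n" for n
  proof -
    obtain \<mu> where "\<mu> \<in> ?A n" using ne by blast
    from information_nonneg[OF this] upper[OF this] \<rho> show ?thesis by linarith
  qed
  have super: "a m + a n \<le> a (m + n)" for m n
  proof -
    have 1: "?I m \<mu> + ?I n \<mu>' \<le> a (m + n)" if \<mu>: "\<mu> \<in> ?A m" "\<mu>' \<in> ?A n" for \<mu> \<mu>'
    proof -
      obtain \<nu> where "\<nu> \<in> ?A (m + n)" "?I m \<mu> + ?I n \<mu>' \<le> ?I (m + n) \<nu>"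
        using information_superadditive[OF \<mu> less_imp_le[OF \<rho>]] by blast
      with upper[of \<nu> "m + n"] show ?thesis by linarith
    qed
    \<comment> \<open>The suprema are taken one after the other: over the first law with the second
      fixed, then over the second.\<close>
    have "a m \<le> a (m + n) - ?I n \<mu>'" if "\<mu>' \<in> ?A n" for \<mu>'
      by (rule least) (use 1[OF _ that] in \<open>auto simp: le_diff_eq\<close>)
    then have "a n \<le> a (m + n) - a m" by (intro least) (auto simp: algebra_simps)
    then show ?thesis by linarith
  qed
  obtain l where l: "(\<lambda>n. a n / real n) \<longlonglongrightarrow> l" "\<And>n. n \<ge> 1 \<Longrightarrow> a n / real n \<le> l"
    "\<And>e. e > 0 \<Longrightarrow> \<exists>n\<ge>1. l - e < a n / real n"
    by (rule fekete_superadditive[of a B]) (use super nonneg B in \<open>auto intro!: least\<close>)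
  \<comment> \<open>The supremum is finite, so the extended real supremum agrees with the real one;
    \<open>n >= 1\<close> keeps the division meaningful.\<close>
  have rate: "comb_rate 2 \<sigma>\<^sub>c \<sigma>\<^sub>r \<rho> n = ereal (a n / real n)" if n: "n \<ge> 1" for n
  proof -
    have "(SUP \<mu>\<in>?A n. ereal (?I n \<mu>)) = ereal (a n)"
    proof -
      obtain \<mu> where \<mu>: "\<mu> \<in> ?A n" using ne by blast
      have "ereal (?I n \<mu>) \<le> (SUP \<mu>\<in>?A n. ereal (?I n \<mu>))" by (rule SUP_upper[OF \<mu>])
      moreover have "(SUP \<mu>\<in>?A n. ereal (?I n \<mu>)) \<le> ereal (a n)" by (intro SUP_least) (simp add: upper)
      ultimately have "\<bar>SUP \<mu>\<in>?A n. ereal (?I n \<mu>)\<bar> \<noteq> \<infinity>" by auto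
      then show ?thesis unfolding a_def by (rule ereal_SUP[symmetric])
    qed
    then show ?thesis using n by (simp add: comb_rate_def)
  qed
  have lim: "comb_rate 2 \<sigma>\<^sub>c \<sigma>\<^sub>r \<rho> \<longlonglongrightarrow> ereal l"
  proof (rule Lim_transform_eventually)
    show "(\<lambda>n. ereal (a n / real n)) \<longlonglongrightarrow> ereal l" using l(1) by (rule tendsto_ereal)
    show "\<forall>\<^sub>F n in sequentially. ereal (a n / real n) = comb_rate 2 \<sigma>\<^sub>c \<sigma>\<^sub>r \<rho> n"
      using eventually_ge_at_top[of "1::nat"] by eventually_elim (simp add: rate)
  qed
  show thesis
  proof (rule that[OF lim])
    show "comb_capacity 2 \<sigma>\<^sub>c \<sigma>\<^sub>r \<rho> = ereal l" unfolding comb_capacity_def by (rule limI[OF lim])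
    show "\<forall>n\<ge>1. \<forall>\<mu>\<in>?A n. ?I n \<mu> \<le> real n * l"
    proof (intro allI impI ballI)
      fix n :: nat and \<mu> assume n: "1 \<le> n" and \<mu>: "\<mu> \<in> ?A n"
      have "a n \<le> real n * l" using l(2)[OF n] n by (simp add: field_simps)
      with upper[OF \<mu>] show "?I n \<mu> \<le> real n * l" by linarith
    qed
    show "\<forall>u. (\<forall>n. \<forall>\<mu>\<in>?A n. ?I n \<mu> \<le> real n * u) \<longrightarrow> l \<le> u"
    proof (intro allI impI)
      fix u assume u: "\<forall>n. \<forall>\<mu>\<in>?A n. ?I n \<mu> \<le> real n * u"
      show "l \<le> u"
      proof (rule LIMSEQ_le_const2[OF l(1)], intro exI allI impI)
        fix n :: nat assume n: "1 \<le> n"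
        have "a n \<le> real n * u" using u by (intro least) auto
        then show "a n / real n \<le> u" using n by (simp add: field_simps)
      qed
    qed
  qed
qed

end

subsection \<open>The asymptotic capacity\<close>

text \<open>By independence the joint density is the product of the wrapped densities cut off to the
  circle. The entropy is therefore a sum, and the division by \<open>ln 2\<close> converts nats into
  bits.\<close>

lemma entropy_independent_wrapped_normal:
  fixes \<Delta>\<^sub>c \<Delta>\<^sub>r :: "'a \<Rightarrow> real"
  assumes \<sigma>\<^sub>c: "\<sigma>\<^sub>c > 0" and \<sigma>\<^sub>r: "\<sigma>\<^sub>r > 0" and \<Omega>: "prob_space \<Omega>"
    and indep: "prob_space.indep_var \<Omega> borel \<Delta>\<^sub>c borel \<Delta>\<^sub>r"
    and c: "distr \<Omega> borel \<Delta>\<^sub>c = wrapped_normal \<sigma>\<^sub>c" and r: "distr \<Omega> borel \<Delta>\<^sub>r = wrapped_normal \<sigma>\<^sub>r"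
  shows "prob_space.entropy \<Omega> 2 (lborel \<Otimes>\<^sub>M lborel) (\<lambda>\<omega>. (\<Delta>\<^sub>c \<omega>, \<Delta>\<^sub>r \<omega>)) = (phase_entropy \<sigma>\<^sub>c + phase_entropy \<sigma>\<^sub>r) / ln 2"
proof -
  interpret prob_space \<Omega> by fact
  interpret information_space \<Omega> 2 by standard simp
  let ?L = "lborel \<Otimes>\<^sub>M lborel :: (real \<times> real) measure"
  let ?X = "\<lambda>\<omega>. (\<Delta>\<^sub>c \<omega>, \<Delta>\<^sub>r \<omega>)"
  let ?g = "\<lambda>\<sigma> t. wrapped_density \<sigma> t * indicator circle t :: real"
  let ?f = "\<lambda>p. ?g \<sigma>\<^sub>c (fst p) * ?g \<sigma>\<^sub>r (snd p)"
  have rv[measurable]: "\<Delta>\<^sub>c \<in> borel_measurable \<Omega>" "\<Delta>\<^sub>r \<in> borel_measurable \<Omega>"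
    and joint: "distr \<Omega> borel \<Delta>\<^sub>c \<Otimes>\<^sub>M distr \<Omega> borel \<Delta>\<^sub>r = distr \<Omega> (borel \<Otimes>\<^sub>M borel) ?X"
    using indep unfolding indep_var_distribution_eq by auto
  have gm[measurable]: "?g \<sigma> \<in> borel_measurable borel" if "\<sigma> > 0" for \<sigma>
    using wrapped_density_measurable[OF that] by measurable
  have g0: "0 \<le> ?g \<sigma> t" if "\<sigma> > 0" for \<sigma> t
    using wrapped_density_pos[OF that, of t] by (simp add: indicator_def)
  have fm: "?f \<in> borel_measurable ?L"
    unfolding measurable_cong_sets[OF sets_pair_measure_cong[OF sets_lborel sets_lborel] refl]
    by (rule borel_measurable_times[OF measurable_compose[OF measurable_fst gm[OF \<sigma>\<^sub>c]] measurable_compose[OF measurable_snd gm[OF \<sigma>\<^sub>r]]])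
  have "distr \<Omega> ?L ?X = distr \<Omega> (borel \<Otimes>\<^sub>M borel) ?X"
    by (intro distr_cong sets_pair_measure_cong) auto
  also have "\<dots> = wrapped_normal \<sigma>\<^sub>c \<Otimes>\<^sub>M wrapped_normal \<sigma>\<^sub>r" unfolding joint[symmetric] c r ..
  also have "\<dots> = density ?L (\<lambda>(x, y). ennreal (?g \<sigma>\<^sub>c x) * ennreal (?g \<sigma>\<^sub>r y))"
    unfolding wrapped_normal_density[OF \<sigma>\<^sub>c] wrapped_normal_density[OF \<sigma>\<^sub>r]
  proof (rule pair_measure_density)
    show "sigma_finite_measure (density lborel (\<lambda>t. ennreal (?g \<sigma>\<^sub>r t)))"
      unfolding wrapped_normal_density[OF \<sigma>\<^sub>r, symmetric]
      by (rule prob_space_imp_sigma_finite[OF prob_space_wrapped_normal[OF \<sigma>\<^sub>r]])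
  qed (use gm[OF \<sigma>\<^sub>c] gm[OF \<sigma>\<^sub>r] in \<open>auto intro: lborel.sigma_finite_measure_axioms\<close>)
  also have "\<dots> = density ?L (\<lambda>p. ennreal (?f p))"
    using g0[OF \<sigma>\<^sub>c] g0[OF \<sigma>\<^sub>r] by (simp add: case_prod_beta' ennreal_mult)
  finally have D: "distr \<Omega> ?L ?X = density ?L (\<lambda>p. ennreal (?f p))" .
  have Xm: "?X \<in> \<Omega> \<rightarrow>\<^sub>M ?L"
    using measurable_Pair[OF rv] by (simp add: measurable_cong_sets[OF refl sets_pair_measure_cong[OF sets_lborel sets_lborel]])
  have dist: "distributed \<Omega> ?L ?X (\<lambda>p. ennreal (?f p))"
    using D Xm measurable_compose[OF fm measurable_ennreal] by (simp add: distributed_def)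
  have lm: "(\<lambda>p. log 2 (?f p)) \<in> borel_measurable ?L" by (rule borel_measurable_log[OF fm borel_measurable_const])
  have "prob_space.entropy \<Omega> 2 ?L ?X = - (\<integral>p. ?f p * log 2 (?f p) \<partial>?L)"
    by (rule entropy_distr[OF dist]) (intro mult_nonneg_nonneg g0 \<sigma>\<^sub>c \<sigma>\<^sub>r)
  also have "(\<integral>p. ?f p * log 2 (?f p) \<partial>?L) = (\<integral>p. log 2 (?f p) \<partial>density ?L (\<lambda>p. ennreal (?f p)))"
    by (subst integral_density[OF lm fm]) (auto intro!: AE_I2 mult_nonneg_nonneg g0 \<sigma>\<^sub>c \<sigma>\<^sub>r)
  also have "\<dots> = (\<integral>\<omega>. log 2 (?f (?X \<omega>)) \<partial>\<Omega>)"
    unfolding D[symmetric] by (rule integral_distr[OF Xm lm])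
  also have "\<dots> = (\<integral>\<omega>. (ln (wrapped_density \<sigma>\<^sub>c (\<Delta>\<^sub>c \<omega>)) + ln (wrapped_density \<sigma>\<^sub>r (\<Delta>\<^sub>r \<omega>))) / ln 2 \<partial>\<Omega>)"
  proof (rule integral_cong_AE)
    \<comment> \<open>Off the circle the joint density vanishes and its logarithm does not split;
      both increments lie on the circle almost surely.\<close>
    have ae: "AE \<omega> in \<Omega>. \<Delta> \<omega> \<in> circle" if \<sigma>: "\<sigma> > 0" and d: "distr \<Omega> borel \<Delta> = wrapped_normal \<sigma>" and m: "\<Delta> \<in> borel_measurable \<Omega>" for \<Delta> \<sigma>
    proof -
      have "AE t in wrapped_normal \<sigma>. t \<in> circle"
        unfolding wrapped_normal_density[OF \<sigma>] using gm[OF \<sigma>] by (subst AE_density) (auto simp: indicator_def intro!: AE_I2)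
      then show ?thesis unfolding d[symmetric] by (rule AE_distrD[OF m])
    qed
    show "AE \<omega> in \<Omega>. log 2 (?f (?X \<omega>)) = (ln (wrapped_density \<sigma>\<^sub>c (\<Delta>\<^sub>c \<omega>)) + ln (wrapped_density \<sigma>\<^sub>r (\<Delta>\<^sub>r \<omega>))) / ln 2"
      using ae[OF \<sigma>\<^sub>c c rv(1)] ae[OF \<sigma>\<^sub>r r rv(2)]
    proof eventually_elim
      case (elim \<omega>)
      then show ?case
        using wrapped_density_pos[OF \<sigma>\<^sub>c, of "\<Delta>\<^sub>c \<omega>"] wrapped_density_pos[OF \<sigma>\<^sub>r, of "\<Delta>\<^sub>r \<omega>"]
        by (simp add: log_def ln_mult)
    qed
    show "(\<lambda>\<omega>. log 2 (?f (?X \<omega>))) \<in> borel_measurable \<Omega>" by (rule measurable_compose[OF Xm lm])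
    show "(\<lambda>\<omega>. (ln (wrapped_density \<sigma>\<^sub>c (\<Delta>\<^sub>c \<omega>)) + ln (wrapped_density \<sigma>\<^sub>r (\<Delta>\<^sub>r \<omega>))) / ln 2) \<in> borel_measurable \<Omega>"
      using measurable_compose[OF rv(1) wrapped_density_measurable[OF \<sigma>\<^sub>c]] measurable_compose[OF rv(2) wrapped_density_measurable[OF \<sigma>\<^sub>r]]
      by measurable
  qed
  also have "\<dots> = (- phase_entropy \<sigma>\<^sub>c + - phase_entropy \<sigma>\<^sub>r) / ln 2"
  proof -
    have "has_bochner_integral \<Omega> (\<lambda>\<omega>. ln (wrapped_density \<sigma> (\<Delta> \<omega>))) (- phase_entropy \<sigma>)"
      if "\<sigma> > 0" "distr \<Omega> borel \<Delta> = wrapped_normal \<sigma>" "\<Delta> \<in> borel_measurable \<Omega>" for \<Delta> \<sigma>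
      by (rule integral_distr_comp[OF that(3)])
        (simp add: that(2) has_bochner_integral_iff phase_entropy_def integrable_ln_wrapped_density[OF that(1)])
    from has_bochner_integral_add[OF this[OF \<sigma>\<^sub>c c rv(1)] this[OF \<sigma>\<^sub>r r rv(2)]] show ?thesis
      by (simp add: has_bochner_integral_iff)
  qed
  finally show ?thesis by (simp add: field_simps)
qed

text \<open>The upper bound holds for every number of blocks and passes to the capacity at once. The
  lower bound holds up to an additive constant and is brought to the capacity by taking many
  blocks.\<close>

lemma (in comb2) capacity_asymptotic:
  assumes \<eta>: "\<eta> > 0"
  shows "\<exists>\<rho>\<^sub>0>0. \<forall>\<rho>\<ge>\<rho>\<^sub>0. \<forall>l. comb_capacity 2 \<sigma>\<^sub>c \<sigma>\<^sub>r \<rho> = ereal l \<longrightarrow>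
    \<bar>l * ln 2 - (ln \<rho> + 2 * ln pi - phase_entropy \<sigma>\<^sub>c - phase_entropy \<sigma>\<^sub>r)\<bar> \<le> \<eta>"
proof -
  let ?A = "\<lambda>n \<rho>. admissible_laws 2 n \<rho>" and ?I = "comb_information 2 \<sigma>\<^sub>c \<sigma>\<^sub>r"
  let ?F = "\<lambda>\<rho>. ln \<rho> + 2 * ln pi - phase_entropy \<sigma>\<^sub>c - phase_entropy \<sigma>\<^sub>r"
  obtain \<rho>\<^sub>0 where \<rho>\<^sub>0: "\<rho>\<^sub>0 > 0" "\<forall>\<rho>\<ge>\<rho>\<^sub>0. \<forall>n. \<forall>\<mu>\<in>?A n \<rho>. ?I n \<mu> * ln 2 \<le> real n * (?F \<rho> + \<eta>)"
    by (rule information_upper[OF \<eta>])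
  obtain \<rho>\<^sub>1 where \<rho>\<^sub>1: "\<rho>\<^sub>1 > 0" "\<forall>\<rho>\<ge>\<rho>\<^sub>1. \<exists>D. \<forall>n. \<exists>\<mu>\<in>?A n \<rho>. real n * (?F \<rho> - \<eta>) - D \<le> ?I n \<mu> * ln 2"
    by (rule information_lower[OF \<eta>])
  have "\<bar>l' * ln 2 - ?F \<rho>\<bar> \<le> \<eta>" if \<rho>: "\<rho> \<ge> max \<rho>\<^sub>0 \<rho>\<^sub>1" and l': "comb_capacity 2 \<sigma>\<^sub>c \<sigma>\<^sub>r \<rho> = ereal l'" for \<rho> l'
  proof -
    have p: "\<rho> > 0" "\<rho> \<ge> \<rho>\<^sub>0" "\<rho> \<ge> \<rho>\<^sub>1" using \<rho> \<rho>\<^sub>0(1) by auto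
    obtain l where l: "comb_capacity 2 \<sigma>\<^sub>c \<sigma>\<^sub>r \<rho> = ereal l"
      and le: "\<forall>n\<ge>1. \<forall>\<mu>\<in>?A n \<rho>. ?I n \<mu> \<le> real n * l"
      and least: "\<forall>u. (\<forall>n. \<forall>\<mu>\<in>?A n \<rho>. ?I n \<mu> \<le> real n * u) \<longrightarrow> l \<le> u"
      by (rule capacity[OF p(1)])
    have "l' = l" using l l' by simp
    have ln2: "ln 2 > (0::real)" by simp
    have "l \<le> (?F \<rho> + \<eta>) / ln 2"
    proof (rule least[rule_format])
      fix n \<mu> assume "\<mu> \<in> ?A n \<rho>"
      then have "?I n \<mu> * ln 2 \<le> real n * (?F \<rho> + \<eta>)" using \<rho>\<^sub>0(2) p(2) by blast
      then show "?I n \<mu> \<le> real n * ((?F \<rho> + \<eta>) / ln 2)" using ln2 by (simp only: times_divide_eq_right pos_le_divide_eq)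
    qed
    then have upper: "l * ln 2 \<le> ?F \<rho> + \<eta>" using ln2 by (simp only: pos_le_divide_eq)
    obtain D where D: "\<forall>n. \<exists>\<mu>\<in>?A n \<rho>. real n * (?F \<rho> - \<eta>) - D \<le> ?I n \<mu> * ln 2" using \<rho>\<^sub>1(2) p(3) by blast
    have lower: "?F \<rho> - \<eta> \<le> l * ln 2"
    proof (rule ccontr)
      assume "\<not> ?F \<rho> - \<eta> \<le> l * ln 2"
      then have pos: "0 < (?F \<rho> - \<eta>) - l * ln 2" by simp
      \<comment> \<open>A positive gap in the rate is multiplied by \<open>n\<close>, while
        \<open>D\<close> stays fixed.\<close>
      then obtain n :: nat where n: "\<bar>D\<bar> < real n * ((?F \<rho> - \<eta>) - l * ln 2)" using reals_Archimedean3 by blast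
      then have n1: "1 \<le> n" using abs_ge_zero[of D] by (cases n) auto
      obtain \<mu> where \<mu>: "\<mu> \<in> ?A n \<rho>" "real n * (?F \<rho> - \<eta>) - D \<le> ?I n \<mu> * ln 2" using D by blast
      have "?I n \<mu> * ln 2 \<le> real n * l * ln 2" using le n1 \<mu>(1) by (intro mult_right_mono) auto
      moreover have "real n * ((?F \<rho> - \<eta>) - l * ln 2) = real n * (?F \<rho> - \<eta>) - real n * l * ln 2" by (simp only: right_diff_distrib mult.assoc)
      ultimately show False using \<mu>(2) n by linarith
    qed
    show ?thesis unfolding \<open>l' = l\<close> using upper lower by (simp only: abs_le_iff) linarith
  qed
  moreover have "max \<rho>\<^sub>0 \<rho>\<^sub>1 > 0" using \<rho>\<^sub>0(1) by simp
  ultimately show ?thesis by blast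
qed

theorem mainTheorem5:
  fixes \<sigma>\<^sub>c \<sigma>\<^sub>r :: real
    and \<Omega> :: "'a measure"
    and \<Delta>\<^sub>c \<Delta>\<^sub>r :: "'a \<Rightarrow> real"
  assumes "\<sigma>\<^sub>c > 0" and "\<sigma>\<^sub>r > 0"
    and "prob_space \<Omega>"
    and "prob_space.indep_var \<Omega> borel \<Delta>\<^sub>c borel \<Delta>\<^sub>r"
    and "distr \<Omega> borel \<Delta>\<^sub>c = wrapped_normal \<sigma>\<^sub>c"
    and "distr \<Omega> borel \<Delta>\<^sub>r = wrapped_normal \<sigma>\<^sub>r"
  shows "(\<forall>\<rho>>0. comb_rate 2 \<sigma>\<^sub>c \<sigma>\<^sub>r \<rho> \<longlonglongrightarrow> comb_capacity 2 \<sigma>\<^sub>c \<sigma>\<^sub>r \<rho>) \<and>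
    (\<exists>r :: real \<Rightarrow> real. r \<in> o(\<lambda>_. 1) \<and>
      (\<forall>\<rho>>0. comb_capacity 2 \<sigma>\<^sub>c \<sigma>\<^sub>r \<rho> =
        ereal (log 2 \<rho> + 2 * log 2 pi
          - prob_space.entropy \<Omega> 2 (lborel \<Otimes>\<^sub>M lborel) (\<lambda>\<omega>. (\<Delta>\<^sub>c \<omega>, \<Delta>\<^sub>r \<omega>))
          + r \<rho>)))"
proof -
  interpret comb2 \<sigma>\<^sub>c \<sigma>\<^sub>r by unfold_locales (rule assms)+
  let ?C = "comb_capacity 2 \<sigma>\<^sub>c \<sigma>\<^sub>r"
  let ?F = "\<lambda>\<rho>. log 2 \<rho> + 2 * log 2 pi
          - prob_space.entropy \<Omega> 2 (lborel \<Otimes>\<^sub>M lborel) (\<lambda>\<omega>. (\<Delta>\<^sub>c \<omega>, \<Delta>\<^sub>r \<omega>))"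
  have F: "?F \<rho> = (ln \<rho> + 2 * ln pi - phase_entropy \<sigma>\<^sub>c - phase_entropy \<sigma>\<^sub>r) / ln 2" for \<rho>
    unfolding entropy_independent_wrapped_normal[OF assms] log_def by (simp add: diff_divide_distrib add_divide_distrib)
  \<comment> \<open>For positive \<rho> the capacity is finite, so \<open>real_of_ereal\<close>
    returns its value.\<close>
  define r where "r \<rho> = real_of_ereal (?C \<rho>) - ?F \<rho>" for \<rho>
  have C: "?C \<rho> = ereal (?F \<rho> + r \<rho>)" "comb_rate 2 \<sigma>\<^sub>c \<sigma>\<^sub>r \<rho> \<longlonglongrightarrow> ?C \<rho>" if \<rho>: "\<rho> > 0" for \<rho>
  proof -
    obtain l where "comb_rate 2 \<sigma>\<^sub>c \<sigma>\<^sub>r \<rho> \<longlonglongrightarrow> ereal l" "?C \<rho> = ereal l" by (rule capacity[OF \<rho>])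
    then show "?C \<rho> = ereal (?F \<rho> + r \<rho>)" "comb_rate 2 \<sigma>\<^sub>c \<sigma>\<^sub>r \<rho> \<longlonglongrightarrow> ?C \<rho>" by (simp_all add: r_def)
  qed
  have "(r \<longlongrightarrow> 0) at_top"
  proof (rule tendstoI)
    fix \<epsilon> :: real assume \<epsilon>: "\<epsilon> > 0"
    \<comment> \<open>The factor \<open>ln 2\<close> converts bits into nats; halving \<epsilon>
      leaves room for the strict inequality.\<close>
    have "\<epsilon> / 2 * ln 2 > 0" using \<epsilon> by simp
    from capacity_asymptotic[OF this] obtain \<rho>\<^sub>0 where \<rho>\<^sub>0: "\<rho>\<^sub>0 > 0"
      "\<forall>\<rho>\<ge>\<rho>\<^sub>0. \<forall>l. ?C \<rho> = ereal l \<longrightarrow> \<bar>l * ln 2 - (ln \<rho> + 2 * ln pi - phase_entropy \<sigma>\<^sub>c - phase_entropy \<sigma>\<^sub>r)\<bar> \<le> \<epsilon> / 2 * ln 2"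
      by blast
    show "\<forall>\<^sub>F \<rho> in at_top. dist (r \<rho>) 0 < \<epsilon>"
      using eventually_ge_at_top[of \<rho>\<^sub>0]
    proof eventually_elim
      case (elim \<rho>)
      let ?c = "ln \<rho> + 2 * ln pi - phase_entropy \<sigma>\<^sub>c - phase_entropy \<sigma>\<^sub>r"
      have "?C \<rho> = ereal (?F \<rho> + r \<rho>)" using elim \<rho>\<^sub>0(1) by (intro C) simp
      then have "\<bar>(?F \<rho> + r \<rho>) * ln 2 - ?c\<bar> \<le> \<epsilon> / 2 * ln 2" using \<rho>\<^sub>0(2) elim by blast
      moreover have "(?F \<rho> + r \<rho>) * ln 2 - ?c = r \<rho> * ln 2" unfolding F by (simp add: distrib_right)
      ultimately have "\<bar>r \<rho>\<bar> * ln 2 \<le> \<epsilon> / 2 * ln 2" by (simp only: abs_mult) simp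
      then have "\<bar>r \<rho>\<bar> \<le> \<epsilon> / 2" by simp
      then show ?case using \<epsilon> by (simp add: dist_real_def)
    qed
  qed
  then have "r \<in> o(\<lambda>_. 1)" by (intro smalloI_tendsto) auto
  with C show ?thesis by blast
qed

end
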